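(* Let $\mathcal{O}=\{t_1,\dots,t_\mu\}$ be an order ideal in $\mathbb{T}^n$, and let $\mathcal{H}=(H_0,H_1,\dots)$ be an $(n,\mu)$-admissible Hilbert function which dominates $\mathrm{HF}^a_{\mathcal{O}}$. Let $\{\mathcal{O}'_1,\dots,\mathcal{O}'_\ell\}$ be the set of all order ideals in $\mathbb{T}^n$ with affine Hilbert function $\mathcal{H}$. For $i=1,\dots,\ell$, let $J_{\mathcal{O}'_i}\subseteq K[C'_i]$ be the ideal $\mathrm{CBLocus}(\mathcal{O}'_i)$, and let $I^{\mathrm{dfb}}_{\mathcal{O}\mathcal{O}'_i}$ and $J_i$ be the ideals of $K[C]$ obtained from $J_{\mathcal{O}'_i}$ by the combination procedure (both $\mathrm{CBLocus}$ and the combination procedure are defined in the context). Then for the ideal $$I^{\mathrm{NCB}}_{\mathcal{O}}=\sum_{i=1}^\ell\Bigl(\bigl(I^{\mathrm{dfb}}_{\mathcal{O}\mathcal{O}'_i}+I(\mathbb{B}_{\mathcal{O}}(\overline{\mathcal{H}}))\bigr)\cap\bigl(J_i+I(\mathbb{B}_{\mathcal{O}}(\overline{\mathcal{H}}))\bigr)\Bigr)$$ of $K[C]$, the set $\mathbb{B}_{\mathcal{O}}(\overline{\mathcal{H}})\setminus\mathcal{Z}(I^{\mathrm{NCB}}_{\mathcal{O}})$ contains precisely the $K$-rational points of $\mathbb{B}_{\mathcal{O}}(\mathcal{H})$ which represent schemes having the Cayley-Bacharach property.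
   Context: $K$ is an arbitrary field, $P=K[x_1,\dots,x_n]$, and $\mathbb{T}^n$ is the monoid of terms (power products) in $x_1,\dots,x_n$. An order ideal is a finite set $\mathcal{O}=\{t_1,\dots,t_\mu\}\subset\mathbb{T}^n$ with $\mu\ge 1$ containing every divisor in $\mathbb{T}^n$ of each of its elements; it is always ordered so that $\deg(t_1)\le\cdots\le\deg(t_\mu)$, hence $t_1=1$. Its border is $\partial\mathcal{O}=(x_1\mathcal{O}\cup\cdots\cup x_n\mathcal{O})\setminus\mathcal{O}=\{b_1,\dots,b_\nu\}$, and its affine Hilbert function is $\mathrm{HF}^a_{\mathcal{O}}(i)=\#\{j\mid\deg(t_j)\le i\}$. Let $C=\{c_{ij}\mid 1\le i\le\mu,\ 1\le j\le\nu\}$ be new indeterminates (the coordinates of $\mathbb{B}_{\mathcal{O}}$). The $r$-th generic multiplication matrix $\mathcal{A}_r=(a^{(r)}_{ij})\in\mathrm{Mat}_\mu(K[C])$ has $a^{(r)}_{ij}=\delta_{im}$ (Kronecker delta) if $x_rt_j=t_m$ and $a^{(r)}_{ij}=c_{im}$ if $x_rt_j=b_m$. $I(\mathbb{B}_{\mathcal{O}})\subseteq K[C]$ is generated by the entries of all commutators $\mathcal{A}_r\mathcal{A}_s-\mathcal{A}_s\mathcal{A}_r$, and the border basis scheme $\mathbb{B}_{\mathcal{O}}\subseteq\mathrm{Spec}(K[C])$ is the closed subscheme it defines. For a $K$-rational point $\Gamma=(\gamma_{ij})$ of $\mathbb{B}_{\mathcal{O}}$, let $I_\Gamma\subset P$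 be generated by $b_j-\sum_i\gamma_{ij}t_i$; $\Gamma$ represents the 0-dimensional scheme $\mathbb{X}_\Gamma\subset\mathbb{A}^n_K$ with vanishing ideal $I_\Gamma$, and $R_\Gamma=P/I_\Gamma$. All of this applies likewise to other order ideals $\mathcal{O}'$, with coordinates denoted $C'=\{c'_{\kappa\lambda}\}$. For a term $t=x_1^{\alpha_1}\cdots x_n^{\alpha_n}$, $t(M_1,\dots,M_n)=M_1^{\alpha_1}\cdots M_n^{\alpha_n}$; $\mathrm{adj}$ is the adjugate matrix; $\mathcal{Z}(\cdot)$ is the zero locus. For a 0-dimensional $\mathbb{X}\subset\mathbb{A}^n_K$ with $R_{\mathbb{X}}=P/I_{\mathbb{X}}$, let $F_iR_{\mathbb{X}}$ be the image of the polynomials of degree $\le i$; $\mathrm{HF}^a_{\mathbb{X}}(i)=\mathrm{HF}^a_{R_{\mathbb{X}}}(i)=\dim_K F_iR_{\mathbb{X}}$; $\mathrm{ord}_{\mathcal{F}}(f)=\min\{i\mid f\in F_iR_{\mathbb{X}}\}$ for $f\ne 0$; $\mathrm{ri}(R_{\mathbb{X}})=\min\{i\in\mathbb{Z}\mid F_jR_{\mathbb{X}}=R_{\mathbb{X}}\text{ for all }j\ge i\}$. Cayley-Bacharach property: let $I_{\mathbb{X}}=\mathfrak{Q}_1\cap\cdots\cap\mathfrak{Q}_s$ be the primary decomposition with $\mathfrak{Q}_i$ being $\mathfrak{M}_i$-primary, $\mathfrak{M}_i$ maximal, with image $\mathfrak{m}_i$ in $R_{\mathbb{X}}$. A minimal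 $\mathfrak{Q}_i$-divisor of $I_{\mathbb{X}}$ is an ideal $J=\mathfrak{Q}_1\cap\cdots\cap\mathfrak{Q}'_i\cap\cdots\cap\mathfrak{Q}_s$ with $\mathfrak{Q}_i\subset\mathfrak{Q}'_i\subseteq\mathfrak{M}_i$ (for $\mathfrak{Q}_i=\mathfrak{M}_i$ one takes $\mathfrak{Q}'_i=P$) and $\dim_K(\mathfrak{Q}'_i/\mathfrak{Q}_i)=\dim_K(P/\mathfrak{M}_i)$. Put $\mathrm{ri}(J/I_{\mathbb{X}})=\max\{\mathrm{ord}_{\mathcal{F}}(f)\mid f\in J/I_{\mathbb{X}}\setminus\{0\}\}$, and let $\mathrm{sepdeg}(\mathfrak{m}_i)$ be the minimum of $\mathrm{ri}(J/I_{\mathbb{X}})$ over all minimal $\mathfrak{Q}_i$-divisors $J$. $\mathbb{X}$ has the Cayley-Bacharach property if $\mathrm{sepdeg}(\mathfrak{m}_i)=\mathrm{ri}(R_{\mathbb{X}})$ for all $i$. A sequence $(H_i)$ dominates $(H'_i)$ if $H_i\ge H'_i$ for all $i\ge 0$ (strictly, if they moreover differ); $\mathcal{H}$ is $(n,\mu)$-admissible if $\mathcal{H}=\mathrm{HF}^a_{\mathbb{X}}$ for some 0-dimensional $\mathbb{X}\subset\mathbb{A}^n_K$ of length $\mu$. $\mathbb{B}_{\mathcal{O}}(\overline{\mathcal{H}})$ is the closed subscheme of $\mathbb{B}_{\mathcal{O}}$ which is the closure of the set of $K$-rational points $\Gamma$ with $\mathrm{HF}^a_{R_\Gamma}$ dominated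 by $\mathcal{H}$; $\mathbb{B}_{\mathcal{O}}(\mathcal{H})$ is the complement in it of the closure of the set of those $\Gamma$ with $\mathrm{HF}^a_{R_\Gamma}$ strictly dominated by $\mathcal{H}$ (so its $K$-rational points are the $\Gamma$ with $\mathrm{HF}^a_{R_\Gamma}=\mathcal{H}$). Ideals: for a sequence $\mathcal{G}=(G_0,G_1,\dots)$ dominating $\mathrm{HF}^a_{\mathcal{O}}$ with $\sigma=\min\{i\mid G_i=\mu\}$, $I(\mathbb{B}_{\mathcal{O}}(\overline{\mathcal{G}}))=I(\mathbb{B}_{\mathcal{O}})+\sum_{i=1}^{\sigma-1}D_i$, where $D_i$ is generated by the minors of size $G_i+1$ of the matrix whose columns are the first columns of $u(\mathcal{A}_1,\dots,\mathcal{A}_n)$, $u$ ranging over the terms of degree $\le i$ (minors of size exceeding the matrix contribute the zero ideal). With $\rho=\min\{i\mid H_i=\mu\}$ and $\mathcal{H}'_i$ obtained from $\mathcal{H}$ by replacing $H_i$ with $H_i-1$, $I(Z_{\mathcal{O}}(\overline{\mathcal{H}}))=\bigcap I(\mathbb{B}_{\mathcal{O}}(\overline{\mathcal{H}'_i}))$, where the intersection is over $i\in\{1,\dots,\rho\}$ with $H_i-1\ge\mathrm{HF}^a_{\mathcal{O}}(i)$ (empty intersection $=\langle 1\rangle$). $\mathrm{CBLocus}(\mathcal{O}')$ for an order ideal $\mathcal{O}'=\{t'_1,\dots,t'_\mu\}$ with border $\{b'_\lambda\}$ and coordinates $C'=\{c'_{\kappa\lambda}\}$: let $I(\mathbb{B}^{\mathrm{df}}_{\mathcal{O}'})$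 be $I(\mathbb{B}_{\mathcal{O}'})$ plus the ideal generated by all $c'_{\kappa\lambda}$ with $\deg(t'_\kappa)>\deg(b'_\lambda)$; let $M_{t'_i}$ be the matrix $t'_i$ evaluated at the generic multiplication matrices for $\mathcal{O}'$ with these $c'_{\kappa\lambda}$ set to zero; let $\Delta=\#\{i\mid\deg(t'_i)=\deg(t'_\mu)\}$; for $j=1,\dots,\Delta$ let $V_j$ be the matrix whose $i$-th column is the $(\mu-\Delta+j)$-th column of $M_{t'_i}^{\mathrm{tr}}$; then $\mathrm{CBLocus}(\mathcal{O}')$ is $I(\mathbb{B}^{\mathrm{df}}_{\mathcal{O}'})$ plus the ideal of maximal minors of the block column matrix $\mathrm{Col}(V_1,\dots,V_\Delta)$. Combination procedure: for $\mathcal{O}'_i=\{t'_1,\dots,t'_\mu\}$ with border $\{b'_\lambda\}$, coordinates $C'_i=\{c'_{\kappa\lambda}\}$ and $J_{\mathcal{O}'_i}=\langle a_{i1},\dots,a_{ir_i}\rangle$, let $T'\in\mathrm{Mat}_\mu(K[C])$ be the matrix whose $\kappa$-th column is the first column of $t'_\kappa(\mathcal{A}_1,\dots,\mathcal{A}_n)$, let $\delta_i=\det(T')$, let $B'_\lambda$ be the first column of $b'_\lambda(\mathcal{A}_1,\dots,\mathcal{A}_n)$, and let $p_{\kappa\lambda}\in K[C]$ be the $\kappa$-th entry of $\mathrm{adj}(T')B'_\lambda$. Let $a^\ast_{ij}\in K[C'_i][z]$ be the homogenization of $a_{ij}$ with respect to a new indeterminate $z$, and $\hat a_{ij}\in K[C]$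 the result of substituting $c'_{\kappa\lambda}\mapsto p_{\kappa\lambda}$, $z\mapsto\delta_i$ in it. Then $J_i=\langle\hat a_{i1},\dots,\hat a_{ir_i}\rangle$ and $I^{\mathrm{dfb}}_{\mathcal{O}\mathcal{O}'_i}=I(Z_{\mathcal{O}}(\overline{\mathcal{H}}))\cap\langle\delta_i\rangle$. Conventions: $K$-rational points are to be read as $L$-rational points over field extensions $L\supseteq K$, e.g. $L=\overline{K}$ (in particular closures are formed using $\overline{K}$-rational points); subschemes and their defining ideals are considered up to radical. *)

theory Defs
  imports
    "HOL-Library.Poly_Mapping"
    "HOL-Algebra.Algebraic_Closure_Type"
    "HOL-Algebra.Embedded_Algebras"
    "HOL-Algebra.QuotRing"
    "Jordan_Normal_Form.Determinant"
    "Jordan_Normal_Form.DL_Submatrix"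
    "Jordan_Normal_Form.Ring_Hom_Matrix"
begin

section \<open>Polynomial rings\<close>

text \<open>
  Terms are exponent functions of finite support, written additively: the term
  \<open>s\<close> divides \<open>t\<close> iff \<open>t = s + u\<close> for some \<open>u\<close>. A polynomial is a finitely supported
  coefficient function on terms; \<open>single t c\<close> is the polynomial \<open>c \<cdot> t\<close>.
\<close>

type_synonym 'v monom = "'v \<Rightarrow>\<^sub>0 nat"
type_synonym ('v, 'a) mpoly = "'v monom \<Rightarrow>\<^sub>0 'a"

definition mdeg :: "'v monom \<Rightarrow> nat" where
  "mdeg m = (\<Sum>v\<in>Poly_Mapping.keys m. Poly_Mapping.lookup m v)"

definition var :: "'v \<Rightarrow> ('v, 'a::comm_ring_1) mpoly" where
  "var v = Poly_Mapping.single (Poly_Mapping.single v 1) 1"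

definition const :: "'a \<Rightarrow> ('v, 'a::comm_ring_1) mpoly" where
  "const c = Poly_Mapping.single 0 c"

text \<open>The polynomials in which only the indeterminates from \<open>V\<close> occur.\<close>

definition poly_ring :: "'v set \<Rightarrow> ('v, 'a::comm_ring_1) mpoly ring" where
  "poly_ring V = \<lparr> carrier = {p. \<forall>m\<in>Poly_Mapping.keys p. Poly_Mapping.keys m \<subseteq> V},
     monoid.mult = (*), one = 1, ring.zero = 0, add = (+) \<rparr>"

lemma cring_poly_ring: "cring (poly_ring V :: ('v, 'a::comm_ring_1) mpoly ring)"
proof -
  let ?C = "{p :: ('v, 'a) mpoly. \<forall>m\<in>Poly_Mapping.keys p. Poly_Mapping.keys m \<subseteq> V}"
  have add: "p + q \<in> ?C" if "p \<in> ?C" "q \<in> ?C" for p q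
    using that Poly_Mapping.keys_add[of p q] by blast
  have mult: "p * q \<in> ?C" if "p \<in> ?C" "q \<in> ?C" for p q
  proof -
    have "Poly_Mapping.keys m \<subseteq> V" if "m \<in> Poly_Mapping.keys (p * q)" for m
    proof -
      from that keys_mult[of p q] obtain a b
        where "m = a + b" "a \<in> Poly_Mapping.keys p" "b \<in> Poly_Mapping.keys q" by blast
      then show ?thesis
        using \<open>p \<in> ?C\<close> \<open>q \<in> ?C\<close> Poly_Mapping.keys_add[of a b] by blast
    qed
    then show ?thesis by blast
  qed
  have zero: "0 \<in> ?C" and one: "1 \<in> ?C"
    by simp_all
  have "Poly_Mapping.keys (- p) = Poly_Mapping.keys p" for p :: "('v, 'a) mpoly"
    by (simp add: set_eq_iff in_keys_iff)
  then have neg: "- p \<in> ?C" if "p \<in> ?C" for p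
    using that by simp
  have ab: "abelian_group \<lparr> carrier = ?C, monoid.mult = (*), one = 1, ring.zero = 0, add = (+) \<rparr>"
  proof (rule abelian_groupI, unfold ring_record_simps)
    show "\<exists>y\<in>?C. y + x = 0" if "x \<in> ?C" for x
      using neg[OF that] by (rule bexI[rotated]) (rule add.left_inverse)
  qed (rule add zero add.assoc add.commute add_0_left; assumption?)+
  have mo: "Group.comm_monoid \<lparr> carrier = ?C, monoid.mult = (*), one = 1, ring.zero = 0, add = (+) \<rparr>"
    by (rule Group.comm_monoidI, unfold monoid.simps partial_object.simps)
       (rule mult one mult.assoc mult.commute mult_1_left; assumption?)+
  show ?thesis
    unfolding poly_ring_def
    by (rule cringI[OF ab mo]) (unfold ring_record_simps, rule distrib_right)
qed

text \<open>
  The value of a polynomial when its coefficients are mapped by \<open>h\<close> and its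
  indeterminates are replaced according to \<open>x\<close>; \<open>poly_subst const x\<close> is substitution of
  polynomials for the indeterminates.
\<close>

definition poly_subst :: "('a \<Rightarrow> 'b) \<Rightarrow> ('v \<Rightarrow> 'b) \<Rightarrow> ('v, 'a::zero) mpoly \<Rightarrow> 'b::comm_ring_1" where
  "poly_subst h x p = (\<Sum>m\<in>Poly_Mapping.keys p.
     h (Poly_Mapping.lookup p m) * (\<Prod>v\<in>Poly_Mapping.keys m. x v ^ Poly_Mapping.lookup m v))"

text \<open>The homogenizing indeterminate is \<open>None\<close>.\<close>

definition homogenize :: "('v, 'a::comm_ring_1) mpoly \<Rightarrow> ('v option, 'a) mpoly" where
  "homogenize p = (let d = Max (insert 0 (mdeg ` Poly_Mapping.keys p)) in
     \<Sum>m\<in>Poly_Mapping.keys p. Poly_Mapping.single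
       ((\<Sum>v\<in>Poly_Mapping.keys m. Poly_Mapping.single (Some v) (Poly_Mapping.lookup m v))
          + Poly_Mapping.single None (d - mdeg m))
       (Poly_Mapping.lookup p m))"

text \<open>Finite sums of ideals over the index list \<open>xs\<close>.\<close>

definition ideal_sum :: "('r, 'm) ring_scheme \<Rightarrow> ('i \<Rightarrow> 'r set) \<Rightarrow> 'i list \<Rightarrow> 'r set" where
  "ideal_sum R J xs = foldr (\<lambda>i S. J i <+>\<^bsub>R\<^esub> S) xs {\<zero>\<^bsub>R\<^esub>}"

definition minors :: "nat \<Rightarrow> 'a::comm_ring_1 mat \<Rightarrow> 'a set" where
  "minors k A = {det (submatrix A I J) | I J.
     I \<subseteq> {..<dim_row A} \<and> J \<subseteq> {..<dim_col A} \<and> card I = k \<and> card J = k}"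


section \<open>Zero-dimensional schemes and the Cayley-Bacharach property\<close>

text \<open>
  A zero-dimensional subscheme of affine \<open>n\<close>-space is given by its vanishing ideal \<open>I\<close>
  in \<open>KX n\<close>; its affine coordinate ring is \<open>coord_ring n I\<close>.
\<close>

abbreviation KX :: "nat \<Rightarrow> (nat, 'a::comm_ring_1) mpoly ring" where
  "KX n \<equiv> poly_ring {..<n}"

definition coord_ring :: "nat \<Rightarrow> (nat, 'a::field) mpoly set \<Rightarrow> (nat, 'a) mpoly set ring" where
  "coord_ring n I = KX n Quot I"

definition residue :: "nat \<Rightarrow> (nat, 'a::field) mpoly set \<Rightarrow> (nat, 'a) mpoly \<Rightarrow> (nat, 'a) mpoly set" where
  "residue n I p = I +>\<^bsub>KX n\<^esub> p"

definition scalars :: "nat \<Rightarrow> (nat, 'a::field) mpoly set \<Rightarrow> (nat, 'a) mpoly set set" where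
  "scalars n I = range (\<lambda>c. residue n I (const c))"

definition kdim :: "nat \<Rightarrow> (nat, 'a::field) mpoly set \<Rightarrow> (nat, 'a) mpoly set set \<Rightarrow> nat" where
  "kdim n I E = ring.dim (coord_ring n I) (scalars n I) E"

definition zero_dim_of_length :: "nat \<Rightarrow> (nat, 'a::field) mpoly set \<Rightarrow> nat \<Rightarrow> bool" where
  "zero_dim_of_length n I \<mu> \<longleftrightarrow> ideal I (KX n) \<and>
     ring.dimension (coord_ring n I) \<mu> (scalars n I) (carrier (coord_ring n I))"

definition filtration :: "nat \<Rightarrow> (nat, 'a::field) mpoly set \<Rightarrow> int \<Rightarrow> (nat, 'a) mpoly set set" where
  "filtration n I i = residue n I ` {p \<in> carrier (KX n). \<forall>m\<in>Poly_Mapping.keys p. int (mdeg m) \<le> i}"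

definition HFa :: "nat \<Rightarrow> (nat, 'a::field) mpoly set \<Rightarrow> nat \<Rightarrow> nat" where
  "HFa n I i = kdim n I (filtration n I (int i))"

definition ri :: "nat \<Rightarrow> (nat, 'a::field) mpoly set \<Rightarrow> int" where
  "ri n I = (LEAST i. \<forall>j\<ge>i. filtration n I j = carrier (coord_ring n I))"

definition ord_filtration :: "nat \<Rightarrow> (nat, 'a::field) mpoly set \<Rightarrow> (nat, 'a) mpoly set \<Rightarrow> int" where
  "ord_filtration n I f = (LEAST i. f \<in> filtration n I i)"

definition radical :: "('r, 'm) ring_scheme \<Rightarrow> 'r set \<Rightarrow> 'r set" where
  "radical R I = {a \<in> carrier R. \<exists>k::nat. a [^]\<^bsub>R\<^esub> k \<in> I}"

definition primary_ideal :: "'r set \<Rightarrow> ('r, 'm) ring_scheme \<Rightarrow> bool" where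
  "primary_ideal Q R \<longleftrightarrow> ideal Q R \<and> Q \<noteq> carrier R \<and>
     (\<forall>a\<in>carrier R. \<forall>b\<in>carrier R. a \<otimes>\<^bsub>R\<^esub> b \<in> Q \<longrightarrow> a \<in> Q \<or> b \<in> radical R Q)"

text \<open>
  Primary decomposition of the ideal of a zero-dimensional scheme. Since the radicals
  are pairwise distinct maximal ideals, it is automatically irredundant and unique.
\<close>

definition primary_decomposition ::
    "nat \<Rightarrow> (nat, 'a::field) mpoly set \<Rightarrow> (nat, 'a) mpoly set set \<Rightarrow> bool" where
  "primary_decomposition n I QS \<longleftrightarrow> finite QS \<and>
     (\<forall>Q\<in>QS. primary_ideal Q (KX n) \<and> maximalideal (radical (KX n) Q) (KX n)) \<and>
     inj_on (radical (KX n)) QS \<and> I = carrier (KX n) \<inter> \<Inter>QS"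

definition minimal_divisor ::
    "nat \<Rightarrow> (nat, 'a::field) mpoly set set \<Rightarrow> (nat, 'a) mpoly set \<Rightarrow> (nat, 'a) mpoly set \<Rightarrow> bool" where
  "minimal_divisor n QS Q J \<longleftrightarrow> (\<exists>Q'. ideal Q' (KX n) \<and>
     (let M = radical (KX n) Q in
        (if Q = M then Q' = carrier (KX n) else Q \<subset> Q' \<and> Q' \<subseteq> M) \<and>
        kdim n Q (residue n Q ` Q') = kdim n M (carrier (coord_ring n M))) \<and>
     J = Q' \<inter> \<Inter>(QS - {Q}))"

definition ri_divisor :: "nat \<Rightarrow> (nat, 'a::field) mpoly set \<Rightarrow> (nat, 'a) mpoly set \<Rightarrow> int" where
  "ri_divisor n I J =
     Max (ord_filtration n I ` (residue n I ` J - {\<zero>\<^bsub>coord_ring n I\<^esub>}))"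

definition sepdeg ::
    "nat \<Rightarrow> (nat, 'a::field) mpoly set \<Rightarrow> (nat, 'a) mpoly set set \<Rightarrow> (nat, 'a) mpoly set \<Rightarrow> int" where
  "sepdeg n I QS Q = Min {ri_divisor n I J | J. minimal_divisor n QS Q J}"

definition cayley_bacharach :: "nat \<Rightarrow> (nat, 'a::field) mpoly set \<Rightarrow> bool" where
  "cayley_bacharach n I \<longleftrightarrow>
     (\<exists>QS. primary_decomposition n I QS \<and> (\<forall>Q\<in>QS. sepdeg n I QS Q = ri n I))"

definition dominates :: "(nat \<Rightarrow> nat) \<Rightarrow> (nat \<Rightarrow> nat) \<Rightarrow> bool" where
  "dominates H H' \<longleftrightarrow> (\<forall>i. H' i \<le> H i)"

definition strictly_dominates :: "(nat \<Rightarrow> nat) \<Rightarrow> (nat \<Rightarrow> nat) \<Rightarrow> bool" where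
  "strictly_dominates H H' \<longleftrightarrow> dominates H H' \<and> H \<noteq> H'"

definition admissible :: "'a::field itself \<Rightarrow> nat \<Rightarrow> nat \<Rightarrow> (nat \<Rightarrow> nat) \<Rightarrow> bool" where
  "admissible _ n \<mu> H \<longleftrightarrow>
     (\<exists>I :: (nat, 'a) mpoly set. zero_dim_of_length n I \<mu> \<and> H = HFa n I)"


section \<open>Order ideals and border basis schemes\<close>

text \<open>
  All indices start at 0, so the indeterminate \<open>x\<^sub>r\<close> is \<open>var r\<close> for \<open>r < n\<close>, and
  the coordinate \<open>c\<^sub>i\<^sub>j\<close> is \<open>var (i, j)\<close> for \<open>i < \<mu>\<close>, \<open>j < \<nu>\<close>.
\<close>

definition terms :: "nat \<Rightarrow> nat monom set" where
  "terms n = {t. Poly_Mapping.keys t \<subseteq> {..<n}}"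

definition order_ideal :: "nat \<Rightarrow> nat monom set \<Rightarrow> bool" where
  "order_ideal n S \<longleftrightarrow> finite S \<and> S \<noteq> {} \<and> S \<subseteq> terms n \<and>
     (\<forall>t\<in>S. \<forall>s u. t = s + u \<longrightarrow> s \<in> S)"

definition HFa_terms :: "nat monom set \<Rightarrow> nat \<Rightarrow> nat" where
  "HFa_terms S i = card {t \<in> S. mdeg t \<le> i}"

definition border :: "nat \<Rightarrow> nat monom set \<Rightarrow> nat monom set" where
  "border n S = {Poly_Mapping.single r 1 + t | r t. r < n \<and> t \<in> S} - S"

text \<open>
  An order ideal together with a degree-ordered enumeration \<open>ts\<close> of its terms and an
  enumeration \<open>bs\<close> of its border.
\<close>

definition enumerated_order_ideal :: "nat \<Rightarrow> nat monom list \<Rightarrow> nat monom list \<Rightarrow> bool" where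
  "enumerated_order_ideal n ts bs \<longleftrightarrow>
     order_ideal n (set ts) \<and> distinct ts \<and> sorted (map mdeg ts) \<and>
     distinct bs \<and> set bs = border n (set ts)"

abbreviation KC :: "nat monom list \<Rightarrow> nat monom list \<Rightarrow> (nat \<times> nat, 'a::comm_ring_1) mpoly ring" where
  "KC ts bs \<equiv> poly_ring ({..<length ts} \<times> {..<length bs})"

definition gen_mult_mat ::
    "nat monom list \<Rightarrow> nat monom list \<Rightarrow> nat \<Rightarrow> (nat \<times> nat, 'a::comm_ring_1) mpoly mat" where
  "gen_mult_mat ts bs r = mat (length ts) (length ts) (\<lambda>(i, j).
     let u = Poly_Mapping.single r 1 + ts ! j in
     if u \<in> set ts then (if ts ! i = u then 1 else 0)
     else var (i, THE m. m < length bs \<and> bs ! m = u))"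

text \<open>
  The matrices need not commute, so the order of the factors matters in
  the value of a term at \<open>M\<^sub>1, \<dots>, M\<^sub>n\<close>.
\<close>

definition eval_term :: "nat \<Rightarrow> nat \<Rightarrow> (nat \<Rightarrow> 'r::comm_ring_1 mat) \<Rightarrow> nat monom \<Rightarrow> 'r mat" where
  "eval_term n \<mu> M t = foldr (\<lambda>r A. (M r ^\<^sub>m Poly_Mapping.lookup t r) * A) [0..<n] (1\<^sub>m \<mu>)"

definition first_col ::
    "nat \<Rightarrow> nat monom list \<Rightarrow> nat monom list \<Rightarrow> nat monom \<Rightarrow> (nat \<times> nat, 'a::comm_ring_1) mpoly vec" where
  "first_col n ts bs u = col (eval_term n (length ts) (gen_mult_mat ts bs) u) 0"

definition I_BO :: "nat \<Rightarrow> nat monom list \<Rightarrow> nat monom list \<Rightarrow> (nat \<times> nat, 'a::comm_ring_1) mpoly set" where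
  "I_BO n ts bs = (let A = gen_mult_mat ts bs in
     Idl\<^bsub>KC ts bs\<^esub> {(A r * A s - A s * A r) $$ (i, j) | r s i j.
       r < n \<and> s < n \<and> i < length ts \<and> j < length ts})"

definition I_point :: "nat \<Rightarrow> nat monom list \<Rightarrow> nat monom list \<Rightarrow> 'a::field mat \<Rightarrow> (nat, 'a) mpoly set" where
  "I_point n ts bs \<Gamma> = Idl\<^bsub>KX n\<^esub> {Poly_Mapping.single (bs ! j) 1 -
     (\<Sum>i<length ts. Poly_Mapping.single (ts ! i) (\<Gamma> $$ (i, j))) | j. j < length bs}"

text \<open>
  The \<open>L\<close>-rational zeros of a subset of \<open>K[C]\<close>, where \<open>\<iota> : K \<rightarrow> L\<close> is a field extension.
  A point is the matrix \<open>(\<gamma>\<^sub>i\<^sub>j)\<close> of its coordinates.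
\<close>

definition zero_locus ::
    "('k::field \<Rightarrow> 'l::field) \<Rightarrow> nat monom list \<Rightarrow> nat monom list \<Rightarrow> (nat \<times> nat, 'k) mpoly set \<Rightarrow> 'l mat set" where
  "zero_locus \<iota> ts bs I = {\<Gamma> \<in> carrier_mat (length ts) (length bs). \<forall>f\<in>I. poly_subst \<iota> (($$) \<Gamma>) f = 0}"

text \<open>
  The vanishing ideal in \<open>K[C]\<close> of a set of points over the algebraic closure of \<open>K\<close>. It
  defines the (reduced) closure of this set in the spectrum of \<open>K[C]\<close>.
\<close>

definition vanishing_ideal ::
    "nat monom list \<Rightarrow> nat monom list \<Rightarrow> 'k::field alg_closure mat set \<Rightarrow> (nat \<times> nat, 'k) mpoly set" where
  "vanishing_ideal ts bs S = {f \<in> carrier (KC ts bs). \<forall>\<Gamma>\<in>S. poly_subst to_ac (($$) \<Gamma>) f = 0}"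

text \<open>
  The \<open>L\<close>-rational points of the closed subscheme of points with Hilbert function
  dominated by \<open>H\<close>, and of its open subscheme of points with Hilbert function \<open>H\<close>.
\<close>

definition BO_bar_points ::
    "('k::field \<Rightarrow> 'l::field) \<Rightarrow> nat \<Rightarrow> nat monom list \<Rightarrow> nat monom list \<Rightarrow> (nat \<Rightarrow> nat) \<Rightarrow> 'l mat set" where
  "BO_bar_points \<iota> n ts bs H = zero_locus \<iota> ts bs (vanishing_ideal ts bs
     {\<Gamma> \<in> zero_locus to_ac ts bs (I_BO n ts bs). dominates H (HFa n (I_point n ts bs \<Gamma>))})"

definition BO_points ::
    "('k::field \<Rightarrow> 'l::field) \<Rightarrow> nat \<Rightarrow> nat monom list \<Rightarrow> nat monom list \<Rightarrow> (nat \<Rightarrow> nat) \<Rightarrow> 'l mat set" where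
  "BO_points \<iota> n ts bs H = BO_bar_points \<iota> n ts bs H - zero_locus \<iota> ts bs (vanishing_ideal ts bs
     {\<Gamma> \<in> zero_locus to_ac ts bs (I_BO n ts bs).
        strictly_dominates H (HFa n (I_point n ts bs \<Gamma>))})"


section \<open>Ideals defining loci in border basis schemes\<close>

text \<open>
  The columns are listed in the order provided by the library on \<open>nat monom\<close>; another
  order changes the minors by a sign only.
\<close>

definition I_BO_bar ::
    "nat \<Rightarrow> nat monom list \<Rightarrow> nat monom list \<Rightarrow> (nat \<Rightarrow> nat) \<Rightarrow> (nat \<times> nat, 'a::comm_ring_1) mpoly set" where
  "I_BO_bar n ts bs G = (let \<mu> = length ts;
      \<sigma> = (LEAST i. G i = \<mu>);
      W = (\<lambda>i. mat_of_cols \<mu>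
             (map (first_col n ts bs) (sorted_list_of_set {u \<in> terms n. mdeg u \<le> i})));
      D = (\<lambda>i. Idl\<^bsub>KC ts bs\<^esub> minors (G i + 1) (W i))
    in I_BO n ts bs <+>\<^bsub>KC ts bs\<^esub> ideal_sum (KC ts bs) D [1..<\<sigma>])"

definition I_ZO_bar ::
    "nat \<Rightarrow> nat monom list \<Rightarrow> nat monom list \<Rightarrow> (nat \<Rightarrow> nat) \<Rightarrow> (nat \<times> nat, 'a::comm_ring_1) mpoly set" where
  "I_ZO_bar n ts bs H = (let \<rho> = (LEAST i. H i = length ts) in
     carrier (KC ts bs) \<inter>
     (\<Inter>i\<in>{i\<in>{1..\<rho>}. H i - 1 \<ge> HFa_terms (set ts) i}. I_BO_bar n ts bs (H(i := H i - 1))))"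

definition CBLocus ::
    "nat \<Rightarrow> nat monom list \<Rightarrow> nat monom list \<Rightarrow> (nat \<times> nat, 'a::comm_ring_1) mpoly set" where
  "CBLocus n ts bs = (let \<mu> = length ts;
      Bad = {(k, l). k < \<mu> \<and> l < length bs \<and> mdeg (ts ! k) > mdeg (bs ! l)};
      I_df = I_BO n ts bs <+>\<^bsub>KC ts bs\<^esub> Idl\<^bsub>KC ts bs\<^esub> (var ` Bad);
      kill = poly_subst const (\<lambda>v. if v \<in> Bad then 0 else var v);
      M = (\<lambda>i. eval_term n \<mu> (\<lambda>r. map_mat kill (gen_mult_mat ts bs r)) (ts ! i));
      \<Delta> = card {i. i < \<mu> \<and> mdeg (ts ! i) = mdeg (last ts)};
      V = (\<lambda>j. mat_of_cols \<mu> (map (\<lambda>i. col (transpose_mat (M i)) (\<mu> - \<Delta> + j)) [0..<\<mu>]));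
      Col = mat (\<Delta> * \<mu>) \<mu> (\<lambda>(i, k). V (i div \<mu>) $$ (i mod \<mu>, k))
    in I_df <+>\<^bsub>KC ts bs\<^esub> Idl\<^bsub>KC ts bs\<^esub> minors \<mu> Col)"

text \<open>
  The combination procedure: \<open>(ts, bs)\<close> is the order ideal \<open>O\<close> with its border,
  \<open>(ts', bs')\<close> is \<open>O'\<close> with its border.
\<close>

definition transition_mat ::
    "nat \<Rightarrow> nat monom list \<Rightarrow> nat monom list \<Rightarrow> nat monom list \<Rightarrow> (nat \<times> nat, 'a::comm_ring_1) mpoly mat" where
  "transition_mat n ts bs ts' = mat_of_cols (length ts) (map (first_col n ts bs) ts')"

definition transfer_poly ::
    "nat \<Rightarrow> nat monom list \<Rightarrow> nat monom list \<Rightarrow> nat monom list \<Rightarrow> nat monom list \<Rightarrow>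
     (nat \<times> nat, 'a::comm_ring_1) mpoly \<Rightarrow> (nat \<times> nat, 'a) mpoly" where
  "transfer_poly n ts bs ts' bs' a = (let T = transition_mat n ts bs ts' in
     poly_subst const
       (\<lambda>v. case v of None \<Rightarrow> det T
                    | Some (k, l) \<Rightarrow> (adj_mat T *\<^sub>v first_col n ts bs (bs' ! l)) $ k)
       (homogenize a))"

definition J_ideal ::
    "nat \<Rightarrow> nat monom list \<Rightarrow> nat monom list \<Rightarrow> nat monom list \<Rightarrow> nat monom list \<Rightarrow>
     (nat \<times> nat, 'a::comm_ring_1) mpoly list \<Rightarrow> (nat \<times> nat, 'a) mpoly set" where
  "J_ideal n ts bs ts' bs' as = Idl\<^bsub>KC ts bs\<^esub> (transfer_poly n ts bs ts' bs' ` set as)"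

definition I_dfb ::
    "nat \<Rightarrow> nat monom list \<Rightarrow> nat monom list \<Rightarrow> (nat \<Rightarrow> nat) \<Rightarrow> nat monom list \<Rightarrow>
     (nat \<times> nat, 'a::comm_ring_1) mpoly set" where
  "I_dfb n ts bs H ts' =
     I_ZO_bar n ts bs H \<inter> Idl\<^bsub>KC ts bs\<^esub> {det (transition_mat n ts bs ts')}"

definition I_NCB ::
    "nat \<Rightarrow> nat monom list \<Rightarrow> nat monom list \<Rightarrow> (nat \<Rightarrow> nat) \<Rightarrow> nat \<Rightarrow>
     (nat \<Rightarrow> nat monom list) \<Rightarrow> (nat \<Rightarrow> nat monom list) \<Rightarrow>
     (nat \<Rightarrow> (nat \<times> nat, 'a::comm_ring_1) mpoly list) \<Rightarrow> (nat \<times> nat, 'a) mpoly set" where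
  "I_NCB n ts bs H l ts' bs' as = ideal_sum (KC ts bs)
     (\<lambda>i. (I_dfb n ts bs H (ts' i) <+>\<^bsub>KC ts bs\<^esub> I_BO_bar n ts bs H) \<inter>
          (J_ideal n ts bs (ts' i) (bs' i) (as i) <+>\<^bsub>KC ts bs\<^esub> I_BO_bar n ts bs H))
     [0..<l]"

end

theory Submission
  imports Defs
begin

text \<open>
  Let \<open>\<Gamma>\<close> be a point of \<open>BO_bar_points \<iota> n ts bs H\<close>, with vanishing ideal \<open>I\<^sub>\<Gamma>\<close>, coordinate ring
  \<open>R\<close> and degree filtration \<open>F\<^sub>i R\<close>.

  The multiplication matrices at \<open>\<Gamma>\<close> commute. Hence evaluating terms at them gives a normal form
  map onto the span of the order ideal \<open>O\<close> with kernel \<open>I\<^sub>\<Gamma>\<close> (\<open>NF_eq_zero_iff\<close>), and the affine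
  Hilbert function at \<open>i\<close> is the rank of the matrix whose columns are the coordinates of the terms
  of degree at most \<open>i\<close>. Therefore bounds on the Hilbert function are determinantal equations:
  the ideal \<open>I_BO_bar\<close> expresses that the Hilbert function is dominated by \<open>H\<close>
  (\<open>vanishes_I_BO_bar_H_iff\<close>), and on the locus where it is, the ideal \<open>I_ZO_bar\<close> expresses that it
  differs from \<open>H\<close> (\<open>vanishes_I_ZO_bar_iff\<close>). Both loci in the statement are defined by closures of sets of
  points over the algebraic closure of \<open>K\<close>, whereas \<open>\<Gamma>\<close> is defined over an arbitrary extension. The
  link is that \<open>\<Gamma>\<close> specializes to points over the algebraic closure at which all equations over \<open>K\<close>
  satisfied by \<open>\<Gamma>\<close> persist and a given inequation is kept (\<open>specialize_point\<close>). It yields that the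
  points of the open locus are those with Hilbert function \<open>H\<close> (\<open>mem_BO_points_iff\<close>).

  A point lies outside the zero locus of a sum of intersections of two ideals iff both ideals of
  some summand are nonzero at the point. So \<open>\<Gamma>\<close> is outside the zero locus of \<open>I_NCB\<close> iff its Hilbert
  function is \<open>H\<close> and for some \<open>i\<close> the determinant \<open>\<delta>\<^sub>i\<close> and the ideal \<open>J\<^sub>i\<close> are nonzero at \<open>\<Gamma>\<close>. Now
  \<open>\<delta>\<^sub>i\<close> is nonzero at \<open>\<Gamma>\<close> iff the order ideal \<open>O'\<^sub>i\<close> is a basis of \<open>R\<close>. In that case Cramer's rule
  provides a point \<open>\<Gamma>'\<close> of the border basis scheme of \<open>O'\<^sub>i\<close> with the same vanishing ideal
  (\<open>I_point_new_point\<close>), and the generators of \<open>J\<^sub>i\<close> take at \<open>\<Gamma>\<close> the values that the generators of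
  \<open>CBLocus\<close> take at \<open>\<Gamma>'\<close>, up to powers of \<open>\<delta>\<^sub>i\<close> (\<open>vanishes_J_ideal_iff\<close>).

  The Hilbert function of \<open>\<Gamma>'\<close> is that of \<open>O'\<^sub>i\<close>, so normal forms with respect to \<open>O'\<^sub>i\<close> do not raise
  degrees, and the filtration step below the regularity index consists of the combinations of the
  terms of \<open>O'\<^sub>i\<close> of less than top degree. Read in coordinates, the vanishing of the maximal minors in
  \<open>CBLocus\<close> means that there is a nonzero \<open>f \<in> R\<close> such that \<open>f R\<close> is contained in this filtration step
  (\<open>vanishes_CBLocus_iff\<close>). By \<open>cayley_bacharach_iff\<close> this is the failure of the Cayley-Bacharach
  property: the ideal \<open>f R\<close> contains a minimal nonzero ideal of \<open>R\<close>, and this is a minimal divisor.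

  It remains to see that some \<open>O'\<^sub>i\<close> is a basis of \<open>R\<close> if the Hilbert function is \<open>H\<close>. This is
  Macaulay's theorem: the standard terms for a degree-compatible term order form an order ideal
  which is a basis of \<open>R\<close> and has the Hilbert function of \<open>R\<close> (\<open>HFa_standard_terms\<close>,
  \<open>det_standard_terms\<close>).
\<close>

section \<open>Evaluation of polynomials\<close>

abbreviation keys :: "('v \<Rightarrow>\<^sub>0 'b::zero) \<Rightarrow> 'v set" where "keys \<equiv> Poly_Mapping.keys"
abbreviation lookup :: "('v \<Rightarrow>\<^sub>0 'b::zero) \<Rightarrow> 'v \<Rightarrow> 'b" where "lookup \<equiv> Poly_Mapping.lookup"
abbreviation single :: "'v \<Rightarrow> 'b \<Rightarrow> ('v \<Rightarrow>\<^sub>0 'b::zero)" where "single \<equiv> Poly_Mapping.single"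

definition term_value :: "('v \<Rightarrow> 'b::comm_ring_1) \<Rightarrow> 'v monom \<Rightarrow> 'b" where
  "term_value x m = (\<Prod>v\<in>keys m. x v ^ lookup m v)"

lemma term_value_superset:
  assumes "finite S" "keys m \<subseteq> S"
  shows "term_value x m = (\<Prod>v\<in>S. x v ^ lookup m v)"
  unfolding term_value_def
  by (rule prod.mono_neutral_left) (use assms in \<open>auto simp: in_keys_iff\<close>)

lemma term_value_zero [simp]: "term_value x 0 = 1"
  by (simp add: term_value_def)

lemma term_value_single [simp]: "term_value x (single v k) = x v ^ k"
  by (simp add: term_value_def)

lemma term_value_add: "term_value x (a + b) = term_value x a * term_value x b"
proof -
  let ?S = "keys a \<union> keys b"
  have "term_value x (a + b) = (\<Prod>v\<in>?S. x v ^ lookup (a + b) v)"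
    by (rule term_value_superset) (use Poly_Mapping.keys_add[of a b] in auto)
  also have "\<dots> = (\<Prod>v\<in>?S. x v ^ lookup a v) * (\<Prod>v\<in>?S. x v ^ lookup b v)"
    by (simp add: lookup_add power_add prod.distrib)
  finally show ?thesis
    by (simp add: term_value_superset[of ?S])
qed

lemma poly_subst_eq_sum:
  assumes "finite S" "keys p \<subseteq> S" "h 0 = 0"
  shows "poly_subst h x p = (\<Sum>m\<in>S. h (lookup p m) * term_value x m)"
  unfolding poly_subst_def term_value_def[symmetric]
  by (rule sum.mono_neutral_left) (use assms in \<open>auto simp: in_keys_iff\<close>)

lemma sum_of_terms: "(\<Sum>m\<in>keys p. single m (lookup p m)) = p"
  by (rule poly_mapping_eqI)
     (auto simp: lookup_sum lookup_single when_def in_keys_iff sum.delta' if_distrib cong: if_cong)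

context comm_ring_hom
begin

lemma poly_subst_zero [simp]: "poly_subst hom x 0 = 0"
  by (simp add: poly_subst_def)

lemma poly_subst_single: "poly_subst hom x (single m c) = hom c * term_value x m"
  by (cases "c = 0") (simp_all add: poly_subst_def term_value_def)

lemma poly_subst_add: "poly_subst hom x (p + q) = poly_subst hom x p + poly_subst hom x q"
proof -
  let ?S = "keys p \<union> keys q"
  have "keys (p + q) \<subseteq> ?S"
    by (rule Poly_Mapping.keys_add)
  then show ?thesis
    by (simp add: poly_subst_eq_sum[of ?S] lookup_add hom_add distrib_right sum.distrib)
qed

lemma poly_subst_sum: "poly_subst hom x (sum f A) = (\<Sum>a\<in>A. poly_subst hom x (f a))"
  by (induction A rule: infinite_finite_induct) (simp_all add: poly_subst_add)

lemma poly_subst_mult: "poly_subst hom x (p * q) = poly_subst hom x p * poly_subst hom x q"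
proof -
  have "p * q = (\<Sum>a\<in>keys p. \<Sum>b\<in>keys q. single (a + b) (lookup p a * lookup q b))"
    by (subst (1) sum_of_terms[symmetric], subst (3) sum_of_terms[symmetric])
       (simp add: sum_product Poly_Mapping.mult_single)
  also have "poly_subst hom x \<dots> = (\<Sum>a\<in>keys p. \<Sum>b\<in>keys q.
      (hom (lookup p a) * term_value x a) * (hom (lookup q b) * term_value x b))"
    by (simp add: poly_subst_sum poly_subst_single hom_mult term_value_add mult_ac)
  also have "\<dots> = poly_subst hom x p * poly_subst hom x q"
    by (simp add: poly_subst_def term_value_def sum_product)
  finally show ?thesis .
qed

lemma comm_ring_hom_poly_subst: "comm_ring_hom (poly_subst hom x)"
proof
  show "poly_subst hom x 1 = 1"
    using poly_subst_single[of x 0 1] by simp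
qed (simp_all add: poly_subst_add poly_subst_mult)

lemma poly_subst_var [simp]: "poly_subst hom x (var v) = x v"
  by (simp add: var_def poly_subst_single)

lemma poly_subst_const [simp]: "poly_subst hom x (const c) = hom c"
  by (simp add: const_def poly_subst_single)

end

lemma const_simps [simp]:
  "const 0 = 0" "const 1 = 1" "const (a + b) = const a + const b" "const (a * b) = const a * const b"
  "const (- a) = - const a"
  by (simp_all add: const_def single_add Poly_Mapping.mult_single single_uminus)

lemma comm_ring_hom_const: "comm_ring_hom const"
  by standard simp_all

lemma (in comm_ring_hom) poly_subst_poly_subst:
  "poly_subst hom x (poly_subst const y p) = poly_subst hom (\<lambda>v. poly_subst hom x (y v)) p"
proof -
  interpret E: comm_ring_hom "poly_subst hom x" by (rule comm_ring_hom_poly_subst)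
  show ?thesis
    unfolding poly_subst_def[of const] poly_subst_def[of hom "\<lambda>v. poly_subst hom x (y v)"]
    by (simp add: E.hom_sum E.hom_mult E.hom_prod E.hom_power)
qed

lemma poly_subst_cong:
  assumes "\<And>m v. m \<in> keys p \<Longrightarrow> v \<in> keys m \<Longrightarrow> x v = y v"
  shows "poly_subst h x p = poly_subst h y p"
  unfolding poly_subst_def using assms by (intro sum.cong prod.cong refl arg_cong2[where f = "(*)"]) auto

section \<open>Polynomials in a set of indeterminates\<close>

definition subring_set :: "'a::comm_ring_1 set \<Rightarrow> bool" where
  "subring_set C \<longleftrightarrow> 1 \<in> C \<and> (\<forall>a\<in>C. \<forall>b\<in>C. a - b \<in> C \<and> a * b \<in> C)"

lemma
  assumes "subring_set C"
  shows subring_set_one: "1 \<in> C"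
    and subring_set_zero: "0 \<in> C"
    and subring_set_diff: "a \<in> C \<Longrightarrow> b \<in> C \<Longrightarrow> a - b \<in> C"
    and subring_set_uminus: "a \<in> C \<Longrightarrow> - a \<in> C"
    and subring_set_add: "a \<in> C \<Longrightarrow> b \<in> C \<Longrightarrow> a + b \<in> C"
    and subring_set_mult: "a \<in> C \<Longrightarrow> b \<in> C \<Longrightarrow> a * b \<in> C"
proof -
  show one: "1 \<in> C" using assms by (simp add: subring_set_def)
  show diff: "a - b \<in> C" if "a \<in> C" "b \<in> C" for a b using assms that by (simp add: subring_set_def)
  show zero: "0 \<in> C" using diff[OF one one] by simp
  show neg: "- a \<in> C" if "a \<in> C" for a using diff[OF zero that] by simp
  show "a + b \<in> C" if "a \<in> C" "b \<in> C" for a b using diff[OF that(1) neg[OF that(2)]] by simp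
  show "a * b \<in> C" if "a \<in> C" "b \<in> C" for a b using assms that by (simp add: subring_set_def)
qed

lemma subring_set_sum: "subring_set C \<Longrightarrow> (\<And>a. a \<in> A \<Longrightarrow> f a \<in> C) \<Longrightarrow> sum f A \<in> C"
  by (induction A rule: infinite_finite_induct) (auto simp: subring_set_zero subring_set_add)

lemma subring_set_prod: "subring_set C \<Longrightarrow> (\<And>a. a \<in> A \<Longrightarrow> f a \<in> C) \<Longrightarrow> prod f A \<in> C"
  by (induction A rule: infinite_finite_induct) (auto simp: subring_set_one subring_set_mult)

lemma subring_set_power: "subring_set C \<Longrightarrow> a \<in> C \<Longrightarrow> a ^ k \<in> C"
  by (induction k) (auto simp: subring_set_one subring_set_mult)

lemma subring_set_det:
  assumes C: "subring_set C" and A: "\<And>i j. i < dim_row A \<Longrightarrow> j < dim_col A \<Longrightarrow> A $$ (i, j) \<in> C"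
  shows "det A \<in> C"
proof (cases "dim_row A = dim_col A")
  case True
  have s: "signof p \<in> C" for p :: "nat \<Rightarrow> nat"
    using C by (auto simp: sign_def subring_set_one subring_set_uminus)
  have "p i < dim_col A" if "p permutes {0..<dim_row A}" "i < dim_row A" for p i
    using permutes_in_image[OF that(1), of i] that(2) True by auto
  then show ?thesis
    using True A unfolding det_def
    by (auto intro!: subring_set_sum[OF C] subring_set_mult[OF C] s subring_set_prod[OF C])
qed (simp add: det_def subring_set_zero[OF C])

definition mat_over :: "'a set \<Rightarrow> nat \<Rightarrow> nat \<Rightarrow> 'a mat \<Rightarrow> bool" where
  "mat_over C n m A \<longleftrightarrow> A \<in> carrier_mat n m \<and> (\<forall>i<n. \<forall>j<m. A $$ (i, j) \<in> C)"

lemma mat_over_carrier: "mat_over C n m A \<Longrightarrow> A \<in> carrier_mat n m"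
  and mat_over_entry: "mat_over C n m A \<Longrightarrow> i < n \<Longrightarrow> j < m \<Longrightarrow> A $$ (i, j) \<in> C"
  by (simp_all add: mat_over_def)

lemma mat_over_one: "subring_set C \<Longrightarrow> mat_over C n n (1\<^sub>m n)"
  by (auto simp: mat_over_def subring_set_one subring_set_zero one_mat_def)

lemma mat_over_mult:
  assumes C: "subring_set C" and A: "mat_over C n k A" and B: "mat_over C k m B"
  shows "mat_over C n m (A * B)"
  unfolding mat_over_def
proof (intro conjI allI impI)
  show "A * B \<in> carrier_mat n m"
    using mat_over_carrier[OF A] mat_over_carrier[OF B] by simp
  fix i j assume "i < n" "j < m"
  then show "(A * B) $$ (i, j) \<in> C"
    using mat_over_carrier[OF A] mat_over_carrier[OF B] mat_over_entry[OF A] mat_over_entry[OF B]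
    by (auto simp: scalar_prod_def intro!: subring_set_sum[OF C] subring_set_mult[OF C])
qed

lemma mat_over_pow: "subring_set C \<Longrightarrow> mat_over C n n A \<Longrightarrow> mat_over C n n (A ^\<^sub>m k)"
proof (induction k)
  case 0
  then show ?case by (auto simp: mat_over_def subring_set_one subring_set_zero)
next
  case (Suc k)
  then show ?case by (simp add: mat_over_mult)
qed

lemma mat_over_det: "subring_set C \<Longrightarrow> mat_over C n n A \<Longrightarrow> det A \<in> C"
  by (rule subring_set_det) (auto simp: mat_over_def)

lemma mat_over_adj:
  assumes C: "subring_set C" and A: "mat_over C n n A"
  shows "mat_over C n n (adj_mat A)"
  unfolding mat_over_def
proof (intro conjI allI impI)
  have cA: "A \<in> carrier_mat n n" by (rule mat_over_carrier[OF A])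
  show "adj_mat A \<in> carrier_mat n n"
    by (rule adj_mat(1)[OF cA])
  fix i j assume ij: "i < n" "j < n"
  have "det (mat_delete A j i) \<in> C"
    using cA ij mat_over_entry[OF A]
    by (intro subring_set_det[OF C]) (auto simp: mat_delete_def)
  then show "adj_mat A $$ (i, j) \<in> C"
    using cA ij by (auto simp: adj_mat_def cofactor_def intro!: subring_set_mult[OF C] subring_set_power[OF C]
        subring_set_uminus[OF C] subring_set_one[OF C])
qed

lemma minors_subset:
  assumes C: "subring_set C" and A: "mat_over C n m A"
  shows "minors k A \<subseteq> C"
proof -
  have "det (submatrix A I J) \<in> C" for I J
  proof (rule subring_set_det[OF C])
    fix i j assume "i < dim_row (submatrix A I J)" "j < dim_col (submatrix A I J)"
    then have ij: "i < card {i. i < dim_row A \<and> i \<in> I}" "j < card {j. j < dim_col A \<and> j \<in> J}"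
      by (simp_all add: dim_submatrix)
    show "submatrix A I J $$ (i, j) \<in> C"
      using mat_over_carrier[OF A] pick_le[OF ij(1)] pick_le[OF ij(2)]
      by (auto simp: submatrix_index[OF ij] intro!: mat_over_entry[OF A])
  qed
  then show ?thesis
    by (auto simp: minors_def)
qed

lemma carrier_poly_ring: "carrier (poly_ring V) = {p. \<forall>m\<in>keys p. keys m \<subseteq> V}"
  by (simp add: poly_ring_def)

lemma poly_ring_ops [simp]:
  "a \<otimes>\<^bsub>poly_ring V\<^esub> b = a * b" "\<one>\<^bsub>poly_ring V\<^esub> = 1" "\<zero>\<^bsub>poly_ring V\<^esub> = 0" "a \<oplus>\<^bsub>poly_ring V\<^esub> b = a + b"
  by (simp_all add: poly_ring_def)

lemma poly_ring_a_inv: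
  assumes "a \<in> carrier (poly_ring V)"
  shows "\<ominus>\<^bsub>poly_ring V\<^esub> a = - (a :: ('v, 'a::comm_ring_1) mpoly)"
proof -
  interpret cring "poly_ring V :: ('v, 'a) mpoly ring" by (rule cring_poly_ring)
  have "- a \<in> carrier (poly_ring V)"
    using assms by (simp add: carrier_poly_ring)
  then show ?thesis
    using sum_zero_eq_neg[OF _ assms, of "- a"] by simp
qed

lemma poly_ring_pow [simp]: "a [^]\<^bsub>poly_ring V\<^esub> (k::nat) = (a :: ('v, 'a::comm_ring_1) mpoly) ^ k"
  by (induction k) (simp_all add: nat_pow_def poly_ring_def mult.commute)

lemma subring_set_poly_ring: "subring_set (carrier (poly_ring V) :: ('v, 'a::comm_ring_1) mpoly set)"
proof -
  interpret cring "poly_ring V :: ('v, 'a) mpoly ring" by (rule cring_poly_ring)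
  have "a - b \<in> carrier (poly_ring V)" if "a \<in> carrier (poly_ring V)" "b \<in> carrier (poly_ring V)"
    for a b :: "('v, 'a) mpoly"
    using minus_closed[OF that] that by (simp add: a_minus_def poly_ring_a_inv)
  then show ?thesis
    using m_closed one_closed by (auto simp: subring_set_def)
qed

lemma single_in_poly_ring: "keys t \<subseteq> V \<Longrightarrow> single t c \<in> carrier (poly_ring V)"
  by (simp add: carrier_poly_ring)

lemma const_in_poly_ring: "const c \<in> carrier (poly_ring V)"
  by (simp add: carrier_poly_ring const_def)

lemma var_in_poly_ring: "v \<in> V \<Longrightarrow> var v \<in> carrier (poly_ring V)"
  by (simp add: carrier_poly_ring var_def)

lemma poly_subst_in_subring:
  assumes C: "subring_set C" and h: "\<And>c. h c \<in> C" and x: "\<And>m v. m \<in> keys p \<Longrightarrow> v \<in> keys m \<Longrightarrow> x v \<in> C"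
  shows "poly_subst h x p \<in> C"
  unfolding poly_subst_def
  by (intro subring_set_sum[OF C] subring_set_mult[OF C] h subring_set_prod[OF C] subring_set_power[OF C] x)

text \<open>
  The ideals of a polynomial ring, in terms of the operations of the type: closure under
  negation comes for free from multiplication by \<open>-1\<close>.
\<close>

lemma ideal_poly_ring_iff:
  "ideal (I :: ('v, 'a::comm_ring_1) mpoly set) (poly_ring V) \<longleftrightarrow>
     I \<subseteq> carrier (poly_ring V) \<and> 0 \<in> I \<and> (\<forall>a\<in>I. \<forall>b\<in>I. a + b \<in> I) \<and>
     (\<forall>a\<in>I. \<forall>p\<in>carrier (poly_ring V). p * a \<in> I)"
proof
  assume "ideal I (poly_ring V)"
  then interpret ideal I "poly_ring V" .
  show "I \<subseteq> carrier (poly_ring V) \<and> 0 \<in> I \<and> (\<forall>a\<in>I. \<forall>b\<in>I. a + b \<in> I) \<and>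
     (\<forall>a\<in>I. \<forall>p\<in>carrier (poly_ring V). p * a \<in> I)"
    using a_subset additive_subgroup.zero_closed[OF additive_subgroup_axioms]
      additive_subgroup.a_closed[OF additive_subgroup_axioms] I_l_closed
    by auto
next
  assume I: "I \<subseteq> carrier (poly_ring V) \<and> 0 \<in> I \<and> (\<forall>a\<in>I. \<forall>b\<in>I. a + b \<in> I) \<and>
     (\<forall>a\<in>I. \<forall>p\<in>carrier (poly_ring V). p * a \<in> I)"
  interpret R: cring "poly_ring V :: ('v, 'a) mpoly ring" by (rule cring_poly_ring)
  have m1: "- 1 \<in> carrier (poly_ring V)"
    by (rule subring_set_uminus[OF subring_set_poly_ring subring_set_one[OF subring_set_poly_ring]])
  show "ideal I (poly_ring V)"
  proof (rule idealI[OF R.ring_axioms])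
    show "subgroup I (add_monoid (poly_ring V))"
    proof (rule R.add.subgroupI)
      fix a assume "a \<in> I"
      with I m1 have "- 1 * a \<in> I" "a \<in> carrier (poly_ring V)" by blast+
      then show "\<ominus>\<^bsub>poly_ring V\<^esub> a \<in> I" by (simp add: poly_ring_a_inv)
    qed (use I in auto)
  qed (use I in \<open>auto simp: mult.commute\<close>)
qed

section \<open>Specialization of points to the algebraic closure\<close>

text \<open>
  Ring homomorphisms defined on a subring of a field, given as total functions with arbitrary values
  elsewhere.
\<close>

definition hom_on :: "'l::field set \<Rightarrow> ('l \<Rightarrow> 'o::field) \<Rightarrow> bool" where
  "hom_on A \<phi> \<longleftrightarrow> \<phi> 1 = 1 \<and> (\<forall>a\<in>A. \<forall>b\<in>A. \<phi> (a + b) = \<phi> a + \<phi> b \<and> \<phi> (a * b) = \<phi> a * \<phi> b)"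

definition poly_over :: "'l::field set \<Rightarrow> 'l poly \<Rightarrow> bool" where
  "poly_over A p \<longleftrightarrow> (\<forall>i. coeff p i \<in> A)"

lemma
  assumes A: "subring_set A" and \<phi>: "hom_on A \<phi>"
  shows hom_on_zero: "\<phi> 0 = 0"
    and hom_on_one: "\<phi> 1 = 1"
    and hom_on_add: "a \<in> A \<Longrightarrow> b \<in> A \<Longrightarrow> \<phi> (a + b) = \<phi> a + \<phi> b"
    and hom_on_mult: "a \<in> A \<Longrightarrow> b \<in> A \<Longrightarrow> \<phi> (a * b) = \<phi> a * \<phi> b"
proof -
  have "\<phi> (0 + 0) = \<phi> 0 + \<phi> 0"
    using \<phi> subring_set_zero[OF A] unfolding hom_on_def by blast
  then show "\<phi> 0 = 0" by (metis add_0_left add_cancel_right_right)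
qed (use \<phi> in \<open>auto simp: hom_on_def\<close>)

lemma hom_on_sum:
  assumes A: "subring_set A" and \<phi>: "hom_on A \<phi>" and "\<And>i. i \<in> S \<Longrightarrow> f i \<in> A"
  shows "\<phi> (sum f S) = (\<Sum>i\<in>S. \<phi> (f i))"
  using assms(3)
  by (induction S rule: infinite_finite_induct)
     (auto simp: hom_on_zero[OF A \<phi>] hom_on_add[OF A \<phi>] subring_set_sum[OF A])

lemma hom_on_prod:
  assumes A: "subring_set A" and \<phi>: "hom_on A \<phi>" and "\<And>i. i \<in> S \<Longrightarrow> f i \<in> A"
  shows "\<phi> (prod f S) = (\<Prod>i\<in>S. \<phi> (f i))"
  using assms(3)
  by (induction S rule: infinite_finite_induct)
     (auto simp: hom_on_one[OF A \<phi>] hom_on_mult[OF A \<phi>] subring_set_prod[OF A])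

lemma hom_on_power:
  assumes A: "subring_set A" and \<phi>: "hom_on A \<phi>" and "a \<in> A"
  shows "\<phi> (a ^ k) = \<phi> a ^ k"
  using assms(3)
  by (induction k) (auto simp: hom_on_one[OF A \<phi>] hom_on_mult[OF A \<phi>] subring_set_power[OF A])

context
  fixes A :: "'l::field set"
  assumes A: "subring_set A"
begin

lemma poly_over_zero: "poly_over A 0"
  by (simp add: poly_over_def subring_set_zero[OF A])

lemma poly_over_add: "poly_over A p \<Longrightarrow> poly_over A q \<Longrightarrow> poly_over A (p + q)"
  by (simp add: poly_over_def subring_set_add[OF A])

lemma poly_over_diff: "poly_over A p \<Longrightarrow> poly_over A q \<Longrightarrow> poly_over A (p - q)"
  by (simp add: poly_over_def subring_set_diff[OF A])

lemma poly_over_mult: "poly_over A p \<Longrightarrow> poly_over A q \<Longrightarrow> poly_over A (p * q)"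
  by (auto simp: poly_over_def coeff_mult intro!: subring_set_sum[OF A] subring_set_mult[OF A])

lemma poly_over_smult: "c \<in> A \<Longrightarrow> poly_over A p \<Longrightarrow> poly_over A (smult c p)"
  by (simp add: poly_over_def subring_set_mult[OF A])

lemma poly_over_monom: "c \<in> A \<Longrightarrow> poly_over A (Polynomial.monom c k)"
  by (simp add: poly_over_def subring_set_zero[OF A])

lemma poly_over_const: "c \<in> A \<Longrightarrow> poly_over A [:c:]"
  using poly_over_monom[of c 0] by (simp add: monom_0)

lemma subring_adjoin: "subring_set {poly p x |p. poly_over A p}"
  unfolding subring_set_def
proof (intro conjI ballI)
  show "1 \<in> {poly p x |p. poly_over A p}"
    using poly_over_const[OF subring_set_one[OF A]] by (force intro: exI[of _ "[:1:]"])
  fix a b assume "a \<in> {poly p x |p. poly_over A p}" "b \<in> {poly p x |p. poly_over A p}"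
  then obtain p q where "a = poly p x" "poly_over A p" "b = poly q x" "poly_over A q"
    by blast
  then have "a - b = poly (p - q) x" "poly_over A (p - q)" "a * b = poly (p * q) x" "poly_over A (p * q)"
    by (simp_all add: poly_over_diff poly_over_mult)
  then show "a - b \<in> {poly p x |p. poly_over A p}" "a * b \<in> {poly p x |p. poly_over A p}"
    by blast+
qed

lemma map_poly_hom_on:
  assumes \<phi>: "hom_on A \<phi>" and p: "poly_over A p" and q: "poly_over A q"
  shows map_poly_hom_on_add: "map_poly \<phi> (p + q) = map_poly \<phi> p + map_poly \<phi> q"
    and map_poly_hom_on_mult: "map_poly \<phi> (p * q) = map_poly \<phi> p * map_poly \<phi> q"
proof -
  note [simp] = coeff_map_poly[of \<phi>, OF hom_on_zero[OF A \<phi>]]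
  have pq: "coeff p i \<in> A" "coeff q i \<in> A" for i
    using p q by (auto simp: poly_over_def)
  show "map_poly \<phi> (p + q) = map_poly \<phi> p + map_poly \<phi> q"
    by (rule poly_eqI) (simp add: hom_on_add[OF A \<phi>] pq)
  show "map_poly \<phi> (p * q) = map_poly \<phi> p * map_poly \<phi> q"
    by (rule poly_eqI)
       (simp add: coeff_mult hom_on_sum[OF A \<phi>] hom_on_mult[OF A \<phi>] pq subring_set_mult[OF A])
qed

lemma map_poly_hom_on_const: "hom_on A \<phi> \<Longrightarrow> map_poly \<phi> [:c:] = [:\<phi> c:]"
  by (rule poly_eqI) (auto simp: coeff_map_poly[OF hom_on_zero[OF A]] coeff_pCons hom_on_zero[OF A] split: nat.split)

text \<open>
  Over a ring that is not a field, division with remainder is possible up to a power of the leading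
  coefficient, which is harmless if this coefficient does not map to \<open>0\<close>.
\<close>

lemma pseudo_division_over:
  assumes p: "poly_over A p" "p \<noteq> 0" and q: "poly_over A q"
  obtains k s r where "poly_over A s" "poly_over A r" "smult (lead_coeff p ^ k) q = s * p + r"
    "r = 0 \<or> degree r < degree p"
proof -
  let ?a = "lead_coeff p"
  have a: "?a \<in> A" using p by (simp add: poly_over_def)
  have "\<exists>k s r. poly_over A s \<and> poly_over A r \<and> smult (?a ^ k) q = s * p + r \<and>
      (r = 0 \<or> degree r < degree p)" if "q = 0 \<or> degree q < m" "poly_over A q" for m q
    using that
  proof (induction m arbitrary: q)
    case 0
    then show ?case
      by (intro exI[of _ 0] exI[of _ "0::'l poly"]) (simp add: poly_over_zero)
  next
    case (Suc m)
    show ?case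
    proof (cases "q = 0 \<or> degree q < degree p")
      case True
      then show ?thesis
        using Suc.prems by (intro exI[of _ 0] exI[of _ "0::'l poly"] exI[of _ q]) (simp add: poly_over_zero)
    next
      case False
      let ?t = "Polynomial.monom (lead_coeff q) (degree q - degree p)"
      let ?q = "smult ?a q - ?t * p"
      have t: "poly_over A ?t"
        using Suc.prems(2) by (intro poly_over_monom) (simp add: poly_over_def)
      have q': "poly_over A ?q"
        by (intro poly_over_diff poly_over_smult poly_over_mult a p t Suc.prems)
      have dt: "degree (?t * p) \<le> degree q"
        using degree_mult_le[of ?t p] degree_monom_le[of "lead_coeff q" "degree q - degree p"] False by linarith
      then have le: "degree ?q \<le> degree q"
        by (intro degree_diff_le) (auto intro: order.trans[OF degree_smult_le])
      have "coeff (?t * p) (degree q) = lead_coeff q * ?a"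
        using False by (simp add: coeff_monom_mult)
      then have "coeff ?q (degree q) = 0"
        by (simp add: mult.commute)
      then have "?q = 0 \<or> degree ?q < degree q"
        using le by (metis leading_coeff_0_iff le_neq_implies_less)
      then have "?q = 0 \<or> degree ?q < m"
        using Suc.prems False by auto
      from Suc.IH[OF this q'] obtain k s r where ks: "poly_over A s" "poly_over A r"
        "smult (?a ^ k) ?q = s * p + r" "r = 0 \<or> degree r < degree p" by blast
      have "smult (?a ^ Suc k) q = (s + smult (?a ^ k) ?t) * p + r"
        using ks(3) by (simp add: smult_diff_right algebra_simps)
      moreover have "poly_over A (s + smult (?a ^ k) ?t)"
        by (intro poly_over_add poly_over_smult ks t subring_set_power[OF A] a)
      ultimately show ?thesis
        using ks by blast
    qed
  qed
  from this[of q "Suc (degree q)"] q that show ?thesis by auto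
qed

end

lemma alg_closed_nonroot:
  fixes q :: "'o::alg_closed_field poly"
  assumes "q \<noteq> 0"
  obtains \<omega> where "poly q \<omega> \<noteq> 0"
proof (cases "degree q = 0")
  case True
  then obtain c where "q = [:c:]" by (metis degree_0_id)
  with assms that[of 0] show ?thesis by simp
next
  case False
  then have "degree (q - 1) > 0"
    using degree_add_eq_left[of "- 1" q] by simp
  then obtain \<omega> where "poly (q - 1) \<omega> = 0"
    using alg_closed_imp_poly_has_root by blast
  with that[of \<omega>] show ?thesis by simp
qed

text \<open>
  The step from \<open>A\<close> to \<open>A[x]\<close>: if \<open>x\<close> is transcendental over \<open>A\<close>, nearly every value may be
  prescribed for it. If \<open>x\<close> is a zero of a polynomial \<open>p\<close> of minimal degree with leading
  coefficient \<open>a\<^sub>0\<close>, the roots of the image of \<open>p\<close> may be prescribed as soon as \<open>a\<^sub>0\<close> does not map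
  to \<open>0\<close>; and \<open>p\<close> together with any \<open>\<beta>\<close> that does not vanish at \<open>x\<close> generates a nonzero constant,
  which keeps the image of \<open>\<beta>\<close> nonzero at that root if it does not map to \<open>0\<close> itself.
\<close>

lemma extend_to_adjoined_element:
  fixes A :: "'l::field set"
  assumes A: "subring_set A" and \<beta>: "poly_over A \<beta>" and b: "poly \<beta> x \<noteq> 0"
  obtains a where "a \<in> A" "a \<noteq> 0"
    "\<And>\<phi> :: 'l \<Rightarrow> 'o::alg_closed_field. hom_on A \<phi> \<Longrightarrow> \<phi> a \<noteq> 0 \<Longrightarrow>
       \<exists>\<omega>. poly (map_poly \<phi> \<beta>) \<omega> \<noteq> 0 \<and>
           (\<forall>q. poly_over A q \<longrightarrow> poly q x = 0 \<longrightarrow> poly (map_poly \<phi> q) \<omega> = 0)"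
proof (cases "\<exists>p. poly_over A p \<and> p \<noteq> 0 \<and> poly p x = 0")
  case False
  have "lead_coeff \<beta> \<in> A" "lead_coeff \<beta> \<noteq> 0"
    using \<beta> b by (auto simp: poly_over_def)
  moreover have "\<exists>\<omega>. poly (map_poly \<phi> \<beta>) \<omega> \<noteq> 0 \<and>
           (\<forall>q. poly_over A q \<longrightarrow> poly q x = 0 \<longrightarrow> poly (map_poly \<phi> q) \<omega> = 0)"
    if \<phi>: "hom_on A \<phi>" "\<phi> (lead_coeff \<beta>) \<noteq> 0" for \<phi> :: "'l \<Rightarrow> 'o"
  proof -
    have "coeff (map_poly \<phi> \<beta>) (degree \<beta>) \<noteq> 0"
      using \<phi> by (simp add: coeff_map_poly hom_on_zero[OF A])
    then have "map_poly \<phi> \<beta> \<noteq> 0" by auto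
    then obtain \<omega> where "poly (map_poly \<phi> \<beta>) \<omega> \<noteq> 0" by (rule alg_closed_nonroot)
    moreover have "poly (map_poly \<phi> q) \<omega> = 0" if "poly_over A q" "poly q x = 0" for q
      using False that by (cases "q = 0") auto
    ultimately show ?thesis by blast
  qed
  ultimately show ?thesis by (rule that)
next
  case True
  define p where "p = (ARG_MIN degree p. poly_over A p \<and> p \<noteq> 0 \<and> poly p x = 0)"
  have p: "poly_over A p" "p \<noteq> 0" "poly p x = 0"
    using arg_min_natI[of "\<lambda>p. poly_over A p \<and> p \<noteq> 0 \<and> poly p x = 0" _ degree] True
    unfolding p_def by blast+
  have p_min: "degree p \<le> degree q" if "poly_over A q" "q \<noteq> 0" "poly q x = 0" for q
    unfolding p_def by (rule arg_min_nat_le) (use that in auto)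
  \<comment> \<open>The ideal of \<open>A[X]\<close> generated by \<open>\<beta>\<close> and \<open>p\<close>. An element \<open>d\<close> of least degree in it divides all
    its elements up to constants by pseudo-division; as \<open>d\<close> does not vanish at \<open>x\<close> but divides \<open>p\<close>,
    the minimality of \<open>p\<close> makes it constant.\<close>
  define S where "S = {u * \<beta> + v * p |u v. poly_over A u \<and> poly_over A v}"
  have S_over: "poly_over A d" if "d \<in> S" for d
    using that by (auto simp: S_def intro!: poly_over_add[OF A] poly_over_mult[OF A] \<beta> p)
  have S_diff: "smult c d - u * e \<in> S" if prems: "c \<in> A" "poly_over A u" "d \<in> S" "e \<in> S" for c u d e
  proof -
    obtain u1 v1 u2 v2 where uv: "d = u1 * \<beta> + v1 * p" "e = u2 * \<beta> + v2 * p"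
      "poly_over A u1" "poly_over A v1" "poly_over A u2" "poly_over A v2"
      using prems(3,4) by (auto simp: S_def)
    have "smult c d - u * e = (smult c u1 - u * u2) * \<beta> + (smult c v1 - u * v2) * p"
      by (simp add: uv smult_add_right algebra_simps)
    moreover have "poly_over A (smult c u1 - u * u2)" "poly_over A (smult c v1 - u * v2)"
      using prems(1,2) uv by (auto intro!: poly_over_diff[OF A] poly_over_smult[OF A] poly_over_mult[OF A])
    ultimately show ?thesis
      unfolding S_def by blast
  qed
  have one: "poly_over A 1" and zero: "poly_over A 0"
    using poly_over_const[OF A subring_set_one[OF A]] poly_over_zero[OF A] by (simp_all add: one_pCons)
  have "\<beta> = 1 * \<beta> + 0 * p" "p = 0 * \<beta> + 1 * p" by simp_all
  then have \<beta>S: "\<beta> \<in> S" and pS: "p \<in> S"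
    using one zero unfolding S_def by blast+
  define d where "d = (ARG_MIN degree d. d \<in> S \<and> d \<noteq> 0)"
  have d: "d \<in> S" "d \<noteq> 0"
    using arg_min_natI[of "\<lambda>d. d \<in> S \<and> d \<noteq> 0" p degree] p pS unfolding d_def by blast+
  have d_min: "degree d \<le> degree q" if "q \<in> S" "q \<noteq> 0" for q
    unfolding d_def by (rule arg_min_nat_le) (use that in auto)
  let ?e = "lead_coeff d"
  have e: "?e \<in> A" "?e \<noteq> 0" using S_over[OF d(1)] d(2) by (auto simp: poly_over_def)
  have d_dvd: "\<exists>k s. poly_over A s \<and> smult (?e ^ k) q = s * d" if qS: "q \<in> S" for q
  proof -
    obtain k s r where ks: "poly_over A s" "poly_over A r" "smult (?e ^ k) q = s * d + r"
      "r = 0 \<or> degree r < degree d"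
      by (rule pseudo_division_over[OF A S_over[OF d(1)] d(2) S_over[OF qS]])
    have "r \<in> S"
      using S_diff[OF subring_set_power[OF A e(1)] ks(1) qS d(1), of k] ks(3) by simp
    with ks(4) d_min have "r = 0" by force
    with ks show ?thesis by auto
  qed
  have dx: "poly d x \<noteq> 0"
  proof
    assume "poly d x = 0"
    moreover obtain k s where "smult (?e ^ k) \<beta> = s * d" using d_dvd[OF \<beta>S] by blast
    then have "?e ^ k * poly \<beta> x = poly s x * poly d x" by (metis poly_mult poly_smult)
    ultimately show False using b e by simp
  qed
  have "degree d = 0"
  proof -
    obtain k s where s: "poly_over A s" "smult (?e ^ k) p = s * d" using d_dvd[OF pS] by blast
    then have "?e ^ k * poly p x = poly s x * poly d x" by (metis poly_mult poly_smult)
    with p dx have "poly s x = 0" by simp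
    moreover have "s \<noteq> 0" using s p(2) e by auto
    ultimately have "degree p \<le> degree s" using p_min s by blast
    moreover have "degree p = degree s + degree d"
      using arg_cong[OF s(2), of degree] \<open>s \<noteq> 0\<close> d(2) e by (simp add: degree_mult_eq)
    ultimately show ?thesis by simp
  qed
  then obtain c where dc: "d = [:c:]" by (metis degree_0_id)
  with d S_over[OF d(1)] have c: "c \<noteq> 0" "c \<in> A"
    by (auto simp: poly_over_def dest: spec[of _ 0])
  obtain u v where uv: "poly_over A u" "poly_over A v" "[:c:] = u * \<beta> + v * p"
    using d(1) dc by (auto simp: S_def)
  let ?a0 = "lead_coeff p"
  have a0: "?a0 \<in> A" "?a0 \<noteq> 0" using p by (auto simp: poly_over_def)
  have "?a0 * c \<in> A" "?a0 * c \<noteq> 0" using a0 c by (auto simp: subring_set_mult[OF A])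
  moreover have "\<exists>\<omega>. poly (map_poly \<phi> \<beta>) \<omega> \<noteq> 0 \<and>
           (\<forall>q. poly_over A q \<longrightarrow> poly q x = 0 \<longrightarrow> poly (map_poly \<phi> q) \<omega> = 0)"
    if \<phi>: "hom_on A \<phi>" "\<phi> (?a0 * c) \<noteq> 0" for \<phi> :: "'l \<Rightarrow> 'o"
  proof -
    have nz: "\<phi> ?a0 \<noteq> 0" "\<phi> c \<noteq> 0"
      using \<phi> a0 c by (auto simp: hom_on_mult[OF A])
    note mp = map_poly_hom_on_add[OF A \<phi>(1)] map_poly_hom_on_mult[OF A \<phi>(1)]
    have "coeff (map_poly \<phi> p) (degree p) \<noteq> 0"
      using nz \<phi> by (simp add: coeff_map_poly hom_on_zero[OF A])
    then have "degree p \<le> degree (map_poly \<phi> p)" by (rule le_degree)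
    moreover have "degree p > 0"
    proof (rule ccontr)
      assume "\<not> degree p > 0"
      then obtain c where "p = [:c:]" by (metis degree_0_id gr0I)
      with p show False by simp
    qed
    ultimately obtain \<omega> where \<omega>: "poly (map_poly \<phi> p) \<omega> = 0"
      using alg_closed_imp_poly_has_root[of "map_poly \<phi> p"] by auto
    have "map_poly \<phi> [:c:] = map_poly \<phi> u * map_poly \<phi> \<beta> + map_poly \<phi> v * map_poly \<phi> p"
      using uv p \<beta> by (simp only: uv(3)) (simp add: mp poly_over_mult[OF A])
    from arg_cong[OF this, of "\<lambda>p. poly p \<omega>"] have "poly (map_poly \<phi> \<beta>) \<omega> \<noteq> 0"
      using nz \<omega> by (auto simp: map_poly_hom_on_const[OF A \<phi>(1)])
    moreover have "poly (map_poly \<phi> q) \<omega> = 0" if q: "poly_over A q" "poly q x = 0" for q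
    proof -
      obtain k s r where ks: "poly_over A s" "poly_over A r" "smult (?a0 ^ k) q = s * p + r"
        "r = 0 \<or> degree r < degree p"
        by (rule pseudo_division_over[OF A p(1,2) q(1)])
      have "poly r x = 0"
        using arg_cong[OF ks(3), of "\<lambda>p. poly p x"] q p by simp
      with ks p_min[of r] have "r = 0" by force
      with ks have "[:?a0 ^ k:] * q = s * p" by simp
      then have "map_poly \<phi> ([:?a0 ^ k:] * q) = map_poly \<phi> (s * p)" by (rule arg_cong)
      then have "[:\<phi> (?a0 ^ k):] * map_poly \<phi> q = map_poly \<phi> s * map_poly \<phi> p"
        by (subst (asm) (1 2) mp(2)) (use ks p q a0 poly_over_const[OF A] subring_set_power[OF A] in
            \<open>auto simp: map_poly_hom_on_const[OF A \<phi>(1)]\<close>)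
      from arg_cong[OF this, of "\<lambda>p. poly p \<omega>"] show ?thesis
        using \<omega> nz a0 by (simp add: hom_on_power[OF A \<phi>(1)])
    qed
    ultimately show ?thesis by blast
  qed
  ultimately show ?thesis by (rule that)
qed

text \<open>
  A form of the Nullstellensatz, with \<open>A\<close> the \<open>K\<close>-algebra generated by \<open>Y\<close>: adjoining the generators
  one by one, the condition that \<open>b\<close> does not map to \<open>0\<close> is pulled back along the tower of rings to
  such a condition on an element of \<open>K\<close>.
\<close>

lemma extend_hom_finitely_generated:
  fixes \<iota> :: "'k::field \<Rightarrow> 'l::field" and \<tau> :: "'k \<Rightarrow> 'o::alg_closed_field"
  assumes \<iota>: "field_hom \<iota>" and \<tau>: "field_hom \<tau>" and "finite Y"
  shows "\<exists>A. subring_set A \<and> range \<iota> \<subseteq> A \<and> Y \<subseteq> A \<and>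
    (\<forall>b\<in>A. b \<noteq> 0 \<longrightarrow> (\<exists>\<phi>. hom_on A \<phi> \<and> (\<forall>c. \<phi> (\<iota> c) = \<tau> c) \<and> \<phi> b \<noteq> 0))"
  using \<open>finite Y\<close>
proof (induction Y rule: finite_induct)
  case empty
  interpret i: field_hom \<iota> by fact
  interpret t: field_hom \<tau> by fact
  have inv: "inv_into UNIV \<iota> (\<iota> c) = c" for c
    by (simp add: i.inj_f)
  have "subring_set (range \<iota>)"
    unfolding subring_set_def by (auto simp flip: i.hom_minus i.hom_mult i.hom_one)
  moreover have "hom_on (range \<iota>) (\<tau> \<circ> inv_into UNIV \<iota>)"
    unfolding hom_on_def using inv[of 1]
    by (auto simp: inv t.hom_add t.hom_mult simp flip: i.hom_add i.hom_mult)
  moreover have "(\<tau> \<circ> inv_into UNIV \<iota>) b \<noteq> 0" if "b \<in> range \<iota>" "b \<noteq> 0" for b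
    using that inv by auto
  ultimately show ?case
    using inv by (intro exI[of _ "range \<iota>"]) (auto intro!: exI[of _ "\<tau> \<circ> inv_into UNIV \<iota>"])
next
  case (insert x Y)
  then obtain A where A: "subring_set A" "range \<iota> \<subseteq> A" "Y \<subseteq> A"
    and ext: "\<And>b. b \<in> A \<Longrightarrow> b \<noteq> 0 \<Longrightarrow> \<exists>\<phi>. hom_on A \<phi> \<and> (\<forall>c. \<phi> (\<iota> c) = \<tau> c) \<and> \<phi> b \<noteq> 0"
    by blast
  let ?B = "{poly p x |p. poly_over A p}"
  have AB: "A \<subseteq> ?B"
    using poly_over_const[OF A(1)] by (force intro: exI[of _ "[:_:]"])
  have xB: "x \<in> ?B"
    using poly_over_monom[OF A(1) subring_set_one[OF A(1)], of 1]
    by (force simp: poly_monom intro!: exI[of _ "Polynomial.monom 1 1"])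
  have "\<exists>\<psi>. hom_on ?B \<psi> \<and> (\<forall>c. \<psi> (\<iota> c) = \<tau> c) \<and> \<psi> b \<noteq> 0" if bB: "b \<in> ?B" "b \<noteq> 0" for b
  proof -
    obtain \<beta> where \<beta>: "poly_over A \<beta>" "b = poly \<beta> x" using bB by blast
    obtain a where a: "a \<in> A" "a \<noteq> 0" and step: "\<And>\<phi> :: 'l \<Rightarrow> 'o. hom_on A \<phi> \<Longrightarrow> \<phi> a \<noteq> 0 \<Longrightarrow>
       \<exists>\<omega>. poly (map_poly \<phi> \<beta>) \<omega> \<noteq> 0 \<and>
           (\<forall>q. poly_over A q \<longrightarrow> poly q x = 0 \<longrightarrow> poly (map_poly \<phi> q) \<omega> = 0)"
      by (rule extend_to_adjoined_element[OF A(1) \<beta>(1)]) (use bB \<beta> in auto)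
    obtain \<phi> where \<phi>: "hom_on A \<phi>" "\<And>c. \<phi> (\<iota> c) = \<tau> c" "\<phi> a \<noteq> 0" using ext[OF a] by blast
    obtain \<omega> where \<omega>: "poly (map_poly \<phi> \<beta>) \<omega> \<noteq> 0"
      and ker: "\<And>q. poly_over A q \<Longrightarrow> poly q x = 0 \<Longrightarrow> poly (map_poly \<phi> q) \<omega> = 0"
      using step[OF \<phi>(1,3)] by blast
    \<comment> \<open>The choice of the representative does not matter: the difference of two of them vanishes at
      \<open>x\<close>, and therefore its image vanishes at \<open>\<omega>\<close>.\<close>
    define \<psi> where "\<psi> y = poly (map_poly \<phi> (SOME p. poly_over A p \<and> poly p x = y)) \<omega>" for y
    have \<psi>: "\<psi> (poly p x) = poly (map_poly \<phi> p) \<omega>" if p: "poly_over A p" for p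
    proof -
      define q where "q = (SOME q. poly_over A q \<and> poly q x = poly p x)"
      have q: "poly_over A q" "poly q x = poly p x"
        using someI[of "\<lambda>q. poly_over A q \<and> poly q x = poly p x" p] p unfolding q_def by auto
      have "map_poly \<phi> (p + (q - p)) = map_poly \<phi> p + map_poly \<phi> (q - p)"
        by (rule map_poly_hom_on_add[OF A(1) \<phi>(1) p poly_over_diff[OF A(1) q(1) p]])
      moreover have "poly (map_poly \<phi> (q - p)) \<omega> = 0"
        using q p by (intro ker poly_over_diff[OF A(1)]) auto
      ultimately show ?thesis
        unfolding \<psi>_def q_def[symmetric] by simp
    qed
    have \<psi>A: "\<psi> y = \<phi> y" if "y \<in> A" for y
      using \<psi>[OF poly_over_const[OF A(1) that]] by (simp add: map_poly_hom_on_const[OF A(1) \<phi>(1)])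
    have "hom_on ?B \<psi>"
      unfolding hom_on_def
    proof (intro conjI ballI)
      show "\<psi> 1 = 1"
        by (simp add: \<psi>A subring_set_one[OF A(1)] hom_on_one[OF A(1) \<phi>(1)])
      fix y z assume "y \<in> ?B" "z \<in> ?B"
      then obtain p q where pq: "y = poly p x" "poly_over A p" "z = poly q x" "poly_over A q" by blast
      show "\<psi> (y + z) = \<psi> y + \<psi> z"
        using \<psi>[OF poly_over_add[OF A(1) pq(2,4)]] pq
        by (simp add: \<psi> map_poly_hom_on_add[OF A(1) \<phi>(1)])
      show "\<psi> (y * z) = \<psi> y * \<psi> z"
        using \<psi>[OF poly_over_mult[OF A(1) pq(2,4)]] pq
        by (simp add: \<psi> map_poly_hom_on_mult[OF A(1) \<phi>(1)])
    qed
    moreover have "\<psi> (\<iota> c) = \<tau> c" for c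
      using \<psi>A[of "\<iota> c"] A(2) \<phi>(2) by auto
    moreover have "\<psi> b \<noteq> 0"
      using \<psi>[OF \<beta>(1)] \<omega> \<beta>(2) by simp
    ultimately show ?thesis by blast
  qed
  then show ?case
    using subring_adjoin[OF A(1), of x] AB xB A(2,3)
    by (intro exI[of _ ?B]) (intro conjI; blast)
qed

lemma specialize_point:
  fixes \<iota> :: "'k::field \<Rightarrow> 'l::field" and \<tau> :: "'k \<Rightarrow> 'o::alg_closed_field" and x :: "'v \<Rightarrow> 'l"
  assumes \<iota>: "field_hom \<iota>" and \<tau>: "field_hom \<tau>" and V: "finite V"
    and g: "g \<in> carrier (poly_ring V)" "poly_subst \<iota> x g \<noteq> 0"
  obtains y where "poly_subst \<tau> y g \<noteq> 0"
    "\<And>f. f \<in> carrier (poly_ring V) \<Longrightarrow> poly_subst \<iota> x f = 0 \<Longrightarrow> poly_subst \<tau> y f = 0"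
proof -
  from extend_hom_finitely_generated[OF \<iota> \<tau> finite_imageI[OF V, of x]] obtain A
    where AA: "subring_set A \<and> range \<iota> \<subseteq> A \<and> x ` V \<subseteq> A \<and>
      (\<forall>b\<in>A. b \<noteq> 0 \<longrightarrow> (\<exists>\<phi>. hom_on A \<phi> \<and> (\<forall>c. \<phi> (\<iota> c) = \<tau> c) \<and> \<phi> b \<noteq> 0))" ..
  then have A: "subring_set A" "range \<iota> \<subseteq> A" "x ` V \<subseteq> A" by simp_all
  have ext: "\<exists>\<phi>. hom_on A \<phi> \<and> (\<forall>c. \<phi> (\<iota> c) = \<tau> c) \<and> \<phi> b \<noteq> 0" if "b \<in> A" "b \<noteq> 0" for b
    using AA that by simp
  have val: "poly_subst \<iota> x f \<in> A" if "f \<in> carrier (poly_ring V)" for f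
    using that A by (intro poly_subst_in_subring[OF A(1)]) (auto simp: carrier_poly_ring image_subset_iff)
  obtain \<phi> where \<phi>: "hom_on A \<phi>" "\<And>c. \<phi> (\<iota> c) = \<tau> c" "\<phi> (poly_subst \<iota> x g) \<noteq> 0"
    using ext[OF val[OF g(1)] g(2)] by blast
  have "\<phi> (poly_subst \<iota> x f) = poly_subst \<tau> (\<phi> \<circ> x) f" if f: "f \<in> carrier (poly_ring V)" for f
  proof -
    have mem: "\<iota> c \<in> A" for c using A by blast
    have xm: "x v \<in> A" if "m \<in> keys f" "v \<in> keys m" for m v
      using f that A by (auto simp: carrier_poly_ring image_subset_iff)
    have tv: "(\<Prod>v\<in>keys m. x v ^ lookup m v) \<in> A" if "m \<in> keys f" for m
      using xm[OF that] by (intro subring_set_prod[OF A(1)] subring_set_power[OF A(1)])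
    have "\<phi> (poly_subst \<iota> x f) =
        (\<Sum>m\<in>keys f. \<phi> (\<iota> (lookup f m) * (\<Prod>v\<in>keys m. x v ^ lookup m v)))"
      unfolding poly_subst_def by (intro hom_on_sum[OF A(1) \<phi>(1)] subring_set_mult[OF A(1)] mem tv)
    also have "\<dots> = (\<Sum>m\<in>keys f. \<tau> (lookup f m) * (\<Prod>v\<in>keys m. (\<phi> \<circ> x) v ^ lookup m v))"
    proof (rule sum.cong[OF refl])
      fix m assume m: "m \<in> keys f"
      have "\<phi> (\<Prod>v\<in>keys m. x v ^ lookup m v) = (\<Prod>v\<in>keys m. \<phi> (x v ^ lookup m v))"
        by (intro hom_on_prod[OF A(1) \<phi>(1)] subring_set_power[OF A(1)] xm[OF m])
      also have "\<dots> = (\<Prod>v\<in>keys m. (\<phi> \<circ> x) v ^ lookup m v)"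
        by (intro prod.cong refl) (simp add: hom_on_power[OF A(1) \<phi>(1) xm[OF m]])
      finally show "\<phi> (\<iota> (lookup f m) * (\<Prod>v\<in>keys m. x v ^ lookup m v)) =
          \<tau> (lookup f m) * (\<Prod>v\<in>keys m. (\<phi> \<circ> x) v ^ lookup m v)"
        by (simp only: hom_on_mult[OF A(1) \<phi>(1) mem tv[OF m]] \<phi>(2))
    qed
    finally show ?thesis
      by (simp add: poly_subst_def)
  qed
  note eq = this
  show ?thesis
  proof (rule that[of "\<phi> \<circ> x"])
    show "poly_subst \<tau> (\<phi> \<circ> x) g \<noteq> 0"
      using \<phi>(3) eq[OF g(1)] by simp
    show "poly_subst \<tau> (\<phi> \<circ> x) f = 0" if "f \<in> carrier (poly_ring V)" "poly_subst \<iota> x f = 0" for f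
      using eq[OF that(1)] that(2) hom_on_zero[OF A(1) \<phi>(1)] by simp
  qed
qed

section \<open>Minors and independent columns\<close>

no_notation fps_nth (infixl "$" 75)

lemma bij_betw_pick:
  assumes "finite S"
  shows "bij_betw (pick S) {..<card S} S"
proof -
  have inj: "inj_on (pick S) {..<card S}"
    by (rule linorder_inj_onI) (auto dest: pick_mono_le)
  moreover have "pick S ` {..<card S} \<subseteq> S"
    using pick_in_set_le by auto
  ultimately have "pick S ` {..<card S} = S"
    using assms by (intro card_subset_eq) (simp_all add: card_image)
  with inj show ?thesis
    by (simp add: bij_betw_def)
qed

lemma sum_pick:
  assumes "finite S"
  shows "(\<Sum>j<card S. f (pick S j)) = (\<Sum>j\<in>S. f j)"
  by (rule sum.reindex_bij_betw[OF bij_betw_pick[OF assms]])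

lemma submatrix_eq_mat:
  assumes "A \<in> carrier_mat m N" "I \<subseteq> {..<m}" "J \<subseteq> {..<N}"
  shows "submatrix A I J = mat (card I) (card J) (\<lambda>(i, j). A $$ (pick I i, pick J j))"
proof -
  have "{i. i < m \<and> i \<in> I} = I" "{j. j < N \<and> j \<in> J} = J"
    using assms by auto
  then show ?thesis
    using assms(1) by (simp add: submatrix_def)
qed

text \<open>Independence of the family of columns rather than of their set: equal columns are dependent.\<close>

definition columns_independent :: "'a::field mat \<Rightarrow> nat set \<Rightarrow> bool" where
  "columns_independent A J \<longleftrightarrow>
     (\<forall>c. (\<forall>i<dim_row A. (\<Sum>j\<in>J. A $$ (i, j) * c j) = 0) \<longrightarrow> (\<forall>j\<in>J. c j = 0))"

lemma det_nonzero_iff: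
  fixes A :: "'a::field mat"
  assumes "A \<in> carrier_mat k k"
  shows "det A \<noteq> 0 \<longleftrightarrow> (\<forall>c. (\<forall>i<k. (\<Sum>j<k. A $$ (i, j) * c j) = 0) \<longrightarrow> (\<forall>j<k. c j = 0))"
    (is "_ \<longleftrightarrow> ?R")
proof
  assume d: "det A \<noteq> 0"
  show ?R
  proof (intro allI impI)
    fix c j assume c: "\<forall>i<k. (\<Sum>j<k. A $$ (i, j) * c j) = 0" and j: "j < k"
    have "A *\<^sub>v vec k c = 0\<^sub>v k"
      using assms c by (intro eq_vecI) (auto simp: scalar_prod_def atLeast0LessThan)
    with d have "vec k c = 0\<^sub>v k"
      using det_0_iff_vec_prod_zero_field[OF assms] vec_carrier by blast
    from arg_cong[OF this, of "\<lambda>v. v $ j"] j show "c j = 0" by simp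
  qed
next
  assume R: ?R
  show "det A \<noteq> 0"
  proof
    assume "det A = 0"
    then obtain v where v: "v \<in> carrier_vec k" "v \<noteq> 0\<^sub>v k" "A *\<^sub>v v = 0\<^sub>v k"
      using assms by (auto simp: det_0_iff_vec_prod_zero_field)
    have "(\<Sum>j<k. A $$ (i, j) * v $ j) = 0" if i: "i < k" for i
      using arg_cong[OF v(3), of "\<lambda>w. w $ i"] assms v(1) i
      by (simp add: scalar_prod_def atLeast0LessThan)
    with R have "v = 0\<^sub>v k"
      using v(1) by (intro eq_vecI) auto
    with v(2) show False ..
  qed
qed

text \<open>Padding with zero rows turns fewer equations than unknowns into a singular square system.\<close>

lemma zero_row_kernel:
  fixes a :: "nat \<Rightarrow> nat \<Rightarrow> 'a::field"
  assumes "r < k"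
  shows "\<exists>c. (\<forall>i<r. (\<Sum>j<k. a i j * c j) = 0) \<and> (\<exists>j<k. c j \<noteq> 0)"
proof -
  let ?A = "mat k k (\<lambda>(i, j). if i < r then a i j else 0)"
  have A: "?A \<in> carrier_mat k k" by simp
  have "?A = mat\<^sub>r k k (\<lambda>i. if i = r then 0\<^sub>v k else vec k (\<lambda>j. if i < r then a i j else 0))"
    by (rule eq_matI) auto
  then have "det ?A = 0"
    using det_row_0[OF assms, of "\<lambda>i. vec k (\<lambda>j. if i < r then a i j else 0)"] by simp
  then obtain c where c: "\<And>i. i < k \<Longrightarrow> (\<Sum>j<k. ?A $$ (i, j) * c j) = 0" "\<exists>j<k. c j \<noteq> 0"
    using det_nonzero_iff[OF A] by blast
  have "(\<Sum>j<k. a i j * c j) = 0" if "i < r" for i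
    using c(1)[of i] that assms by simp
  with c(2) show ?thesis by blast
qed

text \<open>
  Independence of the columns in \<open>J\<close> produces a nonzero minor: choose a maximal set \<open>I\<close> of
  rows which are independent after restriction to the columns in \<open>J\<close>. All rows are
  combinations of these, so a relation between the columns in \<open>J\<close> may be tested on the rows
  in \<open>I\<close>; counting equations and unknowns in both directions, \<open>I\<close> has as many elements as \<open>J\<close>.
\<close>

lemma nonzero_minor_iff:
  fixes A :: "'a::field mat"
  assumes A: "A \<in> carrier_mat m N"
  shows "(\<exists>d\<in>minors k A. d \<noteq> 0) \<longleftrightarrow> (\<exists>J\<subseteq>{..<N}. card J = k \<and> columns_independent A J)"
proof
  assume "\<exists>d\<in>minors k A. d \<noteq> 0"
  then obtain I J where IJ: "I \<subseteq> {..<m}" "J \<subseteq> {..<N}" "card I = k" "card J = k"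
    "det (submatrix A I J) \<noteq> 0"
    using A by (auto simp: minors_def)
  have fin: "finite I" "finite J" using IJ finite_subset by blast+
  let ?S = "submatrix A I J"
  have S: "?S = mat k k (\<lambda>(i, j). A $$ (pick I i, pick J j))"
    using submatrix_eq_mat[OF A IJ(1,2)] IJ by simp
  have "columns_independent A J"
    unfolding columns_independent_def
  proof (intro allI impI)
    fix c assume c: "\<forall>i<dim_row A. (\<Sum>j\<in>J. A $$ (i, j) * c j) = 0"
    have "(\<Sum>j<k. ?S $$ (i, j) * c (pick J j)) = 0" if "i < k" for i
    proof -
      have "pick I i \<in> I" using pick_in_set_le[of i I] that IJ by simp
      with c A IJ(1) have "(\<Sum>j\<in>J. A $$ (pick I i, j) * c j) = 0" by auto
      with sum_pick[OF fin(2), of "\<lambda>j. A $$ (pick I i, j) * c j"] that show ?thesis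
        by (simp add: S IJ)
    qed
    moreover have "?S \<in> carrier_mat k k"
      by (simp add: S)
    ultimately have z: "c (pick J j) = 0" if "j < k" for j
      using IJ(5) that det_nonzero_iff[of ?S k] by (auto dest!: spec[of _ "\<lambda>j. c (pick J j)"])
    show "\<forall>j\<in>J. c j = 0"
    proof
      fix j assume "j \<in> J"
      then have "j \<in> pick J ` {..<card J}"
        using bij_betw_pick[OF fin(2)] by (simp add: bij_betw_def)
      then show "c j = 0" using z IJ(4) by auto
    qed
  qed
  with IJ show "\<exists>J\<subseteq>{..<N}. card J = k \<and> columns_independent A J" by blast
next
  assume "\<exists>J\<subseteq>{..<N}. card J = k \<and> columns_independent A J"
  then obtain J where J: "J \<subseteq> {..<N}" "card J = k" "columns_independent A J" by blast
  have finJ: "finite J" using J(1) finite_subset by blast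
  define indep where "indep I \<longleftrightarrow> I \<subseteq> {..<m} \<and>
    (\<forall>d. (\<forall>j\<in>J. (\<Sum>i\<in>I. d i * A $$ (i, j)) = 0) \<longrightarrow> (\<forall>i\<in>I. d i = 0))" for I
  have "indep {}" by (simp add: indep_def)
  moreover have "card I \<le> m" if "indep I" for I
    using that card_mono[of "{..<m}" I] by (auto simp: indep_def)
  ultimately obtain I where I: "indep I" and I_max: "\<And>I'. indep I' \<Longrightarrow> card I' \<le> card I"
    using ex_has_greatest_nat[of indep "{}" card "Suc m"] by (metis less_Suc_eq_le)
  have I': "I \<subseteq> {..<m}" and finI: "finite I"
    using I finite_subset by (auto simp: indep_def)
  have comb: "\<exists>e. \<forall>j\<in>J. A $$ (i, j) = (\<Sum>i'\<in>I. e i' * A $$ (i', j))" if i: "i < m" for i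
  proof (cases "i \<in> I")
    case True
    have "(\<Sum>i'\<in>I. (if i' = i then 1 else 0) * A $$ (i', j)) = A $$ (i, j)" for j
      using True finI by (simp add: if_distrib[of "\<lambda>x. x * _"] cong: if_cong)
    then show ?thesis
      by (intro exI[of _ "\<lambda>i'. if i' = i then 1 else 0"]) simp
  next
    case False
    then have "card (insert i I) > card I" using finI by simp
    then have "\<not> indep (insert i I)" using I_max[of "insert i I"] by auto
    then obtain d where d: "\<And>j. j \<in> J \<Longrightarrow> (\<Sum>i'\<in>insert i I. d i' * A $$ (i', j)) = 0"
      and d_nz: "\<exists>i'\<in>insert i I. d i' \<noteq> 0"
      using I' i unfolding indep_def by blast
    have d': "d i * A $$ (i, j) + (\<Sum>i'\<in>I. d i' * A $$ (i', j)) = 0" if "j \<in> J" for j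
      using d[OF that] False finI by simp
    have "d i \<noteq> 0"
    proof
      assume "d i = 0"
      with d' I have "\<forall>i'\<in>I. d i' = 0" by (simp add: indep_def)
      with d_nz \<open>d i = 0\<close> show False by auto
    qed
    have "A $$ (i, j) = (\<Sum>i'\<in>I. (- d i' / d i) * A $$ (i', j))" if "j \<in> J" for j
    proof -
      have "(\<Sum>i'\<in>I. (- d i' / d i) * A $$ (i', j)) = - (\<Sum>i'\<in>I. d i' * A $$ (i', j)) / d i"
        by (simp add: sum_negf sum_divide_distrib)
      also have "\<dots> = A $$ (i, j)"
        using d'[OF that] \<open>d i \<noteq> 0\<close> by (simp add: field_simps add_eq_0_iff)
      finally show ?thesis by simp
    qed
    then show ?thesis
      by (intro exI[of _ "\<lambda>i'. - d i' / d i"] ballI)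
  qed
  have test: "\<forall>j\<in>J. c j = 0" if c: "\<And>i. i \<in> I \<Longrightarrow> (\<Sum>j\<in>J. A $$ (i, j) * c j) = 0" for c
  proof -
    have "(\<Sum>j\<in>J. A $$ (i, j) * c j) = 0" if i: "i < m" for i
    proof -
      obtain e where e: "\<And>j. j \<in> J \<Longrightarrow> A $$ (i, j) = (\<Sum>i'\<in>I. e i' * A $$ (i', j))"
        using comb[OF i] by blast
      have "(\<Sum>j\<in>J. A $$ (i, j) * c j) = (\<Sum>j\<in>J. \<Sum>i'\<in>I. e i' * (A $$ (i', j) * c j))"
        by (rule sum.cong) (simp_all add: e sum_distrib_right mult.assoc)
      also have "\<dots> = (\<Sum>i'\<in>I. e i' * (\<Sum>j\<in>J. A $$ (i', j) * c j))"
        by (subst sum.swap) (simp add: sum_distrib_left)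
      finally show ?thesis by (simp add: c)
    qed
    then show ?thesis
      using J(3) A by (auto simp: columns_independent_def)
  qed
  have bI: "bij_betw (pick I) {..<card I} I" and bJ: "bij_betw (pick J) {..<card J} J"
    by (rule bij_betw_pick; fact)+
  have "I = pick I ` {..<card I}" "J = pick J ` {..<k}"
    using bI bJ J(2) by (simp_all add: bij_betw_def)
  then have onI: "\<And>i. i \<in> I \<Longrightarrow> \<exists>i'<card I. pick I i' = i"
    and onJ: "\<And>j. j \<in> J \<Longrightarrow> \<exists>j'<k. pick J j' = j"
    by (metis imageE lessThan_iff)+
  have inJ: "pick J j \<in> J" if "j < k" for j
    using pick_in_set_le[of j J] that J(2) by simp
  have inI: "pick I i \<in> I" if "i < card I" for i
    using pick_in_set_le[of i I] that by simp
  have kernel: "\<forall>j<k. c j = 0"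
    if c: "\<And>i. i < card I \<Longrightarrow> (\<Sum>j<k. A $$ (pick I i, pick J j) * c j) = 0" for c
  proof -
    define c' where "c' j = c (the_inv_into {..<k} (pick J) j)" for j
    have c'J: "c' (pick J j) = c j" if "j < k" for j
      using the_inv_into_f_f[of "pick J" "{..<k}" j] bJ that J(2) by (simp add: c'_def bij_betw_def)
    have "(\<Sum>j\<in>J. A $$ (i, j) * c' j) = 0" if i: "i \<in> I" for i
    proof -
      obtain i' where i': "i' < card I" "pick I i' = i" using onI[OF i] by blast
      have "(\<Sum>j\<in>J. A $$ (i, j) * c' j) = (\<Sum>j<k. A $$ (i, pick J j) * c' (pick J j))"
        using sum_pick[OF finJ, of "\<lambda>j. A $$ (i, j) * c' j"] J(2) by simp
      also have "\<dots> = 0" using c[OF i'(1)] i'(2) by (simp add: c'J)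
      finally show ?thesis .
    qed
    then have "\<forall>j\<in>J. c' j = 0" by (rule test)
    then show ?thesis using c'J inJ by metis
  qed
  have "\<not> card I < k"
    using zero_row_kernel[of "card I" k "\<lambda>i j. A $$ (pick I i, pick J j)"] kernel by blast
  moreover have "\<not> k < card I"
  proof
    assume "k < card I"
    from zero_row_kernel[OF this, of "\<lambda>j i. A $$ (pick I i, pick J j)"]
    obtain d i0 where d: "\<And>j. j < k \<Longrightarrow> (\<Sum>i<card I. A $$ (pick I i, pick J j) * d i) = 0"
      and i0: "i0 < card I" "d i0 \<noteq> 0" by blast
    define d' where "d' i = d (the_inv_into {..<card I} (pick I) i)" for i
    have d'I: "d' (pick I i) = d i" if "i < card I" for i
      using the_inv_into_f_f[of "pick I" "{..<card I}" i] bI that by (simp add: d'_def bij_betw_def)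
    have "(\<Sum>i\<in>I. d' i * A $$ (i, j)) = 0" if j: "j \<in> J" for j
    proof -
      obtain j' where j': "j' < k" "pick J j' = j" using onJ[OF j] by blast
      have "(\<Sum>i\<in>I. d' i * A $$ (i, j)) = (\<Sum>i<card I. d' (pick I i) * A $$ (pick I i, j))"
        using sum_pick[OF finI, of "\<lambda>i. d' i * A $$ (i, j)"] by simp
      also have "\<dots> = 0" using d[OF j'(1)] j'(2) by (simp add: d'I mult.commute)
      finally show ?thesis .
    qed
    with I have "\<forall>i\<in>I. d' i = 0" by (simp add: indep_def)
    with inI[OF i0(1)] d'I[OF i0(1)] i0(2) show False by simp
  qed
  ultimately have cI: "card I = k" by simp
  have S: "submatrix A I J = mat k k (\<lambda>(i, j). A $$ (pick I i, pick J j))"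
    using submatrix_eq_mat[OF A I' J(1)] cI J(2) by simp
  have "det (submatrix A I J) \<noteq> 0"
    by (subst det_nonzero_iff[of _ k]) (use kernel in \<open>auto simp: S cI\<close>)
  moreover have "det (submatrix A I J) \<in> minors k A"
    using A I' J cI by (auto simp: minors_def)
  ultimately show "\<exists>d\<in>minors k A. d \<noteq> 0" by blast
qed

section \<open>Dimensions of quotients\<close>

definition smul :: "'a::field \<Rightarrow> ('v, 'a) mpoly \<Rightarrow> ('v, 'a) mpoly" where
  "smul c p = const c * p"

lemma lookup_smul [simp]: "lookup (smul c p) m = c * lookup p m"
proof -
  have "smul c p = (\<Sum>m\<in>keys p. single m (c * lookup p m))"
    unfolding smul_def
    by (subst (1) sum_of_terms[symmetric]) (simp add: sum_distrib_left const_def Poly_Mapping.mult_single)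
  then show ?thesis
    by (auto simp: lookup_sum lookup_single when_def in_keys_iff if_distrib cong: if_cong)
qed

global_interpretation mp: vector_space "smul :: 'a::field \<Rightarrow> ('v, 'a) mpoly \<Rightarrow> ('v, 'a) mpoly"
  by standard (simp_all add: smul_def algebra_simps)

global_interpretation mpp: vector_space_pair
  "smul :: 'a::field \<Rightarrow> ('v, 'a) mpoly \<Rightarrow> ('v, 'a) mpoly"
  "smul :: 'a::field \<Rightarrow> ('v, 'a) mpoly \<Rightarrow> ('v, 'a) mpoly"
  ..

abbreviation mlinear :: "(('v, 'a::field) mpoly \<Rightarrow> ('v, 'a) mpoly) \<Rightarrow> bool" where
  "mlinear \<equiv> Vector_Spaces.linear smul smul"

lemma smul_mult: "smul c p * q = smul c (p * q)" "p * smul c q = smul c (p * q)"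
  by (simp_all add: smul_def mult_ac)

lemma single_eq_smul: "single m c = smul c (single m 1)"
  by (simp add: smul_def const_def Poly_Mapping.mult_single)

lemma subspace_keys: "mp.subspace {p :: ('v, 'a::field) mpoly. keys p \<subseteq> S}"
proof (rule mp.subspaceI)
  fix p q :: "('v, 'a) mpoly" and c
  show "p + q \<in> {p. keys p \<subseteq> S}" if "p \<in> {p. keys p \<subseteq> S}" "q \<in> {p. keys p \<subseteq> S}"
    using that Poly_Mapping.keys_add[of p q] by blast
  show "smul c p \<in> {p. keys p \<subseteq> S}" if "p \<in> {p. keys p \<subseteq> S}"
    using that by (auto simp: in_keys_iff)
qed simp

lemma span_terms: "mp.span ((\<lambda>m. single m 1) ` S) = {p :: ('v, 'a::field) mpoly. keys p \<subseteq> S}"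
proof
  show "mp.span ((\<lambda>m. single m 1) ` S) \<subseteq> {p :: ('v, 'a) mpoly. keys p \<subseteq> S}"
    by (rule mp.span_minimal[OF _ subspace_keys]) auto
  show "{p :: ('v, 'a) mpoly. keys p \<subseteq> S} \<subseteq> mp.span ((\<lambda>m. single m 1) ` S)"
  proof
    fix p :: "('v, 'a) mpoly" assume "p \<in> {p. keys p \<subseteq> S}"
    then have "(\<Sum>m\<in>keys p. smul (lookup p m) (single m 1)) \<in> mp.span ((\<lambda>m. single m 1) ` S)"
      by (intro mp.span_sum mp.span_scale mp.span_base) auto
    then show "p \<in> mp.span ((\<lambda>m. single m 1) ` S)"
      by (simp flip: single_eq_smul add: sum_of_terms)
  qed
qed

lemma inj_single_one: "inj (\<lambda>m. single m (1::'a::zero_neq_one))"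
  by (rule injI) (metis keys_single singleton_inject zero_neq_one)

lemma independent_terms: "mp.independent ((\<lambda>m. single m 1 :: ('v, 'a::field) mpoly) ` S)"
  unfolding mp.dependent_def
proof
  assume "\<exists>a\<in>(\<lambda>m. single m (1::'a)) ` S. a \<in> mp.span ((\<lambda>m. single m 1) ` S - {a})"
  then obtain m where "m \<in> S" "single m (1::'a) \<in> mp.span ((\<lambda>m. single m 1) ` S - {single m 1})"
    by blast
  moreover have "(\<lambda>m. single m (1::'a)) ` S - {single m 1} = (\<lambda>m. single m 1) ` (S - {m})"
    using inj_single_one[where 'a = 'a] by (auto simp: inj_def)
  ultimately show False
    by (simp add: span_terms)
qed

definition linear_extension :: "('v monom \<Rightarrow> ('v, 'a::field) mpoly) \<Rightarrow> ('v, 'a) mpoly \<Rightarrow> ('v, 'a) mpoly" where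
  "linear_extension g p = (\<Sum>m\<in>keys p. smul (lookup p m) (g m))"

lemma linear_extension_superset:
  assumes "finite S" "keys p \<subseteq> S"
  shows "linear_extension g p = (\<Sum>m\<in>S. smul (lookup p m) (g m))"
  unfolding linear_extension_def
  by (rule sum.mono_neutral_left) (use assms in \<open>auto simp: in_keys_iff\<close>)

lemma mlinear_linear_extension: "mlinear (linear_extension g)"
proof
  show "linear_extension g (p + q) = linear_extension g p + linear_extension g q" for p q
    using Poly_Mapping.keys_add[of p q]
    by (simp add: linear_extension_superset[of "keys p \<union> keys q"] lookup_add mp.scale_left_distrib sum.distrib)
  show "linear_extension g (smul c p) = smul c (linear_extension g p)" for c p
  proof -
    have "keys (smul c p) \<subseteq> keys p" by (auto simp: in_keys_iff)
    then show ?thesis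
      by (simp add: linear_extension_superset[of "keys p"] mp.scale_sum_right)
  qed
qed

lemma linear_extension_single [simp]: "linear_extension g (single m c) = smul c (g m)"
  by (cases "c = 0") (simp_all add: linear_extension_def)

lemma mlinear_eqI:
  fixes p :: "('v, 'a::field) mpoly"
  assumes "mlinear f" "mlinear g" "\<And>m. m \<in> keys p \<Longrightarrow> f (single m 1) = g (single m 1)"
  shows "f p = g p"
proof -
  have "p \<in> mp.span ((\<lambda>m. single m 1) ` keys p)"
    by (simp add: span_terms)
  then show ?thesis
  proof (rule mpp.linear_eq_on[OF assms(1,2)])
    fix b :: "('v, 'a) mpoly" assume "b \<in> (\<lambda>m. single m 1) ` keys p"
    then show "f b = g b"
      by (elim imageE) (simp only: assms(3))
  qed
qed

lemma mlinear_mult_left: "mlinear ((*) q)" and mlinear_mult_right: "mlinear (\<lambda>p. p * q)"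
  by standard (simp_all add: smul_mult algebra_simps)

lemma mlinear_comp: "mlinear f \<Longrightarrow> mlinear g \<Longrightarrow> mlinear (\<lambda>p. f (g p))"
  using Vector_Spaces.linear_compose[of smul smul g smul f] by (simp add: o_def)

context
  fixes f :: "('v, 'a::field) mpoly \<Rightarrow> ('v, 'a) mpoly"
  assumes f: "mlinear f"
begin

lemma
  shows mlinear_add: "f (p + q) = f p + f q"
    and mlinear_diff: "f (p - q) = f p - f q"
    and mlinear_scale: "f (smul c p) = smul c (f p)"
    and mlinear_zero: "f 0 = 0"
    and mlinear_sum: "f (sum g S) = (\<Sum>i\<in>S. f (g i))"
    and mlinear_subspace_image: "mp.subspace U \<Longrightarrow> mp.subspace (f ` U)"
    and mlinear_span_image: "mp.span (f ` T) = f ` mp.span T"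
  using mpp.linear_add[OF f] mpp.linear_diff[OF f] mpp.linear_scale[OF f] mpp.linear_0[OF f]
    mpp.linear_sum[OF f] mpp.linear_subspace_image[OF f] mpp.linear_span_image[OF f]
  by auto

end

text \<open>A projection along \<open>I\<close>. It allows replacing the quotient by \<open>I\<close> by an image of polynomials.\<close>

lemma exists_linear_with_kernel:
  assumes "mp.subspace (I :: ('v, 'a::field) mpoly set)"
  obtains f where "mlinear f" "{p. f p = 0} = I"
proof -
  obtain B where B: "B \<subseteq> I" "mp.independent B" "I \<subseteq> mp.span B"
    using mp.basis_exists by metis
  have spB: "mp.span B = I"
    using B assms by (simp add: mp.span_subspace)
  let ?E = "mp.extend_basis B"
  have E: "B \<subseteq> ?E" "mp.independent ?E" "mp.span ?E = UNIV"
    using mp.extend_basis_superset[OF B(2)] mp.independent_extend_basis[OF B(2)]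
      mp.span_extend_basis[OF B(2)] by auto
  obtain f where f: "mlinear f" "\<And>b. b \<in> ?E \<Longrightarrow> f b = (if b \<in> B then 0 else b)"
    using mpp.linear_independent_extend[OF E(2), of "\<lambda>b. if b \<in> B then 0 else b"] by metis
  have f0: "f p = 0" if "p \<in> mp.span B" for p
    by (rule mpp.linear_eq_0_on_span[OF f(1) _ that]) (use f(2) E(1) in auto)
  have f1: "f p = p" if "p \<in> mp.span (?E - B)" for p
    by (rule mpp.linear_eq_on[OF f(1) _ that, of "\<lambda>p. p"])
       (use f(2) mp.linear_ident in \<open>auto simp: mp.module_hom_ident\<close>)
  have "f p = 0 \<longleftrightarrow> p \<in> mp.span B" for p
  proof
    assume fp: "f p = 0"
    have "?E = B \<union> (?E - B)" using E(1) by auto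
    with E(3) have "p \<in> mp.span (B \<union> (?E - B))" by auto
    then obtain x y where xy: "p = x + y" "x \<in> mp.span B" "y \<in> mp.span (?E - B)"
      by (auto simp only: mp.span_Un)
    then have "f p = y" using mlinear_add[OF f(1), of x y] f0 f1 by simp
    with fp xy show "p \<in> mp.span B" by simp
  qed (rule f0)
  with spB show ?thesis
    by (intro that[OF f(1)]) auto
qed

lemma residue_image: "residue n I p = (\<lambda>i. i + p) ` I"
  by (auto simp: residue_def a_r_coset_def r_coset_def)

lemma subspace_carrier_KX: "mp.subspace (carrier (KX n) :: (nat, 'a::field) mpoly set)"
  using subspace_keys[of "{m. keys m \<subseteq> {..<n}}"] by (simp add: carrier_poly_ring subset_iff Ball_def)

context
  fixes n :: nat and I :: "(nat, 'a::field) mpoly set"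
  assumes I: "ideal I (KX n)"
begin

lemma
  shows ideal_KX_subset: "I \<subseteq> carrier (KX n)"
    and ideal_KX_zero: "0 \<in> I"
    and ideal_KX_add: "a \<in> I \<Longrightarrow> b \<in> I \<Longrightarrow> a + b \<in> I"
    and ideal_KX_mult: "a \<in> I \<Longrightarrow> p \<in> carrier (KX n) \<Longrightarrow> p * a \<in> I"
    and ideal_KX_mult_right: "a \<in> I \<Longrightarrow> p \<in> carrier (KX n) \<Longrightarrow> a * p \<in> I"
  using I by (auto simp: ideal_poly_ring_iff mult.commute)

lemma ideal_KX_smul: "a \<in> I \<Longrightarrow> smul c a \<in> I"
  unfolding smul_def by (rule ideal_KX_mult[OF _ const_in_poly_ring])

lemma ideal_KX_uminus: "a \<in> I \<Longrightarrow> - a \<in> I"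
  using ideal_KX_smul[of a "- 1"] by (simp add: smul_def)

lemma ideal_KX_diff: "a \<in> I \<Longrightarrow> b \<in> I \<Longrightarrow> a - b \<in> I"
  using ideal_KX_add[of a "- b"] ideal_KX_uminus[of b] by simp

lemma subspace_ideal_KX: "mp.subspace I"
  by (rule mp.subspaceI) (auto intro: ideal_KX_zero ideal_KX_add ideal_KX_smul)

lemma residue_eq_iff: "residue n I p = residue n I q \<longleftrightarrow> p - q \<in> I"
proof
  assume "residue n I p = residue n I q"
  moreover have "p \<in> residue n I p"
    using ideal_KX_zero by (force simp: residue_image)
  ultimately obtain i where "i \<in> I" "p = i + q"
    by (auto simp: residue_image)
  then show "p - q \<in> I" by simp
next
  assume d: "p - q \<in> I"
  have "i + p = (i + (p - q)) + q" "i + q = (i - (p - q)) + p" for i by simp_all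
  with d show "residue n I p = residue n I q"
    unfolding residue_image image_def by (blast intro: ideal_KX_add ideal_KX_diff)
qed

lemma residue_eq_zero_iff: "residue n I p = I \<longleftrightarrow> p \<in> I"
  using residue_eq_iff[of p 0] by (simp add: residue_image)

lemma ring_coord_ring: "ring (coord_ring n I)"
  unfolding coord_ring_def by (rule ideal.quotient_is_ring[OF I])

lemma carrier_coord_ring: "carrier (coord_ring n I) = residue n I ` carrier (KX n)"
  by (auto simp: coord_ring_def FactRing_def A_RCOSETS_def' residue_def)

lemma coord_ring_zero: "\<zero>\<^bsub>coord_ring n I\<^esub> = I"
  by (simp add: coord_ring_def FactRing_def)

lemma coord_ring_add:
  assumes "p \<in> carrier (KX n)" "q \<in> carrier (KX n)"
  shows "residue n I p \<oplus>\<^bsub>coord_ring n I\<^esub> residue n I q = residue n I (p + q)"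
proof -
  interpret abelian_subgroup I "KX n"
    by (rule abelian_subgroupI3[OF ideal.axioms(1)[OF I]])
       (rule ring.is_abelian_group[OF cring.axioms(1)[OF cring_poly_ring]])
  show ?thesis
    using a_rcos_sum[OF assms] by (simp add: coord_ring_def FactRing_def residue_def)
qed

lemma coord_ring_mult:
  assumes "p \<in> carrier (KX n)" "q \<in> carrier (KX n)"
  shows "residue n I p \<otimes>\<^bsub>coord_ring n I\<^esub> residue n I q = residue n I (p * q)"
  using ideal.rcoset_mult_add[OF I assms] by (simp add: coord_ring_def FactRing_def residue_def)

lemma line_extension_residue:
  assumes w: "w \<in> carrier (KX n)" and U: "U \<subseteq> carrier (KX n)"
  shows "ring.line_extension (coord_ring n I) (scalars n I) (residue n I w) (residue n I ` U)
    = residue n I ` {smul c w + u |c u. u \<in> U}"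
proof -
  have "residue n I (const c) \<otimes>\<^bsub>coord_ring n I\<^esub> residue n I w \<oplus>\<^bsub>coord_ring n I\<^esub> residue n I u
      = residue n I (smul c w + u)" if "u \<in> U" for c u
    using w U that subring_set_mult[OF subring_set_poly_ring const_in_poly_ring w, of c]
    by (subst coord_ring_mult[OF const_in_poly_ring w], subst coord_ring_add) (auto simp: smul_def)
  note eq = this
  show ?thesis
  proof (intro equalityI subsetI)
    fix z assume "z \<in> ring.line_extension (coord_ring n I) (scalars n I) (residue n I w) (residue n I ` U)"
    then obtain c u where "u \<in> U" "z = residue n I (const c) \<otimes>\<^bsub>coord_ring n I\<^esub> residue n I w
        \<oplus>\<^bsub>coord_ring n I\<^esub> residue n I u"
      unfolding ring.line_extension_mem_iff[OF ring_coord_ring] scalars_def by (elim bexE imageE) simp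
    then show "z \<in> residue n I ` {smul c w + u |c u. u \<in> U}"
      by (simp only: eq) blast
  next
    fix z assume "z \<in> residue n I ` {smul c w + u |c u. u \<in> U}"
    then obtain c u where "u \<in> U" "z = residue n I (const c) \<otimes>\<^bsub>coord_ring n I\<^esub> residue n I w
        \<oplus>\<^bsub>coord_ring n I\<^esub> residue n I u"
      by (elim imageE CollectE exE conjE) (simp only: eq)
    then show "z \<in> ring.line_extension (coord_ring n I) (scalars n I) (residue n I w) (residue n I ` U)"
      unfolding ring.line_extension_mem_iff[OF ring_coord_ring] scalars_def
      by (intro bexI[of _ "residue n I (const c)"] bexI[of _ "residue n I u"]) simp_all
  qed
qed

text \<open>
  Dimensions in the coordinate ring are dimensions of spaces of polynomials: a linear map
  \<open>f\<close> with kernel \<open>I\<close> identifies the quotient \<open>U / I\<close> with \<open>f ` U\<close>.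
\<close>

lemma basis_of_dimension:
  assumes f: "mlinear f" and ker: "\<And>p. p \<in> carrier (KX n) \<Longrightarrow> f p = 0 \<longleftrightarrow> p \<in> I"
    and d: "ring.dimension (coord_ring n I) d (scalars n I) E"
  shows "\<exists>U B. mp.subspace U \<and> I \<subseteq> U \<and> U \<subseteq> carrier (KX n) \<and> E = residue n I ` U \<and>
    finite B \<and> card B = d \<and> mp.independent B \<and> mp.span B = f ` U"
  using d
proof (induction d K\<equiv>"scalars n I" E rule: ring.dimension.induct[OF ring_coord_ring, consumes 1])
  case 1
  have "residue n I ` I = {\<zero>\<^bsub>coord_ring n I\<^esub>}"
    using residue_eq_zero_iff ideal_KX_zero by (auto simp: coord_ring_zero image_iff)
  moreover have "f ` I = {0}"
    using ker ideal_KX_subset ideal_KX_zero by (force simp: image_iff)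
  ultimately show ?case
    using subspace_ideal_KX ideal_KX_subset
    by - (rule exI[where x = I], rule exI[where x = "{}"], auto simp: mp.independent_empty)
next
  case (2 v E d)
  then obtain U B where U: "mp.subspace U" "I \<subseteq> U" "U \<subseteq> carrier (KX n)" "E = residue n I ` U"
    and B: "finite B" "card B = d" "mp.independent B" "mp.span B = f ` U" by blast
  obtain w where w: "w \<in> carrier (KX n)" "v = residue n I w"
    using 2 by (auto simp: carrier_coord_ring)
  let ?U = "{smul c w + u |c u. u \<in> U}"
  have wU: "f w \<notin> f ` U"
  proof
    assume "f w \<in> f ` U"
    then obtain u where u: "u \<in> U" "f w = f u" by blast
    then have "f (w - u) = 0" by (simp add: mlinear_diff[OF f])
    moreover have "w - u \<in> carrier (KX n)"
      using w u U subring_set_diff[OF subring_set_poly_ring] by blast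
    ultimately have "w - u \<in> I" using ker by blast
    then have "residue n I w = residue n I u" by (simp add: residue_eq_iff)
    with u w U 2 show False by blast
  qed
  have "mp.subspace (mp.span (insert w U))" by (rule mp.subspace_span)
  moreover have spw: "mp.span (insert w U) = ?U"
  proof -
    have "x \<in> mp.span (insert w U) \<longleftrightarrow> x \<in> ?U" for x
    proof -
      have "x \<in> mp.span (insert w U) \<longleftrightarrow> (\<exists>c. x - smul c w \<in> U)"
        using U(1) by (simp add: mp.span_breakdown_eq mp.span_eq_iff[THEN iffD2])
      also have "\<dots> \<longleftrightarrow> x \<in> ?U"
      proof
        assume "\<exists>c. x - smul c w \<in> U"
        then obtain c where "x - smul c w \<in> U" ..
        moreover have "x = smul c w + (x - smul c w)" by simp
        ultimately show "x \<in> ?U" by blast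
      next
        assume "x \<in> ?U"
        then obtain c u where "x = smul c w + u" "u \<in> U" by blast
        then show "\<exists>c. x - smul c w \<in> U" by (intro exI[of _ c]) simp
      qed
      finally show ?thesis .
    qed
    then show ?thesis by blast
  qed
  ultimately have subU: "mp.subspace ?U" by simp
  have "ring.line_extension (coord_ring n I) (scalars n I) v E = residue n I ` ?U"
    unfolding w(2) U(4) by (rule line_extension_residue[OF w(1) U(3)])
  moreover have "I \<subseteq> ?U"
    using U(2) spw by (metis mp.span_superset insert_subset order.trans)
  moreover have "?U \<subseteq> carrier (KX n)"
    using mp.span_minimal[of "insert w U", OF _ subspace_carrier_KX] w(1) U(3) by (simp add: spw)
  moreover have "finite (insert (f w) B)" using B by simp
  moreover have "f w \<notin> mp.span B" using wU B(4) by simp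
  then have "card (insert (f w) B) = Suc d" "mp.independent (insert (f w) B)"
    using B mp.span_base[of "f w" B] by (auto simp: mp.independent_insertI card_insert_if)
  moreover have "mp.span (insert (f w) B) = f ` ?U"
  proof -
    have "mp.span (insert (f w) B) = mp.span (insert (f w) (f ` U))"
      using mlinear_subspace_image[OF f U(1)] by (simp add: mp.span_insert B(4) mp.span_eq_iff[THEN iffD2])
    also have "\<dots> = f ` mp.span (insert w U)"
      using mlinear_span_image[OF f, of "insert w U"] by simp
    finally show ?thesis by (simp add: spw)
  qed
  ultimately show ?case using subU by blast
qed

lemma dimension_of_basis:
  assumes f: "mlinear f" and ker: "\<And>p. p \<in> carrier (KX n) \<Longrightarrow> f p = 0 \<longleftrightarrow> p \<in> I"
    and "finite B" "mp.independent B"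
    and "mp.subspace U" "I \<subseteq> U" "U \<subseteq> carrier (KX n)" "mp.span B = f ` U"
  shows "ring.dimension (coord_ring n I) (card B) (scalars n I) (residue n I ` U)"
  using assms(3-)
proof (induction B arbitrary: U rule: finite_induct)
  case empty
  then have "f u = 0" if "u \<in> U" for u using that by auto
  then have "U = I" using empty ker by blast
  then have "residue n I ` U = {\<zero>\<^bsub>coord_ring n I\<^esub>}"
    using residue_eq_zero_iff ideal_KX_zero by (auto simp: coord_ring_zero image_iff)
  then show ?case
    using ring.dimension.intros(1)[OF ring_coord_ring] by simp
next
  case (insert b B U)
  then obtain w where w: "w \<in> U" "b = f w"
    using mp.span_base[of b "insert b B"] by auto
  have bB: "b \<notin> mp.span B" "mp.independent B"
    using insert by (simp_all add: mp.independent_insert)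
  let ?U = "{u \<in> U. f u \<in> mp.span B}"
  have sub: "mp.subspace ?U"
    using insert.prems(2) mlinear_add[OF f] mlinear_scale[OF f] mlinear_zero[OF f]
    by (intro mp.subspaceI)
       (auto simp: mp.span_zero mp.span_add mp.span_scale mp.subspace_0 mp.subspace_add mp.subspace_scale)
  have fU: "mp.span B = f ` ?U"
  proof -
    have "mp.span B \<subseteq> f ` U"
      using insert.prems(5) mp.span_mono[of B "insert b B"] by auto
    then show ?thesis by auto
  qed
  have IU: "I \<subseteq> ?U"
  proof
    fix x assume "x \<in> I"
    with ker[of x] ideal_KX_subset insert.prems(3) show "x \<in> ?U"
      by (auto simp: mp.span_zero)
  qed
  have dim: "ring.dimension (coord_ring n I) (card B) (scalars n I) (residue n I ` ?U)"
    using insert.prems(4) by (intro insert.IH bB(2) sub IU fU) auto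
  have wC: "w \<in> carrier (KX n)" using w insert.prems by blast
  have "residue n I w \<notin> residue n I ` ?U"
  proof
    assume "residue n I w \<in> residue n I ` ?U"
    then obtain u where u: "u \<in> ?U" "w - u \<in> I" by (auto simp: residue_eq_iff)
    then have "f (w - u) = 0" using ker ideal_KX_subset by blast
    then have "b = f u" using w by (simp add: mlinear_diff[OF f])
    with u bB show False by simp
  qed
  moreover have "residue n I w \<in> carrier (coord_ring n I)"
    using wC by (simp add: carrier_coord_ring)
  ultimately have "ring.dimension (coord_ring n I) (Suc (card B)) (scalars n I)
      (ring.line_extension (coord_ring n I) (scalars n I) (residue n I w) (residue n I ` ?U))"
    using ring.dimension.intros(2)[OF ring_coord_ring] dim by blast
  also have "ring.line_extension (coord_ring n I) (scalars n I) (residue n I w) (residue n I ` ?U)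
      = residue n I ` {smul c w + u |c u. u \<in> ?U}"
    using insert.prems(4) by (intro line_extension_residue wC) auto
  also have "{smul c w + u |c u. u \<in> ?U} = U"
  proof
    show "{smul c w + u |c u. u \<in> ?U} \<subseteq> U"
      using w insert.prems(2) by (auto simp: mp.subspace_add mp.subspace_scale)
    show "U \<subseteq> {smul c w + u |c u. u \<in> ?U}"
    proof
      fix x assume x: "x \<in> U"
      then have "f x \<in> mp.span (insert b B)" using insert.prems(5) by blast
      then obtain c where c: "f x - smul c b \<in> mp.span B" by (auto simp: mp.span_breakdown_eq)
      have "f (x - smul c w) \<in> mp.span B"
        using c w by (simp add: mlinear_diff[OF f] mlinear_scale[OF f])
      moreover have "x - smul c w \<in> U"
        using x w insert.prems(2) by (simp add: mp.subspace_diff mp.subspace_scale)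
      ultimately have "x - smul c w \<in> ?U" by simp
      moreover have "x = smul c w + (x - smul c w)" by simp
      ultimately show "x \<in> {smul c w + u |c u. u \<in> ?U}" by blast
    qed
  qed
  finally show ?case using insert by simp
qed

lemma dimension_iff:
  assumes f: "mlinear f" and ker: "\<And>p. p \<in> carrier (KX n) \<Longrightarrow> f p = 0 \<longleftrightarrow> p \<in> I"
    and U: "mp.subspace U" "U \<subseteq> carrier (KX n)"
  shows "ring.dimension (coord_ring n I) d (scalars n I) (residue n I ` U) \<longleftrightarrow>
    (\<exists>B. finite B \<and> card B = d \<and> mp.independent B \<and> mp.span B = f ` U)"
proof -
  \<comment> \<open>This is \<open>U + I\<close>, which has the same residue classes and the same image as \<open>U\<close>.\<close>
  let ?U = "{u \<in> carrier (KX n). f u \<in> f ` U}"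
  have fU: "f ` ?U = f ` U" using U by auto
  have mem: "p \<in> W \<longleftrightarrow> residue n I p \<in> residue n I ` W"
    if "mp.subspace W" "I \<subseteq> W" for p W
  proof
    assume "residue n I p \<in> residue n I ` W"
    then obtain q where "q \<in> W" "p - q \<in> I" by (auto simp: residue_eq_iff)
    with that mp.subspace_add[of W q "p - q"] show "p \<in> W" by auto
  qed auto
  have resU: "residue n I ` ?U = residue n I ` U"
  proof
    show "residue n I ` ?U \<subseteq> residue n I ` U"
    proof
      fix z assume "z \<in> residue n I ` ?U"
      then obtain p u where pu: "z = residue n I p" "p \<in> carrier (KX n)" "u \<in> U" "f p = f u" by auto
      then have "f (p - u) = 0" by (simp add: mlinear_diff[OF f])
      moreover have "p - u \<in> carrier (KX n)"
        using pu U subring_set_diff[OF subring_set_poly_ring] by blast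
      ultimately have "residue n I p = residue n I u" using ker by (simp add: residue_eq_iff)
      with pu show "z \<in> residue n I ` U" by blast
    qed
  qed (use U in auto)
  have subU: "mp.subspace ?U"
    using mlinear_subspace_image[OF f U(1)] subspace_carrier_KX
    by (intro mp.subspaceI)
       (auto simp: mlinear_add[OF f] mlinear_scale[OF f] mlinear_zero[OF f] mp.subspace_0
         intro: mp.subspace_add mp.subspace_scale)
  have IU: "I \<subseteq> ?U"
    using ker ideal_KX_subset mp.subspace_0[OF U(1)] mlinear_zero[OF f] by (force simp: image_iff)
  show ?thesis
  proof
    assume "ring.dimension (coord_ring n I) d (scalars n I) (residue n I ` U)"
    from basis_of_dimension[OF f ker this]
    obtain W B where W: "mp.subspace W" "I \<subseteq> W" "W \<subseteq> carrier (KX n)" "residue n I ` U = residue n I ` W"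
      and B: "finite B \<and> card B = d \<and> mp.independent B \<and> mp.span B = f ` W" by blast
    have "p \<in> W \<longleftrightarrow> p \<in> ?U" for p
      unfolding mem[OF W(1,2)] mem[OF subU IU] resU W(4) ..
    then have "W = ?U" by blast
    with B fU show "\<exists>B. finite B \<and> card B = d \<and> mp.independent B \<and> mp.span B = f ` U" by auto
  next
    assume "\<exists>B. finite B \<and> card B = d \<and> mp.independent B \<and> mp.span B = f ` U"
    then obtain B where B: "finite B" "card B = d" "mp.independent B" "mp.span B = f ` ?U"
      unfolding fU by blast
    from dimension_of_basis[OF f ker B(1,3) subU IU _ B(4)] B(2)
    show "ring.dimension (coord_ring n I) d (scalars n I) (residue n I ` U)"
      by (simp add: resU)
  qed
qed

lemma kdim_eq_dim:
  assumes f: "mlinear f" and ker: "\<And>p. p \<in> carrier (KX n) \<Longrightarrow> f p = 0 \<longleftrightarrow> p \<in> I"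
    and U: "mp.subspace U" "U \<subseteq> carrier (KX n)" and T: "finite T" "f ` U \<subseteq> mp.span T"
  shows "kdim n I (residue n I ` U) = mp.dim (f ` U)"
proof -
  obtain B where B: "B \<subseteq> f ` U" "mp.independent B" "f ` U \<subseteq> mp.span B"
    using mp.basis_exists by metis
  have finB: "finite B"
    using mp.independent_span_bound[OF T(1) B(2)] B(1) T(2) by blast
  have spB: "mp.span B = f ` U"
    using B mlinear_subspace_image[OF f U(1)] by (simp add: mp.span_subspace)
  have iff: "ring.dimension (coord_ring n I) d (scalars n I) (residue n I ` U) \<longleftrightarrow> d = mp.dim (f ` U)" for d
  proof -
    have "ring.dimension (coord_ring n I) d (scalars n I) (residue n I ` U) \<longleftrightarrow>
        (\<exists>B. finite B \<and> card B = d \<and> mp.independent B \<and> mp.span B = f ` U)"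
      by (rule dimension_iff[OF f ker U])
    also have "\<dots> \<longleftrightarrow> d = mp.dim (f ` U)"
    proof
      assume "d = mp.dim (f ` U)"
      with mp.dim_span_eq_card_independent[OF B(2)] finB B(2) spB
      show "\<exists>B. finite B \<and> card B = d \<and> mp.independent B \<and> mp.span B = f ` U"
        by (intro exI[of _ B]) simp
    next
      assume "\<exists>B. finite B \<and> card B = d \<and> mp.independent B \<and> mp.span B = f ` U"
      then obtain B' where B': "card B' = d" "mp.independent B'" "mp.span B' = f ` U" by blast
      with mp.dim_span_eq_card_independent[OF B'(2)] show "d = mp.dim (f ` U)" by simp
    qed
    finally show ?thesis .
  qed
  show ?thesis
    unfolding kdim_def ring.dim_def[OF ring_coord_ring] over_def iff by simp
qed

end

section \<open>The Cayley-Bacharach property and minimal ideals\<close>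

text \<open>
  The regularity index and orders are least elements of sets of integers, which exist only for sets
  that are bounded below.
\<close>

lemma
  assumes "P (i0::int)" "\<And>i. P i \<Longrightarrow> 0 \<le> i"
  shows Least_int: "P (LEAST i. P i)" and Least_int_le: "P i \<Longrightarrow> (LEAST i. P i) \<le> i"
proof -
  let ?k = "LEAST k. P (int k)"
  have P: "P (int ?k)"
    by (rule LeastI[of "\<lambda>k. P (int k)" "nat i0"]) (use assms in simp)
  have le: "int ?k \<le> i" if "P i" for i
    using Least_le[of "\<lambda>k. P (int k)" "nat i"] assms(2)[OF that] that by simp
  have "(LEAST i. P i) = int ?k"
    by (rule Least_equality) (use P le in auto)
  with P le show "P (LEAST i. P i)" "P i \<Longrightarrow> (LEAST i. P i) \<le> i" by auto
qed

lemma dim_strict_mono: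
  assumes "finite T" "W \<subseteq> mp.span T" "mp.subspace U" "mp.subspace W" "U \<subset> W"
  shows "mp.dim U < mp.dim W"
proof -
  obtain B where B: "B \<subseteq> U" "mp.independent B" "U \<subseteq> mp.span B" "card B = mp.dim U"
    using mp.basis_exists by metis
  obtain B' where B': "B' \<subseteq> W" "mp.independent B'" "W \<subseteq> mp.span B'" "card B' = mp.dim W"
    using mp.basis_exists by metis
  obtain w where w: "w \<in> W" "w \<notin> U" using assms(5) by blast
  have spB: "mp.span B = U" using B assms(3) by (simp add: mp.span_subspace)
  have fin: "finite B" "finite B'"
    using mp.independent_span_bound[OF assms(1) B(2)] mp.independent_span_bound[OF assms(1) B'(2)]
      B(1) B'(1) assms(2,5) by auto
  have "w \<notin> B" "w \<notin> mp.span B" using w spB B(1) by auto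
  then have "mp.independent (insert w B)" "card (insert w B) = Suc (mp.dim U)"
    using B fin by (simp_all add: mp.independent_insertI)
  moreover have "insert w B \<subseteq> mp.span B'" using w B(1) assms(5) B'(3) by blast
  ultimately show ?thesis
    using mp.independent_span_bound[OF fin(2), of "insert w B"] B'(4) by simp
qed

lemma telescope_one_minus_power:
  fixes z :: "'b::comm_ring_1"
  shows "(1 - z) * (\<Sum>i<k. z ^ i) = 1 - z ^ k"
proof (induction k)
  case (Suc k)
  have "(1 - z) * (\<Sum>i<Suc k. z ^ i) = (1 - z) * (\<Sum>i<k. z ^ i) + (1 - z) * z ^ k"
    by (simp add: distrib_left)
  with Suc show ?case
    by (simp add: left_diff_distrib)
qed simp

definition minimal_over :: "nat \<Rightarrow> (nat, 'a::field) mpoly set \<Rightarrow> (nat, 'a) mpoly set \<Rightarrow> bool" where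
  "minimal_over n Q J \<longleftrightarrow> ideal J (KX n) \<and> Q \<subset> J \<and>
     (\<forall>J'. ideal J' (KX n) \<longrightarrow> Q \<subset> J' \<longrightarrow> J' \<subseteq> J \<longrightarrow> J' = J)"

abbreviation (input) KXC :: "nat \<Rightarrow> (nat, 'a::field) mpoly set" where "KXC n \<equiv> carrier (KX n)"

lemmas KXC_one = subring_set_one[OF subring_set_poly_ring[of "{..<n}"]] for n
lemmas KXC_zero = subring_set_zero[OF subring_set_poly_ring[of "{..<n}"]] for n
lemmas KXC_add = subring_set_add[OF subring_set_poly_ring[of "{..<n}"]] for n
lemmas KXC_diff = subring_set_diff[OF subring_set_poly_ring[of "{..<n}"]] for n
lemmas KXC_mult = subring_set_mult[OF subring_set_poly_ring[of "{..<n}"]] for n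
lemmas KXC_power = subring_set_power[OF subring_set_poly_ring[of "{..<n}"]] for n

lemma ideal_principal_sum:
  assumes Q: "ideal Q (KX n)" and g: "g \<in> KXC n"
  shows "ideal {q + p * g |q p. q \<in> Q \<and> p \<in> KXC n} (KX n)"
  unfolding ideal_poly_ring_iff
proof (intro conjI ballI subsetI)
  note QC = ideal_KX_subset[OF Q, THEN subsetD]
  let ?J = "{q + p * g |q p. q \<in> Q \<and> p \<in> KXC n}"
  show "0 \<in> ?J"
    using ideal_KX_zero[OF Q] KXC_zero[of n] by force
  show "a \<in> KXC n" if "a \<in> ?J" for a
    using that g QC by (auto intro!: KXC_add KXC_mult)
  show "a + b \<in> ?J" if "a \<in> ?J" "b \<in> ?J" for a b
  proof -
    from that obtain q p q' p' where *: "a = q + p * g" "b = q' + p' * g" "q \<in> Q" "q' \<in> Q"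
      "p \<in> KXC n" "p' \<in> KXC n" by blast
    then have "a + b = (q + q') + (p + p') * g" by (simp add: algebra_simps)
    with * show ?thesis using ideal_KX_add[OF Q] KXC_add by blast
  qed
  show "r * a \<in> ?J" if "a \<in> ?J" "r \<in> KXC n" for r a
  proof -
    from that obtain q p where *: "a = q + p * g" "q \<in> Q" "p \<in> KXC n" by blast
    then have "r * a = r * q + (r * p) * g" by (simp add: algebra_simps)
    with * that(2) show ?thesis using ideal_KX_mult[OF Q] KXC_mult by blast
  qed
qed

lemma ideal_colon:
  assumes Q: "ideal Q (KX n)" and g: "g \<in> KXC n"
  shows "ideal {p \<in> KXC n. p * g \<in> Q} (KX n)"
  unfolding ideal_poly_ring_iff
  using ideal_KX_zero[OF Q] ideal_KX_add[OF Q] ideal_KX_mult[OF Q] KXC_zero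
  by (auto simp: distrib_right mult.assoc intro: KXC_add KXC_mult)

lemma ideal_KXC: "ideal (KXC n) (KX n)"
  by (auto simp: ideal_poly_ring_iff intro: KXC_zero KXC_add KXC_mult)

lemma ideal_KX_eq_carrier: "ideal Q (KX n) \<Longrightarrow> 1 \<in> Q \<Longrightarrow> Q = KXC n"
  using ideal_KX_subset[of Q n] ideal_KX_mult[of Q n 1] by auto

lemma minimal_over_principal:
  assumes Q: "ideal Q (KX n)" and J: "minimal_over n Q J" and g: "g \<in> J" "g \<notin> Q"
  shows "J = {q + p * g |q p. q \<in> Q \<and> p \<in> KXC n}" (is "J = ?J")
proof -
  have J': "ideal J (KX n)" "Q \<subset> J" using J by (simp_all add: minimal_over_def)
  have gC: "g \<in> KXC n" using ideal_KX_subset[OF J'(1)] g by blast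
  have "Q \<subseteq> ?J" using KXC_zero[of n] by force
  moreover have "g \<in> ?J" using ideal_KX_zero[OF Q] KXC_one[of n] by force
  moreover have "?J \<subseteq> J"
    using g J' ideal_KX_add[OF J'(1)] ideal_KX_mult[OF J'(1)] by blast
  ultimately show ?thesis
    using J g ideal_principal_sum[OF Q gC] unfolding minimal_over_def by blast
qed

text \<open>
  Nilpotent action on a minimal ideal is zero: otherwise \<open>m g\<close> would generate it modulo \<open>Q\<close>, so
  \<open>(1 - m p) g \<in> Q\<close> for some \<open>p\<close>, although \<open>1 - m p\<close> acts invertibly on \<open>g\<close>.
\<close>

lemma minimal_over_nilpotent:
  assumes Q: "ideal Q (KX n)" and J: "minimal_over n Q J" and g: "g \<in> J"
    and m: "m \<in> KXC n" and nil: "m ^ k * g \<in> Q"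
  shows "m * g \<in> Q"
proof (rule ccontr)
  assume mg: "m * g \<notin> Q"
  have J': "ideal J (KX n)" using J by (simp add: minimal_over_def)
  have gC: "g \<in> KXC n" using ideal_KX_subset[OF J'] g by blast
  have "g \<notin> Q" using mg ideal_KX_mult[OF Q _ m] by blast
  have "m * g \<in> J" using ideal_KX_mult[OF J' g m] .
  from minimal_over_principal[OF Q J this mg] g
  obtain q p where qp: "g = q + p * (m * g)" "q \<in> Q" "p \<in> KXC n" by blast
  let ?z = "m * p"
  have zC: "?z \<in> KXC n" using m qp by (simp add: KXC_mult)
  have "q = (1 - ?z) * g" using qp(1) by (simp add: algebra_simps)
  moreover have "(\<Sum>i<k. ?z ^ i) \<in> KXC n"
    by (intro subring_set_sum[OF subring_set_poly_ring] KXC_power zC)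
  ultimately have "(\<Sum>i<k. ?z ^ i) * ((1 - ?z) * g) \<in> Q"
    using ideal_KX_mult[OF Q qp(2)] by simp
  moreover have "(\<Sum>i<k. ?z ^ i) * ((1 - ?z) * g) = (1 - ?z ^ k) * g"
    unfolding telescope_one_minus_power[symmetric] by (simp only: mult_ac)
  moreover have "p ^ k * (m ^ k * g) \<in> Q" by (rule ideal_KX_mult[OF Q nil KXC_power[OF qp(3)]])
  then have "?z ^ k * g \<in> Q" by (simp add: power_mult_distrib mult_ac)
  ultimately have "(1 - ?z ^ k) * g + ?z ^ k * g \<in> Q" using ideal_KX_add[OF Q] by simp
  then have "g \<in> Q" by (simp add: algebra_simps)
  with \<open>g \<notin> Q\<close> show False ..
qed

text \<open>
  Multiplication by an element \<open>g\<close> of \<open>J\<close> outside \<open>Q\<close> identifies the residue field of \<open>M\<close> with \<open>J / Q\<close>: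
  it is onto because \<open>g\<close> generates \<open>J\<close> over \<open>Q\<close>, and its kernel contains \<open>M\<close> and is proper.
\<close>

lemma kdim_minimal_over:
  assumes Q: "ideal Q (KX n)" and J: "minimal_over n Q J" and M: "maximalideal M (KX n)"
    and MJ: "\<And>m g. m \<in> M \<Longrightarrow> g \<in> J \<Longrightarrow> m * g \<in> Q"
  shows "kdim n Q (residue n Q ` J) = kdim n M (carrier (coord_ring n M))"
proof -
  have iM: "ideal M (KX n)" using M by (rule maximalideal.axioms)
  have iJ: "ideal J (KX n)" using J by (simp add: minimal_over_def)
  obtain g where g: "g \<in> J" "g \<notin> Q" using J by (auto simp: minimal_over_def)
  have gC: "g \<in> KXC n" using ideal_KX_subset[OF iJ] g by blast
  let ?A = "{p \<in> KXC n. p * g \<in> Q}"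
  have A: "?A = M"
  proof -
    have "M \<subseteq> ?A" using MJ g ideal_KX_subset[OF iM] by blast
    moreover have "?A \<noteq> KXC n" using g KXC_one[of n] by force
    ultimately show ?thesis
      using maximalideal.I_maximal[OF M ideal_colon[OF Q gC]] by blast
  qed
  obtain f where f: "mlinear f" "{p. f p = 0} = Q"
    using exists_linear_with_kernel[OF subspace_ideal_KX[OF Q]] by blast
  have f1: "mlinear (\<lambda>p. f (p * g))"
    by (rule mlinear_comp[OF f(1) mlinear_mult_right])
  have ker1: "f (p * g) = 0 \<longleftrightarrow> p \<in> M" if "p \<in> KXC n" for p
    using f(2) A that by blast
  have ker: "f p = 0 \<longleftrightarrow> p \<in> Q" for p using f(2) by blast
  have img: "(\<lambda>p. f (p * g)) ` KXC n = f ` J"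
  proof
    show "(\<lambda>p. f (p * g)) ` KXC n \<subseteq> f ` J"
      using ideal_KX_mult[OF iJ g(1)] by blast
    show "f ` J \<subseteq> (\<lambda>p. f (p * g)) ` KXC n"
    proof
      fix z assume "z \<in> f ` J"
      then obtain q p where "z = f (q + p * g)" "q \<in> Q" "p \<in> KXC n"
        using minimal_over_principal[OF Q J g] by auto
      then show "z \<in> (\<lambda>p. f (p * g)) ` KXC n"
        using ker[of q] by (simp add: mlinear_add[OF f(1)])
    qed
  qed
  have "ring.dimension (coord_ring n Q) d (scalars n Q) (residue n Q ` J) \<longleftrightarrow>
      ring.dimension (coord_ring n M) d (scalars n M) (carrier (coord_ring n M))" for d
  proof -
    have "ring.dimension (coord_ring n Q) d (scalars n Q) (residue n Q ` J) \<longleftrightarrow>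
        (\<exists>B. finite B \<and> card B = d \<and> mp.independent B \<and> mp.span B = f ` J)"
      by (rule dimension_iff[OF Q f(1) ker subspace_ideal_KX[OF iJ] ideal_KX_subset[OF iJ]])
    moreover have "ring.dimension (coord_ring n M) d (scalars n M) (residue n M ` KXC n) \<longleftrightarrow>
        (\<exists>B. finite B \<and> card B = d \<and> mp.independent B \<and> mp.span B = (\<lambda>p. f (p * g)) ` KXC n)"
      by (rule dimension_iff[OF iM f1 ker1 subspace_carrier_KX subset_refl])
    ultimately show ?thesis
      by (simp only: img carrier_coord_ring[OF iM])
  qed
  then show ?thesis
    by (simp add: kdim_def ring.dim_def[OF ring_coord_ring[OF Q]] ring.dim_def[OF ring_coord_ring[OF iM]]
        over_def)
qed

lemma maximal_prime:
  assumes "maximalideal M (KX n :: (nat, 'a::field) mpoly ring)" "a \<in> KXC n" "b \<in> KXC n" "a * b \<in> M"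
  shows "a \<in> M \<or> b \<in> M"
  using primeideal.I_prime[OF cring.maximalideal_prime[OF cring_poly_ring assms(1)] assms(2,3)] assms(4)
  by simp

lemma maximal_one_notin:
  fixes M :: "(nat, 'a::field) mpoly set"
  assumes M: "maximalideal M (KX n)"
  shows "1 \<notin> M"
proof
  assume "1 \<in> M"
  then have "M = KXC n" by (rule ideal_KX_eq_carrier[OF maximalideal.axioms(1)[OF M]])
  then show False using maximalideal.I_notcarr[OF M] by simp
qed

lemma maximal_power:
  assumes M: "maximalideal M (KX n)" and "a \<in> KXC n" "a ^ k \<in> M"
  shows "a \<in> M"
  using assms(3)
proof (induction k)
  case 0
  then show ?case using maximal_one_notin[OF M] by simp
next
  case (Suc k)
  then show ?case
    using maximal_prime[OF M assms(2) KXC_power[OF assms(2), of k]] by auto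
qed

lemma prime_avoids_intersection:
  assumes M: "maximalideal M (KX n)" and "finite A"
    and A: "\<And>B. B \<in> A \<Longrightarrow> ideal B (KX n) \<and> \<not> B \<subseteq> M"
  shows "\<exists>e\<in>KXC n. e \<notin> M \<and> (\<forall>B\<in>A. e \<in> B)"
  using assms(2,3)
proof (induction A rule: finite_induct)
  case empty
  then show ?case using KXC_one[of n] maximal_one_notin[OF M] by blast
next
  case (insert B A)
  then obtain e where e: "e \<in> KXC n" "e \<notin> M" "\<And>B. B \<in> A \<Longrightarrow> e \<in> B" by blast
  obtain b where b: "b \<in> B" "b \<notin> M" using insert by blast
  have iB: "ideal B (KX n)" using insert by blast
  have bC: "b \<in> KXC n" using ideal_KX_subset[OF iB] b by blast
  have "e * b \<notin> M" using maximal_prime[OF M e(1) bC] e b by blast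
  moreover have "e * b \<in> B" by (rule ideal_KX_mult[OF iB b(1) e(1)])
  moreover have "e * b \<in> B'" if "B' \<in> A" for B'
    using ideal_KX_mult_right[of B' n e b] e(3)[OF that] bC insert.prems that by blast
  ultimately show ?case using KXC_mult[OF e(1) bC] by blast
qed

lemma mem_radical: "a \<in> radical (KX n) Q \<longleftrightarrow> a \<in> KXC n \<and> (\<exists>k. a ^ k \<in> Q)"
  by (simp add: radical_def)

text \<open>
  The ideal of a nonempty zero-dimensional scheme. The coordinate ring is represented by the image of
  a linear map \<open>f\<close> with kernel \<open>I\<close>; this image is finite-dimensional because it lies in the span of
  the finite set \<open>T\<close>. For a point of a border basis scheme, \<open>f\<close> will be the normal form map and \<open>T\<close> the
  order ideal.
\<close>

locale zero_dim_ideal =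
  fixes n :: nat and I :: "(nat, 'a::field) mpoly set"
    and f :: "(nat, 'a) mpoly \<Rightarrow> (nat, 'a) mpoly" and T :: "(nat, 'a) mpoly set"
  assumes I: "ideal I (KX n)" and one_notin: "1 \<notin> I"
    and f: "mlinear f" and ker: "\<And>p. p \<in> KXC n \<Longrightarrow> f p = 0 \<longleftrightarrow> p \<in> I"
    and T: "finite T" "f ` KXC n \<subseteq> mp.span T"
begin

lemma dim_ideal_strict_mono:
  assumes A: "ideal A (KX n)" and B: "ideal B (KX n)" and "I \<subseteq> A" "A \<subset> B"
  shows "mp.dim (f ` A) < mp.dim (f ` B)"
proof (rule dim_strict_mono[OF T(1)])
  show "f ` B \<subseteq> mp.span T" using ideal_KX_subset[OF B] T(2) by blast
  show "mp.subspace (f ` A)" "mp.subspace (f ` B)"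
    by (rule mlinear_subspace_image[OF f subspace_ideal_KX]; fact)+
  obtain b where b: "b \<in> B" "b \<notin> A" using assms by blast
  have "f b \<notin> f ` A"
  proof
    assume "f b \<in> f ` A"
    then obtain a where a: "a \<in> A" "f b = f a" by blast
    then have "f (b - a) = 0" by (simp add: mlinear_diff[OF f])
    moreover have "b - a \<in> KXC n"
      using a b ideal_KX_subset[OF A] ideal_KX_subset[OF B] KXC_diff by blast
    ultimately have "b - a \<in> A" using ker assms(3) by blast
    then have "b \<in> A" using ideal_KX_add[OF A, of "b - a" a] a by simp
    with b show False by simp
  qed
  with b assms(4) show "f ` A \<subset> f ` B" by blast
qed

lemma ideal_eq_of_dim_le:
  assumes "ideal A (KX n)" "ideal B (KX n)" "I \<subseteq> A" "A \<subseteq> B" "mp.dim (f ` B) \<le> mp.dim (f ` A)"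
  shows "A = B"
proof (rule ccontr)
  assume "A \<noteq> B"
  with assms(4) have "A \<subset> B" by blast
  from dim_ideal_strict_mono[OF assms(1-3) this] assms(5) show False by simp
qed

lemma dim_le: "ideal A (KX n) \<Longrightarrow> mp.dim (f ` A) \<le> card T"
  using ideal_KX_subset[of A n] T by (intro mp.dim_le_card) auto

lemma exists_minimal_over:
  assumes Q: "I \<subseteq> Q" "ideal Q (KX n)" and B: "ideal B (KX n)" "Q \<subset> B"
  obtains J where "minimal_over n Q J" "J \<subseteq> B"
proof -
  let ?P = "\<lambda>J. ideal J (KX n) \<and> Q \<subset> J \<and> J \<subseteq> B"
  define J where "J = (ARG_MIN (\<lambda>J. mp.dim (f ` J)) J. ?P J)"
  have J: "?P J"
    using arg_min_natI[of ?P B "\<lambda>J. mp.dim (f ` J)"] B unfolding J_def by blast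
  have J_le: "mp.dim (f ` J) \<le> mp.dim (f ` J')" if "?P J'" for J'
    unfolding J_def by (rule arg_min_nat_le[of ?P]) (rule that)
  have "J' = J" if J': "ideal J' (KX n)" "Q \<subset> J'" "J' \<subseteq> J" for J'
  proof (rule ccontr)
    assume "J' \<noteq> J"
    with J' have "J' \<subset> J" by blast
    moreover have "I \<subseteq> J'" using Q J' by blast
    ultimately have "mp.dim (f ` J') < mp.dim (f ` J)"
      using dim_ideal_strict_mono[OF J'(1)] J by blast
    moreover have "?P J'" using J' J by blast
    ultimately show False using J_le[of J'] by simp
  qed
  then have "minimal_over n Q J" using J by (simp add: minimal_over_def)
  with J that show ?thesis by blast
qed

lemma exists_maximal:
  assumes A: "ideal A (KX n)" "I \<subseteq> A" "1 \<notin> A"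
  obtains M where "maximalideal M (KX n)" "A \<subseteq> M"
proof -
  let ?P = "\<lambda>M. ideal M (KX n) \<and> A \<subseteq> M \<and> 1 \<notin> M"
  have "\<exists>M. ?P M \<and> (\<forall>M'. ?P M' \<longrightarrow> mp.dim (f ` M') \<le> mp.dim (f ` M))"
    by (rule ex_has_greatest_nat[of ?P A _ "Suc (card T)"]) (use A dim_le in \<open>auto simp: less_Suc_eq_le\<close>)
  then obtain M where M: "?P M" and le: "\<And>M'. ?P M' \<Longrightarrow> mp.dim (f ` M') \<le> mp.dim (f ` M)" by blast
  have "maximalideal M (KX n)"
  proof (rule maximalidealI)
    show "ideal M (KX n)" using M by simp
    show "KXC n \<noteq> M" using M KXC_one by blast
    fix J assume J: "ideal J (KX n)" "M \<subseteq> J" "J \<subseteq> KXC n"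
    show "J = M \<or> J = KXC n"
    proof (rule ccontr)
      assume "\<not> (J = M \<or> J = KXC n)"
      then have "1 \<notin> J" "M \<subset> J" using ideal_KX_eq_carrier[OF J(1)] J by auto
      moreover have "I \<subseteq> M" using M A by blast
      ultimately have "mp.dim (f ` M) < mp.dim (f ` J)"
        using dim_ideal_strict_mono[of M J] M J by blast
      moreover have "?P J" using M J \<open>1 \<notin> J\<close> by blast
      ultimately show False using le[of J] by simp
    qed
  qed
  with M that show ?thesis by blast
qed

subsection \<open>Primary decomposition\<close>

text \<open>The polynomials that vanish in the localization of the coordinate ring at \<open>M\<close>.\<close>

definition component :: "(nat, 'a) mpoly set \<Rightarrow> (nat, 'a) mpoly set" where
  "component M = {p \<in> KXC n. \<exists>s\<in>KXC n. s \<notin> M \<and> s * p \<in> I}"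

lemma componentI: "p \<in> KXC n \<Longrightarrow> s \<in> KXC n \<Longrightarrow> s \<notin> M \<Longrightarrow> s * p \<in> I \<Longrightarrow> p \<in> component M"
  by (auto simp: component_def)

context
  fixes M assumes M: "maximalideal M (KX n)" and IM: "I \<subseteq> M"
begin

lemma ideal_component: "ideal (component M) (KX n)"
  unfolding ideal_poly_ring_iff
proof (intro conjI ballI)
  show "component M \<subseteq> KXC n" by (auto simp: component_def)
  show "0 \<in> component M"
    using componentI[OF KXC_zero KXC_one maximal_one_notin[OF M]] ideal_KX_zero[OF I] by simp
  fix a assume "a \<in> component M"
  then obtain s where s: "a \<in> KXC n" "s \<in> KXC n" "s \<notin> M" "s * a \<in> I" by (auto simp: component_def)
  show "p * a \<in> component M" if p: "p \<in> KXC n" for p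
  proof -
    have "s * (p * a) = p * (s * a)" by (simp only: mult_ac)
    with ideal_KX_mult[OF I s(4) p] have "s * (p * a) \<in> I" by (simp only:)
    then show ?thesis by (rule componentI[OF KXC_mult[OF p s(1)] s(2,3)])
  qed
  fix b assume "b \<in> component M"
  then obtain t where t: "b \<in> KXC n" "t \<in> KXC n" "t \<notin> M" "t * b \<in> I" by (auto simp: component_def)
  have "(s * t) * (a + b) = t * (s * a) + s * (t * b)" by (simp add: algebra_simps)
  moreover have "\<dots> \<in> I"
    by (intro ideal_KX_add[OF I] ideal_KX_mult[OF I] s t)
  moreover have "s * t \<notin> M" using maximal_prime[OF M s(2) t(2)] s t by blast
  ultimately show "a + b \<in> component M"
    using componentI[OF KXC_add[OF s(1) t(1)] KXC_mult[OF s(2) t(2)]] by simp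
qed

lemma subset_component: "I \<subseteq> component M"
proof
  fix p assume "p \<in> I"
  then show "p \<in> component M"
    using ideal_KX_subset[OF I] KXC_one[of n] maximal_one_notin[OF M] by (intro componentI[of p 1]) auto
qed

lemma component_subset: "component M \<subseteq> M"
proof
  fix p assume "p \<in> component M"
  then obtain s where s: "p \<in> KXC n" "s \<in> KXC n" "s \<notin> M" "s * p \<in> I" by (auto simp: component_def)
  then show "p \<in> M" using maximal_prime[OF M s(2,1)] IM by blast
qed

text \<open>
  The decreasing chain of ideals \<open>I + \<langle>m\<^sup>k\<rangle>\<close> becomes stationary, so \<open>m\<^sup>k = q + p m\<^sup>k\<^sup>+\<^sup>1\<close> with \<open>q \<in> I\<close> for some
  \<open>k\<close>. Then \<open>1 - p m\<close> multiplies \<open>m\<^sup>k\<close> into \<open>I\<close>, and it does not belong to \<open>M\<close>.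
\<close>

lemma power_in_component:
  assumes m: "m \<in> M"
  shows "\<exists>k. m ^ k \<in> component M"
proof -
  have mC: "m \<in> KXC n" using m ideal_KX_subset[OF maximalideal.axioms(1)[OF M]] by blast
  let ?A = "\<lambda>k. {q + p * m ^ k |q p. q \<in> I \<and> p \<in> KXC n}"
  have iA: "ideal (?A k) (KX n)" for k by (rule ideal_principal_sum[OF I KXC_power[OF mC]])
  define k where "k = (ARG_MIN (\<lambda>k. mp.dim (f ` ?A k)) k. True)"
  have k: "mp.dim (f ` ?A k) \<le> mp.dim (f ` ?A (Suc k))"
    unfolding k_def by (rule arg_min_nat_le) simp
  have sub: "?A (Suc k) \<subseteq> ?A k"
  proof
    fix x assume "x \<in> ?A (Suc k)"
    then obtain q p where "x = q + p * m ^ Suc k" "q \<in> I" "p \<in> KXC n" by blast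
    then have "x = q + (p * m) * m ^ k" "q \<in> I" "p * m \<in> KXC n" by (simp_all add: mult.assoc KXC_mult mC)
    then show "x \<in> ?A k" by blast
  qed
  moreover have "I \<subseteq> ?A (Suc k)" using KXC_zero[of n] by force
  ultimately have "?A (Suc k) = ?A k"
    using ideal_eq_of_dim_le[OF iA iA _ _ k] by simp
  moreover have "m ^ k \<in> ?A k" using ideal_KX_zero[OF I] KXC_one[of n] by force
  ultimately obtain q p where qp: "m ^ k = q + p * m ^ Suc k" "q \<in> I" "p \<in> KXC n" by blast
  have "(1 - p * m) * m ^ k = m ^ k - p * m ^ Suc k" by (simp add: algebra_simps)
  also have "\<dots> = q" using qp(1) by (simp only: diff_eq_eq)
  finally have "(1 - p * m) * m ^ k \<in> I" using qp(2) by simp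
  moreover have "1 - p * m \<notin> M"
  proof
    assume "1 - p * m \<in> M"
    then have "1 - p * m + p * m \<in> M"
      using ideal_KX_add[OF maximalideal.axioms(1)[OF M]] ideal_KX_mult[OF maximalideal.axioms(1)[OF M] m qp(3)]
      by blast
    then show False using maximal_one_notin[OF M] by simp
  qed
  moreover have "1 - p * m \<in> KXC n" by (intro KXC_diff KXC_one KXC_mult qp mC)
  ultimately have "m ^ k \<in> component M" using componentI[OF KXC_power[OF mC]] by blast
  then show ?thesis ..
qed

lemma radical_component: "radical (KX n) (component M) = M"
proof
  show "radical (KX n) (component M) \<subseteq> M"
  proof
    fix x assume "x \<in> radical (KX n) (component M)"
    then obtain k where "x \<in> KXC n" "x ^ k \<in> component M" by (auto simp: mem_radical)
    then show "x \<in> M" using maximal_power[OF M, of x k] component_subset by blast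
  qed
  show "M \<subseteq> radical (KX n) (component M)"
    using power_in_component ideal_KX_subset[OF maximalideal.axioms(1)[OF M]] by (auto simp: mem_radical)
qed

lemma primary_component: "primary_ideal (component M) (KX n)"
  unfolding primary_ideal_def
proof (intro conjI ballI impI)
  show "component M \<noteq> KXC n"
    using component_subset maximal_one_notin[OF M] KXC_one by blast
  fix a b assume ab: "a \<in> KXC n" "b \<in> KXC n" "a \<otimes>\<^bsub>KX n\<^esub> b \<in> component M"
  then obtain s where s: "s \<in> KXC n" "s \<notin> M" "s * (a * b) \<in> I" by (auto simp: component_def)
  show "a \<in> component M \<or> b \<in> radical (KX n) (component M)"
  proof (cases "b \<in> M")
    case False
    then have "s * b \<notin> M" using maximal_prime[OF M s(1) ab(2)] s by blast
    moreover have "(s * b) * a \<in> I" using s(3) by (simp only: mult_ac)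
    ultimately show ?thesis using componentI[OF ab(1) KXC_mult[OF s(1) ab(2)]] by blast
  qed (simp add: radical_component)
qed (rule ideal_component)

end

definition maximals :: "(nat, 'a) mpoly set set" where
  "maximals = {M. maximalideal M (KX n) \<and> I \<subseteq> M}"

text \<open>
  Choose finitely many of the maximal ideals such that their intersection has least dimension. Every
  other one contains this intersection, hence contains one of the chosen ones and is equal to it.
\<close>

lemma finite_maximals: "finite maximals"
proof -
  let ?P = "\<lambda>\<M>. finite \<M> \<and> \<M> \<subseteq> maximals"
  let ?D = "\<lambda>\<M>. KXC n \<inter> \<Inter>\<M>"
  have iM: "ideal M (KX n)" if "M \<in> maximals" for M
    using that maximalideal.axioms(1) by (auto simp: maximals_def)
  have iD: "ideal (?D \<M>) (KX n)" if "\<M> \<subseteq> maximals" for \<M>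
    unfolding ideal_poly_ring_iff
  proof (intro conjI ballI)
    have i: "ideal M (KX n)" if "M \<in> \<M>" for M using iM that \<open>\<M> \<subseteq> maximals\<close> by blast
    show "0 \<in> ?D \<M>" using KXC_zero ideal_KX_zero[OF i] by blast
    show "a + b \<in> ?D \<M>" if "a \<in> ?D \<M>" "b \<in> ?D \<M>" for a b
      using that KXC_add[of a n b] ideal_KX_add[OF i, of _ a b] by blast
    show "p * a \<in> ?D \<M>" if "a \<in> ?D \<M>" "p \<in> KXC n" for a p
      using that KXC_mult[of p n a] ideal_KX_mult[OF i, of _ a p] by blast
  qed blast
  define \<M> where "\<M> = (ARG_MIN (\<lambda>\<M>. mp.dim (f ` ?D \<M>)) \<M>. ?P \<M>)"
  have P: "?P \<M>"
    using arg_min_natI[of ?P "{}" "\<lambda>\<M>. mp.dim (f ` ?D \<M>)"] unfolding \<M>_def by blast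
  have le: "mp.dim (f ` ?D \<M>) \<le> mp.dim (f ` ?D \<N>)" if "?P \<N>" for \<N>
    unfolding \<M>_def by (rule arg_min_nat_le[of ?P]) (rule that)
  have "maximals \<subseteq> \<M>"
  proof
    fix M assume M: "M \<in> maximals"
    then have mM: "maximalideal M (KX n)" by (simp add: maximals_def)
    have "?P (insert M \<M>)" using M P by simp
    note P' = this
    have "?D (insert M \<M>) = ?D \<M>"
    proof (rule ideal_eq_of_dim_le[OF iD iD _ _ le[OF P']])
      show "insert M \<M> \<subseteq> maximals" "\<M> \<subseteq> maximals" using P P' by simp_all
      show "I \<subseteq> ?D (insert M \<M>)"
        using ideal_KX_subset[OF I] P' by (auto simp: maximals_def)
    qed blast
    then have DM: "?D \<M> \<subseteq> M" by blast
    have "\<exists>B\<in>\<M>. B \<subseteq> M"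
    proof (rule ccontr)
      assume "\<not> (\<exists>B\<in>\<M>. B \<subseteq> M)"
      then have "\<exists>e\<in>KXC n. e \<notin> M \<and> (\<forall>B\<in>\<M>. e \<in> B)"
        using P iM by (intro prime_avoids_intersection[OF mM]) auto
      then show False using DM by blast
    qed
    then obtain B where B: "B \<in> \<M>" "B \<subseteq> M" by blast
    then have "maximalideal B (KX n)" using P by (auto simp: maximals_def)
    then have "M = B"
      using maximalideal.I_maximal[OF _ iM[OF M] B(2)] ideal_KX_subset[OF iM[OF M]]
        maximal_one_notin[OF mM] KXC_one by blast
    with B show "M \<in> \<M>" by simp
  qed
  with P show ?thesis using finite_subset by blast
qed

text \<open>If \<open>p\<close> is in all components, the ideal of all \<open>s\<close> with \<open>s p \<in> I\<close> is contained in no maximal ideal.\<close>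

lemma primary_decomposition_components: "primary_decomposition n I (component ` maximals)"
  unfolding primary_decomposition_def
proof (intro conjI ballI)
  show "finite (component ` maximals)" using finite_maximals by simp
  show "primary_ideal Q (KX n)" if "Q \<in> component ` maximals" for Q
    using that primary_component by (auto simp: maximals_def)
  show "maximalideal (radical (KX n) Q) (KX n)" if "Q \<in> component ` maximals" for Q
    using that radical_component by (auto simp: maximals_def)
  show "inj_on (radical (KX n)) (component ` maximals)"
    using radical_component by (auto simp: maximals_def inj_on_def)
  show "I = KXC n \<inter> \<Inter>(component ` maximals)"
  proof
    show "I \<subseteq> KXC n \<inter> \<Inter>(component ` maximals)"
      using ideal_KX_subset[OF I] subset_component by (auto simp: maximals_def)
    show "KXC n \<inter> \<Inter>(component ` maximals) \<subseteq> I"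
    proof
      fix p assume p: "p \<in> KXC n \<inter> \<Inter>(component ` maximals)"
      let ?A = "{s \<in> KXC n. s * p \<in> I}"
      have iA: "ideal ?A (KX n)" using ideal_colon[OF I] p by blast
      have "1 \<in> ?A"
      proof (rule ccontr)
        assume "1 \<notin> ?A"
        moreover have "I \<subseteq> ?A"
          using ideal_KX_mult_right[OF I] p ideal_KX_subset[OF I] by blast
        ultimately obtain M where M: "maximalideal M (KX n)" "?A \<subseteq> M"
          using exists_maximal[OF iA] by blast
        with \<open>I \<subseteq> ?A\<close> p have "p \<in> component M" by (auto simp: maximals_def)
        with M show False by (auto simp: component_def)
      qed
      then show "p \<in> I" by simp
    qed
  qed
qed

subsection \<open>The filtration\<close>

lemma filtration_mono: "i \<le> j \<Longrightarrow> filtration n I i \<subseteq> filtration n I j"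
  by (force simp: filtration_def)

text \<open>The step below the regularity index may have index \<open>-1\<close>, where the filtration is zero.\<close>

lemma filtration_neg: "i < 0 \<Longrightarrow> filtration n I i = {I}"
proof -
  assume i: "i < 0"
  have "\<not> int (mdeg m) \<le> i" for m :: "nat monom" using i by simp
  then have "{p \<in> KXC n. \<forall>m\<in>keys p. int (mdeg m) \<le> i} = {0 :: (nat, 'a) mpoly}"
    using KXC_zero[of n] by auto
  then show ?thesis
    by (simp add: filtration_def residue_image)
qed

lemma residue_eq_of_image: "p \<in> KXC n \<Longrightarrow> q \<in> KXC n \<Longrightarrow> f p = f q \<Longrightarrow> residue n I p = residue n I q"
  using ker[of "p - q"] KXC_diff[of p n q] by (simp add: residue_eq_iff[OF I] mlinear_diff[OF f])

lemma exists_filtration_full: "\<exists>d. filtration n I (int d) = carrier (coord_ring n I)"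
proof -
  obtain B where B: "B \<subseteq> f ` KXC n" "mp.independent B" "f ` KXC n \<subseteq> mp.span B"
    using mp.basis_exists by metis
  have finB: "finite B"
    using mp.independent_span_bound[OF T(1) B(2)] B(1) T(2) by blast
  then obtain P where P: "P \<subseteq> KXC n" "finite P" "B = f ` P"
    using B(1) by (metis finite_subset_image)
  define d where "d = Max (insert 0 (mdeg ` (\<Union>p\<in>P. keys p)))"
  have deg: "mdeg m \<le> d" if "p \<in> P" "m \<in> keys p" for p m
    unfolding d_def by (rule Max_ge) (use P that in auto)
  let ?W = "{p :: (nat, 'a) mpoly. keys p \<subseteq> {m. keys m \<subseteq> {..<n} \<and> mdeg m \<le> d}}"
  have W: "p \<in> ?W \<longleftrightarrow> p \<in> KXC n \<and> (\<forall>m\<in>keys p. int (mdeg m) \<le> int d)" for p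
    by (auto simp: carrier_poly_ring)
  have "mp.span P \<subseteq> ?W"
    by (rule mp.span_minimal[OF _ subspace_keys]) (use P(1) deg in \<open>auto simp: carrier_poly_ring\<close>)
  have "residue n I p \<in> filtration n I (int d)" if p: "p \<in> KXC n" for p
  proof -
    have "f p \<in> f ` mp.span P"
      using B(3) p P(3) by (auto simp: mlinear_span_image[OF f])
    then obtain q where q: "q \<in> mp.span P" "f p = f q" by blast
    with \<open>mp.span P \<subseteq> ?W\<close> have "q \<in> ?W" by blast
    then have q': "q \<in> KXC n" "\<forall>m\<in>keys q. int (mdeg m) \<le> int d" using W by blast+
    have "residue n I p = residue n I q" by (rule residue_eq_of_image[OF p q'(1) q(2)])
    then show ?thesis using q' by (auto simp: filtration_def)
  qed
  then have "filtration n I (int d) = carrier (coord_ring n I)"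
    by (auto simp: carrier_coord_ring[OF I] filtration_def)
  then show ?thesis ..
qed

lemma filtration_full: "ri n I \<le> j \<Longrightarrow> filtration n I j = carrier (coord_ring n I)"
proof -
  let ?P = "\<lambda>i. \<forall>j\<ge>i. filtration n I j = carrier (coord_ring n I)"
  have sub: "filtration n I i \<subseteq> carrier (coord_ring n I)" for i
    by (auto simp: carrier_coord_ring[OF I] filtration_def)
  obtain d where d: "filtration n I (int d) = carrier (coord_ring n I)"
    using exists_filtration_full by blast
  have P0: "?P (int d)"
    using d sub filtration_mono by (intro allI impI equalityI) blast+
  have pos: "0 \<le> i" if P: "?P i" for i
  proof (rule ccontr)
    assume "\<not> 0 \<le> i"
    then have "{I} = carrier (coord_ring n I)" using P filtration_neg[of i] by auto
    then have "residue n I 1 = I" using carrier_coord_ring[OF I] KXC_one[of n] by blast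
    then show False using residue_eq_zero_iff[OF I] one_notin by simp
  qed
  have "?P (ri n I)"
    unfolding ri_def by (rule Least_int[of ?P, OF P0 pos])
  then show "ri n I \<le> j \<Longrightarrow> filtration n I j = carrier (coord_ring n I)" by blast
qed

lemma ord_filtration:
  assumes z: "z \<in> carrier (coord_ring n I)" "z \<noteq> I"
  shows mem_ord_filtration: "z \<in> filtration n I (ord_filtration n I z)"
    and ord_filtration_nonneg: "0 \<le> ord_filtration n I z"
    and ord_filtration_le: "z \<in> filtration n I i \<Longrightarrow> ord_filtration n I z \<le> i"
proof -
  have P0: "z \<in> filtration n I (ri n I)" using filtration_full[of "ri n I"] z by simp
  have pos: "0 \<le> i" if "z \<in> filtration n I i" for i
  proof (rule ccontr)
    assume "\<not> 0 \<le> i"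
    with that z filtration_neg[of i] show False by simp
  qed
  show m: "z \<in> filtration n I (ord_filtration n I z)"
    unfolding ord_filtration_def by (rule Least_int[of "\<lambda>i. z \<in> filtration n I i", OF P0 pos])
  show "0 \<le> ord_filtration n I z" by (rule pos[OF m])
  show "z \<in> filtration n I i \<Longrightarrow> ord_filtration n I z \<le> i"
    unfolding ord_filtration_def by (rule Least_int_le[of "\<lambda>i. z \<in> filtration n I i", OF P0 pos])
qed

lemma ord_filtration_image:
  assumes "Z \<subseteq> carrier (coord_ring n I)"
  shows "ord_filtration n I ` (Z - {I}) \<subseteq> {0..ri n I}"
proof
  fix r assume "r \<in> ord_filtration n I ` (Z - {I})"
  then obtain z where "z \<in> Z - {I}" and r: "r = ord_filtration n I z" by (elim imageE)
  then have z: "z \<in> carrier (coord_ring n I)" "z \<noteq> I" using assms by blast+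
  then show "r \<in> {0..ri n I}"
    using ord_filtration_nonneg[OF z] ord_filtration_le[OF z, of "ri n I"] filtration_full[of "ri n I"] r
    by simp
qed

lemma finite_ord_image:
  "Z \<subseteq> carrier (coord_ring n I) \<Longrightarrow> finite (ord_filtration n I ` (Z - {I}))"
  by (rule finite_subset[OF ord_filtration_image]) simp_all

lemma ri_divisor_le:
  assumes J: "J \<subseteq> KXC n" "\<not> J \<subseteq> I" and sub: "residue n I ` J \<subseteq> filtration n I i"
  shows "ri_divisor n I J \<le> i"
proof -
  let ?Z = "residue n I ` J"
  have Z: "?Z \<subseteq> carrier (coord_ring n I)" using J by (auto simp: carrier_coord_ring[OF I])
  obtain g where "g \<in> J" "g \<notin> I" using J by blast
  then have "residue n I g \<in> ?Z - {I}" using residue_eq_zero_iff[OF I] by blast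
  then have ne: "ord_filtration n I ` (?Z - {I}) \<noteq> {}" by blast
  have "Max (ord_filtration n I ` (?Z - {I})) \<le> i"
  proof (rule Max.boundedI[OF finite_ord_image[OF Z] ne])
    fix r assume "r \<in> ord_filtration n I ` (?Z - {I})"
    then obtain z where z: "z \<in> ?Z" "z \<noteq> I" "r = ord_filtration n I z" by blast
    with Z sub show "r \<le> i" using ord_filtration_le[of z i] by blast
  qed
  then show ?thesis by (simp add: ri_divisor_def coord_ring_zero[OF I])
qed

lemma ri_divisor_eq:
  assumes J: "J \<subseteq> KXC n" and g: "g \<in> J" "residue n I g \<notin> filtration n I (ri n I - 1)"
  shows "ri_divisor n I J = ri n I"
proof -
  let ?Z = "residue n I ` J"
  have Z: "?Z \<subseteq> carrier (coord_ring n I)" using J by (auto simp: carrier_coord_ring[OF I])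
  have gz: "residue n I g \<noteq> I"
  proof
    assume "residue n I g = I"
    moreover have "I \<in> filtration n I (ri n I - 1)"
      unfolding filtration_def using KXC_zero[of n] by (intro image_eqI[of _ _ 0]) (auto simp: residue_image)
    ultimately show False using g by simp
  qed
  have gc: "residue n I g \<in> carrier (coord_ring n I)" using g Z by blast
  have "\<not> ord_filtration n I (residue n I g) \<le> ri n I - 1"
    using filtration_mono mem_ord_filtration[OF gc gz] g(2) by blast
  moreover have le: "ord_filtration n I z \<le> ri n I" if "z \<in> ?Z - {I}" for z
    using that Z ord_filtration_le[of z "ri n I"] filtration_full[of "ri n I"] by auto
  moreover have gm: "residue n I g \<in> ?Z - {I}" using g gz by blast
  ultimately have eq: "ord_filtration n I (residue n I g) = ri n I" using le[OF gm] by linarith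
  have "Max (ord_filtration n I ` (?Z - {I})) = ri n I"
  proof (rule Max_eqI[OF finite_ord_image[OF Z]])
    show "r \<le> ri n I" if "r \<in> ord_filtration n I ` (?Z - {I})" for r
      using ord_filtration_image[OF Z] that by fastforce
    show "ri n I \<in> ord_filtration n I ` (?Z - {I})"
      using imageI[OF gm, of "ord_filtration n I"] unfolding eq .
  qed
  then show ?thesis by (simp add: ri_divisor_def coord_ring_zero[OF I])
qed

text \<open>
  Suppose that the ideal generated by some \<open>g \<notin> I\<close> lies in the filtration step below the regularity
  index modulo \<open>I\<close>. It contains a minimal ideal \<open>J\<close> over \<open>I\<close>. The nilpotence argument shows that \<open>J\<close> is
  killed modulo \<open>I\<close> by the radical of every primary component which does not contain it; since
  distinct radicals are comaximal, there is exactly one such component \<open>Q\<close>. Hence \<open>J\<close> is the minimal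
  divisor obtained by replacing \<open>Q\<close> with \<open>Q + J\<close>, and its value is less than the regularity index.

  Conversely, every minimal divisor contains an element \<open>g \<notin> I\<close>. If no such \<open>g\<close> generates an ideal
  inside that filtration step, all minimal divisors have the regularity index as their value, and
  for each component there is one because the coordinate ring is finite-dimensional.
\<close>

lemma cayley_bacharach_iff:
  "cayley_bacharach n I \<longleftrightarrow>
     \<not> (\<exists>g\<in>KXC n. g \<notin> I \<and> (\<forall>p\<in>KXC n. residue n I (p * g) \<in> filtration n I (ri n I - 1)))"
    (is "_ \<longleftrightarrow> \<not> ?bad")
proof
  assume "cayley_bacharach n I"
  then obtain QS where QS: "primary_decomposition n I QS"
    and sep: "\<And>Q. Q \<in> QS \<Longrightarrow> sepdeg n I QS Q = ri n I"
    by (auto simp: cayley_bacharach_def)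
  have prim: "primary_ideal Q (KX n)" "ideal Q (KX n)" "maximalideal (radical (KX n) Q) (KX n)"
    if "Q \<in> QS" for Q
    using QS that by (auto simp: primary_decomposition_def primary_ideal_def)
  have inj: "inj_on (radical (KX n)) QS" and I_eq: "I = KXC n \<inter> \<Inter>QS"
    using QS by (auto simp: primary_decomposition_def)
  show "\<not> ?bad"
  proof
    assume ?bad
    then obtain g where g: "g \<in> KXC n" "g \<notin> I"
      and small: "\<And>p. p \<in> KXC n \<Longrightarrow> residue n I (p * g) \<in> filtration n I (ri n I - 1)" by blast
    let ?B = "{q + p * g |q p. q \<in> I \<and> p \<in> KXC n}"
    have iB: "ideal ?B (KX n)" by (rule ideal_principal_sum[OF I g(1)])
    have "I \<subseteq> ?B" using KXC_zero[of n] by force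
    moreover have "g \<in> ?B" using ideal_KX_zero[OF I] KXC_one[of n] by force
    ultimately have "I \<subset> ?B" using g by blast
    then obtain J where J: "minimal_over n I J" "J \<subseteq> ?B"
      using exists_minimal_over[OF subset_refl I iB] by blast
    have iJ: "ideal J (KX n)" and IJ: "I \<subset> J"
      and J_min: "\<And>J'. ideal J' (KX n) \<Longrightarrow> I \<subset> J' \<Longrightarrow> J' \<subseteq> J \<Longrightarrow> J' = J"
      using J(1) by (auto simp: minimal_over_def)
    have JC: "J \<subseteq> KXC n" by (rule ideal_KX_subset[OF iJ])
    obtain Q where Q: "Q \<in> QS" "\<not> J \<subseteq> Q" using IJ JC I_eq by blast
    note iQ = prim(2)[OF Q(1)]
    have IQ: "I \<subseteq> Q'" if "Q' \<in> QS" for Q' using I_eq that by blast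
    have JQ: "J \<inter> Q' = I" if Q': "Q' \<in> QS" "\<not> J \<subseteq> Q'" for Q'
    proof (rule ccontr)
      assume "J \<inter> Q' \<noteq> I"
      moreover have "ideal (J \<inter> Q') (KX n)"
        by (rule ring.i_intersect[OF cring.axioms(1)[OF cring_poly_ring] iJ prim(2)[OF Q'(1)]])
      ultimately have "J \<inter> Q' = J" using J_min[of "J \<inter> Q'"] IQ[OF Q'(1)] IJ by blast
      with Q' show False by blast
    qed
    have kill: "m * j \<in> I" if Q': "Q' \<in> QS" "\<not> J \<subseteq> Q'" and m: "m \<in> radical (KX n) Q'" and j: "j \<in> J"
      for Q' m j
    proof -
      obtain k where k: "m \<in> KXC n" "m ^ k \<in> Q'" using m by (auto simp: mem_radical)
      have "m ^ k * j \<in> J" by (rule ideal_KX_mult[OF iJ j KXC_power[OF k(1)]])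
      moreover have "m ^ k * j \<in> Q'" using ideal_KX_mult_right[OF prim(2)[OF Q'(1)] k(2)] j JC by blast
      ultimately have "m ^ k * j \<in> I" using JQ[OF Q'] by blast
      then show ?thesis by (rule minimal_over_nilpotent[OF I J(1) j k(1)])
    qed
    let ?M = "radical (KX n) Q"
    note mM = prim(3)[OF Q(1)]
    have iM: "ideal ?M (KX n)" using mM by (rule maximalideal.axioms)
    \<comment> \<open>Otherwise \<open>J\<close> would be killed by two comaximal ideals.\<close>
    have J_sub: "J \<subseteq> Q'" if Q': "Q' \<in> QS" "Q' \<noteq> Q" for Q'
    proof (rule ccontr)
      assume nJ: "\<not> J \<subseteq> Q'"
      let ?N = "radical (KX n) Q'"
      note mN = prim(3)[OF Q'(1)]
      have "?N \<noteq> ?M" using inj Q' Q by (auto dest: inj_onD)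
      then have "\<not> ?N \<subseteq> ?M"
        using maximalideal.I_maximal[OF mN iM _ ideal_KX_subset[OF iM]] maximal_one_notin[OF mM] KXC_one[of n]
        by metis
      then obtain y where y: "y \<in> ?N" "y \<notin> ?M" by blast
      have yC: "y \<in> KXC n" using y by (simp add: mem_radical)
      have "ideal {q + p * y |q p. q \<in> ?M \<and> p \<in> KXC n} (KX n)"
        by (rule ideal_principal_sum[OF iM yC])
      moreover have "?M \<subseteq> {q + p * y |q p. q \<in> ?M \<and> p \<in> KXC n}" using KXC_zero[of n] by force
      moreover have "y \<in> {q + p * y |q p. q \<in> ?M \<and> p \<in> KXC n}"
        using ideal_KX_zero[OF iM] KXC_one[of n] by force
      ultimately have "{q + p * y |q p. q \<in> ?M \<and> p \<in> KXC n} = KXC n"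
        using maximalideal.I_maximal[OF mM _ _ ideal_KX_subset] y by blast
      then obtain q p where qp: "1 = q + p * y" "q \<in> ?M" "p \<in> KXC n" using KXC_one[of n] by blast
      have "J \<subseteq> I"
      proof
        fix j assume j: "j \<in> J"
        have "j = (q + p * y) * j" using qp(1) by simp
        also have "\<dots> = q * j + p * (y * j)" by (simp add: algebra_simps)
        also have "\<dots> \<in> I"
          by (intro ideal_KX_add[OF I] ideal_KX_mult[OF I] kill[OF Q qp(2) j] kill[OF Q'(1) nJ y(1) j] qp(3))
        finally show "j \<in> I" .
      qed
      with IJ show False by blast
    qed
    obtain j0 where j0: "j0 \<in> J" "j0 \<notin> Q" using Q by blast
    have j0C: "j0 \<in> KXC n" using j0 JC by blast
    \<comment> \<open>This is \<open>Q + J\<close>, since \<open>j0\<close> generates \<open>J\<close> over \<open>I\<close>.\<close>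
    define Q' where "Q' = {q + p * j0 |q p. q \<in> Q \<and> p \<in> KXC n}"
    have iQ': "ideal Q' (KX n)" unfolding Q'_def by (rule ideal_principal_sum[OF iQ j0C])
    have QQ': "Q \<subseteq> Q'" unfolding Q'_def using KXC_zero[of n] by force
    have j0Q': "j0 \<in> Q'" unfolding Q'_def using ideal_KX_zero[OF iQ] KXC_one[of n] by force
    have minQ': "minimal_over n Q Q'"
      unfolding minimal_over_def
    proof (intro conjI allI impI iQ')
      show "Q \<subset> Q'" using QQ' j0Q' j0 by blast
      fix J' assume J': "ideal J' (KX n)" "Q \<subset> J'" "J' \<subseteq> Q'"
      have "ideal (J \<inter> J') (KX n)"
        by (rule ring.i_intersect[OF cring.axioms(1)[OF cring_poly_ring] iJ J'(1)])
      moreover have "I \<subset> J \<inter> J'"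
      proof -
        obtain x where x: "x \<in> J'" "x \<notin> Q" using J' by blast
        have "x \<in> Q'" using x J' by blast
        then obtain q p where qp: "x = q + p * j0" "q \<in> Q" "p \<in> KXC n" unfolding Q'_def by blast
        have "p * j0 = x - q" using qp by simp
        then have "p * j0 \<in> J'" using ideal_KX_diff[OF J'(1) x(1)] qp(2) J'(2) by auto
        moreover have "p * j0 \<in> J" by (rule ideal_KX_mult[OF iJ j0(1) qp(3)])
        moreover have "p * j0 \<notin> I" using x qp ideal_KX_add[OF iQ] IQ[OF Q(1)] by blast
        ultimately show ?thesis using IJ IQ[OF Q(1)] J' by blast
      qed
      ultimately have "J \<inter> J' = J" using J_min by blast
      then have "j0 \<in> J'" using j0 by blast
      then have "Q' \<subseteq> J'"
        unfolding Q'_def using ideal_KX_add[OF J'(1)] ideal_KX_mult[OF J'(1)] J'(2) by blast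
      with J' show "J' = Q'" by blast
    qed
    have kill': "m * h \<in> Q" if m: "m \<in> ?M" and h: "h \<in> Q'" for m h
    proof -
      obtain q p where qp: "h = q + p * j0" "q \<in> Q" "p \<in> KXC n" using h by (auto simp: Q'_def)
      have mC: "m \<in> KXC n" using m by (simp add: mem_radical)
      have "m * h = m * q + p * (m * j0)" by (simp add: qp(1) algebra_simps)
      moreover have "m * j0 \<in> Q" using kill[OF Q m j0(1)] IQ[OF Q(1)] by blast
      ultimately show ?thesis
        using ideal_KX_add[OF iQ ideal_KX_mult[OF iQ qp(2) mC] ideal_KX_mult[OF iQ _ qp(3)]] by simp
    qed
    have QM: "Q \<subseteq> ?M"
    proof
      fix x assume "x \<in> Q"
      then have "x ^ 1 \<in> Q" "x \<in> KXC n" using ideal_KX_subset[OF iQ] by auto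
      then show "x \<in> ?M" by (auto simp: mem_radical intro: exI[of _ 1])
    qed
    have J_eq: "J = Q' \<inter> \<Inter>(QS - {Q})"
    proof
      show "J \<subseteq> Q' \<inter> \<Inter>(QS - {Q})"
      proof
        fix j assume j: "j \<in> J"
        have "j \<in> Q'"
        proof (cases "j \<in> I")
          case True
          then show ?thesis using IQ[OF Q(1)] QQ' by blast
        next
          case False
          have "j0 \<notin> I" using j0 IQ[OF Q(1)] by blast
          from minimal_over_principal[OF I J(1) j0(1) this] j
          obtain q p where "j = q + p * j0" "q \<in> I" "p \<in> KXC n" by blast
          then show ?thesis using IQ[OF Q(1)] by (auto simp: Q'_def)
        qed
        with j J_sub show "j \<in> Q' \<inter> \<Inter>(QS - {Q})" by blast
      qed
      show "Q' \<inter> \<Inter>(QS - {Q}) \<subseteq> J"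
      proof
        fix x assume x: "x \<in> Q' \<inter> \<Inter>(QS - {Q})"
        then obtain q p where qp: "x = q + p * j0" "q \<in> Q" "p \<in> KXC n" by (auto simp: Q'_def)
        have pj: "p * j0 \<in> J" by (rule ideal_KX_mult[OF iJ j0(1) qp(3)])
        have "q \<in> R" if R: "R \<in> QS" for R
        proof (cases "R = Q")
          case False
          then have "x \<in> R" "p * j0 \<in> R" using x R J_sub pj by blast+
          then have "x - p * j0 \<in> R" by (rule ideal_KX_diff[OF prim(2)[OF R]])
          then show ?thesis using qp(1) by simp
        qed (use qp in simp)
        then have "q \<in> I" using I_eq qp(2) ideal_KX_subset[OF iQ] by blast
        then show "x \<in> J" using qp(1) ideal_KX_add[OF iJ _ pj] IJ by blast
      qed
    qed
    have "minimal_divisor n QS Q J"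
    proof (cases "Q = ?M")
      case True
      have "Q' = KXC n"
        using maximalideal.I_maximal[OF mM iQ'] QQ' j0Q' j0 ideal_KX_subset[OF iQ'] True by blast
      moreover have "kdim n Q (residue n Q ` KXC n) = kdim n ?M (carrier (coord_ring n ?M))"
        using True carrier_coord_ring[OF iQ] by simp
      ultimately show ?thesis
        unfolding minimal_divisor_def Let_def using True iQ' J_eq by (intro exI[of _ Q']) simp
    next
      case False
      have "Q' \<subseteq> ?M"
      proof (rule ccontr)
        assume "\<not> Q' \<subseteq> ?M"
        then obtain h where h: "h \<in> Q'" "h \<notin> ?M" by blast
        have "?M \<subseteq> Q"
        proof
          fix m assume m: "m \<in> ?M"
          have "m \<in> Q \<or> h \<in> ?M"
            using prim(1)[OF Q(1)] kill'[OF m h(1)] m h(1) ideal_KX_subset[OF iQ']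
            by (auto simp: primary_ideal_def mem_radical)
          with h show "m \<in> Q" by blast
        qed
        with QM False show False by blast
      qed
      moreover have "Q \<subset> Q'" using QQ' j0Q' j0 by blast
      moreover have "kdim n Q (residue n Q ` Q') = kdim n ?M (carrier (coord_ring n ?M))"
        by (rule kdim_minimal_over[OF iQ minQ' mM kill'])
      ultimately show ?thesis
        unfolding minimal_divisor_def Let_def using False iQ' J_eq by (intro exI[of _ Q']) simp
    qed
    have le: "ri_divisor n I J \<le> ri n I - 1"
    proof (rule ri_divisor_le[OF JC])
      show "\<not> J \<subseteq> I" using IJ by blast
      show "residue n I ` J \<subseteq> filtration n I (ri n I - 1)"
      proof
        fix z assume "z \<in> residue n I ` J"
        then obtain q p where "z = residue n I (q + p * g)" "q \<in> I" "p \<in> KXC n" using J(2) by blast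
        then have "z = residue n I (p * g)" "p \<in> KXC n" by (simp_all add: residue_eq_iff[OF I])
        then show "z \<in> filtration n I (ri n I - 1)" using small by simp
      qed
    qed
    let ?R = "{ri_divisor n I J |J. minimal_divisor n QS Q J}"
    \<comment> \<open>For \<open>Min_le\<close> only finiteness matters; the unspecified value \<open>Max {}\<close> would belong to a
      minimal divisor equal to \<open>I\<close>.\<close>
    have "?R \<subseteq> {0..ri n I} \<union> {Max {}}"
    proof
      fix r assume "r \<in> ?R"
      then obtain J' where J': "r = ri_divisor n I J'" "minimal_divisor n QS Q J'" by blast
      then have J'C: "J' \<subseteq> KXC n"
        using ideal_KX_subset by (auto simp: minimal_divisor_def)
      let ?Z = "residue n I ` J'"
      have Z: "?Z \<subseteq> carrier (coord_ring n I)" using J'C by (auto simp: carrier_coord_ring[OF I])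
      note sub = ord_filtration_image[OF Z]
      have r: "r = Max (ord_filtration n I ` (?Z - {I}))"
        using J'(1) by (simp add: ri_divisor_def coord_ring_zero[OF I])
      show "r \<in> {0..ri n I} \<union> {Max {}}"
      proof (cases "ord_filtration n I ` (?Z - {I}) = {}")
        case True
        then show ?thesis unfolding r by (simp only:) simp
      next
        case False
        from Max_in[OF finite_ord_image[OF Z] False] sub r show ?thesis by blast
      qed
    qed
    then have "finite ?R" by (rule finite_subset) simp
    then have "sepdeg n I QS Q \<le> ri_divisor n I J"
      unfolding sepdeg_def using \<open>minimal_divisor n QS Q J\<close> by (intro Min_le) auto
    with le sep[OF Q(1)] show False by simp
  qed
next
  assume good: "\<not> ?bad"
  define QS where "QS = component ` maximals"
  have QS: "primary_decomposition n I QS"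
    unfolding QS_def by (rule primary_decomposition_components)
  have "sepdeg n I QS Q = ri n I" if "Q \<in> QS" for Q
  proof -
    obtain M where M: "maximalideal M (KX n)" "I \<subseteq> M" "Q = component M"
      using \<open>Q \<in> QS\<close> by (auto simp: QS_def maximals_def)
    have rad: "radical (KX n) Q = M" using radical_component[OF M(1,2)] M(3) by simp
    have iQ: "ideal Q (KX n)" and IQ: "I \<subseteq> Q" and QM: "Q \<subseteq> M" and prim: "primary_ideal Q (KX n)"
      using ideal_component[OF M(1,2)] subset_component[OF M(1,2)] component_subset[OF M(1,2)]
        primary_component[OF M(1,2)] M(3) by simp_all
    have iM: "ideal M (KX n)" using M(1) by (rule maximalideal.axioms)
    have value_eq: "ri_divisor n I J = ri n I" if "minimal_divisor n QS Q J" for J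
    proof -
      obtain Q' where Q': "ideal Q' (KX n)" "J = Q' \<inter> \<Inter>(QS - {Q})"
        "if Q = M then Q' = KXC n else Q \<subset> Q' \<and> Q' \<subseteq> M"
        using \<open>minimal_divisor n QS Q J\<close> unfolding minimal_divisor_def Let_def rad by blast
      have "\<not> Q' \<subseteq> Q"
        using Q'(3) maximal_one_notin[OF M(1)] KXC_one[of n] by (auto split: if_splits)
      then obtain h where h: "h \<in> Q'" "h \<notin> Q" by blast
      have hC: "h \<in> KXC n" using h ideal_KX_subset[OF Q'(1)] by blast
      \<comment> \<open>Multiplication by such an \<open>e\<close> moves \<open>h\<close> into all components other than \<open>Q\<close>, but not into the
        primary ideal \<open>Q\<close>.\<close>
      have "\<exists>e\<in>KXC n. e \<notin> M \<and> (\<forall>B\<in>QS - {Q}. e \<in> B)"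
      proof (rule prime_avoids_intersection[OF M(1)])
        show "finite (QS - {Q})" using finite_maximals by (simp add: QS_def)
        fix B assume "B \<in> QS - {Q}"
        then obtain N where N: "maximalideal N (KX n)" "I \<subseteq> N" "B = component N" "B \<noteq> Q"
          by (auto simp: QS_def maximals_def)
        have "\<not> B \<subseteq> M"
        proof
          assume BM: "B \<subseteq> M"
          have "N \<subseteq> M"
          proof
            fix x assume "x \<in> N"
            then have "x \<in> radical (KX n) B" using radical_component[OF N(1,2)] N(3) by simp
            then obtain k where "x \<in> KXC n" "x ^ k \<in> B" by (auto simp: mem_radical)
            then show "x \<in> M" using maximal_power[OF M(1), of x k] BM by blast
          qed
          then have "N = M"
            using maximalideal.I_maximal[OF N(1) iM _ ideal_KX_subset[OF iM]] maximal_one_notin[OF M(1)]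
              KXC_one[of n] by metis
          then show False using N M by simp
        qed
        then show "ideal B (KX n) \<and> \<not> B \<subseteq> M" using ideal_component[OF N(1,2)] N(3) by simp
      qed
      then obtain e where e: "e \<in> KXC n" "e \<notin> M" "\<And>B. B \<in> QS - {Q} \<Longrightarrow> e \<in> B" by blast
      have iB: "ideal B (KX n)" if "B \<in> QS" for B
        using QS that by (auto simp: primary_decomposition_def primary_ideal_def)
      have g: "h * e \<in> Q'" "\<And>B. B \<in> QS - {Q} \<Longrightarrow> h * e \<in> B"
        using ideal_KX_mult_right[OF Q'(1) h(1) e(1)] ideal_KX_mult[OF iB e(3) hC] by auto
      then have gJ: "h * e \<in> J" using Q'(2) by blast
      have JC: "J \<subseteq> KXC n" using Q' ideal_KX_subset[OF Q'(1)] by blast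
      have "h * e \<notin> Q"
        using prim hC e h rad by (auto simp: primary_ideal_def)
      then have "h * e \<notin> I" using IQ by blast
      moreover have heC: "h * e \<in> KXC n" using gJ JC by blast
      ultimately obtain p where p: "p \<in> KXC n"
        "residue n I (p * (h * e)) \<notin> filtration n I (ri n I - 1)"
        using good by blast
      have "p * (h * e) \<in> Q'" "\<And>B. B \<in> QS - {Q} \<Longrightarrow> p * (h * e) \<in> B"
        using ideal_KX_mult[OF Q'(1) g(1) p(1)] ideal_KX_mult[OF iB g(2) p(1)] by auto
      then have "p * (h * e) \<in> J" using Q'(2) by blast
      then show ?thesis using ri_divisor_eq[OF JC _ p(2)] by blast
    qed
    have "\<exists>J. minimal_divisor n QS Q J"
    proof (cases "Q = M")
      case True
      then show ?thesis
        unfolding minimal_divisor_def Let_def rad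
        using ideal_KXC[of n] carrier_coord_ring[OF iM] by (intro exI[of _ "KXC n \<inter> \<Inter>(QS - {Q})"] exI[of _ "KXC n"]) simp
    next
      case False
      with QM have "Q \<subset> M" by blast
      then obtain Q' where Q': "minimal_over n Q Q'" "Q' \<subseteq> M"
        using exists_minimal_over[OF IQ iQ iM] by blast
      have kill: "m * h \<in> Q" if m: "m \<in> M" and h: "h \<in> Q'" for m h
      proof -
        have "m \<in> radical (KX n) Q" using m rad by simp
        then obtain k where k: "m \<in> KXC n" "m ^ k \<in> Q" by (auto simp: mem_radical)
        have "h \<in> KXC n" using h Q'(2) ideal_KX_subset[OF iM] by blast
        then have "m ^ k * h \<in> Q" by (rule ideal_KX_mult_right[OF iQ k(2)])
        then show ?thesis by (rule minimal_over_nilpotent[OF iQ Q'(1) h k(1)])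
      qed
      have "kdim n Q (residue n Q ` Q') = kdim n M (carrier (coord_ring n M))"
        by (rule kdim_minimal_over[OF iQ Q'(1) M(1) kill])
      then show ?thesis
        unfolding minimal_divisor_def Let_def rad
        using Q' False by (intro exI[of _ "Q' \<inter> \<Inter>(QS - {Q})"] exI[of _ Q']) (simp add: minimal_over_def)
    qed
    then obtain J0 where J0: "minimal_divisor n QS Q J0" ..
    have "{ri_divisor n I J |J. minimal_divisor n QS Q J} = {ri n I}"
    proof (intro equalityI subsetI)
      fix r assume "r \<in> {ri n I}"
      then have "r = ri_divisor n I J0" using value_eq[OF J0] by simp
      with J0 show "r \<in> {ri_divisor n I J |J. minimal_divisor n QS Q J}" by blast
    qed (auto simp: value_eq)
    then show ?thesis by (simp add: sepdeg_def)
  qed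
  with QS show "cayley_bacharach n I" by (auto simp: cayley_bacharach_def)
qed

end

section \<open>Points of border basis schemes\<close>

lemma smul_single: "smul c (single m d) = single m (c * d)"
  by (simp add: smul_def const_def Poly_Mapping.mult_single)

subsection \<open>Terms\<close>

lemma mdeg_superset:
  assumes "finite S" "keys m \<subseteq> S"
  shows "mdeg m = (\<Sum>v\<in>S. lookup m v)"
  unfolding mdeg_def by (rule sum.mono_neutral_left) (use assms in \<open>auto simp: in_keys_iff\<close>)

lemma mdeg_add: "mdeg (a + b) = mdeg a + mdeg b"
  using Poly_Mapping.keys_add[of a b]
  by (simp add: mdeg_superset[of "keys a \<union> keys b"] lookup_add sum.distrib)

lemma mdeg_zero [simp]: "mdeg 0 = 0"
  by (simp add: mdeg_def)

lemma mdeg_single [simp]: "mdeg (single v k) = k"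
  by (simp add: mdeg_def)

lemma mdeg_eq_zero_iff [simp]: "mdeg m = 0 \<longleftrightarrow> m = 0"
proof
  assume "mdeg m = 0"
  then have z: "\<forall>v\<in>keys m. lookup m v = 0" by (simp add: mdeg_def)
  show "m = 0"
  proof (rule poly_mapping_eqI)
    show "lookup m v = lookup 0 v" for v
      using z by (cases "v \<in> keys m") (auto simp: in_keys_iff)
  qed
qed simp

lemma term_split:
  assumes "r \<in> keys (t :: nat monom)"
  obtains s where "t = single r 1 + s" "keys s \<subseteq> keys t"
proof
  have "lookup t r \<ge> 1" using assms by (simp add: in_keys_iff Suc_le_eq)
  then show "t = single r 1 + (t - single r 1)"
    by (intro poly_mapping_eqI) (auto simp: lookup_add lookup_minus lookup_single when_def)
  show "keys (t - single r 1) \<subseteq> keys t"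
    by (auto simp: in_keys_iff lookup_minus)
qed

lemma zero_in_terms [simp]: "0 \<in> terms n"
  by (simp add: terms_def)

lemma add_in_terms: "s \<in> terms n \<Longrightarrow> t \<in> terms n \<Longrightarrow> s + t \<in> terms n"
  using Poly_Mapping.keys_add[of s t] by (auto simp: terms_def)

lemma single_in_terms [simp]: "r < n \<Longrightarrow> single r k \<in> terms n"
  by (simp add: terms_def)

lemma term_induct [consumes 1, case_names zero step]:
  assumes "t \<in> terms n" "P 0" "\<And>r s. r < n \<Longrightarrow> s \<in> terms n \<Longrightarrow> P s \<Longrightarrow> P (single r 1 + s)"
  shows "P t"
  using assms(1)
proof (induction "mdeg t" arbitrary: t)
  case 0
  then show ?case using assms(2) by simp
next
  case (Suc d)
  then have "t \<noteq> 0" by auto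
  then obtain r where r: "r \<in> keys t" by fastforce
  obtain s where s: "t = single r 1 + s" "keys s \<subseteq> keys t" by (rule term_split[OF r])
  have "r < n" "s \<in> terms n" using r s(2) Suc.prems by (auto simp: terms_def)
  moreover have "mdeg s = d" using Suc.hyps(2) by (simp add: s(1) mdeg_add)
  ultimately show ?case using Suc.hyps(1)[of s] assms(3) s(1) by simp
qed

lemma finite_terms_le: "finite {u \<in> terms n. mdeg u \<le> d}"
proof -
  have "(\<lambda>u. restrict (lookup u) {..<n}) ` {u \<in> terms n. mdeg u \<le> d} \<subseteq> {..<n} \<rightarrow>\<^sub>E {..d}"
  proof (rule image_subsetI)
    fix u assume u: "u \<in> {u \<in> terms n. mdeg u \<le> d}"
    have "lookup u v \<le> mdeg u" for v
      using member_le_sum[of v "keys u" "lookup u"] by (cases "v \<in> keys u") (auto simp: mdeg_def in_keys_iff)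
    then show "restrict (lookup u) {..<n} \<in> {..<n} \<rightarrow>\<^sub>E {..d}" using u by (auto intro: order.trans)
  qed
  then have "finite ((\<lambda>u. restrict (lookup u) {..<n}) ` {u \<in> terms n. mdeg u \<le> d})"
    by (rule finite_subset) (simp add: finite_PiE)
  moreover have "inj_on (\<lambda>u. restrict (lookup u) {..<n}) {u \<in> terms n. mdeg u \<le> d}"
  proof (rule inj_onI)
    fix u v assume uv: "u \<in> {u \<in> terms n. mdeg u \<le> d}" "v \<in> {u \<in> terms n. mdeg u \<le> d}"
      "restrict (lookup u) {..<n} = restrict (lookup v) {..<n}"
    show "u = v"
    proof (rule poly_mapping_eqI)
      fix k show "lookup u k = lookup v k"
      proof (cases "k < n")
        case True
        then show ?thesis using fun_cong[OF uv(3), of k] by simp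
      next
        case False
        then have "k \<notin> keys u" "k \<notin> keys v" using uv by (auto simp: terms_def)
        then show ?thesis by (simp add: in_keys_iff)
      qed
    qed
  qed
  ultimately show ?thesis by (rule finite_imageD)
qed

context zero_dim_ideal
begin

lemma filtration_eq_terms:
  "filtration n I (int d) = residue n I ` {p. keys p \<subseteq> {u \<in> terms n. mdeg u \<le> d}}"
  unfolding filtration_def by (rule arg_cong[of _ _ "image _"]) (auto simp: carrier_poly_ring terms_def)

lemma HFa_eq_dim_image: "HFa n I d = mp.dim (f ` (\<lambda>u. single u 1) ` {u \<in> terms n. mdeg u \<le> d})"
proof -
  let ?S = "{u \<in> terms n. mdeg u \<le> d}"
  let ?U = "{p :: (nat, 'a) mpoly. keys p \<subseteq> ?S}"
  have U: "?U \<subseteq> KXC n" by (auto simp: carrier_poly_ring terms_def)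
  have "HFa n I d = mp.dim (f ` ?U)"
    unfolding HFa_def filtration_eq_terms
    by (rule kdim_eq_dim[OF I f ker subspace_keys U T(1)]) (use T(2) U in auto)
  also have "f ` ?U = mp.span (f ` ((\<lambda>u. single u 1) ` ?S))"
    by (simp add: mlinear_span_image[OF f] span_terms)
  finally show ?thesis by simp
qed

end

subsection \<open>Evaluating terms at matrices\<close>

lemma foldr_mult_carrier:
  assumes "\<And>r. M r \<in> carrier_mat k k"
  shows "foldr (\<lambda>r A. M r * A) rs (1\<^sub>m k) \<in> carrier_mat k k"
  by (induction rs) (auto intro: mult_carrier_mat assms)

lemma eval_term_carrier:
  assumes "\<And>r. M r \<in> carrier_mat k k"
  shows "eval_term n k M t \<in> carrier_mat k k"
  unfolding eval_term_def by (rule foldr_mult_carrier) (simp add: assms)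

lemma eval_term_zero:
  assumes "\<And>r. M r \<in> carrier_mat k k"
  shows "eval_term n k M 0 = 1\<^sub>m k"
proof -
  have "foldr (\<lambda>r A. (M r ^\<^sub>m lookup 0 r) * A) rs (1\<^sub>m k) = 1\<^sub>m k" for rs :: "nat list"
    using carrier_matD(1)[OF assms] by (induction rs) simp_all
  then show ?thesis by (simp add: eval_term_def)
qed

text \<open>
  The factors of the product are ordered by their index, so the new factor has to be moved past the
  factors of smaller index.
\<close>

lemma eval_term_add_var:
  fixes M :: "nat \<Rightarrow> 'a::comm_ring_1 mat"
  assumes M: "\<And>r. M r \<in> carrier_mat k k" and comm: "\<And>r s. r < n \<Longrightarrow> s < n \<Longrightarrow> M r * M s = M s * M r"
    and r: "r < n"
  shows "eval_term n k M (single r 1 + t) = M r * eval_term n k M t"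
proof -
  let ?F = "\<lambda>t rs. foldr (\<lambda>r A. (M r ^\<^sub>m lookup t r) * A) rs (1\<^sub>m k)"
  have F: "?F t rs \<in> carrier_mat k k" for t rs
    by (rule foldr_mult_carrier) (simp add: M)
  have pow_comm: "M r * (M s ^\<^sub>m e) = (M s ^\<^sub>m e) * M r" if s: "s < n" for s e
  proof (induction e)
    case 0
    then show ?case using M[of r] M[of s] by simp
  next
    case (Suc e)
    have "M r * (M s ^\<^sub>m e * M s) = (M r * M s ^\<^sub>m e) * M s"
      using M by (intro assoc_mult_mat[symmetric, of _ k k _ k _ k]) auto
    also have "\<dots> = (M s ^\<^sub>m e * M r) * M s" by (simp only: Suc)
    also have "\<dots> = M s ^\<^sub>m e * (M r * M s)"
      using M by (intro assoc_mult_mat[of _ k k _ k _ k]) auto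
    also have "\<dots> = M s ^\<^sub>m e * (M s * M r)" by (simp only: comm[OF r s])
    also have "\<dots> = M s ^\<^sub>m e * M s * M r"
      using M by (intro assoc_mult_mat[symmetric, of _ k k _ k _ k]) auto
    finally show ?case by simp
  qed
  have notin: "?F (single r 1 + t) rs = ?F t rs" if "r \<notin> set rs" for rs
    using that by (induction rs) (auto simp: lookup_add lookup_single)
  have "?F (single r 1 + t) rs = M r * ?F t rs" if "distinct rs" "set rs \<subseteq> {..<n}" "r \<in> set rs" for rs
    using that
  proof (induction rs)
    case (Cons s rs)
    show ?case
    proof (cases "s = r")
      case True
      have "?F (single r 1 + t) (s # rs) = M r ^\<^sub>m Suc (lookup t r) * ?F t rs"
        using Cons True notin[of rs] by (simp add: lookup_add)
      also have "\<dots> = (M r * M r ^\<^sub>m lookup t r) * ?F t rs"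
        using pow_comm[OF r] by simp
      also have "\<dots> = M r * (M r ^\<^sub>m lookup t r * ?F t rs)"
        using M F by (intro assoc_mult_mat[of _ k k _ k _ k]) auto
      finally show ?thesis using True by simp
    next
      case False
      then have IH: "?F (single r 1 + t) rs = M r * ?F t rs" using Cons by simp
      have sn: "s < n" using Cons by simp
      have "?F (single r 1 + t) (s # rs) = M s ^\<^sub>m lookup t s * (M r * ?F t rs)"
        using False IH by (simp add: lookup_add lookup_single)
      also have "\<dots> = (M s ^\<^sub>m lookup t s * M r) * ?F t rs"
        using M F by (intro assoc_mult_mat[symmetric, of _ k k _ k _ k]) auto
      also have "\<dots> = (M r * M s ^\<^sub>m lookup t s) * ?F t rs" by (simp only: pow_comm[OF sn])
      also have "\<dots> = M r * (M s ^\<^sub>m lookup t s * ?F t rs)"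
        using M F by (intro assoc_mult_mat[of _ k k _ k _ k]) auto
      finally show ?thesis by simp
    qed
  qed simp
  from this[of "[0..<n]"] r show ?thesis by (simp add: eval_term_def atLeast0LessThan)
qed

lemma (in comm_ring_hom) hom_eval_term:
  assumes M: "\<And>r. M r \<in> carrier_mat k k"
  shows "map_mat hom (eval_term n k M t) = eval_term n k (\<lambda>r. map_mat hom (M r)) t"
proof -
  let ?F = "\<lambda>rs. foldr (\<lambda>r A. (M r ^\<^sub>m lookup t r) * A) rs (1\<^sub>m k)"
  have F: "?F rs \<in> carrier_mat k k" for rs
    by (rule foldr_mult_carrier) (simp add: M)
  have "map_mat hom (?F rs) = foldr (\<lambda>r A. (map_mat hom (M r) ^\<^sub>m lookup t r) * A) rs (1\<^sub>m k)" for rs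
  proof (induction rs)
    case Nil
    then show ?case by (simp add: mat_hom_one)
  next
    case (Cons r rs)
    have "map_mat hom (?F (r # rs)) = map_mat hom (M r ^\<^sub>m lookup t r) * map_mat hom (?F rs)"
      using mat_hom_mult[of "M r ^\<^sub>m lookup t r" k k "?F rs" k] F M by simp
    with Cons show ?case by (simp add: mat_hom_pow[OF M])
  qed
  then show ?thesis by (simp add: eval_term_def)
qed

lemma eval_term_intertwine:
  assumes M: "\<And>r. M r \<in> carrier_mat k k" and N: "\<And>r. N r \<in> carrier_mat k k" and A: "A \<in> carrier_mat k k"
    and AN: "\<And>r. r < n \<Longrightarrow> A * N r = M r * A"
  shows "A * eval_term n k N t = eval_term n k M t * A"
proof -
  have pow: "A * N r ^\<^sub>m e = M r ^\<^sub>m e * A" if r: "r < n" for r e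
  proof (induction e)
    case 0
    then show ?case using M[of r] N[of r] A by simp
  next
    case (Suc e)
    have "A * (N r ^\<^sub>m e * N r) = (A * N r ^\<^sub>m e) * N r"
      using M N A by (intro assoc_mult_mat[symmetric, of _ k k _ k _ k]) auto
    also have "\<dots> = (M r ^\<^sub>m e * A) * N r" by (simp only: Suc)
    also have "\<dots> = M r ^\<^sub>m e * (A * N r)"
      using M N A by (intro assoc_mult_mat[of _ k k _ k _ k]) auto
    also have "\<dots> = M r ^\<^sub>m e * (M r * A)" by (simp only: AN[OF r])
    also have "\<dots> = M r ^\<^sub>m e * M r * A"
      using M N A by (intro assoc_mult_mat[symmetric, of _ k k _ k _ k]) auto
    finally show ?case by simp
  qed
  have "A * foldr (\<lambda>r B. (N r ^\<^sub>m lookup t r) * B) rs (1\<^sub>m k) = foldr (\<lambda>r B. (M r ^\<^sub>m lookup t r) * B) rs (1\<^sub>m k) * A"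
    if "set rs \<subseteq> {..<n}" for rs
    using that
  proof (induction rs)
    case Nil
    then show ?case using A by simp
  next
    case (Cons r rs)
    let ?FN = "foldr (\<lambda>r B. (N r ^\<^sub>m lookup t r) * B) rs (1\<^sub>m k)"
    let ?FM = "foldr (\<lambda>r B. (M r ^\<^sub>m lookup t r) * B) rs (1\<^sub>m k)"
    have F: "?FN \<in> carrier_mat k k" "?FM \<in> carrier_mat k k"
      by (rule foldr_mult_carrier; simp add: M N)+
    have r: "r < n" using Cons by simp
    have "A * (N r ^\<^sub>m lookup t r * ?FN) = (A * N r ^\<^sub>m lookup t r) * ?FN"
      using N A F by (intro assoc_mult_mat[symmetric, of _ k k _ k _ k]) auto
    also have "\<dots> = (M r ^\<^sub>m lookup t r * A) * ?FN" by (simp only: pow[OF r])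
    also have "\<dots> = M r ^\<^sub>m lookup t r * (A * ?FN)"
      using M A F by (intro assoc_mult_mat[of _ k k _ k _ k]) auto
    also have "\<dots> = M r ^\<^sub>m lookup t r * (?FM * A)" using Cons by simp
    also have "\<dots> = M r ^\<^sub>m lookup t r * ?FM * A"
      using M A F by (intro assoc_mult_mat[symmetric, of _ k k _ k _ k]) auto
    finally show ?case by simp
  qed
  from this[of "[0..<n]"] show ?thesis by (simp add: eval_term_def atLeast0LessThan)
qed

subsection \<open>The normal form\<close>

definition point_mult_mat ::
    "nat monom list \<Rightarrow> nat monom list \<Rightarrow> 'a::comm_ring_1 mat \<Rightarrow> nat \<Rightarrow> 'a mat" where
  "point_mult_mat ts bs \<Gamma> r = mat (length ts) (length ts) (\<lambda>(i, j).
     let u = single r 1 + ts ! j in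
     if u \<in> set ts then (if ts ! i = u then 1 else 0)
     else \<Gamma> $$ (i, THE m. m < length bs \<and> bs ! m = u))"

lemma point_mult_mat_carrier [simp]: "point_mult_mat ts bs \<Gamma> r \<in> carrier_mat (length ts) (length ts)"
  by (simp add: point_mult_mat_def)

lemma dim_point_mult_mat [simp]:
  "dim_row (point_mult_mat ts bs \<Gamma> r) = length ts" "dim_col (point_mult_mat ts bs \<Gamma> r) = length ts"
  by (simp_all add: point_mult_mat_def)

lemma (in comm_ring_hom) hom_gen_mult_mat:
  "map_mat (poly_subst hom (($$) \<Gamma>)) (gen_mult_mat ts bs r) = point_mult_mat ts bs \<Gamma> r"
proof -
  interpret E: comm_ring_hom "poly_subst hom (($$) \<Gamma>)" by (rule comm_ring_hom_poly_subst)
  show ?thesis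
    by (rule eq_matI) (auto simp: gen_mult_mat_def point_mult_mat_def Let_def)
qed

locale enumerated =
  fixes n :: nat and ts bs :: "nat monom list"
  assumes enum: "enumerated_order_ideal n ts bs"
begin

lemma ts_in_terms: "t \<in> set ts \<Longrightarrow> t \<in> terms n"
  and distinct_ts: "distinct ts" and distinct_bs: "distinct bs" and set_bs: "set bs = border n (set ts)"
  and sorted_ts: "sorted (map mdeg ts)" and order_ideal_ts: "order_ideal n (set ts)"
  using enum by (auto simp: enumerated_order_ideal_def order_ideal_def)

lemma ts_divisor: "s + u \<in> set ts \<Longrightarrow> s \<in> set ts"
  using order_ideal_ts by (auto simp: order_ideal_def)

lemma zero_in_ts: "0 \<in> set ts"
proof -
  have "ts \<noteq> []" using order_ideal_ts by (auto simp: order_ideal_def)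
  then show ?thesis using ts_divisor[of 0 "hd ts"] by simp
qed

lemma length_ts_pos: "0 < length ts"
  using zero_in_ts by (cases ts) auto

lemma ts_zero: "ts ! 0 = 0"
proof -
  obtain j where j: "j < length ts" "ts ! j = 0" using zero_in_ts by (auto simp: in_set_conv_nth)
  then have "mdeg (ts ! 0) \<le> mdeg (ts ! j)"
    using sorted_nth_mono[OF sorted_ts, of 0 j] length_ts_pos by simp
  then show ?thesis using j by simp
qed

lemma border_index: "m < length bs \<Longrightarrow> (THE m'. m' < length bs \<and> bs ! m' = bs ! m) = m"
  using distinct_bs by (auto simp: nth_eq_iff_index_eq)

lemma bs_in_terms: "b \<in> set bs \<Longrightarrow> b \<in> terms n"
  using ts_in_terms by (auto simp: set_bs border_def intro: add_in_terms)

lemma ts_cases: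
  assumes "t \<in> set ts" "t \<noteq> 0"
  obtains r s where "r < n" "s \<in> set ts" "t = single r 1 + s"
proof -
  obtain r where r: "r \<in> keys t" using assms(2) by fastforce
  obtain s where s: "t = single r 1 + s" "keys s \<subseteq> keys t" by (rule term_split[OF r])
  have "s \<in> set ts" using ts_divisor[of s "single r 1"] assms(1) s(1) by (simp add: add.commute)
  moreover have "r < n" using r ts_in_terms[OF assms(1)] by (auto simp: terms_def)
  ultimately show ?thesis using that s(1) by blast
qed

lemma bs_cases:
  assumes "b \<in> set bs"
  obtains r s where "r < n" "s \<in> set ts" "b = single r 1 + s" "b \<notin> set ts"
  using assms that by (auto simp: set_bs border_def)

lemma ts_or_bs: "r < n \<Longrightarrow> s \<in> set ts \<Longrightarrow> single r 1 + s \<in> set ts \<or> single r 1 + s \<in> set bs"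
  by (auto simp: set_bs border_def)

end

locale border_point = enumerated n ts bs for n ts bs +
  fixes \<Gamma> :: "'l::field mat"
  assumes mult_commute: "r < n \<Longrightarrow> s < n \<Longrightarrow>
    point_mult_mat ts bs \<Gamma> r * point_mult_mat ts bs \<Gamma> s = point_mult_mat ts bs \<Gamma> s * point_mult_mat ts bs \<Gamma> r"
begin

abbreviation \<mu> :: nat where "\<mu> \<equiv> length ts"
abbreviation MM :: "nat \<Rightarrow> 'l mat" where "MM \<equiv> point_mult_mat ts bs \<Gamma>"
abbreviation EE :: "nat monom \<Rightarrow> 'l mat" where "EE \<equiv> eval_term n \<mu> MM"

text \<open>
  As \<open>1\<close> is the first element of the order ideal, the first column of \<open>u(M\<^sub>1, \<dots>, M\<^sub>n)\<close> is the only
  candidate for the coordinates of the residue class of \<open>u\<close>.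
\<close>

definition coords :: "nat monom \<Rightarrow> 'l vec" where
  "coords u = col (EE u) 0"

definition nf :: "nat monom \<Rightarrow> (nat, 'l) mpoly" where
  "nf u = (\<Sum>i<\<mu>. single (ts ! i) (coords u $ i))"

definition NF :: "(nat, 'l) mpoly \<Rightarrow> (nat, 'l) mpoly" where
  "NF = linear_extension nf"

lemma EE_carrier [simp]: "EE u \<in> carrier_mat \<mu> \<mu>"
  by (rule eval_term_carrier) simp

lemma coords_carrier [simp]: "coords u \<in> carrier_vec \<mu>"
  unfolding coords_def by (rule col_carrier_vec[OF length_ts_pos EE_carrier])

lemma dim_coords [simp]: "dim_vec (coords u) = \<mu>"
  by (rule carrier_vecD[OF coords_carrier])

lemma coords_zero: "coords 0 = unit_vec \<mu> 0"
  unfolding coords_def using length_ts_pos by (simp add: eval_term_zero)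

lemma coords_add_var: "r < n \<Longrightarrow> coords (single r 1 + u) = MM r *\<^sub>v coords u"
  unfolding coords_def
  by (subst eval_term_add_var[OF point_mult_mat_carrier mult_commute])
     (simp_all add: col_mult2[OF point_mult_mat_carrier EE_carrier length_ts_pos])

lemma MM_unit: "k < \<mu> \<Longrightarrow> MM r *\<^sub>v unit_vec \<mu> k = col (MM r) k"
  by (rule eq_vecI) (auto simp: point_mult_mat_def scalar_prod_right_unit)

lemma coords_ts: "j < \<mu> \<Longrightarrow> coords (ts ! j) = unit_vec \<mu> j"
proof (induction "mdeg (ts ! j)" arbitrary: j rule: less_induct)
  case less
  show ?case
  proof (cases "ts ! j = 0")
    case True
    then have "j = 0"
      using less.prems ts_zero distinct_ts length_ts_pos by (metis nth_eq_iff_index_eq)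
    with True show ?thesis using coords_zero by simp
  next
    case False
    have tj: "ts ! j \<in> set ts" using less.prems by simp
    obtain r s where rs: "r < n" "s \<in> set ts" "ts ! j = single r 1 + s"
      by (rule ts_cases[OF tj False])
    obtain k where k: "k < \<mu>" "ts ! k = s" using rs(2) by (auto simp: in_set_conv_nth)
    have "coords s = unit_vec \<mu> k"
      using less.hyps[of k] k rs(3) by (simp add: mdeg_add)
    then have "coords (ts ! j) = col (MM r) k"
      using coords_add_var[OF rs(1), of s] MM_unit[OF k(1)] rs(3) by simp
    also have "\<dots> = unit_vec \<mu> j"
    proof (rule eq_vecI)
      fix i assume "i < dim_vec (unit_vec \<mu> j :: 'l vec)"
      then have i: "i < \<mu>" by simp
      have "ts ! i = ts ! j \<longleftrightarrow> i = j"
        using i less.prems distinct_ts by (simp add: nth_eq_iff_index_eq)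
      then show "col (MM r) k $ i = unit_vec \<mu> j $ i"
        using i k rs(3) tj less.prems by (simp add: point_mult_mat_def Let_def)
    qed (simp add: point_mult_mat_def)
    finally show ?thesis .
  qed
qed

lemma coords_bs: "j < length bs \<Longrightarrow> i < \<mu> \<Longrightarrow> coords (bs ! j) $ i = \<Gamma> $$ (i, j)"
proof -
  assume j: "j < length bs" and i: "i < \<mu>"
  obtain r s where rs: "r < n" "s \<in> set ts" "bs ! j = single r 1 + s" "bs ! j \<notin> set ts"
    using bs_cases[of "bs ! j"] j by (metis nth_mem)
  obtain k where k: "k < \<mu>" "ts ! k = s" using rs(2) by (auto simp: in_set_conv_nth)
  have "coords (bs ! j) = col (MM r) k"
    using coords_add_var[OF rs(1), of s] MM_unit[OF k(1)] coords_ts[OF k(1)] rs(3) k(2) by simp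
  then show ?thesis
    using i k rs(3,4) border_index[OF j] by (simp add: point_mult_mat_def Let_def)
qed

lemma lookup_nf: "i < \<mu> \<Longrightarrow> lookup (nf u) (ts ! i) = coords u $ i"
proof -
  assume i: "i < \<mu>"
  have "lookup (nf u) (ts ! i) = (\<Sum>k<\<mu>. if k = i then coords u $ k else 0)"
    unfolding nf_def lookup_sum
    by (rule sum.cong) (use i distinct_ts in \<open>auto simp: lookup_single when_def nth_eq_iff_index_eq\<close>)
  then show ?thesis using i by simp
qed

lemma keys_nf: "keys (nf u) \<subseteq> set ts"
proof -
  have "keys (nf u) \<subseteq> (\<Union>i\<in>{..<\<mu>}. keys (single (ts ! i) (coords u $ i)))"
    unfolding nf_def by (rule Poly_Mapping.keys_sum)
  also have "\<dots> \<subseteq> set ts" by (auto split: if_splits)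
  finally show ?thesis .
qed

lemma eq_on_ts:
  assumes "keys p \<subseteq> set ts" "keys q \<subseteq> set ts" "\<And>i. i < \<mu> \<Longrightarrow> lookup p (ts ! i) = lookup q (ts ! i)"
  shows "p = q"
proof (rule poly_mapping_eqI)
  fix t show "lookup p t = lookup q t"
  proof (cases "t \<in> set ts")
    case True
    then show ?thesis using assms(3) by (auto simp: in_set_conv_nth)
  next
    case False
    then have "t \<notin> keys p" "t \<notin> keys q" using assms by auto
    then show ?thesis by (simp add: in_keys_iff)
  qed
qed

lemma mlinear_NF: "mlinear NF"
  unfolding NF_def by (rule mlinear_linear_extension)

lemma NF_single [simp]: "NF (single u c) = smul c (nf u)"
  by (simp add: NF_def)

lemma keys_NF: "keys (NF p) \<subseteq> set ts"
proof -
  have "NF p \<in> {q. keys q \<subseteq> set ts}"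
    unfolding NF_def linear_extension_def
    by (intro mp.subspace_sum[OF subspace_keys] mp.subspace_scale[OF subspace_keys]) (simp add: keys_nf)
  then show ?thesis by simp
qed

lemma nf_ts: "t \<in> set ts \<Longrightarrow> nf t = single t 1"
proof -
  assume "t \<in> set ts"
  then obtain j where j: "j < \<mu>" "t = ts ! j" by (auto simp: in_set_conv_nth)
  show ?thesis
  proof (rule eq_on_ts)
    show "keys (single t 1) \<subseteq> set ts" using \<open>t \<in> set ts\<close> by simp
    show "lookup (nf t) (ts ! i) = lookup (single t 1) (ts ! i)" if i: "i < \<mu>" for i
      using i j distinct_ts
      by (auto simp: lookup_nf coords_ts lookup_single when_def nth_eq_iff_index_eq unit_vec_def)
  qed (rule keys_nf)
qed

lemma NF_of_ts: "keys p \<subseteq> set ts \<Longrightarrow> NF p = p"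
  using mlinear_eqI[OF mlinear_NF mp.linear_ident, of p] nf_ts by auto

lemma NF_NF [simp]: "NF (NF p) = NF p"
  by (rule NF_of_ts[OF keys_NF])

text \<open>
  The normal form is defined term by term; that its kernel is an ideal is due to this compatibility
  with multiplication.
\<close>

lemma NF_mult_var:
  assumes r: "r < n"
  shows "NF (single (single r 1) 1 * p) = NF (single (single r 1) 1 * NF p)"
proof (rule mlinear_eqI[where f = "\<lambda>p. NF (single (single r 1) 1 * p)"
      and g = "\<lambda>p. NF (single (single r 1) 1 * NF p)"])
  let ?x = "single (single r 1) 1 :: (nat, 'l) mpoly"
  show "mlinear (\<lambda>p. NF (?x * p))"
    by (rule mlinear_comp[OF mlinear_NF mlinear_mult_left])
  show "mlinear (\<lambda>p. NF (?x * NF p))"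
    by (rule mlinear_comp[OF mlinear_comp[OF mlinear_NF mlinear_mult_left] mlinear_NF])
  fix u
  have "NF (?x * NF (single u 1)) = (\<Sum>k<\<mu>. smul (coords u $ k) (nf (single r 1 + ts ! k)))"
    by (simp add: nf_def[of u] sum_distrib_left Poly_Mapping.mult_single mlinear_sum[OF mlinear_NF])
  also have "\<dots> = nf (single r 1 + u)"
  proof (rule eq_on_ts)
    show "keys (\<Sum>k<\<mu>. smul (coords u $ k) (nf (single r 1 + ts ! k))) \<subseteq> set ts"
      using mp.subspace_sum[OF subspace_keys, of "{..<\<mu>}" "\<lambda>k. smul (coords u $ k) (nf (single r 1 + ts ! k))" "set ts"]
        mp.subspace_scale[OF subspace_keys] keys_nf by blast
    fix i assume i: "i < \<mu>"
    have "coords (single r 1 + ts ! k) $ i = MM r $$ (i, k)" if "k < \<mu>" for k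
      using that i coords_add_var[OF r] by (simp add: coords_ts MM_unit)
    then have "lookup (\<Sum>k<\<mu>. smul (coords u $ k) (nf (single r 1 + ts ! k))) (ts ! i)
        = (\<Sum>k<\<mu>. coords u $ k * MM r $$ (i, k))"
      by (simp add: lookup_sum lookup_nf i)
    also have "\<dots> = (MM r *\<^sub>v coords u) $ i"
      using i by (simp add: scalar_prod_def atLeast0LessThan mult.commute)
    finally show "lookup (\<Sum>k<\<mu>. smul (coords u $ k) (nf (single r 1 + ts ! k))) (ts ! i)
        = lookup (nf (single r 1 + u)) (ts ! i)"
      using coords_add_var[OF r, of u] by (simp add: lookup_nf i)
  qed (rule keys_nf)
  finally show "NF (?x * single u 1) = NF (?x * NF (single u 1))"
    by (simp add: Poly_Mapping.mult_single)
qed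

lemma NF_mult_zero:
  assumes p: "NF p = 0" and q: "q \<in> KXC n"
  shows "NF (q * p) = 0"
proof -
  have "NF (single t 1 * p) = 0" if "t \<in> terms n" for t
    using that
  proof (induction t rule: term_induct)
    case zero
    then show ?case using p by (simp add: single_one)
  next
    case (step r s)
    have "single (single r 1 + s) 1 * p = single (single r 1) 1 * (single s 1 * p)"
      by (simp add: Poly_Mapping.mult_single flip: mult.assoc)
    also have "NF \<dots> = 0"
      using NF_mult_var[OF step(1), of "single s 1 * p"] step(3) mlinear_zero[OF mlinear_NF] by simp
    finally show ?case .
  qed
  moreover have "m \<in> terms n" if "m \<in> keys q" for m
    using q that by (auto simp: carrier_poly_ring terms_def)
  moreover have "q * p = (\<Sum>m\<in>keys q. smul (lookup q m) (single m 1 * p))"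
    by (subst (1) sum_of_terms[of q, symmetric])
       (simp add: sum_distrib_right smul_single flip: smul_mult(1))
  ultimately show ?thesis
    by (simp add: mlinear_sum[OF mlinear_NF] mlinear_scale[OF mlinear_NF])
qed

abbreviation II :: "(nat, 'l) mpoly set" where "II \<equiv> I_point n ts bs \<Gamma>"

lemma I_point_eq:
  "II = Idl\<^bsub>KX n\<^esub> {single (bs ! j) 1 - nf (bs ! j) | j. j < length bs}"
proof -
  have "(\<Sum>i<\<mu>. single (ts ! i) (\<Gamma> $$ (i, j))) = nf (bs ! j)" if "j < length bs" for j
    unfolding nf_def by (rule sum.cong) (simp_all add: coords_bs that)
  then show ?thesis
    unfolding I_point_def by (simp cong: rev_conj_cong)
qed

lemma nf_in_KXC: "nf u \<in> KXC n"
  using keys_nf[of u] ts_in_terms by (auto simp: carrier_poly_ring terms_def)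

lemma NF_in_KXC: "NF p \<in> KXC n"
  using keys_NF[of p] ts_in_terms by (auto simp: carrier_poly_ring terms_def)

lemma generators_in_KXC: "{single (bs ! j) 1 - nf (bs ! j) | j. j < length bs} \<subseteq> KXC n"
proof
  fix x assume "x \<in> {single (bs ! j) 1 - nf (bs ! j) | j. j < length bs}"
  then obtain j where j: "x = single (bs ! j) 1 - nf (bs ! j)" "j < length bs" by blast
  then have "bs ! j \<in> terms n" using bs_in_terms by simp
  then have "single (bs ! j) 1 \<in> KXC n" by (intro single_in_poly_ring) (simp add: terms_def)
  then show "x \<in> KXC n" unfolding j(1) by (rule KXC_diff[OF _ nf_in_KXC])
qed

lemma ideal_I_point: "ideal II (KX n)"
  unfolding I_point_eq by (rule ring.genideal_ideal[OF cring.axioms(1)[OF cring_poly_ring] generators_in_KXC])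

lemma I_point_subset_kernel: "p \<in> II \<Longrightarrow> NF p = 0"
proof -
  have "ideal {p \<in> KXC n. NF p = 0} (KX n)"
    unfolding ideal_poly_ring_iff
    using KXC_zero KXC_add KXC_mult NF_mult_zero mlinear_zero[OF mlinear_NF]
    by (auto simp: mlinear_add[OF mlinear_NF])
  moreover have "{single (bs ! j) 1 - nf (bs ! j) | j. j < length bs} \<subseteq> {p \<in> KXC n. NF p = 0}"
    using generators_in_KXC NF_of_ts[OF keys_nf]
    by (auto simp: mlinear_diff[OF mlinear_NF])
  ultimately have "II \<subseteq> {p \<in> KXC n. NF p = 0}"
    unfolding I_point_eq by (rule ring.genideal_minimal[OF cring.axioms(1)[OF cring_poly_ring]])
  then show "p \<in> II \<Longrightarrow> NF p = 0" by blast
qed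

lemma term_minus_nf: "t \<in> terms n \<Longrightarrow> single t 1 - nf t \<in> II"
proof (induction t rule: term_induct)
  case zero
  then show ?case using nf_ts[OF zero_in_ts] ideal_KX_zero[OF ideal_I_point] by simp
next
  case (step r s)
  let ?x = "single (single r 1) 1 :: (nat, 'l) mpoly"
  have "?x \<in> KXC n" using step(1) by (intro single_in_poly_ring) simp
  from ideal_KX_mult[OF ideal_I_point step(3) this]
  have "single (single r 1 + s) 1 - ?x * nf s \<in> II"
    by (simp add: right_diff_distrib Poly_Mapping.mult_single)
  moreover have "?x * nf s - nf (single r 1 + s) \<in> II"
  proof -
    have "?x * nf s = (\<Sum>k<\<mu>. smul (coords s $ k) (single (single r 1 + ts ! k) 1))"
      by (simp add: nf_def sum_distrib_left Poly_Mapping.mult_single smul_single)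
    moreover have "nf (single r 1 + s) = NF (?x * nf s)"
      using NF_mult_var[OF step(1), of "single s 1"] by (simp add: Poly_Mapping.mult_single)
    ultimately have "?x * nf s - nf (single r 1 + s) =
        (\<Sum>k<\<mu>. smul (coords s $ k) (single (single r 1 + ts ! k) 1 - nf (single r 1 + ts ! k)))"
      by (simp add: mlinear_sum[OF mlinear_NF] mlinear_scale[OF mlinear_NF] mp.scale_right_diff_distrib
          sum_subtractf)
    moreover have "single (single r 1 + ts ! k) 1 - nf (single r 1 + ts ! k) \<in> II" if k: "k < \<mu>" for k
    proof (cases "single r 1 + ts ! k \<in> set ts")
      case True
      then show ?thesis using nf_ts ideal_KX_zero[OF ideal_I_point] by simp
    next
      case False
      then have "single r 1 + ts ! k \<in> set bs" using ts_or_bs[OF step(1), of "ts ! k"] k by simp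
      then obtain j where "j < length bs" "bs ! j = single r 1 + ts ! k" by (auto simp: in_set_conv_nth)
      then have "single (single r 1 + ts ! k) 1 - nf (single r 1 + ts ! k) \<in>
          {single (bs ! j) 1 - nf (bs ! j) | j. j < length bs}"
        by (auto intro!: exI[of _ j])
      then show ?thesis
        unfolding I_point_eq
        using ring.genideal_self[OF cring.axioms(1)[OF cring_poly_ring] generators_in_KXC] by blast
    qed
    moreover from this have "(\<Sum>k<\<mu>. smul (coords s $ k)
        (single (single r 1 + ts ! k) 1 - nf (single r 1 + ts ! k))) \<in> II"
      by (intro mp.subspace_sum[OF subspace_ideal_KX[OF ideal_I_point]] ideal_KX_smul[OF ideal_I_point]) simp
    ultimately show ?thesis by (simp only:)
  qed
  ultimately have "single (single r 1 + s) 1 - ?x * nf s + (?x * nf s - nf (single r 1 + s)) \<in> II"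
    by (rule ideal_KX_add[OF ideal_I_point])
  then show ?case by simp
qed

lemma minus_NF_in_I_point:
  assumes "p \<in> KXC n"
  shows "p - NF p \<in> II"
proof -
  have "p - NF p = (\<Sum>m\<in>keys p. smul (lookup p m) (single m 1 - nf m))"
    unfolding NF_def linear_extension_def
    by (subst (1) sum_of_terms[of p, symmetric])
       (simp add: mp.scale_right_diff_distrib sum_subtractf smul_single)
  also have "\<dots> \<in> II"
    using assms
    by (intro mp.subspace_sum[OF subspace_ideal_KX[OF ideal_I_point]] ideal_KX_smul[OF ideal_I_point]
        term_minus_nf) (auto simp: carrier_poly_ring terms_def)
  finally show ?thesis .
qed

text \<open>
  Commuting multiplication matrices make the order ideal a basis of the coordinate ring. The kernel of
  the normal form is an ideal that contains the generators; and differences of terms and their normal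
  forms are in \<open>I_point\<close> by induction on the term, the step being reduction by a single generator.
\<close>

lemma NF_eq_zero_iff: "p \<in> KXC n \<Longrightarrow> NF p = 0 \<longleftrightarrow> p \<in> II"
  using minus_NF_in_I_point[of p] I_point_subset_kernel[of p] by auto

sublocale zero_dim_ideal n II NF "(\<lambda>t. single t 1) ` set ts"
proof (rule zero_dim_ideal.intro)
  show "1 \<notin> II"
  proof
    assume "1 \<in> II"
    then have "NF (single 0 1) = 0" using I_point_subset_kernel[of 1] by (simp only: single_one)
    moreover have "NF (single 0 1) = single 0 1"
      by (simp only: NF_single nf_ts[OF zero_in_ts] mp.scale_one)
    ultimately show False by simp
  qed
  show "NF ` KXC n \<subseteq> mp.span ((\<lambda>t. single t 1) ` set ts)"
    using keys_NF by (auto simp: span_terms)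
qed (use ideal_I_point mlinear_NF NF_eq_zero_iff in auto)

lemma HFa_eq_dim: "HFa n II d = mp.dim (nf ` {u \<in> terms n. mdeg u \<le> d})"
  by (simp add: HFa_eq_dim_image image_image)

end

subsection \<open>Hilbert functions and minors\<close>

lemma mat_of_cols_entry: "j < length vs \<Longrightarrow> i < m \<Longrightarrow> mat_of_cols m vs $$ (i, j) = vs ! j $ i"
  by (simp add: mat_of_cols_index)

lemma image_nth: "(\<lambda>j. f (xs ! j)) ` {..<length xs} = f ` set xs"
proof -
  have "set xs = (!) xs ` {..<length xs}" by (auto simp: set_conv_nth)
  then show ?thesis by (simp add: image_image)
qed

lemma basis_of_span:
  assumes "finite S"
  obtains B where "B \<subseteq> S" "finite B" "mp.independent B" "mp.span B = mp.span S" "card B = mp.dim S"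
proof -
  obtain B where B: "B \<subseteq> S" "mp.independent B" "S \<subseteq> mp.span B" "card B = mp.dim S"
    using mp.basis_exists by metis
  moreover have "mp.span B = mp.span S"
    using B by (metis mp.span_minimal mp.span_mono mp.subspace_span subset_antisym)
  moreover have "finite B" using B(1) assms by (rule finite_subset)
  ultimately show ?thesis using that by blast
qed

lemma independent_card_le_dim:
  assumes "finite S" "mp.independent B" "B \<subseteq> mp.span S"
  shows "card B \<le> mp.dim S"
proof -
  obtain B' where B': "finite B'" "mp.span B' = mp.span S" "card B' = mp.dim S"
    using basis_of_span[OF assms(1)] by metis
  show ?thesis
    using mp.independent_span_bound[OF B'(1) assms(2)] assms(3) B' by auto
qed

lemma dim_le_of_subset_span:
  assumes "finite S" "finite S'" "S \<subseteq> mp.span S'"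
  shows "mp.dim S \<le> mp.dim S'"
proof -
  obtain B where B: "B \<subseteq> S" "mp.independent B" "card B = mp.dim S"
    using basis_of_span[OF assms(1)] by metis
  show ?thesis
    using independent_card_le_dim[OF assms(2) B(2)] B(1,3) assms(3) by auto
qed

lemma span_eq_of_dim_le:
  assumes "finite S" "finite S'" "S \<subseteq> mp.span S'" "mp.dim S' \<le> mp.dim S"
  shows "mp.span S = mp.span S'"
proof (rule ccontr)
  assume "mp.span S \<noteq> mp.span S'"
  then have "mp.span S \<subset> mp.span S'"
    using mp.span_minimal[OF assms(3)] by blast
  then have "mp.dim (mp.span S) < mp.dim (mp.span S')"
    by (intro dim_strict_mono[OF assms(2)]) auto
  with assms(4) show False by simp
qed

lemma family_independent_iff:
  fixes g :: "'i \<Rightarrow> ('v, 'a::field) mpoly"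
  assumes J: "finite J"
  shows "(\<forall>c. (\<Sum>j\<in>J. smul (c j) (g j)) = 0 \<longrightarrow> (\<forall>j\<in>J. c j = 0)) \<longleftrightarrow> inj_on g J \<and> mp.independent (g ` J)"
proof
  assume L: "\<forall>c. (\<Sum>j\<in>J. smul (c j) (g j)) = 0 \<longrightarrow> (\<forall>j\<in>J. c j = 0)"
  have inj: "inj_on g J"
  proof (rule inj_onI, rule ccontr)
    fix a b assume ab: "a \<in> J" "b \<in> J" "g a = g b" "a \<noteq> b"
    let ?c = "\<lambda>j. (if j = a then 1 else 0) - (if j = b then 1 else 0) :: 'a"
    have "(\<Sum>j\<in>J. smul (?c j) (g j)) =
        (\<Sum>j\<in>J. if j = a then g j else 0) - (\<Sum>j\<in>J. if j = b then g j else 0)"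
      unfolding sum_subtractf[symmetric] by (rule sum.cong) (auto simp: mp.scale_left_diff_distrib)
    also have "\<dots> = 0" using J ab by simp
    finally have "(\<Sum>j\<in>J. smul (?c j) (g j)) = 0" .
    from bspec[OF HOL.mp[OF spec[OF L, of ?c] this] ab(1)] ab(4) show False by simp
  qed
  have "mp.independent (g ` J)"
  proof (rule mp.independent_if_scalars_zero)
    fix u x assume u: "(\<Sum>x\<in>g ` J. smul (u x) x) = 0" and x: "x \<in> g ` J"
    then have "(\<Sum>j\<in>J. smul (u (g j)) (g j)) = 0" by (simp add: sum.reindex[OF inj])
    from L[rule_format, OF this] x show "u x = 0" by blast
  qed (use J in simp)
  with inj show "inj_on g J \<and> mp.independent (g ` J)" by simp
next
  assume R: "inj_on g J \<and> mp.independent (g ` J)"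
  show "\<forall>c. (\<Sum>j\<in>J. smul (c j) (g j)) = 0 \<longrightarrow> (\<forall>j\<in>J. c j = 0)"
  proof (intro allI impI ballI)
    fix c j assume c: "(\<Sum>j\<in>J. smul (c j) (g j)) = 0" and j: "j \<in> J"
    let ?u = "\<lambda>x. c (the_inv_into J g x)"
    have u: "?u (g j) = c j" if "j \<in> J" for j
      using R that by (simp add: the_inv_into_f_f)
    have "(\<Sum>x\<in>g ` J. smul (?u x) x) = (\<Sum>j\<in>J. smul (?u (g j)) (g j))"
      using R by (simp add: sum.reindex)
    also have "\<dots> = (\<Sum>j\<in>J. smul (c j) (g j))"
      by (rule sum.cong) (simp_all add: u)
    finally have "?u (g j) = 0"
      using mp.independentD[of "g ` J" "g ` J" ?u "g j"] R J j c by simp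
    with u[OF j] show "c j = 0" by simp
  qed
qed

context border_point
begin

lemma NF_combination_zero_iff:
  "(\<Sum>j\<in>J. smul (c j) (nf (us j))) = 0 \<longleftrightarrow> (\<forall>i<\<mu>. (\<Sum>j\<in>J. coords (us j) $ i * c j) = 0)"
proof -
  have l: "lookup (\<Sum>j\<in>J. smul (c j) (nf (us j))) (ts ! i) = (\<Sum>j\<in>J. coords (us j) $ i * c j)"
    if "i < \<mu>" for i
    using that by (simp add: lookup_sum lookup_nf mult.commute)
  have k: "keys (\<Sum>j\<in>J. smul (c j) (nf (us j))) \<subseteq> set ts"
    using mp.subspace_sum[OF subspace_keys, of J "\<lambda>j. smul (c j) (nf (us j))" "set ts"]
      mp.subspace_scale[OF subspace_keys] keys_nf by blast
  show ?thesis
  proof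
    assume "(\<Sum>j\<in>J. smul (c j) (nf (us j))) = 0"
    then show "\<forall>i<\<mu>. (\<Sum>j\<in>J. coords (us j) $ i * c j) = 0" using l by (metis lookup_zero)
  next
    assume "\<forall>i<\<mu>. (\<Sum>j\<in>J. coords (us j) $ i * c j) = 0"
    then show "(\<Sum>j\<in>J. smul (c j) (nf (us j))) = 0" using l k by (intro eq_on_ts) simp_all
  qed
qed

lemma columns_independent_coords:
  assumes "J \<subseteq> {..<length us}"
  shows "columns_independent (mat_of_cols \<mu> (map coords us)) J \<longleftrightarrow>
    inj_on (\<lambda>j. nf (us ! j)) J \<and> mp.independent ((\<lambda>j. nf (us ! j)) ` J)"
proof -
  have "finite J" using assms finite_subset by blast
  have "(\<Sum>j\<in>J. mat_of_cols \<mu> (map coords us) $$ (i, j) * c j) = (\<Sum>j\<in>J. coords (us ! j) $ i * c j)"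
    if "i < \<mu>" for i c
    by (rule sum.cong) (use assms that in \<open>auto simp: mat_of_cols_entry\<close>)
  then show ?thesis
    unfolding columns_independent_def family_independent_iff[OF \<open>finite J\<close>, symmetric]
      NF_combination_zero_iff
    by simp
qed

lemma minors_vanish_iff_dim_le:
  "(\<forall>x\<in>minors (Suc k) (mat_of_cols \<mu> (map coords us)). x = 0) \<longleftrightarrow> mp.dim (nf ` set us) \<le> k"
proof -
  let ?A = "mat_of_cols \<mu> (map coords us)"
  have A: "?A \<in> carrier_mat \<mu> (length us)"
    using mat_of_cols_carrier(1)[of \<mu> "map coords us"] by simp
  have img: "(\<lambda>j. nf (us ! j)) ` {..<length us} = nf ` set us"
    by (rule image_nth)
  have "(\<exists>x\<in>minors (Suc k) ?A. x \<noteq> 0) \<longleftrightarrow>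
      (\<exists>J\<subseteq>{..<length us}. card J = Suc k \<and> inj_on (\<lambda>j. nf (us ! j)) J \<and> mp.independent ((\<lambda>j. nf (us ! j)) ` J))"
    unfolding nonzero_minor_iff[OF A] using columns_independent_coords by blast
  also have "\<dots> \<longleftrightarrow> Suc k \<le> mp.dim (nf ` set us)"
  proof
    assume "\<exists>J\<subseteq>{..<length us}. card J = Suc k \<and> inj_on (\<lambda>j. nf (us ! j)) J \<and> mp.independent ((\<lambda>j. nf (us ! j)) ` J)"
    then obtain J where J: "J \<subseteq> {..<length us}" "card J = Suc k" "inj_on (\<lambda>j. nf (us ! j)) J"
      "mp.independent ((\<lambda>j. nf (us ! j)) ` J)" by blast
    have "(\<lambda>j. nf (us ! j)) ` J \<subseteq> mp.span (nf ` set us)"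
      using J(1) img mp.span_superset[of "nf ` set us"] by blast
    then have "card ((\<lambda>j. nf (us ! j)) ` J) \<le> mp.dim (nf ` set us)"
      by (intro independent_card_le_dim J) auto
    then show "Suc k \<le> mp.dim (nf ` set us)" using J by (simp add: card_image)
  next
    assume k: "Suc k \<le> mp.dim (nf ` set us)"
    obtain B where B: "B \<subseteq> nf ` set us" "mp.independent B" "card B = mp.dim (nf ` set us)" "finite B"
      using basis_of_span[of "nf ` set us"] by (metis List.finite_set finite_imageI)
    obtain B' where B': "B' \<subseteq> B" "card B' = Suc k"
      using obtain_subset_with_card_n[of "Suc k" B] k B(3) by auto
    have "B' \<subseteq> (\<lambda>j. nf (us ! j)) ` {..<length us}" unfolding img using B B' by blast
    then obtain J where "J \<subseteq> {..<length us}" "inj_on (\<lambda>j. nf (us ! j)) J" "B' = (\<lambda>j. nf (us ! j)) ` J"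
      unfolding subset_image_inj by blast
    moreover from this have "card J = Suc k" using B'(2) by (simp add: card_image)
    moreover have "mp.independent B'" using B(2) B'(1) by (rule mp.independent_mono)
    ultimately show "\<exists>J\<subseteq>{..<length us}. card J = Suc k \<and> inj_on (\<lambda>j. nf (us ! j)) J \<and> mp.independent ((\<lambda>j. nf (us ! j)) ` J)"
      by blast
  qed
  finally show ?thesis by (meson not_less_eq_eq)
qed

text \<open>
  The Hilbert function as a rank: the normal form identifies the residue classes of polynomials of
  degree at most \<open>d\<close> with the span of the normal forms of the terms of degree at most \<open>d\<close>.
\<close>

lemma HFa_le_iff_minors:
  "HFa n II d \<le> k \<longleftrightarrow> (\<forall>x\<in>minors (Suc k)
     (mat_of_cols \<mu> (map coords (sorted_list_of_set {u \<in> terms n. mdeg u \<le> d}))). x = 0)"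
  by (simp add: minors_vanish_iff_dim_le HFa_eq_dim finite_terms_le)

lemma HFa_mono: "d \<le> e \<Longrightarrow> HFa n II d \<le> HFa n II e"
  unfolding HFa_eq_dim
  by (rule dim_le_of_subset_span)
     (auto simp: finite_terms_le intro!: mp.span_base)

lemma HFa_zero: "HFa n II 0 = 1"
proof -
  have "{u \<in> terms n. mdeg u \<le> 0} = {0}" by auto
  moreover have "mp.independent {single 0 1 :: (nat, 'l) mpoly}"
    using independent_terms[of "{0}"] by simp
  ultimately show ?thesis
    using mp.dim_eq_card_independent[of "{single 0 1 :: (nat, 'l) mpoly}"] nf_ts[OF zero_in_ts]
    by (simp add: HFa_eq_dim)
qed

lemma nf_in_span_ts: "nf u \<in> mp.span ((\<lambda>t. single t 1) ` set ts)"
  using keys_nf by (simp add: span_terms)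

lemma HFa_le_length: "HFa n II d \<le> \<mu>"
proof -
  have "mp.dim (nf ` {u \<in> terms n. mdeg u \<le> d}) \<le> card ((\<lambda>t. single t (1::'l)) ` set ts)"
    using nf_in_span_ts by (intro mp.dim_le_card) auto
  also have "\<dots> \<le> \<mu>" using card_image_le[of "set ts"] card_length[of ts] by (metis List.finite_set le_trans)
  finally show ?thesis by (simp add: HFa_eq_dim)
qed

lemma HFa_terms_eq_dim: "HFa_terms (set ts) d = mp.dim ((\<lambda>t. single t (1::'l)) ` {t \<in> set ts. mdeg t \<le> d})"
  by (simp add: HFa_terms_def mp.dim_eq_card_independent[OF independent_terms]
      card_image inj_on_subset[OF inj_single_one])

lemma HFa_terms_le: "HFa_terms (set ts) d \<le> HFa n II d"
  unfolding HFa_terms_eq_dim HFa_eq_dim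
proof (rule dim_le_of_subset_span)
  show "(\<lambda>t. single t 1) ` {t \<in> set ts. mdeg t \<le> d} \<subseteq> mp.span (nf ` {u \<in> terms n. mdeg u \<le> d})"
  proof (rule image_subsetI)
    fix t assume t: "t \<in> {t \<in> set ts. mdeg t \<le> d}"
    then have "nf t = single t 1" "t \<in> terms n" using nf_ts ts_in_terms by auto
    then show "single t 1 \<in> mp.span (nf ` {u \<in> terms n. mdeg u \<le> d})"
      using t by (metis (mono_tags, lifting) image_eqI mem_Collect_eq mp.span_base)
  qed
qed (simp_all add: finite_terms_le)

text \<open>
  The terms of the order ideal of degree at most \<open>d\<close> are normal forms of themselves. Hence they span a
  subspace of the space of normal forms of degree at most \<open>d\<close>, and its dimension is the same.
\<close>

lemma NF_degree:
  assumes HF: "HFa n II d = HFa_terms (set ts) d" and p: "p \<in> KXC n" "\<And>m. m \<in> keys p \<Longrightarrow> mdeg m \<le> d"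
  shows "keys (NF p) \<subseteq> {t \<in> set ts. mdeg t \<le> d}"
proof -
  let ?S = "{u \<in> terms n. mdeg u \<le> d}" and ?T = "{t \<in> set ts. mdeg t \<le> d}"
  have "(\<lambda>t. single t 1) ` ?T \<subseteq> mp.span (nf ` ?S)"
  proof (rule image_subsetI)
    fix t assume t: "t \<in> ?T"
    then have "nf t = single t 1" "t \<in> terms n" using nf_ts ts_in_terms by auto
    then show "single t 1 \<in> mp.span (nf ` ?S)"
      using t by (metis (mono_tags, lifting) image_eqI mem_Collect_eq mp.span_base)
  qed
  then have eq: "mp.span ((\<lambda>t. single t 1) ` ?T) = mp.span (nf ` ?S)"
    using HF by (intro span_eq_of_dim_le) (simp_all add: finite_terms_le HFa_eq_dim HFa_terms_eq_dim)
  have "p \<in> mp.span ((\<lambda>u. single u 1) ` ?S)"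
    using p by (auto simp: span_terms carrier_poly_ring terms_def)
  then have "NF p \<in> mp.span (NF ` ((\<lambda>u. single u 1) ` ?S))"
    by (simp add: mlinear_span_image[OF mlinear_NF])
  also have "NF ` ((\<lambda>u. single u 1) ` ?S) = nf ` ?S" by (simp add: image_image)
  finally show ?thesis unfolding eq[symmetric] by (simp add: span_terms)
qed

end

subsection \<open>Change of the order ideal\<close>

lemma mult_adj:
  fixes A :: "'a::field mat"
  assumes "A \<in> carrier_mat k k" "det A \<noteq> 0" "v \<in> carrier_vec k"
  shows "A *\<^sub>v (inverse (det A) \<cdot>\<^sub>v (adj_mat A *\<^sub>v v)) = v"
proof -
  have adj: "adj_mat A \<in> carrier_mat k k" "A * adj_mat A = det A \<cdot>\<^sub>m 1\<^sub>m k"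
    using adj_mat[OF assms(1)] by auto
  have "A *\<^sub>v (inverse (det A) \<cdot>\<^sub>v (adj_mat A *\<^sub>v v)) = inverse (det A) \<cdot>\<^sub>v (A *\<^sub>v (adj_mat A *\<^sub>v v))"
    by (rule mult_mat_vec[OF assms(1)]) (use adj assms in auto)
  also have "A *\<^sub>v (adj_mat A *\<^sub>v v) = (A * adj_mat A) *\<^sub>v v"
    by (rule assoc_mult_mat_vec[symmetric, OF assms(1) adj(1) assms(3)])
  also have "\<dots> = det A \<cdot>\<^sub>v v"
    unfolding adj(2)
  proof (rule eq_vecI)
    fix i assume "i < dim_vec (det A \<cdot>\<^sub>v v)"
    then have i: "i < k" using assms(3) by simp
    have "row (det A \<cdot>\<^sub>m 1\<^sub>m k) i \<bullet> v = det A * (row (1\<^sub>m k) i \<bullet> v)"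
      using i assms(3) by (simp add: scalar_prod_def sum_distrib_left mult.assoc)
    then show "((det A \<cdot>\<^sub>m 1\<^sub>m k) *\<^sub>v v) $ i = (det A \<cdot>\<^sub>v v) $ i"
      using i assms(3) by simp
  qed (use assms(3) in simp)
  also have "inverse (det A) \<cdot>\<^sub>v (det A \<cdot>\<^sub>v v) = v"
    using assms(2,3) by (simp add: smult_smult_assoc)
  finally show ?thesis .
qed

lemma mult_left_cancel_mat:
  fixes A :: "'a::field mat"
  assumes A: "A \<in> carrier_mat k k" "det A \<noteq> 0" and B: "B \<in> carrier_mat k m" "C \<in> carrier_mat k m"
    and eq: "A * B = A * C"
  shows "B = C"
proof -
  have adj: "adj_mat A \<in> carrier_mat k k" "adj_mat A * A = det A \<cdot>\<^sub>m 1\<^sub>m k"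
    using adj_mat[OF A(1)] by auto
  have "det A \<cdot>\<^sub>m D = adj_mat A * (A * D)" if D: "D \<in> carrier_mat k m" for D
  proof -
    have "adj_mat A * (A * D) = adj_mat A * A * D"
      by (rule assoc_mult_mat[symmetric, OF adj(1) A(1) D])
    also have "\<dots> = det A \<cdot>\<^sub>m (1\<^sub>m k * D)"
      unfolding adj(2) by (rule mult_smult_assoc_mat[of _ k k _ m]) (use D in auto)
    finally show ?thesis using D by simp
  qed
  then have "det A \<cdot>\<^sub>m B = det A \<cdot>\<^sub>m C" using B eq by metis
  then show ?thesis
    using A(2) B by (auto intro!: eq_matI simp: mat_eq_iff)
qed

lemma mult_mat_vec_zero_iff:
  fixes A :: "'a::field mat"
  assumes "A \<in> carrier_mat k k" "det A \<noteq> 0" "v \<in> carrier_vec k"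
  shows "A *\<^sub>v v = 0\<^sub>v k \<longleftrightarrow> v = 0\<^sub>v k"
  using assms det_0_iff_vec_prod_zero_field[OF assms(1)] by (auto intro!: eq_vecI simp: scalar_prod_def)

context border_point
begin

definition vcoords :: "(nat, 'l) mpoly \<Rightarrow> 'l vec" where
  "vcoords p = vec \<mu> (\<lambda>i. lookup (NF p) (ts ! i))"

lemma vcoords_zero_iff: "vcoords p = 0\<^sub>v \<mu> \<longleftrightarrow> NF p = 0"
proof
  assume v: "vcoords p = 0\<^sub>v \<mu>"
  have "lookup (NF p) (ts ! i) = 0" if "i < \<mu>" for i
    using arg_cong[OF v, of "\<lambda>v. vec_index v i"] that by (simp add: vcoords_def)
  then show "NF p = 0" using keys_NF by (intro eq_on_ts) simp_all
qed (auto simp: vcoords_def intro!: eq_vecI)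

lemma vcoords_entry: "i < \<mu> \<Longrightarrow> vcoords p $ i = (\<Sum>m\<in>keys p. lookup p m * coords m $ i)"
  by (simp add: vcoords_def NF_def linear_extension_def lookup_sum lookup_nf)

lemma independent_iff_det:
  assumes "length us = \<mu>"
  shows "det (mat_of_cols \<mu> (map coords us)) \<noteq> 0 \<longleftrightarrow>
    inj_on (\<lambda>j. nf (us ! j)) {..<\<mu>} \<and> mp.independent (nf ` set us)"
proof -
  let ?A = "mat_of_cols \<mu> (map coords us)"
  have A: "?A \<in> carrier_mat \<mu> \<mu>" using mat_of_cols_carrier(1)[of \<mu> "map coords us"] assms by simp
  have "det ?A \<noteq> 0 \<longleftrightarrow> columns_independent ?A {..<\<mu>}"
    using A by (simp add: det_nonzero_iff[OF A] columns_independent_def Ball_def)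
  also have "\<dots> \<longleftrightarrow> inj_on (\<lambda>j. nf (us ! j)) {..<\<mu>} \<and> mp.independent ((\<lambda>j. nf (us ! j)) ` {..<\<mu>})"
    by (rule columns_independent_coords) (simp add: assms)
  also have "(\<lambda>j. nf (us ! j)) ` {..<\<mu>} = nf ` set us"
    using image_nth[of "nf" us] assms by simp
  finally show ?thesis .
qed

end

text \<open>
  The hypothesis on the determinant says that the second order ideal is a basis of the coordinate ring,
  too. The new point consists of the coordinates of its border terms, by Cramer's rule.
\<close>

locale change_of_order_ideal = border_point n ts bs \<Gamma> + new: enumerated n ts' bs'
  for n ts bs and \<Gamma> :: "'l::field mat" and ts' bs' +
  assumes len: "length ts' = length ts" and det: "det (mat_of_cols \<mu> (map coords ts')) \<noteq> 0"
begin

abbreviation TT :: "'l mat" where "TT \<equiv> mat_of_cols \<mu> (map coords ts')"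

definition new_point :: "'l mat" where
  "new_point = mat \<mu> (length bs') (\<lambda>(k, l). inverse (det TT) * (adj_mat TT *\<^sub>v coords (bs' ! l)) $ k)"

lemma TT_carrier: "TT \<in> carrier_mat \<mu> \<mu>"
  using mat_of_cols_carrier(1)[of \<mu> "map coords ts'"] by (simp add: len)

lemma TT_col: "j < \<mu> \<Longrightarrow> col TT j = coords (ts' ! j)"
  by (simp add: len)

lemma TT_new_point:
  assumes l: "l < length bs'"
  shows "TT *\<^sub>v col new_point l = coords (bs' ! l)"
proof -
  have "adj_mat TT *\<^sub>v coords (bs' ! l) \<in> carrier_vec \<mu>"
    using adj_mat(1)[OF TT_carrier] by auto
  then have "col new_point l = inverse (det TT) \<cdot>\<^sub>v (adj_mat TT *\<^sub>v coords (bs' ! l))"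
    using l carrier_matD[OF adj_mat(1)[OF TT_carrier]] by (intro eq_vecI) (auto simp: new_point_def)
  then show ?thesis
    using mult_adj[OF TT_carrier det coords_carrier] by simp
qed

abbreviation MM' :: "nat \<Rightarrow> 'l mat" where "MM' \<equiv> point_mult_mat ts' bs' new_point"

lemma MM'_carrier: "MM' r \<in> carrier_mat \<mu> \<mu>"
  using point_mult_mat_carrier[of ts' bs' new_point r] by (simp only: len)

lemma mult_var_border:
  assumes r: "r < n" and j: "j < \<mu>"
  shows "TT *\<^sub>v col (MM' r) j = coords (single r 1 + ts' ! j)"
proof (cases "single r 1 + ts' ! j \<in> set ts'")
  case True
  then obtain k where k: "k < \<mu>" "ts' ! k = single r 1 + ts' ! j" by (auto simp: in_set_conv_nth len)
  have "col (MM' r) j = unit_vec \<mu> k"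
  proof (rule eq_vecI)
    fix i assume "i < dim_vec (unit_vec \<mu> k :: 'l vec)"
    then have i: "i < \<mu>" by simp
    have "ts' ! i = ts' ! k \<longleftrightarrow> i = k"
      by (rule nth_eq_iff_index_eq[OF new.distinct_ts]) (use i k in \<open>simp_all add: len\<close>)
    then show "col (MM' r) j $ i = unit_vec \<mu> k $ i"
      using i j k True by (simp add: point_mult_mat_def Let_def len)
  qed (simp add: len)
  moreover have "TT *\<^sub>v unit_vec \<mu> k = col TT k"
    using TT_carrier k by (intro eq_vecI) (auto simp: len mat_of_cols_entry)
  ultimately show ?thesis using TT_col[OF k(1)] k(2) by simp
next
  case False
  then have "single r 1 + ts' ! j \<in> set bs'" using new.ts_or_bs[OF r, of "ts' ! j"] j by (simp add: len)
  then obtain m where m: "m < length bs'" "bs' ! m = single r 1 + ts' ! j" by (auto simp: in_set_conv_nth)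
  have "col (MM' r) j = col new_point m"
  proof (rule eq_vecI)
    fix i assume "i < dim_vec (col new_point m)"
    then have i: "i < \<mu>" by (simp add: new_point_def)
    show "col (MM' r) j $ i = col new_point m $ i"
      using i j m False new.border_index[OF m(1)] by (simp add: point_mult_mat_def Let_def len new_point_def)
  qed (simp add: len new_point_def)
  then show ?thesis using TT_new_point[OF m(1)] m(2) by simp
qed

text \<open>
  \<open>TT\<close> is the matrix of the base change, so the new multiplication matrices are conjugate to the old
  ones. In particular they commute.
\<close>

lemma TT_MM':
  assumes r: "r < n"
  shows "TT * MM' r = MM r * TT"
proof (rule mat_col_eqI)
  fix j assume "j < dim_col (MM r * TT)"
  then have j: "j < \<mu>" by (simp add: len)
  have "col (TT * MM' r) j = TT *\<^sub>v col (MM' r) j"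
    by (rule col_mult2[OF TT_carrier MM'_carrier j])
  also have "\<dots> = MM r *\<^sub>v col TT j"
    using mult_var_border[OF r j] coords_add_var[OF r, of "ts' ! j"] TT_col[OF j] by simp
  also have "\<dots> = col (MM r * TT) j"
    by (rule col_mult2[symmetric, OF point_mult_mat_carrier TT_carrier j])
  finally show "col (TT * MM' r) j = col (MM r * TT) j" .
qed (simp_all add: len)

lemma MM'_commute:
  assumes "r < n" "s < n"
  shows "MM' r * MM' s = MM' s * MM' r"
proof -
  have *: "TT * (MM' r * MM' s) = MM r * MM s * TT" if "r < n" "s < n" for r s
  proof -
    have "TT * (MM' r * MM' s) = TT * MM' r * MM' s"
      by (rule assoc_mult_mat[symmetric, OF TT_carrier MM'_carrier MM'_carrier])
    also have "\<dots> = MM r * TT * MM' s" by (simp only: TT_MM'[OF that(1)])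
    also have "\<dots> = MM r * (TT * MM' s)"
      by (rule assoc_mult_mat[OF point_mult_mat_carrier TT_carrier MM'_carrier])
    also have "\<dots> = MM r * (MM s * TT)" by (simp only: TT_MM'[OF that(2)])
    also have "\<dots> = MM r * MM s * TT"
      by (rule assoc_mult_mat[symmetric, OF point_mult_mat_carrier point_mult_mat_carrier TT_carrier])
    finally show ?thesis .
  qed
  have "TT * (MM' r * MM' s) = TT * (MM' s * MM' r)"
    using *[OF assms] *[OF assms(2,1)] mult_commute[OF assms] by simp
  then show ?thesis
    by (rule mult_left_cancel_mat[OF TT_carrier det mult_carrier_mat[OF MM'_carrier MM'_carrier]
        mult_carrier_mat[OF MM'_carrier MM'_carrier]])
qed

sublocale new: border_point n ts' bs' new_point
  by unfold_locales (rule MM'_commute)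

lemma TT_coords: "TT *\<^sub>v new.coords u = coords u"
proof -
  have c0: "new.EE u = eval_term n \<mu> MM' u" by (simp only: len)
  have EE'c: "new.EE u \<in> carrier_mat \<mu> \<mu>" unfolding c0 by (rule eval_term_carrier) (rule MM'_carrier)
  have "TT * new.EE u = EE u * TT"
    unfolding c0 by (rule eval_term_intertwine[OF point_mult_mat_carrier MM'_carrier TT_carrier TT_MM'])
  then have "col (TT * new.EE u) 0 = col (EE u * TT) 0" by simp
  moreover have "col (TT * new.EE u) 0 = TT *\<^sub>v new.coords u"
    unfolding new.coords_def by (rule col_mult2[OF TT_carrier EE'c length_ts_pos])
  moreover have "col (EE u * TT) 0 = EE u *\<^sub>v col TT 0"
    by (rule col_mult2[OF EE_carrier TT_carrier length_ts_pos])
  moreover have "col TT 0 = unit_vec \<mu> 0"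
    using TT_col[OF length_ts_pos] new.ts_zero coords_zero by simp
  moreover have "EE u *\<^sub>v unit_vec \<mu> 0 = col (EE u) 0"
    using length_ts_pos carrier_matD[OF EE_carrier, of u] by (intro eq_vecI) auto
  ultimately show ?thesis by (simp add: coords_def)
qed

lemma TT_vcoords: "TT *\<^sub>v new.vcoords p = vcoords p"
proof (rule eq_vecI)
  fix i assume "i < dim_vec (vcoords p)"
  then have i: "i < \<mu>" by (simp add: vcoords_def)
  have e: "(TT *\<^sub>v v) $ i = (\<Sum>k<\<mu>. TT $$ (i, k) * v $ k)" if "v \<in> carrier_vec \<mu>" for v
    using i that TT_carrier by (simp add: scalar_prod_def atLeast0LessThan len)
  have "new.vcoords p \<in> carrier_vec \<mu>" by (simp add: new.vcoords_def len)
  then have "(TT *\<^sub>v new.vcoords p) $ i = (\<Sum>k<\<mu>. TT $$ (i, k) * (\<Sum>m\<in>keys p. lookup p m * new.coords m $ k))"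
    by (simp add: e new.vcoords_entry len)
  also have "\<dots> = (\<Sum>m\<in>keys p. lookup p m * (\<Sum>k<\<mu>. TT $$ (i, k) * new.coords m $ k))"
    unfolding sum_distrib_left by (subst sum.swap) (simp add: mult.left_commute)
  also have "\<dots> = (\<Sum>m\<in>keys p. lookup p m * (TT *\<^sub>v new.coords m) $ i)"
  proof (rule sum.cong)
    fix m
    have "new.coords m \<in> carrier_vec \<mu>" using new.coords_carrier[of m] by (simp only: len)
    then show "lookup p m * (\<Sum>k<\<mu>. TT $$ (i, k) * new.coords m $ k) = lookup p m * (TT *\<^sub>v new.coords m) $ i"
      by (simp only: e)
  qed simp
  also have "\<dots> = vcoords p $ i" by (simp only: TT_coords vcoords_entry[OF i])
  finally show "(TT *\<^sub>v new.vcoords p) $ i = vcoords p $ i" .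
qed (simp add: vcoords_def)

text \<open>
  The base change carries the coordinates with respect to the new order ideal to those with respect to
  the old one, so that both normal forms have the same kernel.
\<close>

lemma I_point_new_point: "I_point n ts' bs' new_point = II"
proof -
  have "new.NF p = 0 \<longleftrightarrow> NF p = 0" for p
  proof -
    have c: "new.vcoords p \<in> carrier_vec \<mu>" by (simp add: new.vcoords_def len)
    have "new.NF p = 0 \<longleftrightarrow> new.vcoords p = 0\<^sub>v \<mu>" using new.vcoords_zero_iff[of p] by (simp only: len)
    also have "\<dots> \<longleftrightarrow> vcoords p = 0\<^sub>v \<mu>"
      using mult_mat_vec_zero_iff[OF TT_carrier det c] by (simp only: TT_vcoords)
    finally show ?thesis by (simp only: vcoords_zero_iff)
  qed
  moreover have "p \<in> II \<longleftrightarrow> p \<in> KXC n \<and> NF p = 0" for p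
    using NF_eq_zero_iff ideal_KX_subset[OF ideal_I_point] by blast
  moreover have "p \<in> I_point n ts' bs' new_point \<longleftrightarrow> p \<in> KXC n \<and> new.NF p = 0" for p
    using new.NF_eq_zero_iff ideal_KX_subset[OF new.ideal_I_point] by blast
  ultimately show ?thesis by blast
qed

end

section \<open>Vanishing of ideals at a point\<close>

definition vanishes :: "('k::comm_ring_1 \<Rightarrow> 'l::comm_ring_1) \<Rightarrow> ('v \<Rightarrow> 'l) \<Rightarrow> ('v, 'k) mpoly set \<Rightarrow> bool" where
  "vanishes \<iota> x S \<longleftrightarrow> (\<forall>f\<in>S. poly_subst \<iota> x f = 0)"

lemma mem_zero_locus:
  "\<Gamma> \<in> zero_locus \<iota> ts bs S \<longleftrightarrow> \<Gamma> \<in> carrier_mat (length ts) (length bs) \<and> vanishes \<iota> (($$) \<Gamma>) S"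
  by (simp add: zero_locus_def vanishes_def)

lemma vanishes_subset: "A \<subseteq> B \<Longrightarrow> vanishes \<iota> x B \<Longrightarrow> vanishes \<iota> x A"
  by (auto simp: vanishes_def)

lemma set_add_poly_ring: "A <+>\<^bsub>poly_ring V\<^esub> B = {a + b |a b. a \<in> A \<and> b \<in> B}"
  by (auto simp: set_add_def')

lemma ideal_zero_poly_ring: "ideal {0 :: ('v, 'a::comm_ring_1) mpoly} (poly_ring V)"
  using subring_set_zero[OF subring_set_poly_ring] by (simp add: ideal_poly_ring_iff)

lemma ideal_ideal_sum:
  "(\<And>i. i \<in> set xs \<Longrightarrow> ideal (J i) (poly_ring V)) \<Longrightarrow> ideal (ideal_sum (poly_ring V) J xs) (poly_ring V)"
proof (induction xs)
  case Nil
  then show ?case by (simp add: ideal_sum_def ideal_zero_poly_ring)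
next
  case (Cons i xs)
  then show ?case
    using ring.add_ideals[OF cring.axioms(1)[OF cring_poly_ring], of "J i" V "ideal_sum (poly_ring V) J xs"]
    by (simp add: ideal_sum_def)
qed

lemma ideal_Idl: "S \<subseteq> carrier (poly_ring V) \<Longrightarrow> ideal (Idl\<^bsub>poly_ring V\<^esub> S) (poly_ring V)"
  by (rule ring.genideal_ideal[OF cring.axioms(1)[OF cring_poly_ring]])

lemma ideal_set_add:
  "ideal A (poly_ring V) \<Longrightarrow> ideal B (poly_ring V) \<Longrightarrow> ideal (A <+>\<^bsub>poly_ring V\<^esub> B) (poly_ring V)"
  by (rule ring.add_ideals[OF cring.axioms(1)[OF cring_poly_ring]])

lemma ideal_poly_ring_zero: "ideal A (poly_ring V) \<Longrightarrow> 0 \<in> A"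
  by (simp add: ideal_poly_ring_iff)

context comm_ring_hom
begin

lemma vanishes_Idl:
  fixes S :: "('v, 'a) mpoly set"
  assumes S: "S \<subseteq> carrier (poly_ring V)"
  shows "vanishes hom x (Idl\<^bsub>poly_ring V\<^esub> S) \<longleftrightarrow> vanishes hom x S"
proof
  interpret R: cring "poly_ring V :: ('v, 'a) mpoly ring" by (rule cring_poly_ring)
  interpret E: comm_ring_hom "poly_subst hom x" by (rule comm_ring_hom_poly_subst)
  show "vanishes hom x S" if "vanishes hom x (Idl\<^bsub>poly_ring V\<^esub> S)"
    using R.genideal_self[OF S] that by (rule vanishes_subset)
  assume v: "vanishes hom x S"
  let ?K = "{f \<in> carrier (poly_ring V). poly_subst hom x f = 0}"
  have "ideal ?K (poly_ring V)"
    unfolding ideal_poly_ring_iff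
    using subring_set_zero[OF subring_set_poly_ring] subring_set_add[OF subring_set_poly_ring]
      subring_set_mult[OF subring_set_poly_ring]
    by (auto simp: E.hom_add E.hom_mult)
  moreover have "S \<subseteq> ?K" using S v by (auto simp: vanishes_def)
  ultimately have "Idl\<^bsub>poly_ring V\<^esub> S \<subseteq> ?K" by (rule R.genideal_minimal)
  then show "vanishes hom x (Idl\<^bsub>poly_ring V\<^esub> S)" by (auto simp: vanishes_def)
qed

lemma vanishes_set_add:
  assumes "ideal A (poly_ring V)" "ideal B (poly_ring V)"
  shows "vanishes hom x (A <+>\<^bsub>poly_ring V\<^esub> B) \<longleftrightarrow> vanishes hom x A \<and> vanishes hom x B"
proof
  assume v: "vanishes hom x (A <+>\<^bsub>poly_ring V\<^esub> B)"
  have "a + 0 \<in> A <+>\<^bsub>poly_ring V\<^esub> B" if "a \<in> A" for a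
    using that ideal_poly_ring_zero[OF assms(2)] unfolding set_add_poly_ring by blast
  moreover have "0 + b \<in> A <+>\<^bsub>poly_ring V\<^esub> B" if "b \<in> B" for b
    using that ideal_poly_ring_zero[OF assms(1)] unfolding set_add_poly_ring by blast
  ultimately show "vanishes hom x A \<and> vanishes hom x B"
    using v by (simp add: vanishes_def)
qed (auto simp: vanishes_def set_add_poly_ring poly_subst_add)

lemma vanishes_ideal_sum:
  "(\<And>i. i \<in> set xs \<Longrightarrow> ideal (J i) (poly_ring V)) \<Longrightarrow>
     vanishes hom x (ideal_sum (poly_ring V) J xs) \<longleftrightarrow> (\<forall>i\<in>set xs. vanishes hom x (J i))"
proof (induction xs)
  case Nil
  then show ?case by (simp add: ideal_sum_def vanishes_def)
next
  case (Cons i xs)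
  have "ideal (ideal_sum (poly_ring V) J xs) (poly_ring V)"
    using Cons.prems by (intro ideal_ideal_sum) simp
  with Cons show ?case
    using vanishes_set_add[of "J i" V "ideal_sum (poly_ring V) J xs"] by (simp add: ideal_sum_def)
qed

lemma hom_adj_mat:
  assumes A: "A \<in> carrier_mat k k"
  shows "adj_mat (map_mat hom A) = map_mat hom (adj_mat A)"
proof (rule eq_matI)
  fix i j assume "i < dim_row (map_mat hom (adj_mat A))" "j < dim_col (map_mat hom (adj_mat A))"
  then have ij: "i < k" "j < k" using adj_mat(1)[OF A] by auto
  have "mat_delete (map_mat hom A) j i = map_mat hom (mat_delete A j i)"
  proof (rule eq_matI)
    fix a b assume "a < dim_row (map_mat hom (mat_delete A j i))" "b < dim_col (map_mat hom (mat_delete A j i))"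
    then show "mat_delete (map_mat hom A) j i $$ (a, b) = map_mat hom (mat_delete A j i) $$ (a, b)"
      using A ij by (auto simp: mat_delete_def)
  qed (auto simp: mat_delete_def)
  then show "adj_mat (map_mat hom A) $$ (i, j) = map_mat hom (adj_mat A) $$ (i, j)"
    using A ij by (auto simp: adj_mat_def cofactor_def hom_mult hom_power hom_uminus)
qed (auto simp: adj_mat_def)

lemma hom_minors: "minors k (map_mat hom A) = hom ` minors k A"
proof -
  have sub: "submatrix (map_mat hom A) I J = map_mat hom (submatrix A I J)" for I J
  proof (rule eq_matI)
    fix i j assume "i < dim_row (map_mat hom (submatrix A I J))" "j < dim_col (map_mat hom (submatrix A I J))"
    then have "i < card {i. i < dim_row A \<and> i \<in> I}" "j < card {j. j < dim_col A \<and> j \<in> J}"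
      by (simp_all add: dim_submatrix)
    then show "submatrix (map_mat hom A) I J $$ (i, j) = map_mat hom (submatrix A I J) $$ (i, j)"
      using pick_le[of i "dim_row A" I] pick_le[of j "dim_col A" J]
      by (simp add: submatrix_def)
  qed (simp_all add: dim_submatrix)
  show ?thesis
    unfolding minors_def sub by (auto simp: image_iff)
qed

end

lemma (in idom_hom) vanishes_Int:
  assumes "ideal A (poly_ring V)" "ideal B (poly_ring V)"
  shows "vanishes hom x (A \<inter> B) \<longleftrightarrow> vanishes hom x A \<or> vanishes hom x B"
proof
  assume v: "vanishes hom x (A \<inter> B)"
  show "vanishes hom x A \<or> vanishes hom x B"
  proof (rule ccontr)
    assume "\<not> (vanishes hom x A \<or> vanishes hom x B)"
    then obtain a b where ab: "a \<in> A" "b \<in> B" "poly_subst hom x a \<noteq> 0" "poly_subst hom x b \<noteq> 0"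
      by (auto simp: vanishes_def)
    have "a * b \<in> B" "b * a \<in> A"
      using assms ab(1,2) by (auto simp: ideal_poly_ring_iff subset_iff)
    then have "poly_subst hom x (a * b) = 0" using v by (simp add: vanishes_def mult.commute)
    with ab show False by (simp add: poly_subst_mult)
  qed
qed (auto simp: vanishes_def)

lemma ideal_INT:
  assumes A: "\<And>i. i \<in> I \<Longrightarrow> ideal (A i) (poly_ring V)"
  shows "ideal (carrier (poly_ring V) \<inter> (\<Inter>i\<in>I. A i)) (poly_ring V)"
  unfolding ideal_poly_ring_iff
proof (intro conjI ballI)
  let ?B = "carrier (poly_ring V) \<inter> (\<Inter>i\<in>I. A i)"
  have add: "a + b \<in> A i" if "i \<in> I" "a \<in> A i" "b \<in> A i" for a b i
    using A[OF that(1)] that(2,3) by (simp add: ideal_poly_ring_iff)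
  have mult: "p * a \<in> A i" if "i \<in> I" "a \<in> A i" "p \<in> carrier (poly_ring V)" for a p i
    using A[OF that(1)] that(2,3) by (simp add: ideal_poly_ring_iff)
  show "0 \<in> ?B"
    by (intro IntI INT_I subring_set_zero[OF subring_set_poly_ring] ideal_poly_ring_zero[OF A])
  show "a + b \<in> ?B" if "a \<in> ?B" "b \<in> ?B" for a b
    by (intro IntI INT_I subring_set_add[OF subring_set_poly_ring] add) (use that in auto)
  show "p * a \<in> ?B" if "a \<in> ?B" "p \<in> carrier (poly_ring V)" for a p
    by (intro IntI INT_I subring_set_mult[OF subring_set_poly_ring] mult) (use that in auto)
qed simp

lemma (in idom_hom) vanishes_INT:
  assumes "finite I" "\<And>i. i \<in> I \<Longrightarrow> ideal (A i) (poly_ring V)"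
  shows "vanishes hom x (carrier (poly_ring V) \<inter> (\<Inter>i\<in>I. A i)) \<longleftrightarrow> (\<exists>i\<in>I. vanishes hom x (A i))"
  using assms
proof (induction I rule: finite_induct)
  case empty
  interpret E: comm_ring_hom "poly_subst hom x" by (rule comm_ring_hom_poly_subst)
  show ?case
    using subring_set_one[OF subring_set_poly_ring]
    by (auto simp: vanishes_def intro!: bexI[of _ 1])
next
  case (insert i I)
  let ?B = "carrier (poly_ring V) \<inter> (\<Inter>i\<in>I. A i)"
  have "carrier (poly_ring V) \<inter> (\<Inter>i\<in>insert i I. A i) = A i \<inter> ?B" by auto
  moreover have "vanishes hom x (A i \<inter> ?B) \<longleftrightarrow> vanishes hom x (A i) \<or> vanishes hom x ?B"
    by (rule vanishes_Int[OF _ ideal_INT]) (use insert.prems in auto)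
  ultimately show ?case using insert by simp
qed

subsection \<open>Generic multiplication matrices at a point\<close>

lemma mat_over_eval_term:
  assumes C: "subring_set C" and M: "\<And>r. r < n \<Longrightarrow> mat_over C k k (M r)"
  shows "mat_over C k k (eval_term n k M t)"
proof -
  have "mat_over C k k (foldr (\<lambda>r A. (M r ^\<^sub>m lookup t r) * A) rs (1\<^sub>m k))" if "set rs \<subseteq> {..<n}" for rs
    using that by (induction rs) (auto intro: mat_over_one mat_over_mult mat_over_pow C M)
  then show ?thesis by (simp add: eval_term_def atLeast0LessThan)
qed

lemma gen_mult_mat_carrier [simp]: "gen_mult_mat ts bs r \<in> carrier_mat (length ts) (length ts)"
  by (simp add: gen_mult_mat_def)

context enumerated
begin

lemma mat_over_gen_mult_mat:
  assumes "r < n"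
  shows "mat_over (carrier (KC ts bs)) (length ts) (length ts)
    (gen_mult_mat ts bs r :: (nat \<times> nat, 'a::comm_ring_1) mpoly mat)"
  unfolding mat_over_def
proof (intro conjI allI impI)
  fix i j assume ij: "i < length ts" "j < length ts"
  let ?u = "single r 1 + ts ! j"
  have "(var (i, THE m. m < length bs \<and> bs ! m = ?u) :: (nat \<times> nat, 'a) mpoly) \<in> carrier (KC ts bs)"
    if "?u \<notin> set ts"
  proof -
    have "?u \<in> set bs" using ts_or_bs[OF assms, of "ts ! j"] that ij by simp
    then obtain m where m: "m < length bs" "bs ! m = ?u" by (auto simp: in_set_conv_nth)
    then show ?thesis
      using border_index[OF m(1)] ij by (intro var_in_poly_ring) (simp add: m(2))
  qed
  then show "(gen_mult_mat ts bs r :: (nat \<times> nat, 'a) mpoly mat) $$ (i, j) \<in> carrier (KC ts bs)"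
    using ij by (simp add: gen_mult_mat_def Let_def subring_set_zero[OF subring_set_poly_ring]
        subring_set_one[OF subring_set_poly_ring])
qed simp

lemma mat_over_generic_eval_term:
  "mat_over (carrier (KC ts bs)) (length ts) (length ts) (eval_term n (length ts) (gen_mult_mat ts bs) u)"
  by (rule mat_over_eval_term[OF subring_set_poly_ring mat_over_gen_mult_mat])

lemma first_col_carrier: "first_col n ts bs u \<in> carrier_vec (length ts)"
  unfolding first_col_def
  by (rule col_carrier_vec[OF length_ts_pos mat_over_carrier[OF mat_over_generic_eval_term]])

lemma first_col_entry:
  assumes i: "i < length ts"
  shows "(first_col n ts bs u :: (nat \<times> nat, 'a::comm_ring_1) mpoly vec) $ i \<in> carrier (KC ts bs)"
proof -
  let ?E = "eval_term n (length ts) (gen_mult_mat ts bs) u :: (nat \<times> nat, 'a) mpoly mat"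
  have "?E $$ (i, 0) \<in> carrier (KC ts bs)"
    by (rule mat_over_entry[OF mat_over_generic_eval_term i length_ts_pos])
  moreover have "col ?E 0 $ i = ?E $$ (i, 0)"
    using carrier_matD[OF mat_over_carrier[OF mat_over_generic_eval_term[of u, where 'a = 'a]]] i length_ts_pos
    by (intro index_col) simp_all
  ultimately show ?thesis by (simp add: first_col_def)
qed

lemma mat_over_first_cols:
  "mat_over (carrier (KC ts bs)) (length ts) (length us) (mat_of_cols (length ts) (map (first_col n ts bs) us))"
  using mat_of_cols_carrier(1)[of "length ts" "map (first_col n ts bs) us"]
  by (auto simp: mat_over_def mat_of_cols_entry first_col_entry)

definition commutator_entries :: "(nat \<times> nat, 'a::comm_ring_1) mpoly set" where
  "commutator_entries = {(gen_mult_mat ts bs r * gen_mult_mat ts bs s - gen_mult_mat ts bs s * gen_mult_mat ts bs r)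
     $$ (i, j) | r s i j. r < n \<and> s < n \<and> i < length ts \<and> j < length ts}"

lemma I_BO_eq: "I_BO n ts bs = Idl\<^bsub>KC ts bs\<^esub> commutator_entries"
  by (simp add: I_BO_def commutator_entries_def Let_def)

lemma commutator_entries_subset: "commutator_entries \<subseteq> carrier (KC ts bs)"
proof
  fix x :: "(nat \<times> nat, 'a) mpoly" assume "x \<in> commutator_entries"
  then obtain r s i j where x: "x = (gen_mult_mat ts bs r * gen_mult_mat ts bs s - gen_mult_mat ts bs s * gen_mult_mat ts bs r) $$ (i, j)"
    and rs: "r < n" "s < n" and ij: "i < length ts" "j < length ts"
    unfolding commutator_entries_def by blast
  have o: "mat_over (carrier (KC ts bs)) (length ts) (length ts) (gen_mult_mat ts bs r * gen_mult_mat ts bs s :: (nat \<times> nat, 'a) mpoly mat)"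
    if "r < n" "s < n" for r s
    by (rule mat_over_mult[OF subring_set_poly_ring mat_over_gen_mult_mat[OF that(1)] mat_over_gen_mult_mat[OF that(2)]])
  have "x = (gen_mult_mat ts bs r * gen_mult_mat ts bs s) $$ (i, j) - (gen_mult_mat ts bs s * gen_mult_mat ts bs r) $$ (i, j)"
    unfolding x using ij carrier_matD[OF mat_over_carrier[OF o[OF rs(2,1)]]] by (intro index_minus_mat) auto
  then show "x \<in> carrier (KC ts bs)"
    using mat_over_entry[OF o[OF rs] ij] mat_over_entry[OF o[OF rs(2,1)] ij]
      subring_set_diff[OF subring_set_poly_ring] by simp
qed

lemma ideal_I_BO: "ideal (I_BO n ts bs) (KC ts bs)"
  unfolding I_BO_eq by (rule ideal_Idl[OF commutator_entries_subset])

lemma vanishes_I_BO_iff: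
  fixes \<iota> :: "'k::comm_ring_1 \<Rightarrow> 'l::comm_ring_1"
  assumes "comm_ring_hom \<iota>"
  shows "vanishes \<iota> (($$) \<Gamma>) (I_BO n ts bs) \<longleftrightarrow> (\<forall>r<n. \<forall>s<n.
    point_mult_mat ts bs \<Gamma> r * point_mult_mat ts bs \<Gamma> s = point_mult_mat ts bs \<Gamma> s * point_mult_mat ts bs \<Gamma> r)"
    (is "_ \<longleftrightarrow> ?R")
proof -
  interpret h: comm_ring_hom \<iota> by fact
  interpret E: comm_ring_hom "poly_subst \<iota> (($$) \<Gamma>)" by (rule h.comm_ring_hom_poly_subst)
  let ?\<mu> = "length ts" and ?G = "gen_mult_mat ts bs :: nat \<Rightarrow> (nat \<times> nat, 'k) mpoly mat" and ?M = "point_mult_mat ts bs \<Gamma>"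
  have G: "?G r * ?G s \<in> carrier_mat ?\<mu> ?\<mu>" for r s
    by (rule mult_carrier_mat[of _ ?\<mu> ?\<mu>]) simp_all
  have M: "?M r * ?M s \<in> carrier_mat ?\<mu> ?\<mu>" for r s
    by (rule mult_carrier_mat[of _ ?\<mu> ?\<mu>]) simp_all
  have p: "poly_subst \<iota> (($$) \<Gamma>) ((?G r * ?G s) $$ (i, j)) = (?M r * ?M s) $$ (i, j)"
    if "i < ?\<mu>" "j < ?\<mu>" for r s i j
  proof -
    have "map_mat (poly_subst \<iota> (($$) \<Gamma>)) (?G r * ?G s) = ?M r * ?M s"
      by (subst E.mat_hom_mult[of _ ?\<mu> ?\<mu> _ ?\<mu>]) (simp_all add: h.hom_gen_mult_mat)
    from arg_cong[OF this, of "\<lambda>A. A $$ (i, j)"] show ?thesis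
      using that carrier_matD[OF G, of r s] by simp
  qed
  have e: "poly_subst \<iota> (($$) \<Gamma>) ((?G r * ?G s - ?G s * ?G r) $$ (i, j)) =
      (?M r * ?M s) $$ (i, j) - (?M s * ?M r) $$ (i, j)" if "i < ?\<mu>" "j < ?\<mu>" for r s i j
  proof -
    have "(?G r * ?G s - ?G s * ?G r) $$ (i, j) = (?G r * ?G s) $$ (i, j) - (?G s * ?G r) $$ (i, j)"
      using that carrier_matD[OF G, of s r] by (intro index_minus_mat(1)) simp_all
    then show ?thesis by (simp only: E.hom_minus p[OF that])
  qed
  have "vanishes \<iota> (($$) \<Gamma>) (I_BO n ts bs) \<longleftrightarrow> vanishes \<iota> (($$) \<Gamma>) commutator_entries"
    unfolding I_BO_eq by (rule h.vanishes_Idl[OF commutator_entries_subset])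
  also have "\<dots> \<longleftrightarrow> (\<forall>r<n. \<forall>s<n. \<forall>i<?\<mu>. \<forall>j<?\<mu>. (?M r * ?M s) $$ (i, j) = (?M s * ?M r) $$ (i, j))"
    unfolding vanishes_def commutator_entries_def using e by fastforce
  also have "\<dots> \<longleftrightarrow> ?R"
  proof -
    have "A = B \<longleftrightarrow> (\<forall>i<?\<mu>. \<forall>j<?\<mu>. A $$ (i, j) = B $$ (i, j))"
      if "A \<in> carrier_mat ?\<mu> ?\<mu>" "B \<in> carrier_mat ?\<mu> ?\<mu>" for A B :: "'l mat"
      using that by (auto simp: mat_eq_iff)
    from this[OF M M] show ?thesis by simp
  qed
  finally show ?thesis .
qed

end

context border_point
begin

lemma hom_first_col:
  fixes \<iota> :: "'k::comm_ring_1 \<Rightarrow> 'l"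
  assumes "comm_ring_hom \<iota>" "i < \<mu>"
  shows "poly_subst \<iota> (($$) \<Gamma>) (first_col n ts bs u $ i) = coords u $ i"
proof -
  interpret h: comm_ring_hom \<iota> by fact
  interpret E: comm_ring_hom "poly_subst \<iota> (($$) \<Gamma>)" by (rule h.comm_ring_hom_poly_subst)
  let ?G = "gen_mult_mat ts bs :: nat \<Rightarrow> (nat \<times> nat, 'k) mpoly mat"
  have "map_mat (poly_subst \<iota> (($$) \<Gamma>)) (eval_term n \<mu> ?G u) = EE u"
    using E.hom_eval_term[of ?G \<mu> n u] by (simp add: h.hom_gen_mult_mat)
  from arg_cong[OF this, of "\<lambda>A. A $$ (i, 0)"] show ?thesis
    using assms(2) length_ts_pos carrier_matD[OF EE_carrier, of u]
      carrier_matD[OF eval_term_carrier[of ?G \<mu> n u]]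
    by (simp add: first_col_def coords_def)
qed

lemma hom_first_cols:
  assumes "comm_ring_hom \<iota>"
  shows "map_mat (poly_subst \<iota> (($$) \<Gamma>)) (mat_of_cols \<mu> (map (first_col n ts bs) us)) = mat_of_cols \<mu> (map coords us)"
  by (rule eq_matI) (auto simp: mat_of_cols_entry hom_first_col[OF assms])

end

context enumerated
begin

definition column_minors :: "(nat \<Rightarrow> nat) \<Rightarrow> nat \<Rightarrow> (nat \<times> nat, 'a::comm_ring_1) mpoly set" where
  "column_minors G i = minors (G i + 1) (mat_of_cols (length ts)
     (map (first_col n ts bs) (sorted_list_of_set {u \<in> terms n. mdeg u \<le> i})))"

lemma column_minors_subset: "column_minors G i \<subseteq> carrier (KC ts bs)"
  unfolding column_minors_def by (rule minors_subset[OF subring_set_poly_ring mat_over_first_cols])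

lemma I_BO_bar_eq: "I_BO_bar n ts bs G = I_BO n ts bs <+>\<^bsub>KC ts bs\<^esub>
    ideal_sum (KC ts bs) (\<lambda>i. Idl\<^bsub>KC ts bs\<^esub> (column_minors G i)) [1..<LEAST i. G i = length ts]"
  by (simp add: I_BO_bar_def column_minors_def Let_def)

lemma ideal_I_BO_bar: "ideal (I_BO_bar n ts bs G) (KC ts bs)"
  unfolding I_BO_bar_eq
  by (intro ideal_set_add ideal_I_BO ideal_ideal_sum ideal_Idl column_minors_subset)

end

context border_point
begin

lemma vanishes_I_BO: "comm_ring_hom \<iota> \<Longrightarrow> vanishes \<iota> (($$) \<Gamma>) (I_BO n ts bs)"
  using vanishes_I_BO_iff mult_commute by blast

lemma vanishes_column_minors_iff:
  fixes \<iota> :: "'k::comm_ring_1 \<Rightarrow> 'l"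
  assumes \<iota>: "comm_ring_hom \<iota>"
  shows "vanishes \<iota> (($$) \<Gamma>) (column_minors G i) \<longleftrightarrow> HFa n II i \<le> G i"
proof -
  interpret h: comm_ring_hom \<iota> by fact
  interpret E: comm_ring_hom "poly_subst \<iota> (($$) \<Gamma>)" by (rule h.comm_ring_hom_poly_subst)
  have "vanishes \<iota> (($$) \<Gamma>) (column_minors G i) \<longleftrightarrow> (\<forall>x\<in>poly_subst \<iota> (($$) \<Gamma>) ` column_minors G i. x = 0)"
    by (simp add: vanishes_def)
  also have "poly_subst \<iota> (($$) \<Gamma>) ` column_minors G i = minors (Suc (G i))
      (mat_of_cols \<mu> (map coords (sorted_list_of_set {u \<in> terms n. mdeg u \<le> i})))"
    unfolding column_minors_def E.hom_minors[symmetric] hom_first_cols[OF \<iota>] by simp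
  finally show ?thesis by (simp add: HFa_le_iff_minors)
qed

lemma vanishes_I_BO_bar_iff:
  fixes \<iota> :: "'k::comm_ring_1 \<Rightarrow> 'l"
  assumes \<iota>: "comm_ring_hom \<iota>"
  shows "vanishes \<iota> (($$) \<Gamma>) (I_BO_bar n ts bs G) \<longleftrightarrow> (\<forall>i\<in>{1..<LEAST i. G i = \<mu>}. HFa n II i \<le> G i)"
proof -
  interpret h: comm_ring_hom \<iota> by fact
  have "vanishes \<iota> (($$) \<Gamma>) (Idl\<^bsub>KC ts bs\<^esub> (column_minors G i)) \<longleftrightarrow> HFa n II i \<le> G i" for i
    unfolding h.vanishes_Idl[OF column_minors_subset] by (rule vanishes_column_minors_iff[OF \<iota>])
  note minors = this
  let ?D = "\<lambda>i. Idl\<^bsub>KC ts bs\<^esub> (column_minors G i) :: (nat \<times> nat, 'k) mpoly set"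
  let ?is = "[1..<LEAST i. G i = \<mu>]"
  have D: "ideal (?D i) (KC ts bs)" for i by (rule ideal_Idl[OF column_minors_subset])
  have "vanishes \<iota> (($$) \<Gamma>) (I_BO_bar n ts bs G) \<longleftrightarrow>
      vanishes \<iota> (($$) \<Gamma>) (I_BO n ts bs) \<and> vanishes \<iota> (($$) \<Gamma>) (ideal_sum (KC ts bs) ?D ?is)"
    unfolding I_BO_bar_eq by (rule h.vanishes_set_add[OF ideal_I_BO ideal_ideal_sum[OF D]])
  also have "vanishes \<iota> (($$) \<Gamma>) (ideal_sum (KC ts bs) ?D ?is) \<longleftrightarrow> (\<forall>i\<in>set ?is. vanishes \<iota> (($$) \<Gamma>) (?D i))"
    by (rule h.vanishes_ideal_sum[OF D])
  finally show ?thesis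
    using vanishes_I_BO[OF \<iota>] by (simp add: minors)
qed

end

section \<open>Order ideals adapted to a point\<close>

text \<open>
  Degree-compatibility is what relates leading terms to the filtration by degree. Ties are broken by an
  arbitrary total order that is compatible with multiplication.
\<close>

definition prec :: "nat monom \<Rightarrow> nat monom \<Rightarrow> bool" (infix \<open>\<prec>\<close> 50) where
  "u \<prec> v \<longleftrightarrow> mdeg u < mdeg v \<or> mdeg u = mdeg v \<and> u < v"

lemma prec_irrefl: "\<not> u \<prec> u"
  by (simp add: prec_def)

lemma prec_trans: "u \<prec> v \<Longrightarrow> v \<prec> w \<Longrightarrow> u \<prec> w"
  by (auto simp: prec_def)

lemma prec_total: "u = v \<or> u \<prec> v \<or> v \<prec> u"
  by (auto simp: prec_def)

lemma prec_mdeg: "u \<prec> v \<Longrightarrow> mdeg u \<le> mdeg v"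
  by (auto simp: prec_def)

lemma prec_add: "u \<prec> v \<Longrightarrow> w + u \<prec> w + v"
  by (auto simp: prec_def mdeg_add add_strict_left_mono)

text \<open>
  Only finitely many terms precede a given one, so that induction along the term order is induction on
  this number.
\<close>

definition rank_below :: "nat \<Rightarrow> nat monom \<Rightarrow> nat" where
  "rank_below n u = card {v \<in> terms n. v \<prec> u}"

lemma finite_below: "finite {v \<in> terms n. v \<prec> u}"
  by (rule finite_subset[OF _ finite_terms_le[of n "mdeg u"]]) (auto dest: prec_mdeg)

lemma rank_below_mono:
  assumes "u \<prec> v" "u \<in> terms n"
  shows "rank_below n u < rank_below n v"
  unfolding rank_below_def
proof (rule psubset_card_mono[OF finite_below])
  show "{w \<in> terms n. w \<prec> u} \<subset> {w \<in> terms n. w \<prec> v}"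
    using assms prec_trans[OF _ assms(1)] prec_irrefl[of u] by blast
qed

context border_point
begin

lemma NF_mult_NF:
  assumes "p \<in> KXC n" "q \<in> KXC n"
  shows "NF (p * NF q) = NF (p * q)"
proof -
  have "NF (p * (q - NF q)) = 0"
    by (rule NF_mult_zero) (simp_all add: mlinear_diff[OF mlinear_NF] assms)
  then show ?thesis
    by (simp add: right_diff_distrib mlinear_diff[OF mlinear_NF])
qed

lemma single_term_in_KXC: "t \<in> terms n \<Longrightarrow> single t c \<in> KXC n"
  by (rule single_in_poly_ring) (simp add: terms_def)

lemma NF_single_mult_nf:
  assumes "w \<in> terms n" "u \<in> terms n"
  shows "NF (single w 1 * nf u) = nf (w + u)"
  using NF_mult_NF[OF single_term_in_KXC[OF assms(1), of 1] single_term_in_KXC[OF assms(2), of 1]]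
  by (simp add: Poly_Mapping.mult_single)

text \<open>
  The terms whose residue class is not a combination of those of smaller terms, i.e. the
  complement of the leading term ideal. Because the order of terms is compatible with
  degrees, these terms have the affine Hilbert function of the scheme.
\<close>

definition standard_terms :: "nat monom set" where
  "standard_terms = {u \<in> terms n. nf u \<notin> mp.span (nf ` {v \<in> terms n. v \<prec> u})}"

lemma standard_terms_divisor:
  assumes "s + w \<in> standard_terms"
  shows "s \<in> standard_terms"
proof (rule ccontr)
  assume ns: "s \<notin> standard_terms"
  have sw: "s + w \<in> terms n" and sw': "nf (s + w) \<notin> mp.span (nf ` {v \<in> terms n. v \<prec> s + w})"
    using assms by (auto simp: standard_terms_def)
  have "keys (s + w) = keys s \<union> keys w" by (auto simp: in_keys_iff lookup_add)
  then have s: "s \<in> terms n" and w: "w \<in> terms n" using sw by (auto simp: terms_def)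
  let ?g = "\<lambda>p. NF (single w 1 * p)"
  have g: "mlinear ?g" by (rule mlinear_comp[OF mlinear_NF mlinear_mult_left])
  have "nf s \<in> mp.span (nf ` {v \<in> terms n. v \<prec> s})" using ns s by (simp add: standard_terms_def)
  then have "?g (nf s) \<in> ?g ` mp.span (nf ` {v \<in> terms n. v \<prec> s})" by (rule imageI)
  then have "nf (w + s) \<in> mp.span (?g ` nf ` {v \<in> terms n. v \<prec> s})"
    by (simp only: NF_single_mult_nf[OF w s] mlinear_span_image[OF g])
  moreover have "?g ` nf ` {v \<in> terms n. v \<prec> s} \<subseteq> nf ` {v \<in> terms n. v \<prec> s + w}"
  proof
    fix x assume "x \<in> ?g ` nf ` {v \<in> terms n. v \<prec> s}"
    then obtain v where v: "v \<in> terms n" "v \<prec> s" "x = ?g (nf v)" by blast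
    then have "x = nf (w + v)" by (simp only: NF_single_mult_nf[OF w v(1)])
    moreover have "w + v \<in> terms n" by (rule add_in_terms[OF w v(1)])
    moreover have "w + v \<prec> s + w" using prec_add[OF v(2), of w] by (simp only: add.commute)
    ultimately show "x \<in> nf ` {v \<in> terms n. v \<prec> s + w}" by blast
  qed
  ultimately have "nf (w + s) \<in> mp.span (nf ` {v \<in> terms n. v \<prec> s + w})"
    using mp.span_mono by blast
  then show False using sw' by (simp only: add.commute[of w s])
qed

lemma nf_in_span_standard:
  "u \<in> terms n \<Longrightarrow> nf u \<in> mp.span (nf ` {v \<in> standard_terms. v = u \<or> v \<prec> u})"
proof (induction "rank_below n u" arbitrary: u rule: less_induct)
  case less
  let ?S = "\<lambda>u. {v \<in> standard_terms. v = u \<or> v \<prec> u}"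
  show ?case
  proof (cases "u \<in> standard_terms")
    case True
    then show ?thesis by (intro mp.span_base) blast
  next
    case False
    have "nf ` {v \<in> terms n. v \<prec> u} \<subseteq> mp.span (nf ` ?S u)"
    proof (rule image_subsetI)
      fix v assume v: "v \<in> {v \<in> terms n. v \<prec> u}"
      then have "nf v \<in> mp.span (nf ` ?S v)"
        using less.hyps[of v] rank_below_mono[of v u n] by simp
      moreover have "?S v \<subseteq> ?S u" using v prec_trans by blast
      ultimately show "nf v \<in> mp.span (nf ` ?S u)" using mp.span_mono[OF image_mono] by blast
    qed
    moreover have "nf u \<in> mp.span (nf ` {v \<in> terms n. v \<prec> u})"
      using False less.prems by (simp add: standard_terms_def)
    ultimately show ?thesis using mp.span_minimal[OF _ mp.subspace_span] by blast
  qed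
qed

text \<open>The largest term of a nontrivial relation would be a combination of smaller ones.\<close>

lemma standard_independent:
  assumes F: "finite F" "F \<subseteq> standard_terms"
  shows "inj_on nf F \<and> mp.independent (nf ` F)"
  unfolding family_independent_iff[OF F(1), symmetric]
proof (intro allI impI)
  fix c assume c: "(\<Sum>u\<in>F. smul (c u) (nf u)) = 0"
  show "\<forall>u\<in>F. c u = 0"
  proof (rule ccontr)
    assume nz: "\<not> (\<forall>u\<in>F. c u = 0)"
    let ?G = "{u \<in> F. c u \<noteq> 0}"
    have G: "finite ?G" "?G \<noteq> {}" using F nz by auto
    have "Max (rank_below n ` ?G) \<in> rank_below n ` ?G" by (rule Max_in) (use G in auto)
    then obtain u where uG: "u \<in> ?G" "rank_below n u = Max (rank_below n ` ?G)" by auto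
    then have u: "u \<in> F" "c u \<noteq> 0" by auto
    have u_max: "rank_below n v \<le> rank_below n u" if "v \<in> ?G" for v
      unfolding uG(2) by (rule Max_ge) (use G that in auto)
    have ut: "u \<in> terms n" "nf u \<notin> mp.span (nf ` {v \<in> terms n. v \<prec> u})"
      using u(1) F(2) by (auto simp: standard_terms_def)
    have below: "v \<prec> u" if "v \<in> F" "v \<noteq> u" "c v \<noteq> 0" for v
    proof -
      have "\<not> u \<prec> v" using u_max[of v] that rank_below_mono[of u v n] ut(1) by auto
      then show ?thesis using prec_total[of u v] that by blast
    qed
    have "smul (c v) (nf v) \<in> mp.span (nf ` {v \<in> terms n. v \<prec> u})" if v: "v \<in> F - {u}" for v
    proof (cases "c v = 0")
      case False
      then have "v \<in> {v \<in> terms n. v \<prec> u}" using below v F(2) by (auto simp: standard_terms_def)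
      then show ?thesis by (intro mp.span_scale mp.span_base imageI)
    qed (simp add: mp.span_zero)
    then have "(\<Sum>v\<in>F - {u}. smul (c v) (nf v)) \<in> mp.span (nf ` {v \<in> terms n. v \<prec> u})"
      by (rule mp.span_sum)
    moreover have "smul (c u) (nf u) = - (\<Sum>v\<in>F - {u}. smul (c v) (nf v))"
      using c sum.remove[OF F(1) u(1), of "\<lambda>v. smul (c v) (nf v)"] by (simp add: eq_neg_iff_add_eq_0)
    ultimately have "smul (c u) (nf u) \<in> mp.span (nf ` {v \<in> terms n. v \<prec> u})"
      using mp.span_neg by simp
    then have "smul (inverse (c u)) (smul (c u) (nf u)) \<in> mp.span (nf ` {v \<in> terms n. v \<prec> u})"
      by (rule mp.span_scale)
    with u(2) ut(2) show False by simp
  qed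
qed

lemma card_standard_terms: "card {u \<in> standard_terms. mdeg u \<le> d} = HFa n II d"
proof -
  let ?S = "{u \<in> standard_terms. mdeg u \<le> d}" and ?T = "{u \<in> terms n. mdeg u \<le> d}"
  have ST: "?S \<subseteq> ?T" by (auto simp: standard_terms_def)
  have fin: "finite ?S" by (rule finite_subset[OF ST finite_terms_le])
  have ind: "inj_on nf ?S" "mp.independent (nf ` ?S)"
    using standard_independent[OF fin] by auto
  have "nf ` ?T \<subseteq> mp.span (nf ` ?S)"
  proof (rule image_subsetI)
    fix u assume u: "u \<in> ?T"
    have "{v \<in> standard_terms. v = u \<or> v \<prec> u} \<subseteq> ?S" using u prec_mdeg[of _ u] by fastforce
    then show "nf u \<in> mp.span (nf ` ?S)"
      using nf_in_span_standard[of u] u mp.span_mono[OF image_mono] by blast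
  qed
  moreover have "nf ` ?S \<subseteq> mp.span (nf ` ?T)" using ST mp.span_superset[of "nf ` ?T"] by blast
  ultimately have "mp.span (nf ` ?S) = mp.span (nf ` ?T)" by (simp add: mp.span_eq)
  then have "mp.dim (nf ` ?S) = mp.dim (nf ` ?T)" by (rule mp.span_eq_dim)
  then show ?thesis
    using mp.dim_eq_card_independent[OF ind(2)] ind(1) by (simp add: HFa_eq_dim card_image)
qed

lemma finite_standard_terms: "finite standard_terms"
proof -
  have "card F \<le> \<mu>" if F: "F \<subseteq> standard_terms" "finite F" for F
  proof -
    define d where "d = Max (insert 0 (mdeg ` F))"
    have sub: "F \<subseteq> {u \<in> standard_terms. mdeg u \<le> d}" using F by (auto simp: d_def)
    have "finite {u \<in> standard_terms. mdeg u \<le> d}"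
      by (rule finite_subset[OF _ finite_terms_le[of n d]]) (auto simp: standard_terms_def)
    from card_mono[OF this sub] have "card F \<le> HFa n II d" by (simp only: card_standard_terms)
    then show ?thesis using HFa_le_length[of d] by simp
  qed
  then show ?thesis by (rule finite_if_finite_subsets_card_bdd[THEN conjunct1])
qed

lemma order_ideal_standard_terms: "order_ideal n standard_terms"
  unfolding order_ideal_def
proof (intro conjI ballI allI impI)
  show "finite standard_terms" by (rule finite_standard_terms)
  have "{u \<in> standard_terms. mdeg u \<le> 0} \<noteq> {}"
    using card_standard_terms[of 0] HFa_zero by (metis card.empty zero_neq_one)
  then show "standard_terms \<noteq> {}" by blast
  show "standard_terms \<subseteq> terms n" by (auto simp: standard_terms_def)
  show "s \<in> standard_terms" if "t \<in> standard_terms" "t = s + u" for t s u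
    using that standard_terms_divisor by simp
qed

lemma HFa_standard_terms: "HFa_terms standard_terms = HFa n II"
  by (rule ext) (simp add: HFa_terms_def card_standard_terms)

lemma det_standard_terms:
  assumes "set us = standard_terms" "distinct us" "length us = \<mu>"
  shows "det (mat_of_cols \<mu> (map coords us)) \<noteq> 0"
proof -
  have "inj_on nf (set us)" "mp.independent (nf ` set us)"
    using standard_independent[OF finite_standard_terms subset_refl] assms(1) by auto
  moreover have "inj_on (\<lambda>j. nf (us ! j)) {..<\<mu>}"
  proof (rule inj_onI)
    fix x y assume xy: "x \<in> {..<\<mu>}" "y \<in> {..<\<mu>}" "nf (us ! x) = nf (us ! y)"
    then have "us ! x = us ! y"
      using inj_onD[OF \<open>inj_on nf (set us)\<close> xy(3)] assms(3) by simp
    then show "x = y" using xy(1,2) assms(2,3) by (simp add: nth_eq_iff_index_eq)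
  qed
  ultimately show ?thesis using independent_iff_det[OF assms(3)] by blast
qed

end

section \<open>The Cayley-Bacharach locus\<close>

text \<open>The terms are enumerated by increasing degree, so the terms of top degree come last.\<close>

lemma (in enumerated) last_block:
  assumes "i < length ts"
  shows "mdeg (ts ! i) = mdeg (last ts) \<longleftrightarrow>
    length ts - card {i. i < length ts \<and> mdeg (ts ! i) = mdeg (last ts)} \<le> i"
proof -
  let ?S = "{i. i < length ts \<and> mdeg (ts ! i) = mdeg (last ts)}"
  have last: "last ts = ts ! (length ts - 1)" using length_ts_pos by (intro last_conv_nth) auto
  have mono: "mdeg (ts ! i) \<le> mdeg (ts ! j)" if "i \<le> j" "j < length ts" for i j
    using sorted_nth_mono[OF sorted_ts, of i j] that by simp
  have ne: "length ts - 1 \<in> ?S" using last length_ts_pos by simp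
  define m where "m = Min ?S"
  have m: "m \<in> ?S" unfolding m_def by (rule Min_in) (use ne in auto)
  have "?S = {m..<length ts}"
  proof
    show "?S \<subseteq> {m..<length ts}" using Min_le[of ?S] by (auto simp: m_def)
    show "{m..<length ts} \<subseteq> ?S"
    proof
      fix j assume j: "j \<in> {m..<length ts}"
      then have "mdeg (ts ! m) \<le> mdeg (ts ! j)" "mdeg (ts ! j) \<le> mdeg (last ts)"
        unfolding last by (auto intro!: mono)
      with m j show "j \<in> ?S" by simp
    qed
  qed
  moreover from this have "length ts - card ?S = m" using m by simp
  ultimately show ?thesis using assms by (metis (mono_tags, lifting) atLeastLessThan_iff mem_Collect_eq)
qed

context enumerated
begin

text \<open>The coordinates that are set to zero on the degree filtered locus.\<close>

definition bad :: "(nat \<times> nat) set" where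
  "bad = {(k, l). k < length ts \<and> l < length bs \<and> mdeg (ts ! k) > mdeg (bs ! l)}"

definition kill :: "(nat \<times> nat, 'a::comm_ring_1) mpoly \<Rightarrow> (nat \<times> nat, 'a) mpoly" where
  "kill = poly_subst const (\<lambda>v. if v \<in> bad then 0 else var v)"

definition top_count :: nat where
  "top_count = card {i. i < length ts \<and> mdeg (ts ! i) = mdeg (last ts)}"

definition killed_mat :: "nat monom \<Rightarrow> (nat \<times> nat, 'a::comm_ring_1) mpoly mat" where
  "killed_mat t = eval_term n (length ts) (\<lambda>r. map_mat kill (gen_mult_mat ts bs r)) t"

definition top_rows :: "(nat \<times> nat, 'a::comm_ring_1) mpoly mat" where
  "top_rows = mat (top_count * length ts) (length ts) (\<lambda>(i, k).
     mat_of_cols (length ts) (map (\<lambda>i'. col (transpose_mat (killed_mat (ts ! i')))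
       (length ts - top_count + i div length ts)) [0..<length ts]) $$ (i mod length ts, k))"

lemma CBLocus_eq: "CBLocus n ts bs = (I_BO n ts bs <+>\<^bsub>KC ts bs\<^esub> Idl\<^bsub>KC ts bs\<^esub> (var ` bad))
    <+>\<^bsub>KC ts bs\<^esub> Idl\<^bsub>KC ts bs\<^esub> minors (length ts) top_rows"
  unfolding CBLocus_def Let_def top_rows_def killed_mat_def kill_def bad_def top_count_def ..

lemma killed_mat_carrier: "killed_mat t \<in> carrier_mat (length ts) (length ts)"
  unfolding killed_mat_def by (rule eval_term_carrier) simp

lemma top_count_le: "top_count \<le> length ts"
proof -
  have "top_count \<le> card {..<length ts}" unfolding top_count_def by (rule card_mono) auto
  then show ?thesis by simp
qed

text \<open>The row index \<open>i\<close> encodes the block \<open>i div \<mu>\<close> and the row \<open>i mod \<mu>\<close> inside this block.\<close>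

lemma top_rows_entry:
  assumes "i < top_count * length ts" "k < length ts"
  shows "top_rows $$ (i, k) = killed_mat (ts ! k) $$ (length ts - top_count + i div length ts, i mod length ts)"
proof -
  have "i div length ts < top_count" using assms(1) by (simp add: less_mult_imp_div_less)
  then have a: "length ts - top_count + i div length ts < length ts" using top_count_le by simp
  have b: "i mod length ts < length ts" using length_ts_pos by simp
  show ?thesis
    using assms a b by (simp add: top_rows_def mat_of_cols_entry carrier_matD[OF killed_mat_carrier])
qed

lemma mat_over_top_rows:
  "mat_over (carrier (KC ts bs)) (top_count * length ts) (length ts)
    (top_rows :: (nat \<times> nat, 'a::comm_ring_1) mpoly mat)"
  unfolding mat_over_def
proof (intro conjI allI impI)
  fix i k assume ik: "i < top_count * length ts" "k < length ts"
  have kill: "kill p \<in> carrier (KC ts bs)" if p: "p \<in> carrier (KC ts bs)" for p :: "(nat \<times> nat, 'a) mpoly"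
    unfolding kill_def
  proof (rule poly_subst_in_subring[OF subring_set_poly_ring const_in_poly_ring])
    fix m v assume "m \<in> keys p" "v \<in> keys m"
    then have "v \<in> {..<length ts} \<times> {..<length bs}" using p by (auto simp: carrier_poly_ring)
    then show "(if v \<in> bad then 0 else var v) \<in> carrier (KC ts bs)"
      by (simp add: subring_set_zero[OF subring_set_poly_ring] var_in_poly_ring)
  qed
  have "mat_over (carrier (KC ts bs)) (length ts) (length ts) (map_mat kill (gen_mult_mat ts bs r) :: (nat \<times> nat, 'a) mpoly mat)"
    if "r < n" for r
    using mat_over_gen_mult_mat[OF that, where 'a = 'a]
    unfolding mat_over_def by (auto simp: carrier_matD[OF gen_mult_mat_carrier] intro!: kill)
  then have "mat_over (carrier (KC ts bs)) (length ts) (length ts) (killed_mat (ts ! k) :: (nat \<times> nat, 'a) mpoly mat)"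
    unfolding killed_mat_def by (rule mat_over_eval_term[OF subring_set_poly_ring])
  moreover have "i div length ts < top_count" using ik(1) by (simp add: less_mult_imp_div_less)
  then have "length ts - top_count + i div length ts < length ts" using top_count_le by simp
  moreover have "i mod length ts < length ts" using length_ts_pos by simp
  ultimately show "(top_rows :: (nat \<times> nat, 'a) mpoly mat) $$ (i, k) \<in> carrier (KC ts bs)"
    unfolding top_rows_entry[OF ik] by (rule mat_over_entry)
qed (simp add: top_rows_def)

lemma var_bad_subset: "var ` bad \<subseteq> carrier (KC ts bs)"
  by (auto simp: bad_def intro!: var_in_poly_ring)

end

context border_point
begin

lemma coords_add:
  assumes "t \<in> terms n"
  shows "coords (t + u) = EE t *\<^sub>v coords u"
  using assms
proof (induction t rule: term_induct)
  case zero
  have "EE 0 = 1\<^sub>m \<mu>" by (rule eval_term_zero) simp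
  then show ?case using coords_carrier[of u] by simp
next
  case (step r s)
  have "coords (single r 1 + s + u) = MM r *\<^sub>v (EE s *\<^sub>v coords u)"
    using coords_add_var[OF step(1), of "s + u"] step(3) by (simp only: add.assoc)
  also have "\<dots> = (MM r * EE s) *\<^sub>v coords u"
    by (rule assoc_mult_mat_vec[symmetric, OF point_mult_mat_carrier EE_carrier coords_carrier])
  also have "MM r * EE s = EE (single r 1 + s)"
    by (rule eval_term_add_var[symmetric, OF point_mult_mat_carrier mult_commute step(1)])
  finally show ?case .
qed

lemma EE_entry:
  assumes "t \<in> terms n" "a < \<mu>" "b < \<mu>"
  shows "EE t $$ (a, b) = lookup (nf (t + ts ! b)) (ts ! a)"
proof -
  have "coords (t + ts ! b) = EE t *\<^sub>v unit_vec \<mu> b"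
    by (simp only: coords_add[OF assms(1)] coords_ts[OF assms(3)])
  then show ?thesis
    using assms carrier_matD[OF EE_carrier, of t] by (simp add: lookup_nf)
qed

end

text \<open>
  The points at which the degree filtration of the coordinate ring is the one given by the degrees of
  the terms in the order ideal.
\<close>

locale degree_filtered_point = border_point +
  assumes HF: "HFa n II = HFa_terms (set ts)"
begin

definition top :: nat where "top = mdeg (last ts)"

lemma mdeg_le_top: "t \<in> set ts \<Longrightarrow> mdeg t \<le> top"
proof -
  assume "t \<in> set ts"
  then obtain i where i: "i < \<mu>" "t = ts ! i" by (auto simp: in_set_conv_nth)
  have "last ts = ts ! (\<mu> - 1)" using length_ts_pos by (intro last_conv_nth) auto
  then show ?thesis
    using sorted_nth_mono[OF sorted_ts, of i "\<mu> - 1"] i by (simp add: top_def)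
qed

lemma last_in_ts: "last ts \<in> set ts"
  using length_ts_pos by (intro last_in_set) auto

lemma mem_filtration_iff:
  assumes q: "q \<in> KXC n"
  shows "residue n II q \<in> filtration n II i \<longleftrightarrow> (\<forall>t\<in>keys (NF q). int (mdeg t) \<le> i)"
proof
  assume "residue n II q \<in> filtration n II i"
  then obtain p where p: "p \<in> KXC n" "\<And>m. m \<in> keys p \<Longrightarrow> int (mdeg m) \<le> i" "residue n II q = residue n II p"
    by (auto simp: filtration_def)
  then have "q - p \<in> II" by (simp add: residue_eq_iff[OF ideal_I_point])
  then have "NF (q - p) = 0" by (rule I_point_subset_kernel)
  then have NFq: "NF q = NF p" by (simp add: mlinear_diff[OF mlinear_NF])
  show "\<forall>t\<in>keys (NF q). int (mdeg t) \<le> i"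
  proof (cases "i < 0")
    case True
    have "keys p = {}"
    proof (rule ccontr)
      assume "keys p \<noteq> {}"
      then obtain m where "m \<in> keys p" by blast
      from p(2)[OF this] True show False by simp
    qed
    then have "p = 0" by simp
    then show ?thesis using NFq mlinear_zero[OF mlinear_NF] by simp
  next
    case False
    have "keys (NF p) \<subseteq> {t \<in> set ts. mdeg t \<le> nat i}"
    proof (rule NF_degree[OF _ p(1)])
      show "HFa n II (nat i) = HFa_terms (set ts) (nat i)" by (simp only: HF)
      fix m assume "m \<in> keys p"
      from p(2)[OF this] False show "mdeg m \<le> nat i" by simp
    qed
    then show ?thesis using NFq False by (auto simp: subset_iff nat_le_iff le_nat_iff)
  qed
next
  assume "\<forall>t\<in>keys (NF q). int (mdeg t) \<le> i"
  moreover have "residue n II q = residue n II (NF q)"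
    using minus_NF_in_I_point[OF q] by (simp add: residue_eq_iff[OF ideal_I_point])
  ultimately show "residue n II q \<in> filtration n II i"
    using NF_in_KXC[of q] by (auto simp: filtration_def)
qed

lemma filtration_full_iff: "filtration n II i = carrier (coord_ring n II) \<longleftrightarrow> int top \<le> i"
proof
  assume full: "filtration n II i = carrier (coord_ring n II)"
  have q: "single (last ts) 1 \<in> KXC n" by (rule single_term_in_KXC[OF ts_in_terms[OF last_in_ts]])
  then have "residue n II (single (last ts) 1) \<in> filtration n II i"
    unfolding full carrier_coord_ring[OF ideal_I_point] by (rule imageI)
  then have "\<forall>t\<in>keys (nf (last ts)). int (mdeg t) \<le> i"
    using mem_filtration_iff[OF q] by simp
  then show "int top \<le> i" by (simp add: nf_ts[OF last_in_ts] top_def)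
next
  assume i: "int top \<le> i"
  have "residue n II q \<in> filtration n II i" if "q \<in> KXC n" for q
    unfolding mem_filtration_iff[OF that]
  proof
    fix t assume "t \<in> keys (NF q)"
    then have "mdeg t \<le> top" using keys_NF mdeg_le_top by blast
    then show "int (mdeg t) \<le> i" using i by simp
  qed
  then show "filtration n II i = carrier (coord_ring n II)"
    by (auto simp: carrier_coord_ring[OF ideal_I_point] filtration_def)
qed

lemma ri_eq_top: "ri n II = int top"
  unfolding ri_def filtration_full_iff by (rule Least_equality) auto

definition combination :: "(nat \<Rightarrow> 'a) \<Rightarrow> (nat, 'a) mpoly" where
  "combination c = (\<Sum>k<\<mu>. single (ts ! k) (c k))"

lemma combination_in_KXC: "combination c \<in> KXC n"
  unfolding combination_def
  by (intro subring_set_sum[OF subring_set_poly_ring] single_term_in_KXC ts_in_terms) simp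

lemma keys_combination: "keys (combination c) \<subseteq> set ts"
proof -
  have "keys (combination c) \<subseteq> (\<Union>k\<in>{..<\<mu>}. keys (single (ts ! k) (c k)))"
    unfolding combination_def by (rule Poly_Mapping.keys_sum)
  also have "\<dots> \<subseteq> set ts" by (auto split: if_splits)
  finally show ?thesis .
qed

lemma lookup_combination: "k < \<mu> \<Longrightarrow> lookup (combination c) (ts ! k) = c k"
proof -
  assume k: "k < \<mu>"
  have "lookup (combination c) (ts ! k) = (\<Sum>i<\<mu>. if i = k then c i else 0)"
    unfolding combination_def lookup_sum
    by (rule sum.cong) (use k distinct_ts in \<open>auto simp: lookup_single when_def nth_eq_iff_index_eq\<close>)
  then show ?thesis using k by simp
qed

lemma combination_lookup: "keys p \<subseteq> set ts \<Longrightarrow> combination (\<lambda>k. lookup p (ts ! k)) = p"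
  by (rule eq_on_ts) (simp_all add: keys_combination lookup_combination)

text \<open>The entry of \<open>t\<^sub>k(M\<^sub>1, \<dots>, M\<^sub>n)\<close> at \<open>(a, b)\<close> is the coordinate of \<open>t\<^sub>k t\<^sub>b\<close> at \<open>t\<^sub>a\<close>.\<close>

lemma sum_EE:
  assumes "a < \<mu>" "b < \<mu>"
  shows "(\<Sum>k<\<mu>. EE (ts ! k) $$ (a, b) * c k) = lookup (NF (single (ts ! b) 1 * combination c)) (ts ! a)"
proof -
  have "EE (ts ! k) $$ (a, b) = lookup (nf (ts ! b + ts ! k)) (ts ! a)" if "k < \<mu>" for k
    using EE_entry[OF ts_in_terms assms, of "ts ! k"] that by (simp add: add.commute)
  then have "(\<Sum>k<\<mu>. EE (ts ! k) $$ (a, b) * c k) = (\<Sum>k<\<mu>. c k * lookup (nf (ts ! b + ts ! k)) (ts ! a))"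
    by (intro sum.cong) (simp_all add: mult.commute)
  also have "\<dots> = lookup (NF (single (ts ! b) 1 * combination c)) (ts ! a)"
    by (simp add: combination_def sum_distrib_left Poly_Mapping.mult_single mlinear_sum[OF mlinear_NF] lookup_sum)
  finally show ?thesis .
qed

text \<open>
  A vector \<open>c\<close> in the kernel is an element \<open>f = \<Sum>\<^sub>k c\<^sub>k t\<^sub>k\<close> of the coordinate ring such that no product
  \<open>f t\<^sub>b\<close> has a nonzero coordinate at a term of top degree. As the top degree is the regularity index,
  this says that the ideal generated by \<open>f\<close> is contained in the filtration step below it.
\<close>

lemma not_cayley_bacharach_iff:
  "\<not> cayley_bacharach n II \<longleftrightarrow> (\<exists>c. (\<exists>k<\<mu>. c k \<noteq> 0) \<and>
     (\<forall>a b. a < \<mu> \<longrightarrow> b < \<mu> \<longrightarrow> mdeg (ts ! a) = top \<longrightarrow> (\<Sum>k<\<mu>. EE (ts ! k) $$ (a, b) * c k) = 0))"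
    (is "_ \<longleftrightarrow> (\<exists>c. ?nz c \<and> ?ker c)")
proof -
  have small: "residue n II q \<in> filtration n II (ri n II - 1) \<longleftrightarrow>
      (\<forall>a<\<mu>. mdeg (ts ! a) = top \<longrightarrow> lookup (NF q) (ts ! a) = 0)" if q: "q \<in> KXC n" for q
  proof -
    have "residue n II q \<in> filtration n II (ri n II - 1) \<longleftrightarrow> (\<forall>t\<in>keys (NF q). mdeg t \<noteq> top)"
      unfolding mem_filtration_iff[OF q] ri_eq_top
    proof (rule ball_cong[OF refl])
      fix t assume "t \<in> keys (NF q)"
      then have "mdeg t \<le> top" using keys_NF mdeg_le_top by blast
      then show "int (mdeg t) \<le> int top - 1 \<longleftrightarrow> mdeg t \<noteq> top" by auto
    qed
    also have "\<dots> \<longleftrightarrow> (\<forall>t\<in>set ts. mdeg t = top \<longrightarrow> lookup (NF q) t = 0)"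
      using keys_NF[of q] by (auto simp: in_keys_iff subset_iff)
    also have "\<dots> \<longleftrightarrow> (\<forall>a<\<mu>. mdeg (ts ! a) = top \<longrightarrow> lookup (NF q) (ts ! a) = 0)"
      by (rule all_set_conv_all_nth)
    finally show ?thesis .
  qed
  show ?thesis
  proof
    assume "\<not> cayley_bacharach n II"
    then obtain g where g: "g \<in> KXC n" "g \<notin> II"
      and gs: "\<And>p. p \<in> KXC n \<Longrightarrow> residue n II (p * g) \<in> filtration n II (ri n II - 1)"
      unfolding cayley_bacharach_iff by blast
    let ?c = "\<lambda>k. lookup (NF g) (ts ! k)"
    have c: "combination ?c = NF g" by (rule combination_lookup[OF keys_NF])
    have "?nz ?c"
    proof (rule ccontr)
      assume "\<not> ?nz ?c"
      then have "NF g = 0" using keys_NF by (intro eq_on_ts) simp_all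
      with g NF_eq_zero_iff[OF g(1)] show False by simp
    qed
    moreover have "?ker ?c"
    proof (intro allI impI)
      fix a b assume ab: "a < \<mu>" "b < \<mu>" "mdeg (ts ! a) = top"
      have t: "single (ts ! b) 1 \<in> KXC n" using ab by (intro single_term_in_KXC ts_in_terms) simp
      have "lookup (NF (single (ts ! b) 1 * g)) (ts ! a) = 0"
        using small[OF KXC_mult[OF t g(1)]] gs[OF t] ab by blast
      then show "(\<Sum>k<\<mu>. EE (ts ! k) $$ (a, b) * ?c k) = 0"
        by (simp only: sum_EE[OF ab(1,2)] c NF_mult_NF[OF t g(1)])
    qed
    ultimately show "\<exists>c. ?nz c \<and> ?ker c" by (intro exI[of _ ?c] conjI)
  next
    assume "\<exists>c. ?nz c \<and> ?ker c"
    then obtain c k where k: "k < \<mu>" "c k \<noteq> 0" and ker: "?ker c" by blast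
    let ?g = "combination c"
    note gC = combination_in_KXC[of c]
    have "NF ?g = ?g" by (rule NF_of_ts[OF keys_combination])
    then have "NF ?g \<noteq> 0" using lookup_combination[OF k(1), of c] k(2) by auto
    then have "?g \<notin> II" using NF_eq_zero_iff[OF gC] by simp
    moreover have "residue n II (p * ?g) \<in> filtration n II (ri n II - 1)" if p: "p \<in> KXC n" for p
      unfolding small[OF KXC_mult[OF p gC]]
    proof (intro allI impI)
      fix a assume a: "a < \<mu>" "mdeg (ts ! a) = top"
      have "NF (p * ?g) = NF (NF p * ?g)"
        using NF_mult_NF[OF gC p] by (simp only: mult.commute)
      also have "NF p = (\<Sum>b<\<mu>. smul (lookup (NF p) (ts ! b)) (single (ts ! b) 1))"
        using combination_lookup[OF keys_NF, of p] by (simp add: combination_def smul_single)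
      also have "NF (\<dots> * ?g) = (\<Sum>b<\<mu>. smul (lookup (NF p) (ts ! b)) (NF (single (ts ! b) 1 * ?g)))"
        by (simp only: sum_distrib_right smul_mult mlinear_sum[OF mlinear_NF] mlinear_scale[OF mlinear_NF])
      also have "lookup \<dots> (ts ! a) = (\<Sum>b<\<mu>. lookup (NF p) (ts ! b) * lookup (NF (single (ts ! b) 1 * ?g)) (ts ! a))"
        by (simp only: lookup_sum lookup_smul)
      also have "\<dots> = 0"
      proof (rule sum.neutral, rule ballI)
        fix b assume "b \<in> {..<\<mu>}"
        then have b: "b < \<mu>" by simp
        have "lookup (NF (single (ts ! b) 1 * ?g)) (ts ! a) = 0"
          using ker a b sum_EE[OF a(1) b, of c] by simp
        then show "lookup (NF p) (ts ! b) * lookup (NF (single (ts ! b) 1 * ?g)) (ts ! a) = 0" by simp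
      qed
      finally show "lookup (NF (p * ?g)) (ts ! a) = 0" .
    qed
    ultimately show "\<not> cayley_bacharach n II"
      unfolding cayley_bacharach_iff using gC by blast
  qed
qed

text \<open>
  The entry is a coordinate of a border term at a term of larger degree, which does not occur in the
  normal form.
\<close>

lemma bad_entry_zero: "v \<in> bad \<Longrightarrow> \<Gamma> $$ v = 0"
proof -
  assume "v \<in> bad"
  then obtain k l where v: "v = (k, l)" "k < \<mu>" "l < length bs" "mdeg (ts ! k) > mdeg (bs ! l)"
    by (auto simp: bad_def)
  have b: "bs ! l \<in> terms n" using bs_in_terms v by simp
  have "keys (NF (single (bs ! l) 1)) \<subseteq> {t \<in> set ts. mdeg t \<le> mdeg (bs ! l)}"
    by (rule NF_degree) (use b in \<open>simp_all add: HF single_term_in_KXC\<close>)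
  then have "ts ! k \<notin> keys (nf (bs ! l))" using v by auto
  then have "coords (bs ! l) $ k = 0" using v by (simp add: in_keys_iff flip: lookup_nf)
  then show ?thesis using coords_bs[OF v(3,2)] v(1) by simp
qed

text \<open>
  Setting the coordinates in \<open>bad\<close> to zero does not change the value of the multiplication matrices at
  the point. Hence the block matrix specializes to the system of equations of
  \<open>not_cayley_bacharach_iff\<close>, and the maximal minors detect whether it has a nontrivial solution.
\<close>

lemma vanishes_CBLocus_iff:
  fixes \<iota> :: "'k::comm_ring_1 \<Rightarrow> 'a"
  assumes \<iota>: "comm_ring_hom \<iota>"
  shows "vanishes \<iota> (($$) \<Gamma>) (CBLocus n ts bs) \<longleftrightarrow> \<not> cayley_bacharach n II"
proof -
  interpret h: comm_ring_hom \<iota> by fact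
  interpret E: comm_ring_hom "poly_subst \<iota> (($$) \<Gamma>)" by (rule h.comm_ring_hom_poly_subst)
  interpret K: comm_ring_hom "kill :: (nat \<times> nat, 'k) mpoly \<Rightarrow> _"
    unfolding kill_def by (rule comm_ring_hom.comm_ring_hom_poly_subst[OF comm_ring_hom_const])
  let ?ev = "poly_subst \<iota> (($$) \<Gamma>)"
  let ?T = "top_rows :: (nat \<times> nat, 'k) mpoly mat"
  have ev_kill: "?ev (kill p) = ?ev p" for p
  proof -
    have "?ev (kill p) = poly_subst \<iota> (\<lambda>v. ?ev (if v \<in> bad then 0 else var v)) p"
      unfolding kill_def by (rule h.poly_subst_poly_subst)
    also have "(\<lambda>v. ?ev (if v \<in> bad then 0 else var v)) = ($$) \<Gamma>"
      by (rule ext) (simp add: bad_entry_zero)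
    finally show ?thesis .
  qed
  have ev_killed: "map_mat ?ev (killed_mat t) = EE t" for t
  proof -
    have "map_mat ?ev (killed_mat t) = eval_term n \<mu> (\<lambda>r. map_mat ?ev (map_mat kill (gen_mult_mat ts bs r))) t"
      unfolding killed_mat_def by (rule E.hom_eval_term) simp
    also have "(\<lambda>r. map_mat ?ev (map_mat kill (gen_mult_mat ts bs r))) = MM"
    proof
      fix r
      have "map_mat ?ev (map_mat kill (gen_mult_mat ts bs r)) = map_mat ?ev (gen_mult_mat ts bs r)"
        by (rule eq_matI) (simp_all add: ev_kill)
      then show "map_mat ?ev (map_mat kill (gen_mult_mat ts bs r)) = MM r"
        by (simp only: h.hom_gen_mult_mat)
    qed
    finally show ?thesis .
  qed
  let ?A = "map_mat ?ev ?T"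
  have A: "?A \<in> carrier_mat (top_count * \<mu>) \<mu>"
    using mat_over_carrier[OF mat_over_top_rows[where 'a = 'k]] by simp
  have A_entry: "?A $$ (i, k) = EE (ts ! k) $$ (\<mu> - top_count + i div \<mu>, i mod \<mu>)"
    if ik: "i < top_count * \<mu>" "k < \<mu>" for i k
  proof -
    have "i div \<mu> < top_count" using ik(1) by (simp add: less_mult_imp_div_less)
    then have a: "\<mu> - top_count + i div \<mu> < \<mu>" using top_count_le by simp
    have b: "i mod \<mu> < \<mu>" using length_ts_pos by simp
    have "?A $$ (i, k) = ?ev (?T $$ (i, k))"
      using ik mat_over_carrier[OF mat_over_top_rows[where 'a = 'k]] by simp
    also have "\<dots> = ?ev (killed_mat (ts ! k) $$ (\<mu> - top_count + i div \<mu>, i mod \<mu>))"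
      by (simp only: top_rows_entry[OF ik])
    also have "\<dots> = map_mat ?ev (killed_mat (ts ! k)) $$ (\<mu> - top_count + i div \<mu>, i mod \<mu>)"
      using a b carrier_matD[OF killed_mat_carrier[of "ts ! k", where 'a = 'k]] by simp
    finally show ?thesis by (simp only: ev_killed)
  qed
  have rows: "(\<forall>i<top_count * \<mu>. (\<Sum>k<\<mu>. ?A $$ (i, k) * c k) = 0) \<longleftrightarrow>
      (\<forall>a b. a < \<mu> \<longrightarrow> b < \<mu> \<longrightarrow> mdeg (ts ! a) = top \<longrightarrow> (\<Sum>k<\<mu>. EE (ts ! k) $$ (a, b) * c k) = 0)" for c
  proof
    assume L: "\<forall>i<top_count * \<mu>. (\<Sum>k<\<mu>. ?A $$ (i, k) * c k) = 0"
    show "\<forall>a b. a < \<mu> \<longrightarrow> b < \<mu> \<longrightarrow> mdeg (ts ! a) = top \<longrightarrow> (\<Sum>k<\<mu>. EE (ts ! k) $$ (a, b) * c k) = 0"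
    proof (intro allI impI)
      fix a b assume ab: "a < \<mu>" "b < \<mu>" "mdeg (ts ! a) = top"
      then have a: "\<mu> - top_count \<le> a" using last_block[OF ab(1)] by (simp add: top_def top_count_def)
      let ?i = "(a - (\<mu> - top_count)) * \<mu> + b"
      have j: "a - (\<mu> - top_count) < top_count" using a ab(1) top_count_le by linarith
      have "?i < (a - (\<mu> - top_count)) * \<mu> + \<mu>" using ab(2) by simp
      also have "\<dots> = Suc (a - (\<mu> - top_count)) * \<mu>" by simp
      also have "\<dots> \<le> top_count * \<mu>" using j by (intro mult_le_mono1) simp
      finally have i: "?i < top_count * \<mu>" .
      have dm: "?i div \<mu> = a - (\<mu> - top_count)" "?i mod \<mu> = b" using ab(2) length_ts_pos by simp_all
      have "(\<Sum>k<\<mu>. ?A $$ (?i, k) * c k) = (\<Sum>k<\<mu>. EE (ts ! k) $$ (a, b) * c k)"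
      proof (rule sum.cong)
        fix k assume "k \<in> {..<\<mu>}"
        then have k: "k < \<mu>" by simp
        have "?A $$ (?i, k) = EE (ts ! k) $$ (\<mu> - top_count + ?i div \<mu>, ?i mod \<mu>)" by (rule A_entry[OF i k])
        also have "\<mu> - top_count + ?i div \<mu> = a" using a unfolding dm(1) by simp
        finally show "?A $$ (?i, k) * c k = EE (ts ! k) $$ (a, b) * c k" by (simp only: dm(2))
      qed simp
      then show "(\<Sum>k<\<mu>. EE (ts ! k) $$ (a, b) * c k) = 0" using L i by simp
    qed
  next
    assume R: "\<forall>a b. a < \<mu> \<longrightarrow> b < \<mu> \<longrightarrow> mdeg (ts ! a) = top \<longrightarrow> (\<Sum>k<\<mu>. EE (ts ! k) $$ (a, b) * c k) = 0"
    show "\<forall>i<top_count * \<mu>. (\<Sum>k<\<mu>. ?A $$ (i, k) * c k) = 0"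
    proof (intro allI impI)
      fix i assume i: "i < top_count * \<mu>"
      have "i div \<mu> < top_count" using i by (simp add: less_mult_imp_div_less)
      then have a: "\<mu> - top_count + i div \<mu> < \<mu>" using top_count_le by simp
      have b: "i mod \<mu> < \<mu>" using length_ts_pos by simp
      have d: "mdeg (ts ! (\<mu> - top_count + i div \<mu>)) = top"
        using last_block[OF a] by (simp add: top_def top_count_def)
      have "(\<Sum>k<\<mu>. ?A $$ (i, k) * c k) = (\<Sum>k<\<mu>. EE (ts ! k) $$ (\<mu> - top_count + i div \<mu>, i mod \<mu>) * c k)"
        by (rule sum.cong) (simp_all only: lessThan_iff A_entry[OF i])
      then show "(\<Sum>k<\<mu>. ?A $$ (i, k) * c k) = 0" using R a b d by simp
    qed
  qed
  have full: "J = {..<\<mu>}" if "J \<subseteq> {..<\<mu>}" "card J = \<mu>" for J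
    using that by (intro card_subset_eq) auto
  have "(\<exists>d\<in>minors \<mu> ?A. d \<noteq> 0) \<longleftrightarrow> columns_independent ?A {..<\<mu>}"
    unfolding nonzero_minor_iff[OF A] using full by (metis card_lessThan order_refl)
  also have "\<dots> \<longleftrightarrow> cayley_bacharach n II"
  proof -
    have "columns_independent ?A {..<\<mu>} \<longleftrightarrow>
        (\<forall>c. (\<forall>i<top_count * \<mu>. (\<Sum>k<\<mu>. ?A $$ (i, k) * c k) = 0) \<longrightarrow> (\<forall>k\<in>{..<\<mu>}. c k = 0))"
      unfolding columns_independent_def carrier_matD(1)[OF A] ..
    then show ?thesis using not_cayley_bacharach_iff unfolding rows by blast
  qed
  finally have minors: "(\<forall>d\<in>minors \<mu> ?A. d = 0) \<longleftrightarrow> \<not> cayley_bacharach n II" by blast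
  note ms = minors_subset[OF subring_set_poly_ring mat_over_top_rows[where 'a = 'k], of \<mu>]
  have "vanishes \<iota> (($$) \<Gamma>) (Idl\<^bsub>KC ts bs\<^esub> minors \<mu> ?T) \<longleftrightarrow> vanishes \<iota> (($$) \<Gamma>) (minors \<mu> ?T)"
    by (rule h.vanishes_Idl[OF ms])
  also have "\<dots> \<longleftrightarrow> (\<forall>d\<in>minors \<mu> ?A. d = 0)"
    unfolding E.hom_minors by (simp add: vanishes_def)
  finally have 1: "vanishes \<iota> (($$) \<Gamma>) (Idl\<^bsub>KC ts bs\<^esub> minors \<mu> ?T) \<longleftrightarrow> \<not> cayley_bacharach n II"
    by (simp only: minors)
  have 2: "vanishes \<iota> (($$) \<Gamma>) (Idl\<^bsub>KC ts bs\<^esub> (var ` bad))"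
    unfolding h.vanishes_Idl[OF var_bad_subset] by (auto simp: vanishes_def bad_entry_zero)
  have "vanishes \<iota> (($$) \<Gamma>) (CBLocus n ts bs) \<longleftrightarrow>
      vanishes \<iota> (($$) \<Gamma>) (I_BO n ts bs <+>\<^bsub>KC ts bs\<^esub> Idl\<^bsub>KC ts bs\<^esub> (var ` bad)) \<and>
      vanishes \<iota> (($$) \<Gamma>) (Idl\<^bsub>KC ts bs\<^esub> minors \<mu> ?T)"
    unfolding CBLocus_eq
    by (rule h.vanishes_set_add[OF ideal_set_add[OF ideal_I_BO ideal_Idl[OF var_bad_subset]] ideal_Idl[OF ms]])
  also have "vanishes \<iota> (($$) \<Gamma>) (I_BO n ts bs <+>\<^bsub>KC ts bs\<^esub> Idl\<^bsub>KC ts bs\<^esub> (var ` bad)) \<longleftrightarrow>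
      vanishes \<iota> (($$) \<Gamma>) (I_BO n ts bs) \<and> vanishes \<iota> (($$) \<Gamma>) (Idl\<^bsub>KC ts bs\<^esub> (var ` bad))"
    by (rule h.vanishes_set_add[OF ideal_I_BO ideal_Idl[OF var_bad_subset]])
  finally show ?thesis using 1 2 vanishes_I_BO[OF \<iota>] by simp
qed

end

section \<open>Admissible Hilbert functions\<close>

text \<open>
  A scheme with Hilbert function \<open>H\<close> need not come with a border basis; its coordinate ring is
  represented by a complement of the ideal.
\<close>

lemma admissible_properties:
  assumes "admissible TYPE('k::field) n m H" "0 < m"
  shows "H 0 = 1" "\<And>d e. d \<le> e \<Longrightarrow> H d \<le> H e" "\<And>d. H d \<le> m" "\<exists>d. H d = m"
proof -
  obtain I :: "(nat, 'k) mpoly set" where I: "ideal I (KX n)" and H: "H = HFa n I"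
    and dim: "ring.dimension (coord_ring n I) m (scalars n I) (carrier (coord_ring n I))"
    using assms(1) by (auto simp: admissible_def zero_dim_of_length_def)
  obtain f where f: "mlinear f" "{p. f p = 0} = I"
    using exists_linear_with_kernel[OF subspace_ideal_KX[OF I]] by blast
  have ker: "f p = 0 \<longleftrightarrow> p \<in> I" for p using f(2) by blast
  have "\<exists>B. finite B \<and> card B = m \<and> mp.independent B \<and> mp.span B = f ` KXC n"
    using dim unfolding carrier_coord_ring[OF I]
    by (rule dimension_iff[OF I f(1) ker subspace_carrier_KX subset_refl, THEN iffD1])
  then obtain B where B: "finite B" "card B = m" "mp.independent B" "mp.span B = f ` KXC n" by blast
  have one: "1 \<notin> I"
  proof
    assume "1 \<in> I"
    then have "KXC n = I" using ideal_KX_eq_carrier[OF I] by simp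
    then have "mp.span B \<subseteq> {0}" using ker by (auto simp: B(4))
    then have "B \<subseteq> {0}" using mp.span_superset[of B] by blast
    then have "B = {}" using B(3) mp.dependent_zero[of B] by blast
    with B(2) assms(2) show False by simp
  qed
  interpret Z: zero_dim_ideal n I f B
    by (rule zero_dim_ideal.intro[OF I one f(1) ker B(1)]) (simp add: B(4))
  let ?S = "\<lambda>d. f ` (\<lambda>u. single u 1) ` {u \<in> terms n. mdeg u \<le> d}"
  have S: "finite (?S d)" for d by (simp add: finite_terms_le)
  have Hd: "H d = mp.dim (?S d)" for d unfolding H by (rule Z.HFa_eq_dim_image)
  have "{u \<in> terms n. mdeg u \<le> 0} = {0}" by auto
  then have S0: "?S 0 = {f (single 0 1)}" by simp
  have "f (single 0 1) \<noteq> 0" using ker one by (simp only: single_one) blast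
  then have "mp.independent {f (single 0 1)}" by simp
  then show "H 0 = 1" unfolding Hd S0 by (subst mp.dim_eq_card_independent) simp_all
  show "H d \<le> H e" if "d \<le> e" for d e
    unfolding Hd
  proof (rule dim_le_of_subset_span[OF S S])
    have "?S d \<subseteq> ?S e" using that by (intro image_mono) auto
    then show "?S d \<subseteq> mp.span (?S e)" using mp.span_superset[of "?S e"] by blast
  qed
  show "H d \<le> m" for d
  proof -
    have "?S d \<subseteq> mp.span B"
      unfolding B(4) by (auto simp: carrier_poly_ring terms_def)
    then have "mp.dim (?S d) \<le> card B" using B(1) by (rule mp.dim_le_card)
    then show ?thesis by (simp add: Hd B(2))
  qed
  obtain d where d: "filtration n I (int d) = carrier (coord_ring n I)"
    using Z.exists_filtration_full by blast
  have "H d = kdim n I (residue n I ` KXC n)"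
    by (simp add: H HFa_def d carrier_coord_ring[OF I])
  also have "\<dots> = mp.dim (f ` KXC n)"
    by (rule kdim_eq_dim[OF I f(1) ker subspace_carrier_KX subset_refl B(1)]) (simp add: B(4))
  also have "\<dots> = m" using mp.dim_span_eq_card_independent[OF B(3)] B by simp
  finally show "\<exists>d. H d = m" ..
qed

section \<open>Transfer of equations between border basis schemes\<close>

lemma (in comm_ring_hom) poly_subst_homogenize:
  fixes z :: "'v option \<Rightarrow> 'b"
  shows "poly_subst hom z (homogenize p) = (\<Sum>m\<in>keys p. hom (lookup p m) *
     (term_value (\<lambda>v. z (Some v)) m * z None ^ (Max (insert 0 (mdeg ` keys p)) - mdeg m)))"
proof -
  have sum_single: "term_value z (\<Sum>v\<in>S. single (Some v) (k v)) = (\<Prod>v\<in>S. z (Some v) ^ k v)"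
    if "finite S" for S and k :: "'v \<Rightarrow> nat"
    using that by (induction S rule: finite_induct) (simp_all add: term_value_add)
  show ?thesis
    unfolding homogenize_def Let_def poly_subst_sum poly_subst_single term_value_add
    by (simp add: sum_single term_value_def[of "\<lambda>v. z (Some v)"])
qed

lemma term_value_scale:
  "term_value (\<lambda>v. c * x v) m = c ^ mdeg m * term_value x m"
  by (simp add: term_value_def mdeg_def power_mult_distrib prod.distrib power_sum)

lemma term_value_cong: "(\<And>v. v \<in> keys m \<Longrightarrow> x v = y v) \<Longrightarrow> term_value x m = term_value y m"
  by (simp add: term_value_def)

text \<open>Homogenization clears the denominator \<open>z None\<close> of the substituted fractions.\<close>

lemma (in comm_ring_hom) poly_subst_homogenize_scaled:
  assumes "\<And>m v. m \<in> keys p \<Longrightarrow> v \<in> keys m \<Longrightarrow> z (Some v) = z None * w v"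
  shows "poly_subst hom z (homogenize p) = z None ^ Max (insert 0 (mdeg ` keys p)) * poly_subst hom w p"
proof -
  let ?d = "Max (insert 0 (mdeg ` keys p))"
  have "hom (lookup p m) * (term_value (\<lambda>v. z (Some v)) m * z None ^ (?d - mdeg m))
      = z None ^ ?d * (hom (lookup p m) * term_value w m)" if m: "m \<in> keys p" for m
  proof -
    have "mdeg m \<le> ?d" by (rule Max_ge) (use m in auto)
    then have "z None ^ ?d = z None ^ mdeg m * z None ^ (?d - mdeg m)" by (simp flip: power_add)
    moreover have "term_value (\<lambda>v. z (Some v)) m = z None ^ mdeg m * term_value w m"
      unfolding term_value_scale[symmetric] by (rule term_value_cong) (rule assms[OF m])
    ultimately show ?thesis by (simp only: mult_ac)
  qed
  then show ?thesis
    unfolding poly_subst_homogenize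
    by (simp add: poly_subst_def term_value_def[symmetric] sum_distrib_left)
qed

context enumerated
begin

lemma transfer_poly_in_KC:
  fixes a :: "(nat \<times> nat, 'a::comm_ring_1) mpoly"
  assumes len: "length ts' = length ts" and a: "a \<in> carrier (KC ts' bs')"
  shows "transfer_poly n ts bs ts' bs' a \<in> carrier (KC ts bs)"
proof -
  let ?C = "carrier (KC ts bs) :: (nat \<times> nat, 'a) mpoly set"
  let ?T = "transition_mat n ts bs ts' :: (nat \<times> nat, 'a) mpoly mat"
  let ?z = "\<lambda>v. case v of None \<Rightarrow> det ?T | Some (k, l) \<Rightarrow> (adj_mat ?T *\<^sub>v first_col n ts bs (bs' ! l)) $ k"
  interpret c: comm_ring_hom "const :: 'a \<Rightarrow> (nat \<times> nat, 'a) mpoly" by (rule comm_ring_hom_const)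
  note C = subring_set_poly_ring[of "{..<length ts} \<times> {..<length bs}", where 'a = 'a]
  have T: "mat_over ?C (length ts) (length ts) ?T"
    using mat_over_first_cols[of ts', where 'a = 'a] by (simp add: transition_mat_def len)
  have zN: "?z None \<in> ?C" using mat_over_det[OF C T] by simp
  have zS: "?z (Some v) \<in> ?C" if v: "v \<in> {..<length ts'} \<times> {..<length bs'}" for v
  proof -
    obtain k l where kl: "v = (k, l)" "k < length ts" using v len by auto
    note adj = mat_over_adj[OF C T]
    have "(adj_mat ?T *\<^sub>v first_col n ts bs (bs' ! l)) $ k =
        (\<Sum>i<length ts. adj_mat ?T $$ (k, i) * first_col n ts bs (bs' ! l) $ i)"
      using kl(2) carrier_matD[OF mat_over_carrier[OF adj]]
        carrier_vecD[OF first_col_carrier[of "bs' ! l", where 'a = 'a]]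
      by (simp add: scalar_prod_def atLeast0LessThan)
    also have "\<dots> \<in> ?C"
      by (rule subring_set_sum[OF C], rule subring_set_mult[OF C])
         (use kl(2) in \<open>auto intro: mat_over_entry[OF adj] first_col_entry\<close>)
    finally show ?thesis by (simp add: kl(1))
  qed
  have "poly_subst const ?z (homogenize a) \<in> ?C"
    unfolding c.poly_subst_homogenize
  proof (rule subring_set_sum[OF C], intro subring_set_mult[OF C] subring_set_power[OF C] zN const_in_poly_ring)
    fix m assume "m \<in> keys a"
    then have m: "keys m \<subseteq> {..<length ts'} \<times> {..<length bs'}" using a by (auto simp: carrier_poly_ring)
    show "term_value (\<lambda>v. ?z (Some v)) m \<in> ?C"
      unfolding term_value_def by (intro subring_set_prod[OF C] subring_set_power[OF C] zS) (use m in blast)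
  qed
  then show ?thesis by (simp only: transfer_poly_def Let_def)
qed

lemma ideal_J_ideal:
  assumes "length ts' = length ts" "set as \<subseteq> carrier (KC ts' bs')"
  shows "ideal (J_ideal n ts bs ts' bs' as) (KC ts bs)"
  unfolding J_ideal_def using transfer_poly_in_KC[OF assms(1)] assms(2) by (intro ideal_Idl) blast

end

lemma (in border_point) hom_det_transition:
  assumes "comm_ring_hom \<iota>"
  shows "poly_subst \<iota> (($$) \<Gamma>) (det (transition_mat n ts bs ts')) = det (mat_of_cols \<mu> (map coords ts'))"
proof -
  interpret h: comm_ring_hom \<iota> by fact
  interpret E: comm_ring_hom "poly_subst \<iota> (($$) \<Gamma>)" by (rule h.comm_ring_hom_poly_subst)
  show ?thesis
    unfolding transition_mat_def by (simp only: E.hom_det[symmetric] hom_first_cols[OF assms])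
qed

context change_of_order_ideal
begin

text \<open>
  At \<open>\<Gamma>\<close> the substituted polynomials take the values \<open>det TT * \<gamma>'\<close>, where \<open>\<gamma>'\<close> runs through the
  coordinates of the new point.
\<close>

lemma hom_transfer_poly:
  fixes \<iota> :: "'k::comm_ring_1 \<Rightarrow> 'l"
  assumes \<iota>: "comm_ring_hom \<iota>" and a: "a \<in> carrier (KC ts' bs')"
  shows "poly_subst \<iota> (($$) \<Gamma>) (transfer_poly n ts bs ts' bs' a) =
    det TT ^ Max (insert 0 (mdeg ` keys a)) * poly_subst \<iota> (($$) new_point) a"
proof -
  interpret h: comm_ring_hom \<iota> by fact
  interpret E: comm_ring_hom "poly_subst \<iota> (($$) \<Gamma>)" by (rule h.comm_ring_hom_poly_subst)
  let ?ev = "poly_subst \<iota> (($$) \<Gamma>)"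
  let ?T = "transition_mat n ts bs ts' :: (nat \<times> nat, 'k) mpoly mat"
  let ?y = "\<lambda>v. case v of None \<Rightarrow> det ?T | Some (k, l) \<Rightarrow> (adj_mat ?T *\<^sub>v first_col n ts bs (bs' ! l)) $ k"
  have evT: "map_mat ?ev ?T = TT"
    unfolding transition_mat_def by (rule hom_first_cols[OF \<iota>])
  have T: "?T \<in> carrier_mat \<mu> \<mu>"
    using mat_over_carrier[OF mat_over_first_cols[of ts', where 'a = 'k]] by (simp add: transition_mat_def len)
  have yN: "?ev (?y None) = det TT" by (simp add: hom_det_transition[OF \<iota>])
  have yS: "?ev (?y (Some (k, l))) = (adj_mat TT *\<^sub>v coords (bs' ! l)) $ k" if k: "k < \<mu>" for k l
  proof -
    have d: "dim_row (adj_mat ?T) = \<mu>" "dim_col (adj_mat ?T) = \<mu>" "dim_row (adj_mat TT) = \<mu>" "dim_col (adj_mat TT) = \<mu>"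
      using carrier_matD[OF adj_mat(1)[OF T]] carrier_matD[OF adj_mat(1)[OF TT_carrier]] by simp_all
    have "(adj_mat ?T *\<^sub>v first_col n ts bs (bs' ! l)) $ k =
        (\<Sum>i<\<mu>. adj_mat ?T $$ (k, i) * first_col n ts bs (bs' ! l) $ i)"
      using k d carrier_vecD[OF first_col_carrier[of "bs' ! l", where 'a = 'k]]
      by (simp add: scalar_prod_def atLeast0LessThan)
    also have "?ev \<dots> = (\<Sum>i<\<mu>. ?ev (adj_mat ?T $$ (k, i)) * ?ev (first_col n ts bs (bs' ! l) $ i))"
      by (simp add: E.hom_sum E.hom_mult)
    also have "\<dots> = (\<Sum>i<\<mu>. adj_mat TT $$ (k, i) * coords (bs' ! l) $ i)"
    proof (rule sum.cong)
      fix i assume "i \<in> {..<\<mu>}"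
      then have i: "i < \<mu>" by simp
      have "adj_mat TT = map_mat ?ev (adj_mat ?T)"
        using E.hom_adj_mat[OF T] by (simp only: evT)
      then have "adj_mat TT $$ (k, i) = ?ev (adj_mat ?T $$ (k, i))" using k i d by simp
      then show "?ev (adj_mat ?T $$ (k, i)) * ?ev (first_col n ts bs (bs' ! l) $ i)
          = adj_mat TT $$ (k, i) * coords (bs' ! l) $ i"
        by (simp only: hom_first_col[OF \<iota> i])
    qed simp
    also have "\<dots> = (adj_mat TT *\<^sub>v coords (bs' ! l)) $ k"
      using k d by (simp add: scalar_prod_def atLeast0LessThan)
    finally show ?thesis by simp
  qed
  have "?ev (transfer_poly n ts bs ts' bs' a) = poly_subst \<iota> (\<lambda>v. ?ev (?y v)) (homogenize a)"
    unfolding transfer_poly_def Let_def by (rule h.poly_subst_poly_subst)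
  also have "\<dots> = ?ev (?y None) ^ Max (insert 0 (mdeg ` keys a)) * poly_subst \<iota> (($$) new_point) a"
  proof (rule h.poly_subst_homogenize_scaled)
    fix m v assume "m \<in> keys a" "v \<in> keys m"
    then have "v \<in> {..<\<mu>} \<times> {..<length bs'}" using a by (auto simp: carrier_poly_ring len)
    then obtain k l where v: "v = (k, l)" "k < \<mu>" "l < length bs'" by auto
    show "?ev (?y (Some v)) = ?ev (?y None) * new_point $$ v"
      unfolding yN v(1) yS[OF v(2)] using v det by (simp add: new_point_def)
  qed
  finally show ?thesis by (simp only: yN)
qed

lemma vanishes_J_ideal_iff:
  fixes \<iota> :: "'k::comm_ring_1 \<Rightarrow> 'l"
  assumes \<iota>: "comm_ring_hom \<iota>" and as: "set as \<subseteq> carrier (KC ts' bs')"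
  shows "vanishes \<iota> (($$) \<Gamma>) (J_ideal n ts bs ts' bs' as) \<longleftrightarrow>
    vanishes \<iota> (($$) new_point) (Idl\<^bsub>KC ts' bs'\<^esub> (set as))"
proof -
  interpret h: comm_ring_hom \<iota> by fact
  have "transfer_poly n ts bs ts' bs' ` set as \<subseteq> carrier (KC ts bs)"
    using transfer_poly_in_KC[OF len] as by blast
  then have "vanishes \<iota> (($$) \<Gamma>) (J_ideal n ts bs ts' bs' as) \<longleftrightarrow>
      vanishes \<iota> (($$) \<Gamma>) (transfer_poly n ts bs ts' bs' ` set as)"
    unfolding J_ideal_def by (rule h.vanishes_Idl)
  also have "\<dots> \<longleftrightarrow> vanishes \<iota> (($$) new_point) (set as)"
  proof -
    have "poly_subst \<iota> (($$) \<Gamma>) (transfer_poly n ts bs ts' bs' a) = 0 \<longleftrightarrow> poly_subst \<iota> (($$) new_point) a = 0"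
      if "a \<in> set as" for a
      using hom_transfer_poly[OF \<iota>, of a] as that det by auto
    then show ?thesis by (simp add: vanishes_def)
  qed
  also have "\<dots> \<longleftrightarrow> vanishes \<iota> (($$) new_point) (Idl\<^bsub>KC ts' bs'\<^esub> (set as))"
    by (rule h.vanishes_Idl[OF as, symmetric])
  finally show ?thesis .
qed

end

section \<open>The loci defined by a Hilbert function\<close>

locale hilbert_function = enumerated +
  fixes H :: "nat \<Rightarrow> nat"
  assumes H0: "H 0 = 1" and H_mono: "d \<le> e \<Longrightarrow> H d \<le> H e" and H_le: "H d \<le> length ts"
    and H_full: "\<exists>d. H d = length ts" and H_dom: "dominates H (HFa_terms (set ts))"
begin

definition rho :: nat where "rho = (LEAST i. H i = length ts)"

lemma H_rho: "H rho = length ts"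
  unfolding rho_def using H_full by (rule LeastI_ex)

lemma H_ge_rho: "rho \<le> i \<Longrightarrow> H i = length ts"
  using H_mono[of rho i] H_rho H_le[of i] by simp

lemma H_less_rho: "i < rho \<Longrightarrow> H i < length ts"
  using not_less_Least[of i "\<lambda>i. H i = length ts"] H_le[of i] by (simp add: rho_def)

lemma H_pos: "0 < H i"
  using H_mono[of 0 i] H0 by simp

definition lowered :: "nat set" where
  "lowered = {i \<in> {1..rho}. HFa_terms (set ts) i \<le> H i - 1}"

lemma I_ZO_bar_eq: "I_ZO_bar n ts bs H =
    carrier (KC ts bs) \<inter> (\<Inter>i\<in>lowered. I_BO_bar n ts bs (H(i := H i - 1)))"
  by (simp add: I_ZO_bar_def Let_def rho_def lowered_def)

lemma finite_lowered: "finite lowered"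
  by (simp add: lowered_def)

text \<open>
  Lowering \<open>H\<close> at \<open>rho\<close> itself moves the regularity index up by one. This is why the condition in
  degree \<open>rho\<close> occurs among the determinantal conditions, which stop below the regularity index.
\<close>

lemma Least_lowered:
  assumes "j \<in> lowered"
  shows "(LEAST i. (H(j := H j - 1)) i = length ts) = (if j = rho then Suc rho else rho)"
proof (rule Least_equality)
  have j: "1 \<le> j" "j \<le> rho" using assms by (auto simp: lowered_def)
  show "(H(j := H j - 1)) (if j = rho then Suc rho else rho) = length ts"
    using H_ge_rho by simp
  fix i assume i: "(H(j := H j - 1)) i = length ts"
  show "(if j = rho then Suc rho else rho) \<le> i"
  proof (rule ccontr)
    assume "\<not> (if j = rho then Suc rho else rho) \<le> i"
    then have "i < rho \<or> i = rho \<and> j = rho" by (auto split: if_splits)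
    moreover have "H j - 1 < H j" using H_pos[of j] by simp
    ultimately have "(H(j := H j - 1)) i < length ts"
      using H_less_rho[of i] H_le[of j] by (cases "i = j") auto
    then show False using i by simp
  qed
qed

lemma ideal_I_ZO_bar: "ideal (I_ZO_bar n ts bs H) (KC ts bs)"
  unfolding I_ZO_bar_eq by (rule ideal_INT[OF ideal_I_BO_bar])

end

locale hilbert_point = hilbert_function n ts bs H + border_point n ts bs \<Gamma>
  for n ts bs H and \<Gamma> :: "'l::field mat"
begin

lemma vanishes_I_BO_bar_H_iff:
  assumes "comm_ring_hom \<iota>"
  shows "vanishes \<iota> (($$) \<Gamma>) (I_BO_bar n ts bs H) \<longleftrightarrow> dominates H (HFa n II)"
proof -
  have "(\<forall>i\<in>{1..<rho}. HFa n II i \<le> H i) \<longleftrightarrow> (\<forall>i. HFa n II i \<le> H i)"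
  proof
    assume L: "\<forall>i\<in>{1..<rho}. HFa n II i \<le> H i"
    show "\<forall>i. HFa n II i \<le> H i"
    proof
      fix i
      consider "i = 0" | "i \<in> {1..<rho}" | "rho \<le> i" by force
      then show "HFa n II i \<le> H i"
        using L HFa_zero H0 H_ge_rho[of i] HFa_le_length[of i] by cases simp_all
    qed
  qed simp
  then show ?thesis
    by (simp add: vanishes_I_BO_bar_iff[OF assms] dominates_def rho_def)
qed

lemma vanishes_I_BO_bar_lowered_iff:
  assumes "comm_ring_hom \<iota>" and j: "j \<in> lowered" and dom: "dominates H (HFa n II)"
  shows "vanishes \<iota> (($$) \<Gamma>) (I_BO_bar n ts bs (H(j := H j - 1))) \<longleftrightarrow> HFa n II j < H j"
proof -
  let ?G = "H(j := H j - 1)"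
  have j': "1 \<le> j" "j \<le> rho" using j by (auto simp: lowered_def)
  have d: "HFa n II i \<le> H i" for i using dom by (simp add: dominates_def)
  have "(\<forall>i\<in>{1..<if j = rho then Suc rho else rho}. HFa n II i \<le> ?G i) \<longleftrightarrow> HFa n II j \<le> H j - 1"
    using d j' by auto
  moreover have "vanishes \<iota> (($$) \<Gamma>) (I_BO_bar n ts bs ?G) \<longleftrightarrow>
      (\<forall>i\<in>{1..<if j = rho then Suc rho else rho}. HFa n II i \<le> ?G i)"
    using vanishes_I_BO_bar_iff[OF assms(1), of ?G] by (simp only: Least_lowered[OF j])
  moreover have "HFa n II j \<le> H j - 1 \<longleftrightarrow> HFa n II j < H j"
    using H_pos[of j] by linarith
  ultimately show ?thesis by (simp only:)
qed

text \<open>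
  If the Hilbert function is smaller than \<open>H\<close>, it differs from \<open>H\<close> at some positive index up
  to \<open>rho\<close>, and lowering \<open>H\<close> there still dominates it.
\<close>

lemma vanishes_I_ZO_bar_iff:
  assumes \<iota>: "field_hom \<iota>" and dom: "dominates H (HFa n II)"
  shows "vanishes \<iota> (($$) \<Gamma>) (I_ZO_bar n ts bs H) \<longleftrightarrow> HFa n II \<noteq> H"
proof -
  interpret h: field_hom \<iota> by fact
  have d: "HFa n II i \<le> H i" for i using dom by (simp add: dominates_def)
  have "vanishes \<iota> (($$) \<Gamma>) (I_ZO_bar n ts bs H) \<longleftrightarrow>
      (\<exists>j\<in>lowered. vanishes \<iota> (($$) \<Gamma>) (I_BO_bar n ts bs (H(j := H j - 1))))"
    unfolding I_ZO_bar_eq by (rule h.vanishes_INT[OF finite_lowered ideal_I_BO_bar])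
  also have "\<dots> \<longleftrightarrow> (\<exists>j\<in>lowered. HFa n II j < H j)"
    using vanishes_I_BO_bar_lowered_iff[OF h.comm_ring_hom_axioms _ dom] by blast
  also have "\<dots> \<longleftrightarrow> HFa n II \<noteq> H"
  proof
    assume "HFa n II \<noteq> H"
    then obtain i where "HFa n II i \<noteq> H i" by auto
    then have i: "HFa n II i < H i" using d[of i] by simp
    let ?j = "min i rho"
    have j: "HFa n II ?j < H ?j"
    proof (cases "i \<le> rho")
      case False
      then show ?thesis using i HFa_mono[of rho i] H_ge_rho[of i] H_rho by simp
    qed (use i in simp)
    have "?j \<noteq> 0" using j HFa_zero H0 by (metis less_irrefl)
    moreover have "HFa_terms (set ts) ?j \<le> H ?j - 1" using HFa_terms_le[of ?j] j by linarith
    ultimately have "?j \<in> lowered" by (simp add: lowered_def)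
    with j show "\<exists>j\<in>lowered. HFa n II j < H j" by blast
  qed auto
  finally show ?thesis .
qed

end

lemma ideal_poly_ring_subset: "ideal A (poly_ring V) \<Longrightarrow> A \<subseteq> carrier (poly_ring V)"
  by (simp add: ideal_poly_ring_iff)

context hilbert_function
begin

lemma border_point_of_zero:
  assumes "comm_ring_hom \<iota>" "vanishes \<iota> (($$) \<Gamma>) (I_BO n ts bs)"
  shows "hilbert_point n ts bs H (\<Gamma> :: 'l::field mat)"
proof -
  have "border_point n ts bs \<Gamma>"
    using assms(2) unfolding vanishes_I_BO_iff[OF assms(1)] by unfold_locales blast
  then show ?thesis
    by (intro hilbert_point.intro hilbert_function_axioms)
qed

lemma field_hom_to_ac: "field_hom (to_ac :: 'k::field \<Rightarrow> 'k alg_closure)"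
  by unfold_locales simp_all

text \<open>The argument serves to fix the base field, on which the set depends through its algebraic closure.\<close>

definition dominated_points :: "'k::field itself \<Rightarrow> 'k alg_closure mat set" where
  "dominated_points _ = {\<Gamma> \<in> zero_locus (to_ac :: 'k \<Rightarrow> _) ts bs (I_BO n ts bs). dominates H (HFa n (I_point n ts bs \<Gamma>))}"

definition strictly_dominated_points :: "'k::field itself \<Rightarrow> 'k alg_closure mat set" where
  "strictly_dominated_points _ =
    {\<Gamma> \<in> zero_locus (to_ac :: 'k \<Rightarrow> _) ts bs (I_BO n ts bs). strictly_dominates H (HFa n (I_point n ts bs \<Gamma>))}"

text \<open>The equations in \<open>I_BO_bar\<close> hold at all dominated points, so they extend to the closure.\<close>

lemma mem_BO_bar_pointsD:
  fixes \<iota> :: "'k::field \<Rightarrow> 'l::field"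
  assumes \<iota>: "field_hom \<iota>" and \<Gamma>: "\<Gamma> \<in> BO_bar_points \<iota> n ts bs H"
  shows "\<Gamma> \<in> carrier_mat (length ts) (length bs)" "hilbert_point n ts bs H \<Gamma>"
    "dominates H (HFa n (I_point n ts bs \<Gamma>))"
    "vanishes \<iota> (($$) \<Gamma>) (I_BO_bar n ts bs H)"
proof -
  interpret h: field_hom \<iota> by fact
  interpret a: field_hom "to_ac :: 'k \<Rightarrow> 'k alg_closure" by (rule field_hom_to_ac)
  let ?S = "dominated_points TYPE('k)"
  have \<Gamma>': "\<Gamma> \<in> carrier_mat (length ts) (length bs)" "vanishes \<iota> (($$) \<Gamma>) (vanishing_ideal ts bs ?S)"
    using \<Gamma> by (simp_all add: BO_bar_points_def dominated_points_def mem_zero_locus)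
  have S: "vanishes to_ac (($$) \<Delta>) (I_BO n ts bs :: (nat \<times> nat, 'k) mpoly set)"
      "vanishes to_ac (($$) \<Delta>) (I_BO_bar n ts bs H :: (nat \<times> nat, 'k) mpoly set)" if "\<Delta> \<in> ?S" for \<Delta>
  proof -
    show v: "vanishes to_ac (($$) \<Delta>) (I_BO n ts bs :: (nat \<times> nat, 'k) mpoly set)"
      using that by (simp add: dominated_points_def mem_zero_locus)
    interpret hilbert_point n ts bs H \<Delta> by (rule border_point_of_zero[OF a.comm_ring_hom_axioms v])
    show "vanishes to_ac (($$) \<Delta>) (I_BO_bar n ts bs H :: (nat \<times> nat, 'k) mpoly set)"
      using that by (simp add: vanishes_I_BO_bar_H_iff[OF a.comm_ring_hom_axioms] dominated_points_def)
  qed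
  have sub: "I_BO n ts bs \<subseteq> vanishing_ideal ts bs ?S" "I_BO_bar n ts bs H \<subseteq> vanishing_ideal ts bs ?S"
  proof -
    have *: "I \<subseteq> vanishing_ideal ts bs ?S"
      if I: "I \<subseteq> carrier (KC ts bs)" and v: "\<And>\<Delta>. \<Delta> \<in> ?S \<Longrightarrow> vanishes to_ac (($$) \<Delta>) I"
      for I :: "(nat \<times> nat, 'k) mpoly set"
    proof (rule subsetI)
      fix p assume p: "p \<in> I"
      show "p \<in> vanishing_ideal ts bs ?S"
        using subsetD[OF I p] v p by (simp add: vanishing_ideal_def vanishes_def)
    qed
    show "I_BO n ts bs \<subseteq> vanishing_ideal ts bs ?S"
      by (rule *[OF ideal_poly_ring_subset[OF ideal_I_BO] S(1)])
    show "I_BO_bar n ts bs H \<subseteq> vanishing_ideal ts bs ?S"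
      by (rule *[OF ideal_poly_ring_subset[OF ideal_I_BO_bar] S(2)])
  qed
  show "\<Gamma> \<in> carrier_mat (length ts) (length bs)" by (rule \<Gamma>')
  show hp: "hilbert_point n ts bs H \<Gamma>"
    by (rule border_point_of_zero[OF h.comm_ring_hom_axioms vanishes_subset[OF sub(1) \<Gamma>'(2)]])
  show v: "vanishes \<iota> (($$) \<Gamma>) (I_BO_bar n ts bs H)"
    by (rule vanishes_subset[OF sub(2) \<Gamma>'(2)])
  interpret hilbert_point n ts bs H \<Gamma> by (rule hp)
  show "dominates H (HFa n (I_point n ts bs \<Gamma>))"
    using v by (simp add: vanishes_I_BO_bar_H_iff[OF h.comm_ring_hom_axioms])
qed

text \<open>
  The equations in \<open>I_ZO_bar\<close> hold on the closure of the strictly dominated points and fail at points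
  with Hilbert function \<open>H\<close>. Conversely, let the Hilbert function of \<open>\<Gamma>\<close> be smaller than \<open>H\<close>, and suppose
  that \<open>g\<close> vanishes at all strictly dominated points but not at \<open>\<Gamma>\<close>. Then \<open>\<Gamma>\<close> specializes to a point
  over the algebraic closure at which \<open>g\<close> does not vanish; but its Hilbert function is not larger than
  that of \<open>\<Gamma>\<close>, since upper bounds are determinantal equations, so it is strictly dominated.
\<close>

lemma mem_BO_points_iff:
  fixes \<iota> :: "'k::field \<Rightarrow> 'l::field"
  assumes \<iota>: "field_hom \<iota>" and \<Gamma>: "\<Gamma> \<in> BO_bar_points \<iota> n ts bs H"
  shows "\<Gamma> \<in> BO_points \<iota> n ts bs H \<longleftrightarrow> HFa n (I_point n ts bs \<Gamma>) = H"
proof -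
  interpret h: field_hom \<iota> by fact
  interpret a: field_hom "to_ac :: 'k \<Rightarrow> 'k alg_closure" by (rule field_hom_to_ac)
  note \<Gamma>' = mem_BO_bar_pointsD[OF \<iota> \<Gamma>]
  interpret hilbert_point n ts bs H \<Gamma> by (rule \<Gamma>'(2))
  let ?S = "strictly_dominated_points TYPE('k)"
  let ?V = "{..<length ts} \<times> {..<length bs}"
  have eq: "\<Gamma> \<in> BO_points \<iota> n ts bs H \<longleftrightarrow> \<not> vanishes \<iota> (($$) \<Gamma>) (vanishing_ideal ts bs ?S)"
    using \<Gamma> \<Gamma>'(1) by (simp add: BO_points_def strictly_dominated_points_def mem_zero_locus)
  show ?thesis
    unfolding eq
  proof
    assume nv: "\<not> vanishes \<iota> (($$) \<Gamma>) (vanishing_ideal ts bs ?S)"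
    show "HFa n II = H"
    proof (rule ccontr)
      assume neq: "HFa n II \<noteq> H"
      obtain g where g: "g \<in> vanishing_ideal ts bs ?S" "poly_subst \<iota> (($$) \<Gamma>) g \<noteq> 0"
        using nv by (auto simp: vanishes_def)
      have gC: "g \<in> carrier (poly_ring ?V)" using g(1) by (simp add: vanishing_ideal_def)
      obtain y where y: "poly_subst to_ac y g \<noteq> 0"
        and y0: "\<And>f. f \<in> carrier (poly_ring ?V) \<Longrightarrow> poly_subst \<iota> (($$) \<Gamma>) f = 0 \<Longrightarrow> poly_subst to_ac y f = 0"
        by (rule specialize_point[OF \<iota> field_hom_to_ac _ gC g(2)]) auto
      let ?\<Delta> = "mat (length ts) (length bs) y"
      have ev: "poly_subst to_ac (($$) ?\<Delta>) f = poly_subst to_ac y f" if f: "f \<in> carrier (poly_ring ?V)"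
        for f :: "(nat \<times> nat, 'k) mpoly"
      proof (rule poly_subst_cong)
        fix m v assume "m \<in> keys f" "v \<in> keys m"
        then have "v \<in> ?V" using f by (auto simp: carrier_poly_ring)
        then show "?\<Delta> $$ v = y v" by (cases v) simp
      qed
      have trans: "vanishes to_ac (($$) ?\<Delta>) F"
        if F: "F \<subseteq> carrier (poly_ring ?V)" "vanishes \<iota> (($$) \<Gamma>) F" for F :: "(nat \<times> nat, 'k) mpoly set"
        unfolding vanishes_def
      proof
        fix f assume "f \<in> F"
        then have f: "f \<in> carrier (poly_ring ?V)" "poly_subst \<iota> (($$) \<Gamma>) f = 0"
          using F by (auto simp: vanishes_def)
        show "poly_subst to_ac (($$) ?\<Delta>) f = 0" unfolding ev[OF f(1)] by (rule y0[OF f])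
      qed
      have v: "vanishes to_ac (($$) ?\<Delta>) (I_BO n ts bs :: (nat \<times> nat, 'k) mpoly set)"
        by (rule trans[OF _ vanishes_I_BO[OF h.comm_ring_hom_axioms]])
           (rule ideal_poly_ring_subset[OF ideal_I_BO])
      interpret D: hilbert_point n ts bs H ?\<Delta> by (rule border_point_of_zero[OF a.comm_ring_hom_axioms v])
      have le: "HFa n D.II i \<le> HFa n II i" for i
      proof -
        have "vanishes \<iota> (($$) \<Gamma>) (column_minors (HFa n II) i :: (nat \<times> nat, 'k) mpoly set)"
          by (simp add: vanishes_column_minors_iff[OF h.comm_ring_hom_axioms])
        from trans[OF column_minors_subset this] show ?thesis
          by (simp add: D.vanishes_column_minors_iff[OF a.comm_ring_hom_axioms])
      qed
      have d: "HFa n II i \<le> H i" for i using \<Gamma>'(3) by (simp add: dominates_def)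
      obtain i where "HFa n II i \<noteq> H i" using neq by auto
      then have "HFa n D.II i < H i" using le[of i] d[of i] by simp
      then have "H \<noteq> HFa n D.II" by auto
      moreover have "dominates H (HFa n D.II)"
        unfolding dominates_def using le d order.trans by blast
      ultimately have "?\<Delta> \<in> ?S"
        using v by (simp add: strictly_dominated_points_def mem_zero_locus strictly_dominates_def)
      then have "poly_subst to_ac (($$) ?\<Delta>) g = 0" using g(1) by (simp add: vanishing_ideal_def)
      with y ev[OF gC] show False by simp
    qed
  next
    assume HF: "HFa n II = H"
    have "I_ZO_bar n ts bs H \<subseteq> vanishing_ideal ts bs ?S"
    proof
      fix f :: "(nat \<times> nat, 'k) mpoly" assume f: "f \<in> I_ZO_bar n ts bs H"
      have "poly_subst to_ac (($$) \<Delta>) f = 0" if \<Delta>: "\<Delta> \<in> ?S" for \<Delta>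
      proof -
        have v: "vanishes to_ac (($$) \<Delta>) (I_BO n ts bs :: (nat \<times> nat, 'k) mpoly set)"
          using \<Delta> by (simp add: strictly_dominated_points_def mem_zero_locus)
        interpret D: hilbert_point n ts bs H \<Delta> by (rule border_point_of_zero[OF a.comm_ring_hom_axioms v])
        have "strictly_dominates H (HFa n D.II)" using \<Delta> by (simp add: strictly_dominated_points_def)
        then have "vanishes to_ac (($$) \<Delta>) (I_ZO_bar n ts bs H :: (nat \<times> nat, 'k) mpoly set)"
          using D.vanishes_I_ZO_bar_iff[OF field_hom_to_ac] by (auto simp: strictly_dominates_def)
        with f show ?thesis by (simp add: vanishes_def)
      qed
      moreover have "f \<in> carrier (KC ts bs)"
        using f ideal_poly_ring_subset[OF ideal_I_ZO_bar] by blast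
      ultimately show "f \<in> vanishing_ideal ts bs ?S" by (simp add: vanishing_ideal_def)
    qed
    moreover have "\<not> vanishes \<iota> (($$) \<Gamma>) (I_ZO_bar n ts bs H)"
      using vanishes_I_ZO_bar_iff[OF \<iota> \<Gamma>'(3)] HF by simp
    ultimately show "\<not> vanishes \<iota> (($$) \<Gamma>) (vanishing_ideal ts bs ?S)"
      using vanishes_subset by blast
  qed
qed

end

section \<open>The non-Cayley-Bacharach locus\<close>

theorem mainTheorem12:
  fixes \<iota> :: "'k::field \<Rightarrow> 'l::field"
    and n l :: nat
    and ts bs :: "nat monom list"
    and H :: "nat \<Rightarrow> nat"
    and ts' bs' :: "nat \<Rightarrow> nat monom list"
    and as :: "nat \<Rightarrow> (nat \<times> nat, 'k) mpoly list"
  assumes "field_hom \<iota>"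
    and "enumerated_order_ideal n ts bs"
    and "admissible TYPE('k) n (length ts) H"
    and "dominates H (HFa_terms (set ts))"
    and "\<And>i. i < l \<Longrightarrow> enumerated_order_ideal n (ts' i) (bs' i)"
    and "bij_betw (\<lambda>i. set (ts' i)) {..<l} {S. order_ideal n S \<and> HFa_terms S = H}"
    and "\<And>i. i < l \<Longrightarrow> set (as i) \<subseteq> carrier (KC (ts' i) (bs' i))"
    and "\<And>i. i < l \<Longrightarrow> Idl\<^bsub>KC (ts' i) (bs' i)\<^esub> (set (as i)) = CBLocus n (ts' i) (bs' i)"
  shows "BO_bar_points \<iota> n ts bs H - zero_locus \<iota> ts bs (I_NCB n ts bs H l ts' bs' as)
       = {\<Gamma> \<in> BO_points \<iota> n ts bs H. cayley_bacharach n (I_point n ts bs \<Gamma>)}"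
proof -
  interpret h: field_hom \<iota> by fact
  note \<iota> = h.comm_ring_hom_axioms
  interpret O: enumerated n ts bs by unfold_locales fact
  note adm = admissible_properties[OF assms(3) O.length_ts_pos]
  interpret O: hilbert_function n ts bs H
    by unfold_locales (fact adm assms(4))+
  have HF': "HFa_terms (set (ts' i)) = H" if "i < l" for i
    using bij_betwE[OF assms(6)] that by auto
  have len: "length (ts' i) = length ts" if i: "i < l" for i
  proof -
    interpret N: enumerated n "ts' i" "bs' i" by unfold_locales (rule assms(5)[OF i])
    define d where "d = Max (insert O.rho (mdeg ` set (ts' i)))"
    have "{t \<in> set (ts' i). mdeg t \<le> d} = set (ts' i)"
      by (auto simp: d_def)
    then have "HFa_terms (set (ts' i)) d = length (ts' i)"
      by (simp add: HFa_terms_def distinct_card[OF N.distinct_ts])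
    moreover have "O.rho \<le> d" by (simp add: d_def)
    ultimately show ?thesis using O.H_ge_rho[of d] HF'[OF i] by simp
  qed
  let ?\<delta> = "\<lambda>i. det (transition_mat n ts bs (ts' i)) :: (nat \<times> nat, 'k) mpoly"
  let ?J = "\<lambda>i. J_ideal n ts bs (ts' i) (bs' i) (as i)"
  let ?B = "I_BO_bar n ts bs H :: (nat \<times> nat, 'k) mpoly set"
  let ?Z = "I_ZO_bar n ts bs H :: (nat \<times> nat, 'k) mpoly set"
  have \<delta>C: "{?\<delta> i} \<subseteq> carrier (KC ts bs)" if i: "i < l" for i
  proof -
    have "mat_over (carrier (KC ts bs)) (length ts) (length ts) (transition_mat n ts bs (ts' i) :: (nat \<times> nat, 'k) mpoly mat)"
      using O.mat_over_first_cols[of "ts' i", where 'a = 'k] by (simp add: transition_mat_def len[OF i])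
    from mat_over_det[OF subring_set_poly_ring this] show ?thesis by simp
  qed
  have iD: "ideal (I_dfb n ts bs H (ts' i) :: (nat \<times> nat, 'k) mpoly set) (KC ts bs)" if i: "i < l" for i
    unfolding I_dfb_def
    by (rule ring.i_intersect[OF cring.axioms(1)[OF cring_poly_ring] O.ideal_I_ZO_bar ideal_Idl[OF \<delta>C[OF i]]])
  have iJ: "ideal (?J i) (KC ts bs)" if i: "i < l" for i
    by (rule O.ideal_J_ideal[OF len[OF i] assms(7)[OF i]])
  have iDB: "ideal (I_dfb n ts bs H (ts' i) <+>\<^bsub>KC ts bs\<^esub> ?B) (KC ts bs)"
    and iJB: "ideal (?J i <+>\<^bsub>KC ts bs\<^esub> ?B) (KC ts bs)" if i: "i < l" for i
    by (rule ideal_set_add[OF iD[OF i] O.ideal_I_BO_bar], rule ideal_set_add[OF iJ[OF i] O.ideal_I_BO_bar])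
  have main: "\<Gamma> \<notin> zero_locus \<iota> ts bs (I_NCB n ts bs H l ts' bs' as) \<longleftrightarrow>
      HFa n (I_point n ts bs \<Gamma>) = H \<and> cayley_bacharach n (I_point n ts bs \<Gamma>)"
    if \<Gamma>: "\<Gamma> \<in> BO_bar_points \<iota> n ts bs H" for \<Gamma>
  proof -
    note \<Gamma>' = O.mem_BO_bar_pointsD[OF assms(1) \<Gamma>]
    interpret P: hilbert_point n ts bs H \<Gamma> by (rule \<Gamma>'(2))
    let ?v = "vanishes \<iota> (($$) \<Gamma>) :: (nat \<times> nat, 'k) mpoly set \<Rightarrow> bool"
    let ?det = "\<lambda>i. det (mat_of_cols (length ts) (map P.coords (ts' i)))"
    \<comment> \<open>\<open>I_BO_bar\<close> vanishes at \<open>\<Gamma>\<close> and may be ignored in both sums.\<close>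
    have summand: "?v ((I_dfb n ts bs H (ts' i) <+>\<^bsub>KC ts bs\<^esub> ?B) \<inter> (?J i <+>\<^bsub>KC ts bs\<^esub> ?B)) \<longleftrightarrow>
        HFa n P.II \<noteq> H \<or> ?det i = 0 \<or> ?v (?J i)" if i: "i < l" for i
    proof -
      have "?v (I_dfb n ts bs H (ts' i)) \<longleftrightarrow> ?v ?Z \<or> ?v (Idl\<^bsub>KC ts bs\<^esub> {?\<delta> i})"
        unfolding I_dfb_def by (rule h.vanishes_Int[OF O.ideal_I_ZO_bar ideal_Idl[OF \<delta>C[OF i]]])
      moreover have "?v (Idl\<^bsub>KC ts bs\<^esub> {?\<delta> i}) \<longleftrightarrow> ?det i = 0"
        unfolding h.vanishes_Idl[OF \<delta>C[OF i]] by (simp add: vanishes_def P.hom_det_transition[OF \<iota>])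
      moreover have "?v (I_dfb n ts bs H (ts' i) <+>\<^bsub>KC ts bs\<^esub> ?B) \<longleftrightarrow> ?v (I_dfb n ts bs H (ts' i))"
        using h.vanishes_set_add[OF iD[OF i] O.ideal_I_BO_bar] \<Gamma>'(4) by simp
      moreover have "?v (?J i <+>\<^bsub>KC ts bs\<^esub> ?B) \<longleftrightarrow> ?v (?J i)"
        using h.vanishes_set_add[OF iJ[OF i] O.ideal_I_BO_bar] \<Gamma>'(4) by simp
      ultimately show ?thesis
        using h.vanishes_Int[OF iDB[OF i] iJB[OF i]] P.vanishes_I_ZO_bar_iff[OF assms(1) \<Gamma>'(3)] by simp
    qed
    have "\<Gamma> \<in> zero_locus \<iota> ts bs (I_NCB n ts bs H l ts' bs' as) \<longleftrightarrow>
        (\<forall>i\<in>set [0..<l]. ?v ((I_dfb n ts bs H (ts' i) <+>\<^bsub>KC ts bs\<^esub> ?B) \<inter> (?J i <+>\<^bsub>KC ts bs\<^esub> ?B)))"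
      unfolding mem_zero_locus I_NCB_def
      by (subst h.vanishes_ideal_sum)
         (use \<Gamma>'(1) in \<open>auto intro: ring.i_intersect[OF cring.axioms(1)[OF cring_poly_ring] iDB iJB]\<close>)
    then have NCB: "\<Gamma> \<notin> zero_locus \<iota> ts bs (I_NCB n ts bs H l ts' bs' as) \<longleftrightarrow>
        HFa n P.II = H \<and> (\<exists>i<l. ?det i \<noteq> 0 \<and> \<not> ?v (?J i))"
      using summand by auto
    have CB: "?v (?J i) \<longleftrightarrow> \<not> cayley_bacharach n P.II"
      if i: "i < l" and det: "?det i \<noteq> 0" and HF: "HFa n P.II = H" for i
    proof -
      interpret N: enumerated n "ts' i" "bs' i" by unfold_locales (rule assms(5)[OF i])
      interpret C: change_of_order_ideal n ts bs \<Gamma> "ts' i" "bs' i"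
        by unfold_locales (rule len[OF i], rule det)
      interpret D: degree_filtered_point n "ts' i" "bs' i" C.new_point
        by unfold_locales (simp only: C.I_point_new_point HF HF'[OF i])
      have "?v (?J i) \<longleftrightarrow> vanishes \<iota> (($$) C.new_point) (CBLocus n (ts' i) (bs' i))"
        using C.vanishes_J_ideal_iff[OF \<iota> assms(7)[OF i]] by (simp only: assms(8)[OF i])
      then show ?thesis
        using D.vanishes_CBLocus_iff[OF \<iota>] by (simp only: C.I_point_new_point)
    qed
    have "\<exists>i<l. ?det i \<noteq> 0" if HF: "HFa n P.II = H"
    proof -
      have "P.standard_terms \<in> {S. order_ideal n S \<and> HFa_terms S = H}"
        using P.order_ideal_standard_terms P.HFa_standard_terms HF by simp
      then have "P.standard_terms \<in> (\<lambda>i. set (ts' i)) ` {..<l}"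
        using assms(6) by (simp add: bij_betw_def)
      then obtain i where i: "i < l" "set (ts' i) = P.standard_terms" by auto
      interpret N: enumerated n "ts' i" "bs' i" by unfold_locales (rule assms(5)[OF i(1)])
      show ?thesis
        using P.det_standard_terms[OF i(2) N.distinct_ts len[OF i(1)]] i(1) by blast
    qed
    with NCB CB show ?thesis by blast
  qed
  show ?thesis
  proof (rule Set.set_eqI)
    fix \<Gamma>
    show "\<Gamma> \<in> BO_bar_points \<iota> n ts bs H - zero_locus \<iota> ts bs (I_NCB n ts bs H l ts' bs' as) \<longleftrightarrow>
        \<Gamma> \<in> {\<Gamma> \<in> BO_points \<iota> n ts bs H. cayley_bacharach n (I_point n ts bs \<Gamma>)}"
    proof (cases "\<Gamma> \<in> BO_bar_points \<iota> n ts bs H")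
      case True
      then show ?thesis using main[OF True] O.mem_BO_points_iff[OF assms(1) True] by simp
    next
      case False
      then show ?thesis by (simp add: BO_points_def)
    qed
  qed
qed

end
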